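(* Let $S\subset\mathbb{R}^m$ be a $1$-dimensional semialgebraic set. The following conditions are equivalent: (i) $\mathrm{r}_{\mathfrak B}(S)=1$; (ii) $\mathrm{r}_{\mathfrak B}(S)<+\infty$; (iii) $\mathrm{rs}_{\mathfrak B}(S)=1$; (iv) $\mathrm{rs}_{\mathfrak B}(S)<+\infty$; (v) $\mathrm{r}_{\mathfrak S}(S)=1$; (vi) $\mathrm{r}_{\mathfrak S}(S)<+\infty$; (vii) $\mathrm{rs}_{\mathfrak S}(S)=1$; (viii) $\mathrm{rs}_{\mathfrak S}(S)<+\infty$; (ix) $S$ is irreducible, compact and its Zariski closure $\operatorname{Cl}^{\rm zar}_{\mathbb{R}\mathbb{P}^m}(S)$ in $\mathbb{R}\mathbb{P}^m$ is a (real) rational curve.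
   Context: $\overline{\mathcal B}_n\subset\mathbb{R}^n$ is the closed unit ball centered at the origin and $\mathbb{S}^n\subset\mathbb{R}^{n+1}$ the unit sphere centered at the origin. For $T\subset\mathbb{R}^n$, a rational map $f=(f_1,\dots,f_m):\mathbb{R}^n\dashrightarrow\mathbb{R}^m$ is regular on $T$ if each $f_i=g_i/h_i$ with polynomials $g_i,h_i$ and $h_i$ has no zero on $T$; it is regulous on $T$ if it extends to a continuous function on $T$ and the complement of its set of poles meets $T$ in a dense subset of $T$. $S$ is a regular (resp. regulous) image of $T$ if $S=f(T)$ for some rational map regular (resp. regulous) on $T$. Define $\mathrm{r}_{\mathfrak B}(S)=\inf\{n\ge1: S \text{ is a regular image of } \overline{\mathcal B}_n\}$, $\mathrm{rs}_{\mathfrak B}(S)=\inf\{n\ge1: S \text{ is a regulous image of } \overline{\mathcal B}_n\}$, $\mathrm{r}_{\mathfrak S}(S)=\inf\{n\ge1: S \text{ is a regular image of } \mathbb{S}^n\}$, $\mathrm{rs}_{\mathfrak S}(S)=\inf\{n\ge1: S \text{ is a regulous image of } \mathbb{S}^n\}$, with $\inf\varnothing=+\infty$. A Nash function on an open semialgebraic set $U$ is an analytic function on $U$ satisfying a nontrivial polynomial equation $P(x,f(x))=0$; the ring $\mathcal N(S)$ of Nash functions on a semialgebraic set $S$ consists of functions on $S$ admitting a Nash extension to an open semialgebraic neighborhood of $S$. $S$ is called irreducible if $\mathcal N(S)$ is an integral domain. For a semialgebraic set $S$, $S_{(k)}$ denotes the set of points of $S$ at which $S$ has local dimension $k$. A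 real rational curve is a real projective irreducible curve $C$ such that $C_{(1)}$ is the image of $\mathbb{R}\mathbb{P}^1$ under a birational map. $\mathbb{R}^m$ is identified with $\{x_0=1\}\subset\mathbb{R}\mathbb{P}^m$. *)

theory Defs
  imports "HOL-Analysis.Analysis"
begin

text \<open>Conventions. A point of R^k is represented as a function x :: nat => real with
  x i = 0 for all i >= k. On such points the (product) topology of nat => real is the
  Euclidean one. Polynomial functions in k variables are generated from constants and
  the coordinates x 0, ..., x (k-1) by sums and products.\<close>

definition Rn :: "nat \<Rightarrow> (nat \<Rightarrow> real) set" where
  "Rn k = {x. \<forall>i\<ge>k. x i = 0}"

inductive poly_fun :: "nat \<Rightarrow> ((nat \<Rightarrow> real) \<Rightarrow> real) \<Rightarrow> bool" for k where
  pf_const: "poly_fun k (\<lambda>x. c)"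
| pf_var: "i < k \<Longrightarrow> poly_fun k (\<lambda>x. x i)"
| pf_add: "poly_fun k p \<Longrightarrow> poly_fun k q \<Longrightarrow> poly_fun k (\<lambda>x. p x + q x)"
| pf_mult: "poly_fun k p \<Longrightarrow> poly_fun k q \<Longrightarrow> poly_fun k (\<lambda>x. p x * q x)"

definition sqnorm :: "nat \<Rightarrow> (nat \<Rightarrow> real) \<Rightarrow> real" where
  "sqnorm k x = (\<Sum>i<k. (x i)\<^sup>2)"

definition closed_ball_n :: "nat \<Rightarrow> (nat \<Rightarrow> real) set" where
  "closed_ball_n n = {x \<in> Rn n. sqnorm n x \<le> 1}"

definition sphere_n :: "nat \<Rightarrow> (nat \<Rightarrow> real) set" where
  "sphere_n n = {x \<in> Rn (Suc n). sqnorm (Suc n) x = 1}"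

inductive semialg :: "nat \<Rightarrow> (nat \<Rightarrow> real) set \<Rightarrow> bool" for k where
  sa_pos: "poly_fun k p \<Longrightarrow> semialg k {x \<in> Rn k. p x > 0}"
| sa_zero: "poly_fun k p \<Longrightarrow> semialg k {x \<in> Rn k. p x = 0}"
| sa_union: "semialg k A \<Longrightarrow> semialg k B \<Longrightarrow> semialg k (A \<union> B)"
| sa_compl: "semialg k A \<Longrightarrow> semialg k (Rn k - A)"

definition dim_ge :: "(nat \<Rightarrow> real) set \<Rightarrow> nat \<Rightarrow> bool" where
  "dim_ge S d \<longleftrightarrow> (\<exists>U V g h. openin (top_of_set (Rn d)) U \<and> U \<noteq> {} \<and> V \<subseteq> S
       \<and> homeomorphism U V g h)"

definition dim_eq :: "(nat \<Rightarrow> real) set \<Rightarrow> nat \<Rightarrow> bool" where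
  "dim_eq S d \<longleftrightarrow> dim_ge S d \<and> \<not> dim_ge S (Suc d)"

definition local_dim_set :: "(nat \<Rightarrow> real) set \<Rightarrow> nat \<Rightarrow> (nat \<Rightarrow> real) set" where
  "local_dim_set S k = {x \<in> S. (\<forall>U. open U \<and> x \<in> U \<longrightarrow> dim_ge (S \<inter> U) k)
       \<and> (\<exists>U. open U \<and> x \<in> U \<and> \<not> dim_ge (S \<inter> U) (Suc k))}"

definition rat_map :: "nat \<Rightarrow> nat \<Rightarrow> (nat \<Rightarrow> (nat \<Rightarrow> real) \<Rightarrow> real)
      \<Rightarrow> (nat \<Rightarrow> (nat \<Rightarrow> real) \<Rightarrow> real) \<Rightarrow> bool" where
  "rat_map n m g h \<longleftrightarrow> (\<forall>i<m. poly_fun n (g i) \<and> poly_fun n (h i)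
        \<and> (\<exists>x\<in>Rn n. h i x \<noteq> 0))"

definition rat_repr :: "nat \<Rightarrow> ((nat \<Rightarrow> real) \<Rightarrow> real) \<Rightarrow> ((nat \<Rightarrow> real) \<Rightarrow> real)
      \<Rightarrow> ((nat \<Rightarrow> real) \<Rightarrow> real) \<Rightarrow> ((nat \<Rightarrow> real) \<Rightarrow> real) \<Rightarrow> bool" where
  "rat_repr n g h g' h' \<longleftrightarrow> poly_fun n g' \<and> poly_fun n h'
      \<and> (\<forall>y\<in>Rn n. g' y * h y = g y * h' y)"

definition rat_dom :: "nat \<Rightarrow> nat \<Rightarrow> (nat \<Rightarrow> (nat \<Rightarrow> real) \<Rightarrow> real)
      \<Rightarrow> (nat \<Rightarrow> (nat \<Rightarrow> real) \<Rightarrow> real) \<Rightarrow> (nat \<Rightarrow> real) set" where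
  "rat_dom n m g h = {x \<in> Rn n. \<forall>i<m. \<exists>g' h'. rat_repr n (g i) (h i) g' h' \<and> h' x \<noteq> 0}"

definition regular_image :: "nat \<Rightarrow> nat \<Rightarrow> (nat \<Rightarrow> real) set \<Rightarrow> (nat \<Rightarrow> real) set \<Rightarrow> bool" where
  "regular_image n m T S \<longleftrightarrow> (\<exists>g h. rat_map n m g h \<and> (\<forall>i<m. \<forall>x\<in>T. h i x \<noteq> 0)
      \<and> S = (\<lambda>x. \<lambda>i. if i < m then g i x / h i x else 0) ` T)"

definition regulous_image :: "nat \<Rightarrow> nat \<Rightarrow> (nat \<Rightarrow> real) set \<Rightarrow> (nat \<Rightarrow> real) set \<Rightarrow> bool" where
  "regulous_image n m T S \<longleftrightarrow> (\<exists>g h F. rat_map n m g h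
      \<and> T \<subseteq> closure (T \<inter> rat_dom n m g h)
      \<and> continuous_on T F \<and> (\<forall>x\<in>T. F x \<in> Rn m)
      \<and> (\<forall>x\<in>T. \<forall>i<m. \<forall>g' h'. rat_repr n (g i) (h i) g' h' \<and> h' x \<noteq> 0
                 \<longrightarrow> F x i = g' x / h' x)
      \<and> S = F ` T)"

definition rB :: "nat \<Rightarrow> (nat \<Rightarrow> real) set \<Rightarrow> enat" where
  "rB m S = (INF n\<in>{n. n \<ge> 1 \<and> regular_image n m (closed_ball_n n) S}. enat n)"

definition rsB :: "nat \<Rightarrow> (nat \<Rightarrow> real) set \<Rightarrow> enat" where
  "rsB m S = (INF n\<in>{n. n \<ge> 1 \<and> regulous_image n m (closed_ball_n n) S}. enat n)"

definition rS :: "nat \<Rightarrow> (nat \<Rightarrow> real) set \<Rightarrow> enat" where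
  "rS m S = (INF n\<in>{n. n \<ge> 1 \<and> regular_image (Suc n) m (sphere_n n) S}. enat n)"

definition rsS :: "nat \<Rightarrow> (nat \<Rightarrow> real) set \<Rightarrow> enat" where
  "rsS m S = (INF n\<in>{n. n \<ge> 1 \<and> regulous_image (Suc n) m (sphere_n n) S}. enat n)"

definition real_analytic_on :: "nat \<Rightarrow> (nat \<Rightarrow> real) set \<Rightarrow> ((nat \<Rightarrow> real) \<Rightarrow> real) \<Rightarrow> bool" where
  "real_analytic_on n U f \<longleftrightarrow> (\<forall>a\<in>U. \<exists>\<epsilon>>0. \<exists>c :: (nat \<Rightarrow> nat) \<Rightarrow> real.
      \<forall>x\<in>Rn n. sqnorm n (\<lambda>i. x i - a i) < \<epsilon>\<^sup>2 \<longrightarrow>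
        ((\<lambda>\<alpha>. c \<alpha> * (\<Prod>i<n. (x i - a i) ^ \<alpha> i)) has_sum f x) {\<alpha>. \<forall>i\<ge>n. \<alpha> i = 0})"

definition nash_on_open :: "nat \<Rightarrow> (nat \<Rightarrow> real) set \<Rightarrow> ((nat \<Rightarrow> real) \<Rightarrow> real) \<Rightarrow> bool" where
  "nash_on_open n U f \<longleftrightarrow> real_analytic_on n U f
     \<and> (\<exists>P. poly_fun (Suc n) P \<and> (\<exists>z\<in>Rn (Suc n). P z \<noteq> 0)
            \<and> (\<forall>x\<in>U. P (x(n := f x)) = 0))"

definition nash_on :: "nat \<Rightarrow> (nat \<Rightarrow> real) set \<Rightarrow> ((nat \<Rightarrow> real) \<Rightarrow> real) \<Rightarrow> bool" where
  "nash_on n S f \<longleftrightarrow> (\<exists>U F. semialg n U \<and> openin (top_of_set (Rn n)) U \<and> S \<subseteq> U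
      \<and> nash_on_open n U F \<and> (\<forall>x\<in>S. F x = f x))"

definition nash_irreducible :: "nat \<Rightarrow> (nat \<Rightarrow> real) set \<Rightarrow> bool" where
  "nash_irreducible n S \<longleftrightarrow> S \<noteq> {} \<and> (\<forall>f g. nash_on n S f \<and> nash_on n S g
      \<and> (\<forall>x\<in>S. f x * g x = 0) \<longrightarrow> (\<forall>x\<in>S. f x = 0) \<or> (\<forall>x\<in>S. g x = 0))"

text \<open>Projective geometry. A subset of RP^(k-1) is represented by its affine cone
  with the origin removed, a subset of R^k - {0} closed under nonzero scaling.\<close>
definition homog_poly :: "nat \<Rightarrow> nat \<Rightarrow> ((nat \<Rightarrow> real) \<Rightarrow> real) \<Rightarrow> bool" where
  "homog_poly k d p \<longleftrightarrow> poly_fun k p \<and> (\<forall>t. \<forall>x\<in>Rn k. p (\<lambda>i. t * x i) = t ^ d * p x)"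

definition proj_alg :: "nat \<Rightarrow> (nat \<Rightarrow> real) set \<Rightarrow> bool" where
  "proj_alg k A \<longleftrightarrow> (\<exists>P. (\<forall>p\<in>P. \<exists>d. homog_poly k d p)
      \<and> A = {y \<in> Rn k. y \<noteq> (\<lambda>_. 0) \<and> (\<forall>p\<in>P. p y = 0)})"

definition proj_irreducible :: "nat \<Rightarrow> (nat \<Rightarrow> real) set \<Rightarrow> bool" where
  "proj_irreducible k A \<longleftrightarrow> A \<noteq> {} \<and> (\<forall>B1 B2. proj_alg k B1 \<and> proj_alg k B2
      \<and> A \<subseteq> B1 \<union> B2 \<longrightarrow> A \<subseteq> B1 \<or> A \<subseteq> B2)"

definition hom_emb :: "nat \<Rightarrow> (nat \<Rightarrow> real) \<Rightarrow> (nat \<Rightarrow> real)" where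
  "hom_emb m x = (\<lambda>i. if i = 0 then 1 else if i \<le> m then x (i - 1) else 0)"

definition zar_closure_proj :: "nat \<Rightarrow> (nat \<Rightarrow> real) set \<Rightarrow> (nat \<Rightarrow> real) set" where
  "zar_closure_proj m S = {y \<in> Rn (Suc m). y \<noteq> (\<lambda>_. 0) \<and>
      (\<forall>p d. homog_poly (Suc m) d p \<and> (\<forall>x\<in>S. p (hom_emb m x) = 0) \<longrightarrow> p y = 0)}"

definition normalize_pt :: "nat \<Rightarrow> (nat \<Rightarrow> real) \<Rightarrow> (nat \<Rightarrow> real)" where
  "normalize_pt k y = (\<lambda>i. y i / sqrt (sqnorm k y))"

text \<open>The sphere S^(k-1) double covers RP^(k-1) by a local homeomorphism; local
  dimensions are computed on the spherical section of the cone.\<close>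
definition sph_sec :: "nat \<Rightarrow> (nat \<Rightarrow> real) set \<Rightarrow> (nat \<Rightarrow> real) set" where
  "sph_sec k A = {y \<in> A. sqnorm k y = 1}"

definition proj_dim_eq :: "nat \<Rightarrow> (nat \<Rightarrow> real) set \<Rightarrow> nat \<Rightarrow> bool" where
  "proj_dim_eq k A d \<longleftrightarrow> dim_eq (sph_sec k A) d"

definition proj_local_dim_set :: "nat \<Rightarrow> (nat \<Rightarrow> real) set \<Rightarrow> nat \<Rightarrow> (nat \<Rightarrow> real) set" where
  "proj_local_dim_set k A j = {y \<in> A. normalize_pt k y \<in> local_dim_set (sph_sec k A) j}"

text \<open>A birational map RP^1 --> C (C in RP^(k-1)), given by homogeneous binary forms
  phi_0..phi_(k-1) of a common degree without common nontrivial real zero (so that it is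
  defined on all of RP^1), admitting a rational inverse psi = (a : b) on C with
  psi o phi = id. Its image phi(RP^1), as a cone, is
  {c * phi(z) : c nonzero, z in R^2 nonzero}.\<close>
definition real_rational_curve :: "nat \<Rightarrow> (nat \<Rightarrow> real) set \<Rightarrow> bool" where
  "real_rational_curve k C \<longleftrightarrow> proj_alg k C \<and> proj_irreducible k C \<and> proj_dim_eq k C 1
     \<and> (\<exists>\<phi> d. (\<forall>i<k. homog_poly 2 d (\<phi> i))
          \<and> (\<forall>z\<in>Rn 2. z \<noteq> (\<lambda>_. 0) \<longrightarrow> (\<exists>i<k. \<phi> i z \<noteq> 0))
          \<and> (let \<Phi> = (\<lambda>z. \<lambda>i. if i < k then \<phi> i z else 0) in
              (\<exists>a b e. homog_poly k e a \<and> homog_poly k e b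
                 \<and> (\<forall>z\<in>Rn 2. a (\<Phi> z) * z 1 = b (\<Phi> z) * z 0)
                 \<and> (\<exists>z\<in>Rn 2. a (\<Phi> z) \<noteq> 0 \<or> b (\<Phi> z) \<noteq> 0))
            \<and> proj_local_dim_set k C 1
                = {y. \<exists>c z. c \<noteq> 0 \<and> z \<in> Rn 2 \<and> z \<noteq> (\<lambda>_. 0) \<and> y = (\<lambda>i. c * \<Phi> z i)}))"

end

theory Submission
  imports Defs "HOL-Computational_Algebra.Polynomial_Factorial" "HOL-Computational_Algebra.Field_as_Ring"
begin

text \<open>
  Suppose first that the Zariski closure of a compact irreducible \<open>S\<close> is parametrized by binary forms. A semialgebraic
  set without arcs near a point has isolated points, which irreducibility excludes, so \<open>S\<close> lies on the parametrized
  curve. In a line chart the parameter is integral over the regular functions on \<open>S\<close>. A conductor then turns a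
  separation of the parameter set into a polynomial identity \<open>P\<^sup>2 = Q\<^sup>2 D\<close> with \<open>D > 0\<close> on \<open>S\<close>, that is,
  \<open>(P - Q \<surd>D) (P + Q \<surd>D) = 0\<close> for Nash functions. Hence the parameter set is an interval up to redundant points, and
  \<open>S\<close> is a regular image of \<open>[-1, 1]\<close>.

  Conversely, the ball and the sphere are rational images of affine spaces, so a regulous image \<open>S\<close> is the image of
  a continuous rational map \<open>\<Gamma>\<close> of an affine space. On lines \<open>\<Gamma>\<close> is analytic, which gives irreducibility. If a
  polynomial vanished on the image of a nonconstant line but not on \<open>S\<close>, a plane through that line would produce a
  two-dimensional disc in \<open>S\<close>. Hence the Zariski closure is that of a rational curve, and Lueroth's theorem provides a
  birational parametrization; only finitely many points of the closure are not covered by it.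
\<close>

section \<open>Polynomial functions\<close>

text \<open>In the first half the parametrization need not be injective: a node glues parameters
  together, so a disconnected parameter set may have a connected image, and irreducibility has to
  act through zero divisors instead of connectedness. Let \<alpha> be a polynomial close to 0 on one
  piece of the parameter set and close to 1 on the other. Then
  \<open>\<beta> = 2\<alpha> - 1\<close> changes sign between the pieces, but it is in general not a
  function on \<open>S\<close>. If \<open>\<alpha> (1 - \<alpha>)\<close> is divisible by a
  conductor, then \<open>\<beta>\<^sup>2 = 1 - 4\<alpha> (1 - \<alpha>)\<close> is one, and so is
  \<open>c \<beta>\<close> for the conductor \<open>c\<close>. Comparing \<open>c \<beta>\<close>
  with \<open>c sqrt(\<beta>\<^sup>2) = c |\<beta>|\<close> produces the two Nash factors. When one
  of them vanishes, \<open>c\<close> vanishes on a whole piece, and \<open>c\<close> has only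
  finitely many zeros on the parameter set.

  Dimension is topological throughout: dimension at least d means that an open piece of R^d embeds.
  So lower bounds need explicit embedded arcs or rectangles, upper bounds rest on invariance of
  dimension, and arcs in semialgebraic sets are obtained by solving polynomial differential
  equations with power series.\<close>

type_synonym pt = "nat \<Rightarrow> real"

lemma poly_fun_cong_coords:
  assumes "poly_fun k p" "\<And>i. i < k \<Longrightarrow> x i = y i"
  shows "p x = p y"
  using assms by induction auto

lemma poly_fun_uminus: "poly_fun k p \<Longrightarrow> poly_fun k (\<lambda>x. - p x)"
  using pf_mult[OF pf_const[of k "-1"]] by fastforce

lemma poly_fun_diff: "poly_fun k p \<Longrightarrow> poly_fun k q \<Longrightarrow> poly_fun k (\<lambda>x. p x - q x)"
  using pf_add[OF _ poly_fun_uminus] by fastforce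

lemma poly_fun_power: "poly_fun k p \<Longrightarrow> poly_fun k (\<lambda>x. p x ^ n)"
  by (induction n) (auto intro: poly_fun.intros)

lemma poly_fun_sum: "(\<And>i. i \<in> A \<Longrightarrow> poly_fun k (f i)) \<Longrightarrow> poly_fun k (\<lambda>x. \<Sum>i\<in>A. f i x)"
  by (induction A rule: infinite_finite_induct) (auto intro: poly_fun.intros)

lemma poly_fun_prod: "(\<And>i. i \<in> A \<Longrightarrow> poly_fun k (f i)) \<Longrightarrow> poly_fun k (\<lambda>x. \<Prod>i\<in>A. f i x)"
  by (induction A rule: infinite_finite_induct) (auto intro: poly_fun.intros)

lemmas poly_fun_intros = pf_const pf_var pf_add pf_mult poly_fun_uminus poly_fun_diff
  poly_fun_power poly_fun_sum poly_fun_prod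

lemma poly_fun_mono: "poly_fun k p \<Longrightarrow> k \<le> l \<Longrightarrow> poly_fun l p"
  by (induction rule: poly_fun.induct) (auto intro: poly_fun.intros)

lemma poly_fun_compose:
  assumes "poly_fun k p" "\<And>i. i < k \<Longrightarrow> poly_fun n (Q i)"
  shows "poly_fun n (\<lambda>x. p (\<lambda>i. Q i x))"
  using assms by induction (auto intro: poly_fun.intros)

lemma poly_fun_continuous: "poly_fun k p \<Longrightarrow> continuous_on A p"
proof (induction rule: poly_fun.induct)
  case (pf_var i)
  show ?case by (rule continuous_on_subset[OF continuous_on_product_coordinates]) simp
qed (auto intro: continuous_intros)

lemma poly_fun_compose_poly:
  assumes "poly_fun k p"
  shows "\<exists>R::real poly. \<forall>t. p (\<lambda>i. poly (P i) t) = poly R t"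
  using assms
proof induction
  case (pf_const c)
  show ?case by (rule exI[of _ "[:c:]"]) simp
next
  case (pf_add p q)
  then obtain R S where "\<forall>t. p (\<lambda>i. poly (P i) t) = poly R t" "\<forall>t. q (\<lambda>i. poly (P i) t) = poly S t"
    by blast
  thus ?case by (intro exI[of _ "R + S"]) simp
next
  case (pf_mult p q)
  then obtain R S where "\<forall>t. p (\<lambda>i. poly (P i) t) = poly R t" "\<forall>t. q (\<lambda>i. poly (P i) t) = poly S t"
    by blast
  thus ?case by (intro exI[of _ "R * S"]) simp
qed blast

lemma poly_fun_poly:
  assumes "poly_fun n p"
  shows "poly_fun n (\<lambda>x. poly R (p x))"
  by (induction R) (auto intro!: poly_fun_intros assms)

section \<open>Partial derivatives and a Taylor bound\<close>

definition partial_deriv :: "nat \<Rightarrow> (pt \<Rightarrow> real) \<Rightarrow> pt \<Rightarrow> real" where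
  "partial_deriv i p x = deriv (\<lambda>t. p (x(i := t))) (x i)"

lemma poly_fun_line_derivative:
  assumes "poly_fun k p"
  shows "((\<lambda>t. p (x(i := t))) has_field_derivative partial_deriv i p x) (at (x i))"
proof -
  have "\<exists>d. ((\<lambda>t. p (x(i := t))) has_field_derivative d) (at (x i))"
    using assms
  proof induction
    case (pf_const c)
    show ?case by (rule exI[of _ 0]) simp
  next
    case (pf_var j)
    show ?case
    proof (cases "j = i")
      case True
      thus ?thesis using DERIV_ident by (intro exI[of _ 1]) simp
    next
      case False
      thus ?thesis by (intro exI[of _ 0]) simp
    qed
  next
    case (pf_add p q)
    thus ?case using DERIV_add by blast
  next
    case (pf_mult p q)
    thus ?case using DERIV_mult by blast
  qed
  thus ?thesis unfolding partial_deriv_def by (metis DERIV_imp_deriv)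
qed

lemma partial_deriv_const [simp]: "partial_deriv i (\<lambda>x. c) = (\<lambda>x. 0)"
  by (simp add: partial_deriv_def fun_eq_iff)

lemma partial_deriv_var: "partial_deriv i (\<lambda>x. x j) = (\<lambda>x. if i = j then 1 else 0)"
proof
  fix x :: pt
  have "((\<lambda>t. (x(i := t)) j) has_field_derivative (if i = j then 1 else 0)) (at (x i))"
    by (cases "j = i") simp_all
  thus "partial_deriv i (\<lambda>x. x j) x = (if i = j then 1 else 0)"
    unfolding partial_deriv_def by (rule DERIV_imp_deriv)
qed

lemma partial_deriv_add:
  assumes "poly_fun k p" "poly_fun k q"
  shows "partial_deriv i (\<lambda>x. p x + q x) = (\<lambda>x. partial_deriv i p x + partial_deriv i q x)"
proof
  fix x show "partial_deriv i (\<lambda>x. p x + q x) x = partial_deriv i p x + partial_deriv i q x"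
    using DERIV_add[OF assms[THEN poly_fun_line_derivative[where x=x and i=i]]]
    by (subst partial_deriv_def) (rule DERIV_imp_deriv)
qed

lemma partial_deriv_mult:
  assumes "poly_fun k p" "poly_fun k q"
  shows "partial_deriv i (\<lambda>x. p x * q x) = (\<lambda>x. partial_deriv i p x * q x + p x * partial_deriv i q x)"
proof
  fix x show "partial_deriv i (\<lambda>x. p x * q x) x = partial_deriv i p x * q x + p x * partial_deriv i q x"
    using DERIV_mult[OF assms[THEN poly_fun_line_derivative[where x=x and i=i]]]
    by (subst partial_deriv_def) (auto simp: algebra_simps intro: DERIV_imp_deriv)
qed

lemma poly_fun_partial_deriv: "poly_fun k p \<Longrightarrow> poly_fun k (partial_deriv i p)"
proof (induction rule: poly_fun.induct)
  case (pf_var j)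
  show ?case by (subst partial_deriv_var) (auto intro: poly_fun.intros)
next
  case (pf_add p q)
  thus ?case by (subst partial_deriv_add[where k=k]) (auto intro: poly_fun.intros)
next
  case (pf_mult p q)
  thus ?case by (subst partial_deriv_mult[where k=k]) (auto intro: poly_fun.intros)
qed (auto intro: poly_fun.intros)

lemma partial_deriv_cmult:
  "poly_fun k p \<Longrightarrow> partial_deriv i (\<lambda>x. c * p x) = (\<lambda>x. c * partial_deriv i p x)"
  using partial_deriv_mult[of k "\<lambda>_. c" p i] by (simp add: pf_const)

text \<open>\<open>r\<close> bounds the displacement in the maximum norm. The restriction
  \<open>r \<le> 1\<close> lets quadratic terms be absorbed into linear bounds, so that the class is
  closed under products.\<close>

definition taylor_bound :: "nat \<Rightarrow> pt \<Rightarrow> (pt \<Rightarrow> real) \<Rightarrow> real \<Rightarrow> bool" where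
  "taylor_bound k a p C \<longleftrightarrow> C \<ge> 0 \<and> (\<forall>x r. 0 \<le> r \<and> r \<le> 1 \<and> (\<forall>i<k. \<bar>x i - a i\<bar> \<le> r) \<longrightarrow>
     \<bar>p x - p a\<bar> \<le> C * r \<and>
     \<bar>p x - p a - (\<Sum>i<k. partial_deriv i p a * (x i - a i))\<bar> \<le> C * r\<^sup>2)"

text \<open>The Lipschitz estimate is part of the induction because the remainder of a product contains
  the product of the two increments.\<close>
lemma poly_fun_taylor:
  assumes "poly_fun k p"
  shows "\<exists>C. taylor_bound k a p C"
  using assms
proof induction
  case (pf_const c)
  show ?case by (rule exI[of _ 0]) (simp add: taylor_bound_def)
next
  case (pf_var j)
  have "(\<Sum>i<k. partial_deriv i (\<lambda>x. x j) a * (x i - a i)) = (\<Sum>i<k. if i = j then x i - a i else 0)" for x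
    by (rule sum.cong) (auto simp: partial_deriv_var)
  hence "(\<Sum>i<k. partial_deriv i (\<lambda>x. x j) a * (x i - a i)) = x j - a j" for x
    using pf_var by simp
  thus ?case using pf_var by (intro exI[of _ 1]) (simp add: taylor_bound_def)
next
  case (pf_add p q)
  then obtain C D where CD: "taylor_bound k a p C" "taylor_bound k a q D" by blast
  hence C: "C \<ge> 0" "\<And>x r. 0 \<le> r \<and> r \<le> 1 \<and> (\<forall>i<k. \<bar>x i - a i\<bar> \<le> r) \<Longrightarrow>
     \<bar>p x - p a\<bar> \<le> C * r \<and> \<bar>p x - p a - (\<Sum>i<k. partial_deriv i p a * (x i - a i))\<bar> \<le> C * r\<^sup>2"
    and D: "D \<ge> 0" "\<And>x r. 0 \<le> r \<and> r \<le> 1 \<and> (\<forall>i<k. \<bar>x i - a i\<bar> \<le> r) \<Longrightarrow>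
     \<bar>q x - q a\<bar> \<le> D * r \<and> \<bar>q x - q a - (\<Sum>i<k. partial_deriv i q a * (x i - a i))\<bar> \<le> D * r\<^sup>2"
    unfolding taylor_bound_def by (elim conjE, assumption | simp)+
  show ?case
  unfolding taylor_bound_def
  proof (intro exI[of _ "C + D"] conjI allI impI)
    fix x r assume r: "0 \<le> r \<and> r \<le> 1 \<and> (\<forall>i<k. \<bar>x i - a i\<bar> \<le> r)"
    note 1 = C(2)[OF r] D(2)[OF r]
    show "\<bar>p x + q x - (p a + q a)\<bar> \<le> (C + D) * r" using 1 unfolding distrib_right by linarith
    have "(\<Sum>i<k. partial_deriv i (\<lambda>x. p x + q x) a * (x i - a i))
       = (\<Sum>i<k. partial_deriv i p a * (x i - a i)) + (\<Sum>i<k. partial_deriv i q a * (x i - a i))"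
      by (simp add: partial_deriv_add[OF pf_add.hyps] distrib_right sum.distrib)
    thus "\<bar>p x + q x - (p a + q a) - (\<Sum>i<k. partial_deriv i (\<lambda>x. p x + q x) a * (x i - a i))\<bar> \<le> (C + D) * r\<^sup>2"
      using 1 unfolding distrib_right by linarith
  qed (use C D in auto)
next
  case (pf_mult p q)
  then obtain C D where CD: "taylor_bound k a p C" "taylor_bound k a q D" by blast
  hence C: "C \<ge> 0" "\<And>x r. 0 \<le> r \<and> r \<le> 1 \<and> (\<forall>i<k. \<bar>x i - a i\<bar> \<le> r) \<Longrightarrow>
     \<bar>p x - p a\<bar> \<le> C * r \<and> \<bar>p x - p a - (\<Sum>i<k. partial_deriv i p a * (x i - a i))\<bar> \<le> C * r\<^sup>2"
    and D: "D \<ge> 0" "\<And>x r. 0 \<le> r \<and> r \<le> 1 \<and> (\<forall>i<k. \<bar>x i - a i\<bar> \<le> r) \<Longrightarrow>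
     \<bar>q x - q a\<bar> \<le> D * r \<and> \<bar>q x - q a - (\<Sum>i<k. partial_deriv i q a * (x i - a i))\<bar> \<le> D * r\<^sup>2"
    unfolding taylor_bound_def by (elim conjE, assumption | simp)+
  let ?E = "\<bar>p a\<bar> * D + \<bar>q a\<bar> * C + C * D"
  show ?case
  unfolding taylor_bound_def
  proof (intro exI[of _ ?E] conjI allI impI)
    fix x r assume r: "0 \<le> r \<and> r \<le> 1 \<and> (\<forall>i<k. \<bar>x i - a i\<bar> \<le> r)"
    note 1 = C(2)[OF r] D(2)[OF r]
    have "\<bar>(p x - p a) * (q x - q a)\<bar> \<le> (C * r) * (D * r)"
      unfolding abs_mult using 1 r C(1) D(1) by (intro mult_mono) auto
    hence 2: "\<bar>(p x - p a) * (q x - q a)\<bar> \<le> C * D * r\<^sup>2"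
      by (simp only: power2_eq_square mult_ac)
    also have "\<dots> \<le> C * D * r" using r C(1) D(1)
      by (simp add: power2_eq_square mult_left_le mult_left_mono)
    finally have 3: "\<bar>(p x - p a) * (q x - q a)\<bar> \<le> C * D * r" .
    have 4: "\<bar>p a * (q x - q a)\<bar> \<le> \<bar>p a\<bar> * D * r" "\<bar>q a * (p x - p a)\<bar> \<le> \<bar>q a\<bar> * C * r"
      using 1 by (simp_all add: abs_mult mult_left_mono mult.assoc)
    have e: "p x * q x - p a * q a = (p x - p a) * (q x - q a) + p a * (q x - q a) + q a * (p x - p a)"
      by (simp add: algebra_simps)
    show "\<bar>p x * q x - p a * q a\<bar> \<le> ?E * r" unfolding e using 3 4 unfolding distrib_right by linarith
    let ?P = "\<Sum>i<k. partial_deriv i p a * (x i - a i)"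
    let ?Q = "\<Sum>i<k. partial_deriv i q a * (x i - a i)"
    have "(\<Sum>i<k. partial_deriv i (\<lambda>x. p x * q x) a * (x i - a i)) = q a * ?P + p a * ?Q"
      by (simp add: partial_deriv_mult[OF pf_mult.hyps] sum_distrib_left flip: sum.distrib)
        (simp add: algebra_simps)
    hence e2: "p x * q x - p a * q a - (\<Sum>i<k. partial_deriv i (\<lambda>x. p x * q x) a * (x i - a i))
       = (p x - p a) * (q x - q a) + p a * (q x - q a - ?Q) + q a * (p x - p a - ?P)"
      by (simp add: algebra_simps)
    have 5: "\<bar>p a * (q x - q a - ?Q)\<bar> \<le> \<bar>p a\<bar> * D * r\<^sup>2" "\<bar>q a * (p x - p a - ?P)\<bar> \<le> \<bar>q a\<bar> * C * r\<^sup>2"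
      using 1 by (simp_all add: abs_mult mult_left_mono mult.assoc)
    show "\<bar>p x * q x - p a * q a - (\<Sum>i<k. partial_deriv i (\<lambda>x. p x * q x) a * (x i - a i))\<bar> \<le> ?E * r\<^sup>2"
      unfolding e2 using 2 5 unfolding distrib_right by linarith
  qed (use C D in auto)
qed

section \<open>Arcs in semialgebraic sets\<close>

text \<open>A polynomial of degree at most \<open>d\<close> whose coefficients have absolute sum at most \<open>A\<close>.\<close>
inductive poly_norm :: "nat \<Rightarrow> nat \<Rightarrow> real \<Rightarrow> (pt \<Rightarrow> real) \<Rightarrow> bool" for k where
  pn_const: "\<bar>c\<bar> \<le> A \<Longrightarrow> poly_norm k d A (\<lambda>x. c)"
| pn_var: "i < k \<Longrightarrow> 1 \<le> A \<Longrightarrow> 1 \<le> d \<Longrightarrow> poly_norm k d A (\<lambda>x. x i)"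
| pn_add: "poly_norm k d A p \<Longrightarrow> poly_norm k d B q \<Longrightarrow> poly_norm k d (A + B) (\<lambda>x. p x + q x)"
| pn_mult: "poly_norm k d A p \<Longrightarrow> poly_norm k e B q \<Longrightarrow> poly_norm k (d + e) (A * B) (\<lambda>x. p x * q x)"
| pn_weaken: "poly_norm k d A p \<Longrightarrow> d \<le> d' \<Longrightarrow> A \<le> A' \<Longrightarrow> poly_norm k d' A' p"

lemma poly_norm_nonneg: "poly_norm k d A p \<Longrightarrow> 0 \<le> A"
  by (induction rule: poly_norm.induct) auto

lemma poly_norm_poly_fun: "poly_norm k d A p \<Longrightarrow> poly_fun k p"
  by (induction rule: poly_norm.induct) (auto intro: poly_fun.intros)

lemma poly_fun_poly_norm: "poly_fun k p \<Longrightarrow> \<exists>d A. 1 \<le> d \<and> 1 \<le> A \<and> poly_norm k d A p"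
proof (induction rule: poly_fun.induct)
  case (pf_const c)
  have "poly_norm k 1 (max 1 \<bar>c\<bar>) (\<lambda>x. c)" by (rule pn_const) simp
  thus ?case by (intro exI[of _ 1] exI[of _ "max 1 \<bar>c\<bar>"]) simp
next
  case (pf_var i)
  hence "poly_norm k 1 1 (\<lambda>x. x i)" by (intro pn_var) auto
  thus ?case by (intro exI[of _ 1]) simp
next
  case (pf_add p q)
  then obtain d A e B where "1 \<le> d" "1 \<le> A" "1 \<le> B" "poly_norm k d A p" "poly_norm k e B q" by blast
  hence "poly_norm k (max d e) (A + B) (\<lambda>x. p x + q x)"
    by (intro pn_add pn_weaken[of k d A p "max d e" A] pn_weaken[of k e B q "max d e" B]) simp_all
  thus ?case using \<open>1 \<le> d\<close> \<open>1 \<le> A\<close> \<open>1 \<le> B\<close>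
    by (intro exI[of _ "max d e"] exI[of _ "A + B"]) auto
next
  case (pf_mult p q)
  then obtain d A e B where *: "1 \<le> d" "1 \<le> A" "1 \<le> B" "poly_norm k d A p" "poly_norm k e B q" by blast
  moreover have "1 * 1 \<le> A * B" using * by (intro mult_mono) auto
  ultimately show ?case
    by (intro exI[of _ "d + e"] exI[of _ "A * B"]) (simp add: pn_mult)
qed

lemma poly_norm_bound:
  assumes "poly_norm k d A p" "1 \<le> R" "\<And>i. i < k \<Longrightarrow> \<bar>x i\<bar> \<le> R"
  shows "\<bar>p x\<bar> \<le> A * R ^ d"
  using assms(1)
proof induction
  case (pn_const c A d)
  hence "\<bar>c\<bar> * 1 \<le> A * R ^ d" using assms(2) by (intro mult_mono) auto
  thus ?case by simp
next
  case (pn_var i A d)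
  have "R ^ 1 \<le> R ^ d" using pn_var assms(2) by (intro power_increasing) auto
  hence "1 * R \<le> A * R ^ d" using pn_var assms(2) by (intro mult_mono) auto
  thus ?case using assms(3)[OF pn_var(1)] by simp
next
  case (pn_add d A p B q)
  thus ?case by (simp add: distrib_right)
next
  case (pn_mult d A p e B q)
  hence "\<bar>p x\<bar> * \<bar>q x\<bar> \<le> (A * R ^ d) * (B * R ^ e)" by (intro mult_mono) auto
  thus ?case by (simp add: abs_mult power_add mult_ac)
next
  case (pn_weaken d A p d' A')
  have "A * R ^ d \<le> A' * R ^ d'" using pn_weaken assms(2) poly_norm_nonneg[OF pn_weaken(1)]
    by (intro mult_mono power_increasing) auto
  thus ?case using pn_weaken by simp
qed

section \<open>Lie derivatives and integral curves of polynomial vector fields\<close>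

definition lie_deriv :: "nat \<Rightarrow> (nat \<Rightarrow> pt \<Rightarrow> real) \<Rightarrow> (pt \<Rightarrow> real) \<Rightarrow> pt \<Rightarrow> real" where
  "lie_deriv k v p x = (\<Sum>i<k. v i x * partial_deriv i p x)"

lemma poly_fun_lie_deriv:
  "(\<And>i. i < k \<Longrightarrow> poly_fun k (v i)) \<Longrightarrow> poly_fun k p \<Longrightarrow> poly_fun k (lie_deriv k v p)"
  unfolding lie_deriv_def by (intro poly_fun_intros poly_fun_partial_deriv) auto

lemma lie_deriv_const [simp]: "lie_deriv k v (\<lambda>x. c) = (\<lambda>x. 0)"
  by (simp add: lie_deriv_def fun_eq_iff)

lemma lie_deriv_var:
  assumes "i < k"
  shows "lie_deriv k v (\<lambda>x. x i) = v i"
proof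
  fix x
  have "lie_deriv k v (\<lambda>x. x i) x = (\<Sum>j<k. if j = i then v j x else 0)"
    unfolding lie_deriv_def partial_deriv_var by (rule sum.cong) auto
  thus "lie_deriv k v (\<lambda>x. x i) x = v i x" using assms by simp
qed

lemma lie_deriv_add:
  assumes "poly_fun k p" "poly_fun k q"
  shows "lie_deriv k v (\<lambda>x. p x + q x) = (\<lambda>x. lie_deriv k v p x + lie_deriv k v q x)"
  by (simp add: lie_deriv_def fun_eq_iff partial_deriv_add[OF assms] distrib_left sum.distrib)

lemma lie_deriv_mult:
  assumes "poly_fun k p" "poly_fun k q"
  shows "lie_deriv k v (\<lambda>x. p x * q x) = (\<lambda>x. lie_deriv k v p x * q x + p x * lie_deriv k v q x)"
  by (simp add: lie_deriv_def fun_eq_iff partial_deriv_mult[OF assms] distrib_left sum.distrib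
      sum_distrib_left sum_distrib_right mult_ac)

text \<open>Differentiation costs a factor equal to the degree, and multiplication by the field
  raises the degree by \<open>e\<close>. Growth linear in the degree is what turns into a factorial
  after iteration.\<close>

lemma poly_norm_lie_deriv:
  assumes v: "\<And>i. i < k \<Longrightarrow> poly_norm k e V (v i)" and "0 \<le> V" and "poly_norm k d A p"
  shows "poly_norm k (d + e) (d * V * A) (lie_deriv k v p)"
  using assms(3)
proof induction
  case (pn_const c A d)
  thus ?case using assms(2) by (auto intro!: poly_norm.pn_const)
next
  case (pn_var i A d)
  have "1 * V * 1 \<le> d * V * A" using pn_var assms(2) by (intro mult_mono) auto
  hence "poly_norm k (d + e) (d * V * A) (v i)"
    by (intro poly_norm.pn_weaken[OF v[OF pn_var(1)]]) auto
  thus ?case by (simp add: lie_deriv_var[OF pn_var(1)])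
next
  case (pn_add d A p B q)
  note pf = pn_add.hyps[THEN poly_norm_poly_fun]
  show ?case using poly_norm.pn_add[OF pn_add.IH]
    by (simp add: lie_deriv_add[OF pf] distrib_left)
next
  case (pn_mult d A p d' B q)
  note pf = pn_mult.hyps[THEN poly_norm_poly_fun]
  have 1: "poly_norm k (d + d' + e) (d * V * A * B) (\<lambda>x. lie_deriv k v p x * q x)"
    using poly_norm.pn_mult[OF pn_mult.IH(1) pn_mult.hyps(2)] by (simp add: add_ac)
  have 2: "poly_norm k (d + d' + e) (A * (d' * V * B)) (\<lambda>x. p x * lie_deriv k v q x)"
    using poly_norm.pn_mult[OF pn_mult.hyps(1) pn_mult.IH(2)] by (simp add: add_ac)
  have "d * V * A * B + A * (d' * V * B) = real (d + d') * V * (A * B)"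
    by (simp add: algebra_simps)
  thus ?case using poly_norm.pn_add[OF 1 2] by (simp only: lie_deriv_mult[OF pf])
next
  case (pn_weaken d A p d' A')
  have "d * V * A \<le> d' * V * A'" using pn_weaken assms(2) poly_norm_nonneg[OF pn_weaken(1)]
    by (intro mult_mono) auto
  thus ?case using pn_weaken.hyps by (intro poly_norm.pn_weaken[OF pn_weaken.IH]) auto
qed

lemma poly_fun_lie_deriv_funpow:
  assumes "\<And>i. i < k \<Longrightarrow> poly_fun k (v i)" "poly_fun k p"
  shows "poly_fun k ((lie_deriv k v ^^ n) p)"
  by (induction n) (auto intro: poly_fun_lie_deriv assms)

text \<open>After n steps the degree is \<open>d + n * e\<close>, so the accumulated factors are at
  most a geometric sequence times n factorial. This is exactly the growth under which the Lie series
  has a positive radius of convergence.\<close>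

lemma lie_deriv_funpow_bound:
  assumes v: "\<And>i. i < k \<Longrightarrow> poly_fun k (v i)" and p: "poly_fun k p"
  shows "\<exists>A C. 0 \<le> A \<and> 1 \<le> C \<and> (\<forall>n. \<bar>(lie_deriv k v ^^ n) p a\<bar> \<le> A * C ^ n * fact n)"
proof -
  have "\<exists>e V. 1 \<le> e \<and> 1 \<le> V \<and> (\<forall>i<k. poly_norm k e V (v i))"
  proof -
    have "\<exists>e V. 1 \<le> e \<and> 1 \<le> V \<and> (\<forall>i<l. poly_norm k e V (v i))" if "l \<le> k" for l
      using that
    proof (induction l)
      case 0 thus ?case by (intro exI[of _ 1]) simp
    next
      case (Suc l)
      then obtain e V where 1: "1 \<le> e" "1 \<le> V" "\<forall>i<l. poly_norm k e V (v i)" by auto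
      obtain e' V' where 2: "1 \<le> e'" "1 \<le> V'" "poly_norm k e' V' (v l)"
        using poly_fun_poly_norm[OF v[of l]] Suc.prems by auto
      have "\<forall>i<Suc l. poly_norm k (e + e') (V + V') (v i)"
      proof (intro allI impI)
        fix i assume "i < Suc l"
        then consider "i = l" | "i < l" by linarith
        thus "poly_norm k (e + e') (V + V') (v i)"
        proof cases
          case 1
          show ?thesis unfolding 1 by (rule pn_weaken[OF 2(3)]) (use \<open>1 \<le> V\<close> in auto)
        next
          case 2
          show ?thesis by (rule pn_weaken[OF 1(3)[rule_format, OF 2]]) (use \<open>1 \<le> V'\<close> in auto)
        qed
      qed
      thus ?case using 1 2 by (intro exI[of _ "e + e'"] exI[of _ "V + V'"]) auto
    qed
    thus ?thesis by blast
  qed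
  then obtain e V where eV: "1 \<le> e" "1 \<le> V" "\<And>i. i < k \<Longrightarrow> poly_norm k e V (v i)" by blast
  obtain d A where dA: "1 \<le> d" "1 \<le> A" "poly_norm k d A p" using poly_fun_poly_norm[OF p] by blast
  define R where "R = 1 + (\<Sum>i<k. \<bar>a i\<bar>)"
  have R: "1 \<le> R" "\<And>i. i < k \<Longrightarrow> \<bar>a i\<bar> \<le> R"
    unfolding R_def using member_le_sum[of _ "{..<k}" "\<lambda>i. \<bar>a i\<bar>"] by (auto simp: sum_nonneg intro: add_increasing)
  let ?D = "real d * real e * V"
  have bd: "poly_norm k (d + n * e) (A * ?D ^ n * fact n) ((lie_deriv k v ^^ n) p)" for n
  proof (induction n)
    case 0 thus ?case using dA by simp
  next
    case (Suc n)
    have 1: "poly_norm k (d + n * e + e) (real (d + n * e) * V * (A * ?D ^ n * fact n)) ((lie_deriv k v ^^ Suc n) p)"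
      using poly_norm_lie_deriv[OF eV(3) _ Suc.IH] eV by simp
    \<comment> \<open>As \<open>d\<close> and \<open>e\<close> are at least 1, the new factor
      \<open>d + n * e\<close> is at most \<open>d * e\<close> times the next factor of the
      factorial.\<close>
    have "d + n * e \<le> d * e + d * n * e" using dA(1) eV(1) by (intro add_mono) auto
    hence "d + n * e \<le> d * e * Suc n" by (simp add: algebra_simps)
    hence "real (d + n * e) \<le> real d * real e * real (Suc n)" by (metis of_nat_le_iff of_nat_mult)
    hence "real (d + n * e) * V * (A * ?D ^ n * fact n) \<le> real d * real e * real (Suc n) * V * (A * ?D ^ n * fact n)"
      using eV dA by (intro mult_right_mono) auto
    also have "\<dots> = A * ?D ^ Suc n * fact (Suc n)" by (simp add: algebra_simps)
    finally show ?case by (intro pn_weaken[OF 1]) auto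
  qed
  show ?thesis
  proof (intro exI conjI allI)
    show "0 \<le> A * R ^ d" using dA R by simp
    have "1 * 1 * 1 \<le> ?D" using dA eV by (intro mult_mono) auto
    moreover have "1 \<le> R ^ e" using R by simp
    ultimately have "1 * 1 \<le> ?D * R ^ e" by (intro mult_mono) auto
    thus "1 \<le> ?D * R ^ e" by simp
    have *: "R ^ (d + n * e) = R ^ d * (R ^ e) ^ n" for n
      by (simp add: power_add power_mult mult.commute[of n e])
    show "\<bar>(lie_deriv k v ^^ n) p a\<bar> \<le> (A * R ^ d) * (?D * R ^ e) ^ n * fact n" for n
      using poly_norm_bound[where x = a, OF bd R, of n] unfolding * by (simp add: power_mult_distrib mult_ac)
  qed
qed

text \<open>The Taylor series at time 0 of \<open>p\<close> along the integral curve of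
  \<open>v\<close> that starts at \<open>a\<close>.\<close>

definition lie_series :: "nat \<Rightarrow> (nat \<Rightarrow> pt \<Rightarrow> real) \<Rightarrow> pt \<Rightarrow> (pt \<Rightarrow> real) \<Rightarrow> real fps" where
  "lie_series k v a p = Abs_fps (\<lambda>n. (lie_deriv k v ^^ n) p a / fact n)"

lemma lie_series_deriv: "fps_deriv (lie_series k v a p) = lie_series k v a (lie_deriv k v p)"
proof (rule fps_ext)
  fix n
  have "(lie_deriv k v ^^ Suc n) p a = (lie_deriv k v ^^ n) (lie_deriv k v p) a"
    by (simp add: funpow_swap1)
  moreover have "real (Suc n) * (x / fact (Suc n)) = x / fact n" for x :: real
    by (simp add: fact_Suc del: of_nat_Suc)
  ultimately show "fps_nth (fps_deriv (lie_series k v a p)) n = fps_nth (lie_series k v a (lie_deriv k v p)) n"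
    by (simp add: lie_series_def del: of_nat_Suc fact_Suc funpow.simps)
qed

lemma lie_series_const: "lie_series k v a (\<lambda>x. c) = fps_const c"
proof (rule fps_ext)
  fix n
  have "(lie_deriv k v ^^ Suc l) (\<lambda>x. c) = (\<lambda>x. 0)" for l
    by (induction l) simp_all
  thus "fps_nth (lie_series k v a (\<lambda>x. c)) n = fps_nth (fps_const c) n"
    by (cases n) (simp_all add: lie_series_def del: funpow.simps(2))
qed

context
  fixes k :: nat and v :: "nat \<Rightarrow> pt \<Rightarrow> real"
  assumes v: "\<And>i. i < k \<Longrightarrow> poly_fun k (v i)"
begin

lemma lie_series_add:
  assumes "poly_fun k p" "poly_fun k q"
  shows "lie_series k v a (\<lambda>x. p x + q x) = lie_series k v a p + lie_series k v a q"
proof (rule fps_ext)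
  fix n
  have "(lie_deriv k v ^^ n) (\<lambda>x. p x + q x) = (\<lambda>x. (lie_deriv k v ^^ n) p x + (lie_deriv k v ^^ n) q x)"
  proof (induction n)
    case (Suc n)
    thus ?case
      by (simp add: lie_deriv_add[OF poly_fun_lie_deriv_funpow[where v = v, OF v assms(1)] poly_fun_lie_deriv_funpow[where v = v, OF v assms(2)]])
  qed simp
  thus "fps_nth (lie_series k v a (\<lambda>x. p x + q x)) n = fps_nth (lie_series k v a p + lie_series k v a q) n"
    by (simp add: lie_series_def add_divide_distrib)
qed

text \<open>Both sides satisfy the same differential equation with the same constant term.\<close>
lemma lie_series_mult:
  assumes "poly_fun k p" "poly_fun k q"
  shows "lie_series k v a (\<lambda>x. p x * q x) = lie_series k v a p * lie_series k v a q"
proof (rule fps_ext)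
  fix n
  show "fps_nth (lie_series k v a (\<lambda>x. p x * q x)) n = fps_nth (lie_series k v a p * lie_series k v a q) n"
    using assms
  proof (induction n arbitrary: p q)
    case 0
    thus ?case by (simp add: lie_series_def)
  next
    case (Suc n)
    let ?E = "lie_series k v a" and ?D = "lie_deriv k v"
    note D = poly_fun_lie_deriv[where v = v, OF v]
    have "of_nat (Suc n) * fps_nth (?E (\<lambda>x. p x * q x)) (Suc n) = fps_nth (fps_deriv (?E (\<lambda>x. p x * q x))) n" by simp
    also have "\<dots> = fps_nth (?E (\<lambda>x. ?D p x * q x + p x * ?D q x)) n"
      by (simp only: lie_series_deriv lie_deriv_mult[OF Suc.prems])
    also have "\<dots> = fps_nth (?E (?D p) * ?E q) n + fps_nth (?E p * ?E (?D q)) n"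
      using Suc.prems D by (subst lie_series_add) (auto intro!: pf_mult simp: Suc.IH)
    also have "\<dots> = fps_nth (fps_deriv (?E p * ?E q)) n"
      by (simp add: lie_series_deriv fps_deriv_mult del: fps_deriv_nth)
    also have "\<dots> = of_nat (Suc n) * fps_nth (?E p * ?E q) (Suc n)"
      by (simp del: fps_deriv_mult of_nat_Suc)
    finally show ?case by (simp del: of_nat_Suc)
  qed
qed

lemma lie_series_conv_radius:
  assumes "poly_fun k p"
  shows "0 < fps_conv_radius (lie_series k v a p)"
proof -
  from lie_deriv_funpow_bound[where v = v, OF v assms] obtain A C
    where AC': "0 \<le> A \<and> 1 \<le> C \<and> (\<forall>n. \<bar>(lie_deriv k v ^^ n) p a\<bar> \<le> A * C ^ n * fact n)"
    by blast
  note AC = AC'[THEN conjunct1] AC'[THEN conjunct2, THEN conjunct1]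
    AC'[THEN conjunct2, THEN conjunct2, rule_format]
  \<comment> \<open>At this point the factorial bound leaves a geometric series of ratio
    1/2.\<close>
  have "ereal (norm (1 / (2 * C))) \<le> fps_conv_radius (lie_series k v a p)"
    unfolding fps_conv_radius_def
  proof (rule conv_radius_geI)
    have "norm (fps_nth (lie_series k v a p) n * (1 / (2 * C)) ^ n) \<le> A * (1/2) ^ n" for n
    proof -
      have "\<bar>(lie_deriv k v ^^ n) p a\<bar> / fact n \<le> A * C ^ n" using AC(3)[of n]
        by (simp add: field_simps)
      hence "\<bar>(lie_deriv k v ^^ n) p a\<bar> / fact n * (1 / (2 * C)) ^ n \<le> A * C ^ n * (1 / (2 * C)) ^ n"
        using AC by (intro mult_right_mono) auto
      thus ?thesis using AC
        by (simp add: lie_series_def abs_mult power_mult_distrib power_divide)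
    qed
    thus "summable (\<lambda>n. fps_nth (lie_series k v a p) n * (1 / (2 * C)) ^ n)"
      by (intro summable_comparison_test[OF _ summable_mult[OF summable_geometric]]) auto
  qed
  moreover have "0 < ereal (norm (1 / (2 * C)))" using AC(2) by simp
  ultimately show ?thesis by (meson less_le_trans)
qed

end

text \<open>The coordinates of the curve are the Lie series of the coordinate functions. Since
  taking Lie series is a ring homomorphism, the series of \<open>p\<close> sums to \<open>p\<close>
  along the curve, so \<open>p\<close> vanishes there when all its iterated Lie derivatives vanish
  at \<open>a\<close>. Injectivity comes from coordinate \<open>j\<close>, whose derivative at time
  0 is \<open>v j a\<close>.\<close>

lemma lie_curve:
  assumes "\<forall>i<k. poly_fun k (v i)" and a: "a \<in> Rn k" and "j < k" "v j a \<noteq> 0"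
  shows "\<exists>(\<delta>::real) c. 0 < \<delta> \<and> c 0 = a \<and> continuous_on {-\<delta>..\<delta>} c \<and> inj_on c {-\<delta>..\<delta>} \<and> (\<forall>t. c t \<in> Rn k) \<and>
    (\<forall>p. poly_fun k p \<and> (\<forall>n. (lie_deriv k v ^^ n) p a = 0) \<longrightarrow> (\<forall>t. \<bar>t\<bar> \<le> \<delta> \<longrightarrow> p (c t) = 0))"
proof -
  have v: "poly_fun k (v i)" if "i < k" for i using assms(1) that by blast
  let ?E = "lie_series k v a"
  let ?X = "\<lambda>i. ?E (\<lambda>x. x i)"
  define r where "r = Min (insert 1 ((\<lambda>i. fps_conv_radius (?X i)) ` {..<k}))"
  define c where "c = (\<lambda>t i. if i < k then eval_fps (?X i) t else 0)"
  have r0: "0 < r" unfolding r_def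
    by (subst Min_gr_iff) (auto intro: lie_series_conv_radius[where v = v, OF v] pf_var)
  have rX: "r \<le> fps_conv_radius (?X i)" if "i < k" for i
    unfolding r_def using that by (intro Min_le) auto
  have key: "r \<le> fps_conv_radius (?E p) \<and> (\<forall>t. ereal \<bar>t\<bar> < r \<longrightarrow> eval_fps (?E p) t = p (c t))"
    if "poly_fun k p" for p
    using that
  proof induction
    case (pf_const c)
    thus ?case by (simp add: lie_series_const)
  next
    case (pf_var i)
    thus ?case using rX by (auto simp: c_def)
  next
    case (pf_add p q)
    have 1: "r \<le> fps_conv_radius (?E p + ?E q)"
      by (rule order_trans[OF _ fps_conv_radius_add]) (use pf_add.IH in simp)
    have "eval_fps (?E p + ?E q) t = p (c t) + q (c t)" if "ereal \<bar>t\<bar> < r" for t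
      using that pf_add.IH by (subst eval_fps_add) (auto intro: less_le_trans)
    thus ?case using 1 by (simp add: lie_series_add[where v = v, OF v pf_add.hyps])
  next
    case (pf_mult p q)
    have 1: "r \<le> fps_conv_radius (?E p * ?E q)"
      by (rule order_trans[OF _ fps_conv_radius_mult]) (use pf_mult.IH in simp)
    have "eval_fps (?E p * ?E q) t = p (c t) * q (c t)" if "ereal \<bar>t\<bar> < r" for t
      using that pf_mult.IH by (subst eval_fps_mult) (auto intro: less_le_trans)
    thus ?case using 1 by (simp add: lie_series_mult[where v = v, OF v pf_mult.hyps])
  qed
  define f where "f = ?X j"
  have f1: "eval_fps (fps_deriv f) 0 \<noteq> 0"
    using assms(3,4) by (simp add: f_def lie_series_deriv eval_fps_at_0 lie_deriv_var)
      (simp add: lie_series_def)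
  have rf: "r \<le> fps_conv_radius f" using rX[OF assms(3)] by (simp add: f_def)
  hence rf': "0 < fps_conv_radius (fps_deriv f)"
    using r0 fps_conv_radius_deriv[of f] by (meson less_le_trans)
  have "isCont (eval_fps (fps_deriv f)) 0"
    by (rule continuous_eval_fps) (use rf' in \<open>simp add: zero_ereal_def\<close>)
  then obtain h where h: "0 < h" "\<And>t. \<bar>t\<bar> < h \<Longrightarrow> eval_fps (fps_deriv f) t \<noteq> 0"
    using continuous_at_avoid[of 0 "eval_fps (fps_deriv f)" 0] f1 by auto
  obtain \<rho> where \<rho>: "0 < \<rho>" "ereal \<rho> < r"
    using ereal_dense2[OF r0] by auto
  define \<delta> where "\<delta> = min \<rho> (h / 2)"
  have d: "0 < \<delta>" "\<delta> < h" "\<delta> \<le> \<rho>" using \<rho> h by (auto simp: \<delta>_def)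
  have dr: "ereal \<bar>t\<bar> < r" if "\<bar>t\<bar> \<le> \<delta>" for t
    using that d by (intro le_less_trans[OF _ \<rho>(2)]) simp
  show ?thesis
  proof (intro exI conjI)
    show "0 < \<delta>" by fact
    show "c 0 = a"
    proof
      fix i show "c 0 i = a i"
        using a by (auto simp: c_def eval_fps_at_0 lie_series_def Rn_def)
    qed
    show "continuous_on {-\<delta>..\<delta>} c"
    proof (rule continuous_on_coordinatewise_then_product)
      fix i
      show "continuous_on {-\<delta>..\<delta>} (\<lambda>t. c t i)"
      proof (cases "i < k")
        case True
        have "continuous_on {-\<delta>..\<delta>} (eval_fps (?X i))"
        proof (rule continuous_on_subset[OF continuous_on_eval_fps], rule subsetI)
          fix t assume "t \<in> {-\<delta>..\<delta>}"
          hence "\<bar>t\<bar> \<le> \<delta>" by auto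
          from less_le_trans[OF dr[OF this] rX[OF True]]
          show "t \<in> eball 0 (fps_conv_radius (?X i))" by simp
        qed
        thus ?thesis using True by (simp add: c_def)
      qed (simp add: c_def)
    qed
    have "s = t" if "\<bar>s\<bar> \<le> \<delta>" "\<bar>t\<bar> \<le> \<delta>" "c s = c t" "s \<le> t" for s t
    proof (rule ccontr)
      assume "s \<noteq> t"
      hence "s < t" using that by simp
      have D: "(eval_fps f has_real_derivative eval_fps (fps_deriv f) z) (at z)" if "s \<le> z" "z \<le> t" for z
      proof -
        have "\<bar>z\<bar> \<le> \<delta>" using that \<open>\<bar>s\<bar> \<le> \<delta>\<close> \<open>\<bar>t\<bar> \<le> \<delta>\<close> by auto
        from less_le_trans[OF dr[OF this] rf] show ?thesis
          by (intro has_field_derivative_eval_fps) simp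
      qed
      have "eval_fps f s = eval_fps f t"
        using fun_cong[OF \<open>c s = c t\<close>, of j] assms(3) by (simp add: c_def f_def)
      moreover have "eval_fps f t - eval_fps f s = (t - s) * eval_fps (fps_deriv f) z \<Longrightarrow> \<bar>z\<bar> \<le> \<delta> \<Longrightarrow> eval_fps f t \<noteq> eval_fps f s" for z
        using h(2)[of z] d \<open>s < t\<close> by auto
      moreover obtain z where "s < z" "z < t" "eval_fps f t - eval_fps f s = (t - s) * eval_fps (fps_deriv f) z"
        using MVT2[OF \<open>s < t\<close> D] by blast
      moreover have "\<bar>z\<bar> \<le> \<delta>" using \<open>s < z\<close> \<open>z < t\<close> that(1,2) by auto
      ultimately show False by auto
    qed
    thus "inj_on c {-\<delta>..\<delta>}"
      unfolding inj_on_def by (metis abs_le_iff atLeastAtMost_iff linear minus_le_iff)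
    show "\<forall>t. c t \<in> Rn k" by (simp add: c_def Rn_def)
    show "\<forall>p. poly_fun k p \<and> (\<forall>n. (lie_deriv k v ^^ n) p a = 0) \<longrightarrow> (\<forall>t. \<bar>t\<bar> \<le> \<delta> \<longrightarrow> p (c t) = 0)"
    proof (intro allI impI)
      fix p t assume p: "poly_fun k p \<and> (\<forall>n. (lie_deriv k v ^^ n) p a = 0)" "\<bar>t\<bar> \<le> \<delta>"
      have "?E p = 0" by (rule fps_ext) (simp add: lie_series_def p(1))
      moreover have "eval_fps (?E p) t = p (c t)" using key[of p] dr[OF p(2)] p(1) by blast
      ultimately show "p (c t) = 0" by simp
    qed
  qed
qed


lemma partial_deriv_linear:
  assumes "poly_fun k p" "poly_fun k q"
  shows "partial_deriv i (\<lambda>x. c * p x + d * q x) = (\<lambda>x. c * partial_deriv i p x + d * partial_deriv i q x)"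
  using assms by (subst partial_deriv_add[of k]) (auto intro!: poly_fun_intros simp: partial_deriv_cmult[of k])

section \<open>A nonempty semialgebraic set has an isolated point or contains an arc\<close>

definition has_isolated_point :: "pt set \<Rightarrow> bool" where
  "has_isolated_point X \<longleftrightarrow> (\<exists>x U. open U \<and> X \<inter> U = {x})"

definition contains_arc :: "pt set \<Rightarrow> bool" where
  "contains_arc X \<longleftrightarrow> (\<exists>c a b. a < b \<and> continuous_on {a..b} c \<and> inj_on c {a..b::real} \<and> c ` {a..b} \<subseteq> X)"

lemma contains_arc_mono: "contains_arc X \<Longrightarrow> X \<subseteq> Y \<Longrightarrow> contains_arc Y"
  unfolding contains_arc_def by (meson order_trans)

lemma open_coord_less: "open {y :: pt. \<bar>y i - c\<bar> < e}"
  by (intro open_Collect_less continuous_intros continuous_on_product_coordinates)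

text \<open>The elimination process: \<open>P\<close> is the set of pivots, and for \<open>i \<notin> P\<close> the vector field \<open>w i\<close> is \<open>\<Delta>\<close> times
  the \<open>i\<close>-th coordinate field modulo the pivot fields. The fields \<open>w i\<close> annihilate gradients of
  functions vanishing on \<open>X\<close> which are dual to the pivots.\<close>
lemma arc_or_isolated_algebraic:
  assumes X: "X = {x \<in> Rn k \<inter> V. \<forall>p\<in>Z. p x = 0}" and V: "open V"
    and Z: "\<And>p. p \<in> Z \<Longrightarrow> poly_fun k p" and ne: "X \<noteq> {}"
  shows "has_isolated_point X \<or> contains_arc X"
proof -
  define I where "I = {p. poly_fun k p \<and> (\<forall>x\<in>X. p x = 0)}"
  \<comment> \<open>Gradients at \<open>x\<close> of the polynomials vanishing on \<open>X\<close>;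
    entries of index at least \<open>k\<close> are left free.\<close>
  define Gr where "Gr = (\<lambda>x. {d. \<exists>F\<in>I. \<forall>j<k. d j = partial_deriv j F x})"
  have Gr_lin: "(\<lambda>j. a * d j + b * e j) \<in> Gr x" if "d \<in> Gr x" "e \<in> Gr x" for a b d e x
  proof -
    obtain F where F: "F \<in> I" "\<forall>j<k. d j = partial_deriv j F x"
      using \<open>d \<in> Gr x\<close> unfolding Gr_def by auto
    obtain G where G: "G \<in> I" "\<forall>j<k. e j = partial_deriv j G x"
      using \<open>e \<in> Gr x\<close> unfolding Gr_def by auto
    note FG = F(1) G(1) F(2) G(2)
    have "(\<lambda>x. a * F x + b * G x) \<in> I" using FG unfolding I_def by (auto intro!: poly_fun_intros)
    moreover have "\<forall>j<k. a * d j + b * e j = partial_deriv j (\<lambda>x. a * F x + b * G x) x"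
      using FG by (simp add: partial_deriv_linear[of k] I_def)
    ultimately show ?thesis unfolding Gr_def by blast
  qed
  have Gr_sum: "(\<lambda>j. d j - (\<Sum>p\<in>P. c p * e p j)) \<in> Gr x"
    if "finite P" "d \<in> Gr x" "\<And>p. p \<in> P \<Longrightarrow> e p \<in> Gr x" for P d c e x
    using that(1,3)
  proof (induction P)
    case empty thus ?case using that by simp
  next
    case (insert p P)
    have "(\<lambda>j. 1 * (d j - (\<Sum>p\<in>P. c p * e p j)) + (- c p) * e p j) \<in> Gr x"
      using insert by (intro Gr_lin) auto
    moreover have "(\<lambda>j. 1 * (d j - (\<Sum>p\<in>P. c p * e p j)) + (- c p) * e p j) = (\<lambda>j. d j - (\<Sum>p\<in>insert p P. c p * e p j))"
      using insert by (auto simp: fun_eq_iff)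
    ultimately show ?case by simp
  qed
  define dual where "dual = (\<lambda>P w x. \<forall>p\<in>P. \<exists>d\<in>Gr x. (\<forall>i\<in>P. d i = (if i = p then 1 else 0))
      \<and> (\<forall>i<k. i \<notin> P \<longrightarrow> (\<Sum>j<k. w i j x * d j) = (0::real)))"
  define inv where "inv = (\<lambda>P \<Delta> w. P \<subseteq> {..<k} \<and> poly_fun k \<Delta> \<and> (\<forall>i<k. \<forall>j<k. poly_fun k (w i j))
      \<and> (\<forall>x i j. i < k \<and> i \<notin> P \<and> j \<notin> P \<longrightarrow> w i j x = (if i = j then \<Delta> x else (0::real)))
      \<and> (\<exists>x\<in>X. \<Delta> x \<noteq> 0) \<and> (\<forall>x\<in>X. \<Delta> x \<noteq> 0 \<longrightarrow> dual P w x))"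
  have inv0: "inv {} (\<lambda>_. 1) (\<lambda>i j x. if i = j then 1 else 0)"
    unfolding inv_def dual_def using ne by (auto intro: pf_const)
  have step: "\<exists>P' \<Delta>' w'. inv P' \<Delta>' w' \<and> card P < card P'"
    if inv: "inv P \<Delta> w" and i0: "i0 < k" "i0 \<notin> P" and g: "g \<in> I" and x1: "x1 \<in> X" "\<Delta> x1 \<noteq> 0" "lie_deriv k (w i0) g x1 \<noteq> 0"
    for P \<Delta> w i0 g x1
  proof -
    define L where "L = (\<lambda>i. lie_deriv k (w i) g)"
    \<comment> \<open>One step of fraction-free elimination with the new pivot \<open>i0\<close>:
      the combination kills the derivative of \<open>g\<close>, and multiplying by
      \<open>L i0\<close> instead of dividing keeps all fields polynomial. The common diagonal entry
      becomes \<open>\<Delta> * L i0\<close>.\<close>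
    define w' where "w' = (\<lambda>i j x. L i0 x * w i j x - L i x * w i0 j x)"
    have P: "P \<subseteq> {..<k}" "finite P" using inv finite_subset by (auto simp: inv_def)
    have pg: "poly_fun k g" using g by (simp add: I_def)
    have pw: "poly_fun k (w i j)" if "i < k" "j < k" for i j using inv that by (simp add: inv_def)
    have pL: "poly_fun k (L i)" if "i < k" for i
      unfolding L_def by (intro poly_fun_lie_deriv pw pg that)
    have wd: "w i j x = (if i = j then \<Delta> x else 0)" if "i < k" "i \<notin> P" "j \<notin> P" for x i j
      using inv that by (simp add: inv_def)
    have "dual (insert i0 P) w' x" if x: "x \<in> X" "\<Delta> x * L i0 x \<noteq> 0" for x
    proof -
      have "\<Delta> x \<noteq> 0" "L i0 x \<noteq> 0" using x by auto
      hence "dual P w x" using inv x by (simp add: inv_def)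
      hence "\<forall>p\<in>P. \<exists>d. d \<in> Gr x \<and> (\<forall>i\<in>P. d i = (if i = p then 1 else 0))
        \<and> (\<forall>i<k. i \<notin> P \<longrightarrow> (\<Sum>j<k. w i j x * d j) = 0)"
        unfolding dual_def Bex_def .
      from bchoice[OF this] obtain e where "\<forall>p\<in>P. e p \<in> Gr x \<and> (\<forall>i\<in>P. e p i = (if i = p then 1 else 0))
        \<and> (\<forall>i<k. i \<notin> P \<longrightarrow> (\<Sum>j<k. w i j x * e p j) = 0)" by (elim exE)
      hence e: "\<And>p. p \<in> P \<Longrightarrow> e p \<in> Gr x" "\<And>p i. p \<in> P \<Longrightarrow> i \<in> P \<Longrightarrow> e p i = (if i = p then 1 else 0)"
        "\<And>p i. p \<in> P \<Longrightarrow> i < k \<Longrightarrow> i \<notin> P \<Longrightarrow> (\<Sum>j<k. w i j x * e p j) = 0"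
        by simp_all
      define d where "d = (\<lambda>j. partial_deriv j g x)"
      \<comment> \<open>Subtracting the old dual gradients makes the gradient of \<open>g\<close>
        vanish on the old pivots. Its entry at \<open>i0\<close> is then nonzero, so after scaling
        it is the dual gradient of the new pivot, and it corrects the old ones at
        \<open>i0\<close>.\<close>
      define G where "G = (\<lambda>j. d j - (\<Sum>p\<in>P. d p * e p j))"
      have dG: "d \<in> Gr x" unfolding Gr_def d_def using g by blast
      have GG: "G \<in> Gr x" unfolding G_def by (rule Gr_sum[OF P(2) dG e(1)])
      have GP: "G i = 0" if "i \<in> P" for i
      proof -
        have "(\<Sum>p\<in>P. d p * e p i) = (\<Sum>p\<in>P. if p = i then d p else 0)"
          by (rule sum.cong) (use e(2) that in auto)
        thus ?thesis using that P by (simp add: G_def)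
      qed
      have wG: "(\<Sum>j<k. w i j x * G j) = L i x" if "i < k" "i \<notin> P" for i
      proof -
        have "(\<Sum>j<k. w i j x * G j) = (\<Sum>j<k. w i j x * d j) - (\<Sum>j<k. \<Sum>p\<in>P. d p * (w i j x * e p j))"
          by (simp add: G_def algebra_simps sum_subtractf sum_distrib_left)
        also have "(\<Sum>j<k. \<Sum>p\<in>P. d p * (w i j x * e p j)) = (\<Sum>p\<in>P. d p * (\<Sum>j<k. w i j x * e p j))"
          by (subst sum.swap) (simp add: sum_distrib_left)
        also have "\<dots> = 0" using e(3) that by simp
        finally show ?thesis by (simp add: L_def lie_deriv_def d_def)
      qed
      have "(\<Sum>j<k. w i0 j x * G j) = (\<Sum>j<k. if j = i0 then \<Delta> x * G i0 else 0)"
      proof (rule sum.cong)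
        fix j
        show "w i0 j x * G j = (if j = i0 then \<Delta> x * G i0 else 0)"
          using GP[of j] wd[OF i0, of j x] i0 by (cases "j \<in> P") auto
      qed simp
      hence "\<Delta> x * G i0 = L i0 x" using wG[OF i0] i0 by simp
      hence Gi0: "G i0 \<noteq> 0" using \<open>L i0 x \<noteq> 0\<close> by auto
      have w'sum: "(\<Sum>j<k. w' i j x * f j) = L i0 x * (\<Sum>j<k. w i j x * f j) - L i x * (\<Sum>j<k. w i0 j x * f j)" for i f
        by (simp add: w'_def algebra_simps sum_subtractf sum_distrib_left)
      define G1 where "G1 = (\<lambda>j. (1 / G i0) * G j + 0 * G j)"
      have G1: "G1 \<in> Gr x" unfolding G1_def by (intro Gr_lin GG)
      have w'G1: "(\<Sum>j<k. w' i j x * G1 j) = 0" if "i < k" "i \<notin> P" for i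
      proof -
        have "(\<Sum>j<k. w l j x * G1 j) = (1 / G i0) * (\<Sum>j<k. w l j x * G j)" for l
          by (simp add: G1_def sum_distrib_left)
        thus ?thesis using wG that i0 by (simp add: w'sum)
      qed
      show ?thesis unfolding dual_def
      proof
        fix p assume "p \<in> insert i0 P"
        then consider "p = i0" | "p \<in> P" by blast
        thus "\<exists>d\<in>Gr x. (\<forall>i\<in>insert i0 P. d i = (if i = p then 1 else 0)) \<and>
            (\<forall>i<k. i \<notin> insert i0 P \<longrightarrow> (\<Sum>j<k. w' i j x * d j) = 0)"
        proof cases
          case 1
          show ?thesis
            by (rule bexI[OF _ G1]) (use 1 GP Gi0 w'G1 i0 in \<open>auto simp: G1_def\<close>)
        next
          case 2
          define H where "H = (\<lambda>j. 1 * e p j + (- e p i0) * G1 j)"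
          have H: "H \<in> Gr x" unfolding H_def using 2 e(1) G1 by (intro Gr_lin) auto
          have "(\<Sum>j<k. w' i j x * H j) = 0" if "i < k" "i \<notin> P" for i
          proof -
            have "(\<Sum>j<k. w' i j x * H j) = (\<Sum>j<k. w' i j x * e p j) - e p i0 * (\<Sum>j<k. w' i j x * G1 j)"
              by (simp add: H_def algebra_simps sum_subtractf sum_distrib_left)
            thus ?thesis using w'G1[OF that] e(3)[OF 2] that i0 by (simp add: w'sum)
          qed
          moreover have "H i = (if i = p then 1 else 0)" if "i \<in> insert i0 P" for i
            using that 2 e(2)[OF 2] GP i0 Gi0 by (auto simp: H_def G1_def)
          ultimately show ?thesis by (intro bexI[OF _ H]) auto
        qed
      qed
    qed
    moreover have "w' i j x = (if i = j then \<Delta> x * L i0 x else 0)" if "i < k" "i \<notin> insert i0 P" "j \<notin> insert i0 P" for i j x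
      using that wd[of i j x] wd[of i0 j x] i0 by (auto simp: w'_def)
    moreover have "poly_fun k (w' i j)" if "i < k" "j < k" for i j
      unfolding w'_def by (intro poly_fun_intros pL pw that i0)
    moreover have "poly_fun k (\<lambda>x. \<Delta> x * L i0 x)"
      using inv by (intro poly_fun_intros pL i0) (simp add: inv_def)
    moreover have "\<Delta> x1 * L i0 x1 \<noteq> 0" using x1 by (simp add: L_def)
    ultimately have "inv (insert i0 P) (\<lambda>x. \<Delta> x * L i0 x) w'"
      unfolding inv_def using i0 P x1(1) by blast
    moreover have "card P < card (insert i0 P)" using i0 P by simp
    ultimately show ?thesis by blast
  qed
  have "card P \<le> k" if "inv P \<Delta> w" for P \<Delta> w
    using that card_mono[of "{..<k}" P] by (auto simp: inv_def)
  \<comment> \<open>Take as many pivots as possible; then no remaining field moves any element of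
    \<open>I\<close> at a point of \<open>X\<close> where \<open>\<Delta>\<close> is
    nonzero.\<close>
  hence "\<exists>P. (\<exists>\<Delta> w. inv P \<Delta> w) \<and> (\<forall>Q. (\<exists>\<Delta> w. inv Q \<Delta> w) \<longrightarrow> card Q \<le> card P)"
    using inv0 by (intro ex_has_greatest_nat[where b = "Suc k"]) (auto simp: less_Suc_eq_le le_SucI)
  then obtain P \<Delta> w where inv: "inv P \<Delta> w" and max: "\<And>Q \<Delta> w. inv Q \<Delta> w \<Longrightarrow> card Q \<le> card P"
    by blast
  then obtain x where x: "x \<in> X" "\<Delta> x \<noteq> 0" by (auto simp: inv_def)
  show ?thesis
  proof (cases "P = {..<k}")
    \<comment> \<open>Every coordinate is a pivot, so all unit vectors are gradients at
      \<open>x\<close> of polynomials in \<open>I\<close>. The zero set of these polynomials is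
      isolated at \<open>x\<close>, with a radius read off from their Taylor bounds.\<close>
    case True
    have "dual {..<k} w x" using inv x True by (auto simp: inv_def)
    hence "\<forall>p\<in>{..<k}. \<exists>d\<in>Gr x. \<forall>i<k. d i = (if i = p then 1 else 0)"
      unfolding dual_def Ball_def lessThan_iff by blast
    moreover have "\<exists>F. F \<in> I \<and> (\<forall>i<k. partial_deriv i F x = d i)" if "d \<in> Gr x" for d
      using that unfolding Gr_def by auto
    ultimately have "\<forall>p\<in>{..<k}. \<exists>F. F \<in> I \<and> (\<forall>i<k. partial_deriv i F x = (if i = p then 1 else 0))"
      by fastforce
    from bchoice[OF this] obtain F
      where "\<forall>p\<in>{..<k}. F p \<in> I \<and> (\<forall>i<k. partial_deriv i (F p) x = (if i = p then 1 else 0))" by (elim exE)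
    hence F: "\<And>p. p < k \<Longrightarrow> F p \<in> I" "\<And>p i. p < k \<Longrightarrow> i < k \<Longrightarrow> partial_deriv i (F p) x = (if i = p then 1 else 0)"
      by simp_all
    have "\<forall>p. \<exists>C. p < k \<longrightarrow> taylor_bound k x (F p) C"
      using F(1) poly_fun_taylor by (auto simp: I_def)
    then obtain C where C: "\<And>p. p < k \<Longrightarrow> taylor_bound k x (F p) (C p)" by metis
    define M where "M = 1 + (\<Sum>p<k. C p)"
    have C0: "0 \<le> C p" if "p < k" for p using C[OF that] by (simp add: taylor_bound_def)
    have CM: "C p \<le> M" if "p < k" for p
      unfolding M_def using member_le_sum[of p "{..<k}" C] C0 that by auto
    have M: "1 \<le> M" unfolding M_def using sum_nonneg[of "{..<k}" C] C0 by simp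
    define U where "U = (\<Inter>i<k. {y :: pt. \<bar>y i - x i\<bar> < 1 / M})"
    have "open U" unfolding U_def by (intro open_INT) (auto simp: open_coord_less)
    moreover have "y = x" if "y \<in> X" "y \<in> U" for y
    proof (rule ccontr)
      assume "y \<noteq> x"
      then obtain i0 where "y i0 \<noteq> x i0" by auto
      moreover have "x \<in> Rn k" "y \<in> Rn k" using x that X by auto
      ultimately have i0: "i0 < k" by (metis (mono_tags, lifting) Rn_def linorder_not_le mem_Collect_eq)
      \<comment> \<open>For the coordinate \<open>p\<close> of largest displacement, the linear part
        of \<open>F p\<close> has absolute value \<open>r\<close> while the remainder is at most
        \<open>M * r\<^sup>2\<close>. As \<open>F p\<close> vanishes at both points,
        \<open>r\<close> is at least \<open>1 / M\<close>.\<close>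
      define r where "r = Max ((\<lambda>i. \<bar>y i - x i\<bar>) ` {..<k})"
      have fin: "finite ((\<lambda>i. \<bar>y i - x i\<bar>) ` {..<k})" "(\<lambda>i. \<bar>y i - x i\<bar>) ` {..<k} \<noteq> {}" using i0 by auto
      have r: "\<bar>y i - x i\<bar> \<le> r" if "i < k" for i unfolding r_def by (rule Max_ge) (use that in auto)
      obtain p where p: "p < k" "r = \<bar>y p - x p\<bar>" using Max_in[OF fin] by (auto simp: r_def)
      have "0 < r" using r[OF i0] \<open>y i0 \<noteq> x i0\<close> by linarith
      have "r < 1 / M" using p \<open>y \<in> U\<close> by (auto simp: U_def)
      moreover have "1 / M \<le> 1" using M by simp
      ultimately have "r \<le> 1" by linarith
      hence "\<bar>F p y - F p x - (\<Sum>i<k. partial_deriv i (F p) x * (y i - x i))\<bar> \<le> C p * r\<^sup>2"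
        using C[OF p(1)] r \<open>0 < r\<close> unfolding taylor_bound_def by auto
      moreover have "F p y = 0" "F p x = 0" using F(1)[OF p(1)] that x by (auto simp: I_def)
      moreover have "(\<Sum>i<k. partial_deriv i (F p) x * (y i - x i)) = (\<Sum>i<k. if i = p then y i - x i else 0)"
        by (rule sum.cong) (use F(2)[OF p(1)] in auto)
      ultimately have "r \<le> C p * r\<^sup>2" using p by simp
      also have "\<dots> \<le> M * r\<^sup>2" using CM[OF p(1)] by (intro mult_right_mono) auto
      finally have "1 \<le> M * r" using \<open>0 < r\<close> by (simp add: power2_eq_square)
      thus False using \<open>r < 1 / M\<close> M by (simp add: field_simps)
    qed
    moreover have "x \<in> U" using M by (auto simp: U_def)
    ultimately have "X \<inter> U = {x}" using x(1) by blast
    thus ?thesis using \<open>open U\<close> unfolding has_isolated_point_def by blast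
  next
    case False
    then obtain i0 where i0: "i0 < k" "i0 \<notin> P" using inv by (auto simp: inv_def)
    have kill: "lie_deriv k (w i0) g y = 0" if "g \<in> I" "y \<in> X" "\<Delta> y \<noteq> 0" for g y
      using step[OF inv i0 that] max by (meson not_le)
    \<comment> \<open>The field \<open>w i0\<close> preserves the vanishing on \<open>X\<close> only
      where \<open>\<Delta>\<close> is nonzero. The additional factor \<open>\<Delta>\<close> makes
      the Lie derivative map \<open>I\<close> into itself, so the integral curve stays in the zero
      set.\<close>
    define v where "v = (\<lambda>j y. \<Delta> y * w i0 j y)"
    have v: "poly_fun k (v j)" if "j < k" for j
      unfolding v_def using inv i0 that by (intro pf_mult) (auto simp: inv_def)
    have Lv: "lie_deriv k v g y = \<Delta> y * lie_deriv k (w i0) g y" for g y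
      by (simp add: lie_deriv_def v_def sum_distrib_left mult_ac)
    have DI: "(lie_deriv k v ^^ n) g \<in> I" if "g \<in> I" for g n
    proof (induction n)
      case (Suc n)
      have "poly_fun k (lie_deriv k v ((lie_deriv k v ^^ n) g))"
        using Suc v by (intro poly_fun_lie_deriv) (auto simp: I_def)
      moreover have "lie_deriv k v ((lie_deriv k v ^^ n) g) y = 0" if "y \<in> X" for y
        using kill[OF Suc that] Lv[of "(lie_deriv k v ^^ n) g" y] by (metis mult_zero_left mult_zero_right)
      ultimately show ?case by (simp add: I_def)
    qed (use that in simp)
    have xk: "x \<in> Rn k" using x X by simp
    have vx: "v i0 x \<noteq> 0" using inv i0 x by (auto simp: v_def inv_def)
    have "\<forall>j<k. poly_fun k (v j)" using v by blast
    from lie_curve[OF this xk i0(1) vx] obtain \<delta> :: real and c where cc: "0 < \<delta> \<and> c 0 = x \<and> continuous_on {-\<delta>..\<delta>} c \<and> inj_on c {-\<delta>..\<delta>} \<and> (\<forall>t. c t \<in> Rn k) \<and>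
    (\<forall>p. poly_fun k p \<and> (\<forall>n. (lie_deriv k v ^^ n) p x = 0) \<longrightarrow> (\<forall>t. \<bar>t\<bar> \<le> \<delta> \<longrightarrow> p (c t) = 0))"
      by (elim exE)
    note c = cc[THEN conjunct1] cc[THEN conjunct2, THEN conjunct1] cc[THEN conjunct2, THEN conjunct2, THEN conjunct1]
      cc[THEN conjunct2, THEN conjunct2, THEN conjunct2, THEN conjunct1] cc[THEN conjunct2, THEN conjunct2, THEN conjunct2, THEN conjunct2, THEN conjunct1]
      cc[THEN conjunct2, THEN conjunct2, THEN conjunct2, THEN conjunct2, THEN conjunct2]
    have "isCont c 0" using c by (intro continuous_on_interior[OF c(3)]) auto
    moreover have "c 0 \<in> V" using c x X by simp
    ultimately have "eventually (\<lambda>t. c t \<in> V) (at 0)"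
      using V topological_tendstoD unfolding isCont_def by blast
    then obtain h where h: "0 < h" "\<And>t. t \<noteq> 0 \<Longrightarrow> \<bar>t\<bar> < h \<Longrightarrow> c t \<in> V"
      unfolding eventually_at by (auto simp: dist_real_def)
    define b where "b = min \<delta> (h / 2)"
    have "c t \<in> X" if "t \<in> {-b..b}" for t
    proof -
      have t: "\<bar>t\<bar> \<le> \<delta>" "\<bar>t\<bar> < h" using that h(1) c(1) by (auto simp: b_def)
      have "c t \<in> V" using h(2)[OF _ t(2)] \<open>c 0 \<in> V\<close> by (cases "t = 0") auto
      moreover have "p (c t) = 0" if "p \<in> Z" for p
      proof -
        have "p \<in> I" using that X Z by (simp add: I_def)
        hence "(lie_deriv k v ^^ n) p x = 0" for n using DI[of p n] x by (simp add: I_def)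
        thus ?thesis using c(6) Z[OF that] t(1) by blast
      qed
      ultimately show ?thesis using X c(5) by simp
    qed
    moreover have "{-b..b} \<subseteq> {-\<delta>..\<delta>}" "-b < b" using h c(1) by (auto simp: b_def)
    ultimately have "contains_arc X" unfolding contains_arc_def
      using c(3,4) by (intro exI[of _ c] exI[of _ "-b"] exI[of _ b])
        (auto intro: continuous_on_subset inj_on_subset)
    thus ?thesis ..
  qed
qed

text \<open>Dependence on finitely many signs is stable under unions and complements, so it replaces
  a normal form of semialgebraic sets.\<close>

definition sign_determined :: "nat \<Rightarrow> pt set \<Rightarrow> (pt \<Rightarrow> real) set \<Rightarrow> bool" where
  "sign_determined k S ps \<longleftrightarrow> finite ps \<and> (\<forall>p\<in>ps. poly_fun k p) \<and> S \<subseteq> Rn k \<and>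
    (\<forall>x\<in>Rn k. \<forall>y\<in>Rn k. (\<forall>p\<in>ps. sgn (p x) = sgn (p y)) \<longrightarrow> (x \<in> S \<longleftrightarrow> y \<in> S))"

lemma sign_determinedD:
  assumes "sign_determined k S ps"
  shows "finite ps" "\<And>p. p \<in> ps \<Longrightarrow> poly_fun k p" "S \<subseteq> Rn k"
    "x \<in> Rn k \<Longrightarrow> y \<in> Rn k \<Longrightarrow> (\<And>p. p \<in> ps \<Longrightarrow> sgn (p x) = sgn (p y)) \<Longrightarrow> x \<in> S \<longleftrightarrow> y \<in> S"
proof -
  note sd = assms[unfolded sign_determined_def]
  show "finite ps" "\<And>p. p \<in> ps \<Longrightarrow> poly_fun k p" "S \<subseteq> Rn k" using sd by blast+
  assume *: "x \<in> Rn k" "y \<in> Rn k" "\<And>p. p \<in> ps \<Longrightarrow> sgn (p x) = sgn (p y)"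
  have "\<forall>p\<in>ps. sgn (p x) = sgn (p y)" using *(3) by (rule ballI)
  from sd[THEN conjunct2, THEN conjunct2, THEN conjunct2, THEN bspec, OF *(1), THEN bspec, OF *(2), THEN mp, OF this]
  show "x \<in> S \<longleftrightarrow> y \<in> S" .
qed

lemma semialg_sign_determined:
  assumes "semialg k S"
  shows "\<exists>ps. sign_determined k S ps"
  using assms
proof induction
  case (sa_pos p)
  have "0 < p x \<longleftrightarrow> sgn (p x) = 1" for x by (simp add: sgn_if)
  thus ?case using sa_pos by (intro exI[of _ "{p}"]) (auto simp: sign_determined_def)
next
  case (sa_zero p)
  have "p x = 0 \<longleftrightarrow> sgn (p x) = 0" for x by (simp add: sgn_if)
  thus ?case using sa_zero by (intro exI[of _ "{p}"]) (auto simp: sign_determined_def)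
next
  case (sa_union A B)
  then obtain ps qs where *: "sign_determined k A ps" "sign_determined k B qs" by auto
  have "sign_determined k (A \<union> B) (ps \<union> qs)"
    unfolding sign_determined_def
  proof (intro conjI ballI impI)
    show "finite (ps \<union> qs)" using *[THEN sign_determinedD(1)] by (rule finite_UnI)
    show "A \<union> B \<subseteq> Rn k" using *[THEN sign_determinedD(3)] by (rule Un_least)
    show "poly_fun k p" if "p \<in> ps \<union> qs" for p
      using that sign_determinedD(2)[OF *(1)] sign_determinedD(2)[OF *(2)] by blast
    fix x y assume xy: "x \<in> Rn k" "y \<in> Rn k" "\<forall>p\<in>ps \<union> qs. sgn (p x) = sgn (p y)"
    have "x \<in> A \<longleftrightarrow> y \<in> A" by (rule sign_determinedD(4)[OF *(1) xy(1,2)]) (use xy(3) in blast)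
    moreover have "x \<in> B \<longleftrightarrow> y \<in> B" by (rule sign_determinedD(4)[OF *(2) xy(1,2)]) (use xy(3) in blast)
    ultimately show "x \<in> A \<union> B \<longleftrightarrow> y \<in> A \<union> B" by simp
  qed
  thus ?case by blast
next
  case (sa_compl A)
  then obtain ps where "sign_determined k A ps" by auto
  hence "sign_determined k (Rn k - A) ps" unfolding sign_determined_def by blast
  thus ?case by blast
qed

text \<open>Points near \<open>x\<close> with the same signs as \<open>x\<close> form a locally
  algebraic set \<open>Y\<close>, to which the algebraic case applies. An isolated point of
  \<open>Y\<close> need not be isolated in \<open>S\<close>. One then passes to a neighbourhood of
  it with the point itself removed: the sign vector of \<open>x\<close> no longer occurs there, so
  the number of sign vectors drops.\<close>

lemma arc_or_isolated:
  assumes "semialg k S" "open V" "S \<inter> V \<noteq> {}"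
  shows "has_isolated_point (S \<inter> V) \<or> contains_arc (S \<inter> V)"
proof -
  obtain ps where "sign_determined k S ps"
    using semialg_sign_determined[OF assms(1)] by blast
  note ps = sign_determinedD(1-3)[OF this] and sgn = sign_determinedD(4)[OF this]
  \<comment> \<open>The default 0 outside \<open>ps\<close> leaves only finitely many possible sign
    vectors.\<close>
  define sv :: "pt \<Rightarrow> (pt \<Rightarrow> real) \<Rightarrow> real"
    where "sv = (\<lambda>x p. if p \<in> ps then sgn (p x) else 0)"
  have "sv ` A \<subseteq> {f. \<forall>p. (p \<in> ps \<longrightarrow> f p \<in> {-1,0,1}) \<and> (p \<notin> ps \<longrightarrow> f p = 0)}" for A
  proof -
    have "sgn r \<in> {-1,0,1}" for r :: real by (cases r "0 :: real" rule: linorder_cases) auto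
    hence "\<forall>p. (p \<in> ps \<longrightarrow> sv x p \<in> {-1,0,1}) \<and> (p \<notin> ps \<longrightarrow> sv x p = 0)" for x
      unfolding sv_def by presburger
    thus ?thesis by blast
  qed
  hence fin: "finite (sv ` A)" for A
    by (rule finite_subset[OF _ finite_set_of_finite_funs[OF ps(1)]]) simp
  show ?thesis using assms(2,3)
  proof (induction "card (sv ` (S \<inter> V))" arbitrary: V rule: less_induct)
    case less
    then obtain x where x: "x \<in> S" "x \<in> V" by blast
    define V' where "V' = V \<inter> (\<Inter>p\<in>{p\<in>ps. p x > 0}. {y. p y > 0}) \<inter> (\<Inter>p\<in>{p\<in>ps. p x < 0}. {y. p y < 0})"
    define Y where "Y = {y \<in> Rn k \<inter> V'. \<forall>p\<in>{p\<in>ps. p x = 0}. p y = 0}"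
    have pos: "open {y. p y > 0}" "open {y. p y < 0}" if "p \<in> ps" for p
      by (intro open_Collect_less continuous_on_const poly_fun_continuous[OF ps(2)[OF that]])+
    have "open V'" unfolding V'_def using ps(1) pos less.prems by (intro open_Int open_INT) auto
    have Ysgn: "y \<in> Y \<longleftrightarrow> y \<in> Rn k \<and> y \<in> V \<and> (\<forall>p\<in>ps. sgn (p y) = sgn (p x))" for y
    proof
      show "y \<in> Y \<Longrightarrow> y \<in> Rn k \<and> y \<in> V \<and> (\<forall>p\<in>ps. sgn (p y) = sgn (p x))"
        by (auto simp: Y_def V'_def sgn_if)
    next
      assume *: "y \<in> Rn k \<and> y \<in> V \<and> (\<forall>p\<in>ps. sgn (p y) = sgn (p x))"
      have sg: "(a > 0 \<longrightarrow> b > 0) \<and> (a < 0 \<longrightarrow> b < 0) \<and> (a = 0 \<longrightarrow> b = 0)" if "sgn b = sgn a" for a b :: real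
        using that by (auto simp: sgn_if split: if_splits)
      have "(p x > 0 \<longrightarrow> p y > 0) \<and> (p x < 0 \<longrightarrow> p y < 0) \<and> (p x = 0 \<longrightarrow> p y = 0)" if "p \<in> ps" for p
        by (rule sg) (use * that in blast)
      thus "y \<in> Y" using * by (auto simp: Y_def V'_def)
    qed
    have YS: "Y \<subseteq> S \<inter> V"
    proof
      fix y assume "y \<in> Y"
      hence y: "y \<in> Rn k" "y \<in> V" "\<And>p. p \<in> ps \<Longrightarrow> sgn (p y) = sgn (p x)" using Ysgn by auto
      have "x \<in> Rn k" using x ps(3) by blast
      from sgn[OF y(1) this y(3)] show "y \<in> S \<inter> V" using x y(2) by simp
    qed
    have xY: "x \<in> Y" using x ps(3) Ysgn by auto
    have "has_isolated_point Y \<or> contains_arc Y"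
      using arc_or_isolated_algebraic[OF Y_def \<open>open V'\<close>] ps(2) xY by auto
    thus ?case
    proof
      assume "contains_arc Y" thus ?thesis using contains_arc_mono YS by blast
    next
      assume "has_isolated_point Y"
      then obtain x1 U where U: "open U" "Y \<inter> U = {x1}" unfolding has_isolated_point_def by blast
      define W where "W = V \<inter> U - {x1}"
      have "open W" unfolding W_def using U less.prems by (intro open_Diff) auto
      have x1: "x1 \<in> S" "x1 \<in> V" "x1 \<in> U" using U(2) YS by auto
      show ?thesis
      proof (cases "S \<inter> W = {}")
        case True
        hence "(S \<inter> V) \<inter> U = {x1}" using x1 by (auto simp: W_def)
        thus ?thesis using U unfolding has_isolated_point_def by blast
      next
        case False
        have "sv x \<notin> sv ` (S \<inter> W)"
        proof
          assume "sv x \<in> sv ` (S \<inter> W)"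
          then obtain y where y: "y \<in> S" "y \<in> W" "sv x = sv y" by auto
          have "sgn (p y) = sgn (p x)" if "p \<in> ps" for p
            using fun_cong[OF y(3), of p] that by (simp add: sv_def)
          hence "y \<in> Y" using y ps(3) Ysgn by (auto simp: W_def)
          thus False using y U by (auto simp: W_def)
        qed
        moreover have "sv x \<in> sv ` (S \<inter> V)" "sv ` (S \<inter> W) \<subseteq> sv ` (S \<inter> V)" using x by (auto simp: W_def)
        ultimately have "card (sv ` (S \<inter> W)) < card (sv ` (S \<inter> V))"
          by (intro psubset_card_mono fin) blast
        from less.hyps[OF this \<open>open W\<close> False] show ?thesis
        proof
          assume "contains_arc (S \<inter> W)"
          moreover have "S \<inter> W \<subseteq> S \<inter> V" by (auto simp: W_def)
          ultimately show ?thesis using contains_arc_mono by blast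
        next
          assume "has_isolated_point (S \<inter> W)"
          then obtain y U' where U': "open U'" "S \<inter> W \<inter> U' = {y}" unfolding has_isolated_point_def by blast
          have "S \<inter> V \<inter> (W \<inter> U') = S \<inter> W \<inter> U'" by (auto simp: W_def)
          hence "S \<inter> V \<inter> (W \<inter> U') = {y}" using U'(2) by (rule trans)
          hence "has_isolated_point (S \<inter> V)" unfolding has_isolated_point_def
            using U'(1) \<open>open W\<close> by (intro exI[of _ y] exI[of _ "W \<inter> U'"] conjI open_Int)
          thus ?thesis ..
        qed
      qed
    qed
  qed
qed

section \<open>Power series\<close>

definition midx :: "nat \<Rightarrow> (nat \<Rightarrow> nat) set" where
  "midx n = {I. \<forall>i\<ge>n. I i = 0}"

definition mdeg :: "nat \<Rightarrow> (nat \<Rightarrow> nat) \<Rightarrow> nat" where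
  "mdeg n I = (\<Sum>i<n. I i)"

definition mmon :: "nat \<Rightarrow> pt \<Rightarrow> (nat \<Rightarrow> nat) \<Rightarrow> real" where
  "mmon n h I = (\<Prod>i<n. h i ^ I i)"

lemma mmon_bound:
  assumes "\<And>i. i < n \<Longrightarrow> \<bar>h i\<bar> \<le> r"
  shows "\<bar>mmon n h I\<bar> \<le> r ^ mdeg n I"
proof -
  have "\<bar>mmon n h I\<bar> = (\<Prod>i<n. \<bar>h i\<bar> ^ I i)" by (simp add: mmon_def abs_prod power_abs)
  also have "\<dots> \<le> (\<Prod>i<n. r ^ I i)" using assms by (intro prod_mono) (auto intro: power_mono)
  also have "\<dots> = r ^ mdeg n I" by (simp add: mdeg_def power_sum)
  finally show ?thesis .
qed

text \<open>The weighted l1 norm of the coefficients. It is submultiplicative, so products,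
  substitutions and infinite sums of series are controlled by norms alone.\<close>

abbreviation cnorm :: "nat \<Rightarrow> real \<Rightarrow> ((nat \<Rightarrow> nat) \<Rightarrow> real) \<Rightarrow> real" where
  "cnorm n r c \<equiv> infsum (\<lambda>I. \<bar>c I\<bar> * r ^ mdeg n I) (midx n)"

text \<open>\<open>pser n a r A f\<close>: on the cube of radius \<open>r\<close> around \<open>a\<close>, \<open>f\<close> is the sum of a power series whose
  norm is at most \<open>A\<close>.\<close>
definition pcoeff :: "nat \<Rightarrow> pt \<Rightarrow> real \<Rightarrow> real \<Rightarrow> (pt \<Rightarrow> real) \<Rightarrow> ((nat \<Rightarrow> nat) \<Rightarrow> real) \<Rightarrow> bool" where
  "pcoeff n a r A f c \<longleftrightarrow> (\<lambda>I. \<bar>c I\<bar> * r ^ mdeg n I) summable_on midx n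
     \<and> cnorm n r c \<le> A \<and> (\<forall>x\<in>Rn n. (\<forall>i<n. \<bar>x i - a i\<bar> \<le> r) \<longrightarrow>
          ((\<lambda>I. c I * mmon n (\<lambda>i. x i - a i) I) has_sum f x) (midx n))"

definition pser :: "nat \<Rightarrow> pt \<Rightarrow> real \<Rightarrow> real \<Rightarrow> (pt \<Rightarrow> real) \<Rightarrow> bool" where
  "pser n a r A f \<longleftrightarrow> (\<exists>c. pcoeff n a r A f c)"

lemma pser_weaken: "pser n a r A f \<Longrightarrow> A \<le> B \<Longrightarrow> pser n a r B f"
  unfolding pser_def pcoeff_def by (elim exE conjE) (intro exI conjI, assumption, rule order_trans)

lemma pser_cong:
  assumes "pser n a r A f" "\<And>x. x \<in> Rn n \<Longrightarrow> (\<And>i. i < n \<Longrightarrow> \<bar>x i - a i\<bar> \<le> r) \<Longrightarrow> f x = g x"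
  shows "pser n a r A g"
proof -
  obtain c where "pcoeff n a r A f c" using assms(1) by (auto simp: pser_def)
  hence "pcoeff n a r A g c"
    unfolding pcoeff_def using assms(2) by auto
  thus ?thesis by (auto simp: pser_def)
qed

lemma pser_nonneg:
  assumes "pser n a r A f" "0 \<le> r"
  shows "0 \<le> A"
proof -
  obtain c where "pcoeff n a r A f c" using assms by (auto simp: pser_def)
  hence "cnorm n r c \<le> A" by (simp add: pcoeff_def)
  moreover have "0 \<le> cnorm n r c"
    using assms by (intro infsum_nonneg) auto
  ultimately show ?thesis by linarith
qed

text \<open>Absolute summability over pairs of a summand and a multi-index allows the double series
  to be rearranged into one power series. Sums, products, substitution, inverses and square roots
  are all reduced to this.\<close>

lemma pser_infsum:
  fixes f :: "'b \<Rightarrow> pt \<Rightarrow> real"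
  assumes r: "0 < r" and f: "\<And>k. k \<in> I \<Longrightarrow> pser n a r (B k) (f k)" and B: "B summable_on I"
    and F: "\<And>x. x \<in> Rn n \<Longrightarrow> (\<And>i. i < n \<Longrightarrow> \<bar>x i - a i\<bar> \<le> r) \<Longrightarrow> ((\<lambda>k. f k x) has_sum F x) I"
  shows "pser n a r (infsum B I) F"
proof -
  have "\<forall>k\<in>I. \<exists>c. pcoeff n a r (B k) (f k) c" using f by (auto simp: pser_def)
  from bchoice[OF this] obtain c where c: "\<forall>k\<in>I. pcoeff n a r (B k) (f k) (c k)" by (elim exE)
  define w where "w = (\<lambda>\<alpha>. r ^ mdeg n \<alpha>)"
  have w: "0 < w \<alpha>" for \<alpha> using r by (simp add: w_def)
  have c1: "(\<lambda>\<alpha>. \<bar>c k \<alpha>\<bar> * w \<alpha>) summable_on midx n" "infsum (\<lambda>\<alpha>. \<bar>c k \<alpha>\<bar> * w \<alpha>) (midx n) \<le> B k" if "k \<in> I" for k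
    using c that by (auto simp: pcoeff_def w_def)
  define G where "G = (\<lambda>(k, \<alpha>). \<bar>c k \<alpha>\<bar> * w \<alpha>)"
  define N where "N = (\<lambda>k. infsum (\<lambda>\<alpha>. \<bar>c k \<alpha>\<bar> * w \<alpha>) (midx n))"
  have N0: "0 \<le> N k" for k unfolding N_def using w by (intro infsum_nonneg) (simp add: less_imp_le)
  have Ns: "N summable_on I"
    by (rule summable_on_comparison_test[OF B]) (use c1 N0 in \<open>auto simp: N_def\<close>)
  have Gfib: "((\<lambda>\<alpha>. G (k, \<alpha>)) has_sum N k) (midx n)" if "k \<in> I" for k
    using c1(1)[OF that] by (simp add: G_def N_def)
  have Gs: "G summable_on (I \<times> midx n)"
    by (rule summable_on_SigmaI[OF Gfib Ns]) (auto simp: G_def less_imp_le[OF w])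
  have GN: "(N has_sum infsum G (I \<times> midx n)) I"
    by (rule has_sum_SigmaD[OF has_sum_infsum[OF Gs] Gfib])
  define G' where "G' = (\<lambda>(\<alpha>, k). \<bar>c k \<alpha>\<bar> * w \<alpha>)"
  have G'G: "G' = (\<lambda>(x, y). G (y, x))" by (simp add: G'_def G_def fun_eq_iff)
  have G'sum: "(G' has_sum infsum G (I \<times> midx n)) (midx n \<times> I)"
    unfolding G'G by (rule has_sum_swap[THEN iffD1]) (rule has_sum_infsum[OF Gs])
  have ck: "(\<lambda>k. \<bar>c k \<alpha>\<bar> * w \<alpha>) summable_on I" if "\<alpha> \<in> midx n" for \<alpha>
    using summable_on_SigmaD1[of "\<lambda>\<alpha> k. \<bar>c k \<alpha>\<bar> * w \<alpha>" "midx n" "\<lambda>_. I" \<alpha>] that has_sum_imp_summable[OF G'sum]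
    by (simp add: G'_def)
  have ck': "(\<lambda>k. \<bar>c k \<alpha>\<bar>) summable_on I" if "\<alpha> \<in> midx n" for \<alpha>
  proof -
    have "(\<lambda>k. \<bar>c k \<alpha>\<bar> * w \<alpha> * (1 / w \<alpha>)) summable_on I" by (rule summable_on_cmult_left[OF ck[OF that]])
    thus ?thesis using w[of \<alpha>] by simp
  qed
  have ck'': "(\<lambda>k. c k \<alpha>) summable_on I" if "\<alpha> \<in> midx n" for \<alpha>
    by (rule abs_summable_summable) (use ck'[OF that] in simp)
  define C where "C = (\<lambda>\<alpha>. infsum (\<lambda>k. c k \<alpha>) I)"
  have Cb: "\<bar>C \<alpha>\<bar> * w \<alpha> \<le> infsum (\<lambda>k. \<bar>c k \<alpha>\<bar> * w \<alpha>) I" if "\<alpha> \<in> midx n" for \<alpha>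
  proof -
    have "\<bar>C \<alpha>\<bar> \<le> infsum (\<lambda>k. \<bar>c k \<alpha>\<bar>) I" unfolding C_def
      using norm_infsum_bound[of "\<lambda>k. c k \<alpha>" I] ck'[OF that] by simp
    hence "\<bar>C \<alpha>\<bar> * w \<alpha> \<le> infsum (\<lambda>k. \<bar>c k \<alpha>\<bar>) I * w \<alpha>" using w by (simp add: mult_right_mono less_imp_le)
    also have "\<dots> = infsum (\<lambda>k. \<bar>c k \<alpha>\<bar> * w \<alpha>) I" using ck'[OF that] by (simp add: infsum_cmult_left)
    finally show ?thesis .
  qed
  have fib': "((\<lambda>k. G' (\<alpha>, k)) has_sum infsum (\<lambda>k. \<bar>c k \<alpha>\<bar> * w \<alpha>) I) I" if "\<alpha> \<in> midx n" for \<alpha>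
    using ck[OF that] by (simp add: G'_def)
  have S': "((\<lambda>\<alpha>. infsum (\<lambda>k. \<bar>c k \<alpha>\<bar> * w \<alpha>) I) has_sum infsum G (I \<times> midx n)) (midx n)"
    by (rule has_sum_SigmaD[OF G'sum fib'])
  have Cs: "(\<lambda>\<alpha>. \<bar>C \<alpha>\<bar> * w \<alpha>) summable_on midx n"
    by (rule summable_on_comparison_test[OF has_sum_imp_summable[OF S'] Cb]) (auto simp: less_imp_le[OF w])
  have "infsum (\<lambda>\<alpha>. \<bar>C \<alpha>\<bar> * w \<alpha>) (midx n) \<le> infsum (\<lambda>\<alpha>. infsum (\<lambda>k. \<bar>c k \<alpha>\<bar> * w \<alpha>) I) (midx n)"
    by (rule infsum_mono[OF Cs has_sum_imp_summable[OF S'] Cb])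
  also have "\<dots> = infsum G (I \<times> midx n)" using S' by (rule infsumI)
  also have "\<dots> = infsum N I" using GN by (rule infsumI[symmetric])
  also have "\<dots> \<le> infsum B I" by (rule infsum_mono[OF Ns B]) (use c1 in \<open>auto simp: N_def\<close>)
  finally have bound: "infsum (\<lambda>\<alpha>. \<bar>C \<alpha>\<bar> * w \<alpha>) (midx n) \<le> infsum B I" .
  have "((\<lambda>\<alpha>. C \<alpha> * mmon n (\<lambda>i. x i - a i) \<alpha>) has_sum F x) (midx n)"
    if x: "x \<in> Rn n" "\<forall>i<n. \<bar>x i - a i\<bar> \<le> r" for x
  proof -
    let ?m = "mmon n (\<lambda>i. x i - a i)"
    have mw: "\<bar>?m \<alpha>\<bar> \<le> w \<alpha>" for \<alpha> unfolding w_def using x by (intro mmon_bound) auto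
    define H where "H = (\<lambda>(k, \<alpha>). c k \<alpha> * ?m \<alpha>)"
    have "(\<lambda>z. norm (H z)) summable_on (I \<times> midx n)"
      by (rule summable_on_comparison_test[OF Gs])
        (use mw in \<open>auto simp: H_def G_def abs_mult intro!: mult_left_mono\<close>)
    hence Hs: "H summable_on (I \<times> midx n)" by (rule abs_summable_summable)
    have "((\<lambda>\<alpha>. H (k, \<alpha>)) has_sum f k x) (midx n)" if "k \<in> I" for k
    proof -
      have "pcoeff n a r (B k) (f k) (c k)" using c that by blast
      thus ?thesis using x by (simp add: pcoeff_def H_def)
    qed
    hence "((\<lambda>k. f k x) has_sum infsum H (I \<times> midx n)) I"
      by (rule has_sum_SigmaD[OF has_sum_infsum[OF Hs]])
    moreover have "((\<lambda>k. f k x) has_sum F x) I" using F x by blast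
    ultimately have e: "infsum H (I \<times> midx n) = F x" by (rule has_sum_unique)
    have H1: "((\<lambda>(y, z). H (z, y)) has_sum F x) (midx n \<times> I)"
      using has_sum_infsum[OF Hs] unfolding e by (rule has_sum_swap[THEN iffD1])
    show ?thesis
    proof (rule has_sum_SigmaD[OF H1])
      fix \<alpha> assume "\<alpha> \<in> midx n"
      from has_sum_cmult_left[OF has_sum_infsum[OF ck''[OF this]], of "?m \<alpha>"]
      show "((\<lambda>y. (case (\<alpha>, y) of (y, z) \<Rightarrow> H (z, y))) has_sum C \<alpha> * ?m \<alpha>) I"
        by (simp add: H_def C_def)
    qed
  qed
  hence "pcoeff n a r (infsum B I) F C"
    unfolding pcoeff_def using Cs bound by (simp add: w_def)
  thus ?thesis by (auto simp: pser_def)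
qed

lemma midx_0: "(\<lambda>_. 0) \<in> midx n" by (simp add: midx_def)

lemma pser_const:
  assumes "\<bar>c\<bar> \<le> A"
  shows "pser n a r A (\<lambda>_. c)"
proof -
  let ?c = "\<lambda>I. if I = (\<lambda>_. 0) then c else (0::real)"
  have 1: "((\<lambda>I. \<bar>?c I\<bar> * r ^ mdeg n I) has_sum \<bar>c\<bar>) (midx n)"
    by (rule has_sum_finite_neutralI[where B = "{\<lambda>_. 0}"]) (auto simp: midx_0 mdeg_def)
  have 2: "((\<lambda>I. ?c I * mmon n h I) has_sum c) (midx n)" for h
    by (rule has_sum_finite_neutralI[where B = "{\<lambda>_. 0}"]) (auto simp: midx_0 mmon_def)
  have "pcoeff n a r A (\<lambda>_. c) ?c"
    unfolding pcoeff_def using has_sum_imp_summable[OF 1] infsumI[OF 1] 2 assms by simp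
  thus ?thesis by (auto simp: pser_def)
qed

lemma pser_add:
  assumes r: "0 < r" and f: "pser n a r A f" and g: "pser n a r B g"
  shows "pser n a r (A + B) (\<lambda>x. f x + g x)"
proof -
  have "pser n a r (infsum (\<lambda>b. if b then A else B) UNIV) (\<lambda>x. f x + g x)"
  proof (rule pser_infsum[OF r])
    show "pser n a r (if b then A else B) ((if b then f else g))" for b using f g by simp
  qed (auto simp: UNIV_bool intro!: has_sum_finiteI)
  thus ?thesis by (simp add: UNIV_bool add.commute)
qed

lemma mmon_add: "mmon n h (\<lambda>i. I i + J i) = mmon n h I * mmon n h J"
  by (simp add: mmon_def power_add prod.distrib)

lemma mdeg_add: "mdeg n (\<lambda>i. I i + J i) = mdeg n I + mdeg n J"
  by (simp add: mdeg_def sum.distrib)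

text \<open>Multiplication by the monomial of index \<open>J\<close> moves coefficients by
  \<open>J\<close>. The sum is reindexed along this injection and extended by zero to the
  multi-indices that it misses.\<close>

lemma has_sum_shift:
  fixes d :: "(nat \<Rightarrow> nat) \<Rightarrow> real"
  assumes J: "J \<in> midx n" and "((\<lambda>I. d (\<lambda>i. I i + J i)) has_sum s) (midx n)"
  shows "((\<lambda>I. if \<forall>i. J i \<le> I i then d I else 0) has_sum s) (midx n)"
proof -
  let ?h = "\<lambda>I i. I i + J i"
  have inj: "inj_on ?h (midx n)" by (auto simp: inj_on_def fun_eq_iff)
  have img: "?h ` midx n = {I \<in> midx n. \<forall>i. J i \<le> I i}"
  proof (rule set_eqI, rule iffI)
    fix I assume "I \<in> {I \<in> midx n. \<forall>i. J i \<le> I i}"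
    hence "(\<lambda>i. I i - J i) \<in> midx n" "I = ?h (\<lambda>i. I i - J i)" by (auto simp: midx_def)
    thus "I \<in> ?h ` midx n" by (intro image_eqI[of _ ?h "\<lambda>i. I i - J i"])
  qed (use J in \<open>auto simp: midx_def\<close>)
  have "(d has_sum s) (?h ` midx n)"
    using has_sum_reindex[OF inj, of d s] assms(2) by (simp add: o_def)
  hence "(d has_sum s) {I \<in> midx n. \<forall>i. J i \<le> I i}" unfolding img .
  thus ?thesis
    by (rule has_sum_cong_neutral[THEN iffD1, rotated -1]) auto
qed

lemma pser_monomial_mult:
  assumes r: "0 < r" and g: "pser n a r B g" and J: "J \<in> midx n"
  shows "pser n a r (\<bar>k\<bar> * r ^ mdeg n J * B) (\<lambda>x. k * mmon n (\<lambda>i. x i - a i) J * g x)"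
proof -
  obtain c where c: "pcoeff n a r B g c" using g by (auto simp: pser_def)
  define d where "d = (\<lambda>I. if \<forall>i. J i \<le> I i then k * c (\<lambda>i. I i - J i) else 0)"
  have c1: "((\<lambda>I. \<bar>c I\<bar> * r ^ mdeg n I) has_sum cnorm n r c) (midx n)"
    "cnorm n r c \<le> B" using c by (auto simp: pcoeff_def)
  let ?s = "\<bar>k\<bar> * r ^ mdeg n J * cnorm n r c"
  have "((\<lambda>I. if \<forall>i. J i \<le> I i then \<bar>k * c (\<lambda>i. I i - J i)\<bar> * r ^ mdeg n I else 0) has_sum ?s) (midx n)"
    by (rule has_sum_shift[OF J])
      (use has_sum_cmult_right[OF c1(1), of "\<bar>k\<bar> * r ^ mdeg n J"] in \<open>simp add: mdeg_add power_add abs_mult mult_ac\<close>)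
  moreover have "(\<lambda>I. if \<forall>i. J i \<le> I i then \<bar>k * c (\<lambda>i. I i - J i)\<bar> * r ^ mdeg n I else 0) = (\<lambda>I. \<bar>d I\<bar> * r ^ mdeg n I)"
    by (auto simp: d_def fun_eq_iff)
  ultimately have 1: "((\<lambda>I. \<bar>d I\<bar> * r ^ mdeg n I) has_sum ?s) (midx n)" by simp
  have 2: "((\<lambda>I. d I * mmon n (\<lambda>i. x i - a i) I) has_sum k * mmon n (\<lambda>i. x i - a i) J * g x) (midx n)"
    if "x \<in> Rn n" "\<forall>i<n. \<bar>x i - a i\<bar> \<le> r" for x
  proof -
    let ?m = "mmon n (\<lambda>i. x i - a i)"
    have "((\<lambda>I. c I * ?m I) has_sum g x) (midx n)" using c that by (simp add: pcoeff_def)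
    from has_sum_cmult_right[OF this, of "k * ?m J"]
    have "((\<lambda>I. if \<forall>i. J i \<le> I i then k * c (\<lambda>i. I i - J i) * ?m I else 0) has_sum k * ?m J * g x) (midx n)"
      by (intro has_sum_shift[OF J]) (simp add: mmon_add mult_ac)
    moreover have "(\<lambda>I. if \<forall>i. J i \<le> I i then k * c (\<lambda>i. I i - J i) * ?m I else 0) = (\<lambda>I. d I * ?m I)"
      by (auto simp: d_def fun_eq_iff)
    ultimately show ?thesis by simp
  qed
  have "?s \<le> \<bar>k\<bar> * r ^ mdeg n J * B" using c1(2) r by (intro mult_left_mono) auto
  hence "pcoeff n a r (\<bar>k\<bar> * r ^ mdeg n J * B) (\<lambda>x. k * mmon n (\<lambda>i. x i - a i) J * g x) d"
    unfolding pcoeff_def using has_sum_imp_summable[OF 1] infsumI[OF 1] 2 by simp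
  thus ?thesis by (auto simp: pser_def)
qed

text \<open>\<open>f\<close> is expanded into monomials, each of which is multiplied by the whole
  function \<open>g\<close>; the norms of these products add up to at most
  \<open>A * B\<close>.\<close>

lemma pser_mult:
  assumes r: "0 < r" and f: "pser n a r A f" and g: "pser n a r B g"
  shows "pser n a r (A * B) (\<lambda>x. f x * g x)"
proof -
  obtain c where c: "pcoeff n a r A f c" using f by (auto simp: pser_def)
  define S where "S = cnorm n r c"
  have c1: "(\<lambda>I. \<bar>c I\<bar> * r ^ mdeg n I) summable_on (midx n)" "S \<le> A" using c by (auto simp: pcoeff_def S_def)
  have "pser n a r (infsum (\<lambda>I. \<bar>c I\<bar> * r ^ mdeg n I * B) (midx n)) (\<lambda>x. f x * g x)"
  proof (rule pser_infsum[OF r])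
    show "pser n a r (\<bar>c I\<bar> * r ^ mdeg n I * B) (\<lambda>x. c I * mmon n (\<lambda>i. x i - a i) I * g x)" if "I \<in> midx n" for I
      by (rule pser_monomial_mult[OF r g that])
    show "(\<lambda>I. \<bar>c I\<bar> * r ^ mdeg n I * B) summable_on midx n" by (rule summable_on_cmult_left[OF c1(1)])
    fix x assume "x \<in> Rn n" "\<And>i. i < n \<Longrightarrow> \<bar>x i - a i\<bar> \<le> r"
    hence "((\<lambda>I. c I * mmon n (\<lambda>i. x i - a i) I) has_sum f x) (midx n)" using c by (simp add: pcoeff_def)
    thus "((\<lambda>I. c I * mmon n (\<lambda>i. x i - a i) I * g x) has_sum f x * g x) (midx n)"
      by (rule has_sum_cmult_left)
  qed
  moreover have "infsum (\<lambda>I. \<bar>c I\<bar> * r ^ mdeg n I * B) (midx n) = S * B"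
    unfolding S_def using c1(1) by (simp add: infsum_cmult_left)
  moreover have "S * B \<le> A * B" using c1(2) pser_nonneg[OF g] r by (intro mult_right_mono) auto
  ultimately show ?thesis using pser_weaken by metis
qed

lemma pser_power:
  assumes "0 < r" "pser n a r A f"
  shows "pser n a r (A ^ k) (\<lambda>x. f x ^ k)"
proof (induction k)
  case 0
  show ?case using pser_const[of 1 1] by simp
next
  case (Suc k)
  show ?case using pser_mult[OF assms(1) assms(2) Suc] by simp
qed

lemma pser_prod:
  assumes "0 < r" "finite I" "\<And>i. i \<in> I \<Longrightarrow> pser n a r (A i) (f i)"
  shows "pser n a r (\<Prod>i\<in>I. A i) (\<lambda>x. \<Prod>i\<in>I. f i x)"
  using assms(2,3)
proof (induction I)
  case empty
  show ?case using pser_const[of 1 1] by simp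
next
  case (insert i I)
  have "pser n a r (A i * prod A I) (\<lambda>x. f i x * (\<Prod>i\<in>I. f i x))"
    by (rule pser_mult[OF assms(1)]) (use insert in auto)
  thus ?case using insert.hyps by simp
qed

lemma pser_var:
  assumes "0 < r" "i < n"
  shows "pser n a r r (\<lambda>x. x i - a i)"
proof -
  let ?J = "\<lambda>j. if j = i then 1 else 0 :: nat"
  have "?J \<in> midx n" using assms by (auto simp: midx_def)
  from pser_monomial_mult[OF assms(1) pser_const[of 1 1] this, of a 1]
  have "pser n a r (r ^ mdeg n ?J) (\<lambda>x. mmon n (\<lambda>i. x i - a i) ?J)" by simp
  moreover have "mdeg n ?J = 1" using assms by (simp add: mdeg_def)
  moreover have "mmon n h ?J = h i" for h
  proof -
    have "mmon n h ?J = (\<Prod>j<n. if j = i then h j else 1)" unfolding mmon_def by (rule prod.cong) auto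
    thus ?thesis using assms by simp
  qed
  ultimately show ?thesis by simp
qed

text \<open>The norm tends to 0 linearly with the radius. On a small cube such a function may
  therefore be substituted into the geometric or binomial series.\<close>

definition psmall :: "nat \<Rightarrow> pt \<Rightarrow> (pt \<Rightarrow> real) \<Rightarrow> bool" where
  "psmall n a f \<longleftrightarrow> (\<exists>C\<ge>0. \<forall>r. 0 < r \<and> r \<le> 1 \<longrightarrow> pser n a r (C * r) f)"

lemma psmall_add: "psmall n a f \<Longrightarrow> psmall n a g \<Longrightarrow> psmall n a (\<lambda>x. f x + g x)"
proof -
  assume "psmall n a f" "psmall n a g"
  then obtain C D where *: "0 \<le> C" "0 \<le> D" "\<forall>r. 0 < r \<and> r \<le> 1 \<longrightarrow> pser n a r (C * r) f"
    "\<forall>r. 0 < r \<and> r \<le> 1 \<longrightarrow> pser n a r (D * r) g" unfolding psmall_def by auto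
  have "pser n a r ((C + D) * r) (\<lambda>x. f x + g x)" if "0 < r" "r \<le> 1" for r
    using pser_add[OF that(1), of n a "C * r" f "D * r" g] * that by (simp add: distrib_right)
  thus ?thesis unfolding psmall_def using * by (intro exI[of _ "C + D"]) auto
qed

lemma psmall_mult: "psmall n a f \<Longrightarrow> psmall n a g \<Longrightarrow> psmall n a (\<lambda>x. f x * g x)"
proof -
  assume "psmall n a f" "psmall n a g"
  then obtain C D where *: "0 \<le> C" "0 \<le> D" "\<forall>r. 0 < r \<and> r \<le> 1 \<longrightarrow> pser n a r (C * r) f"
    "\<forall>r. 0 < r \<and> r \<le> 1 \<longrightarrow> pser n a r (D * r) g" unfolding psmall_def by auto
  have "pser n a r ((C * D) * r) (\<lambda>x. f x * g x)" if "0 < r" "r \<le> 1" for r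
  proof (rule pser_weaken)
    show "pser n a r ((C * r) * (D * r)) (\<lambda>x. f x * g x)" using pser_mult[OF that(1)] * that by blast
    have "(C * D * r) * r \<le> (C * D * r) * 1" using * that by (intro mult_left_mono) auto
    thus "(C * r) * (D * r) \<le> (C * D) * r" by (simp add: mult_ac)
  qed
  thus ?thesis unfolding psmall_def using * by (intro exI[of _ "C * D"]) auto
qed

lemma psmall_cmult: "psmall n a f \<Longrightarrow> psmall n a (\<lambda>x. c * f x)"
proof -
  assume "psmall n a f"
  then obtain C where *: "0 \<le> C" "\<forall>r. 0 < r \<and> r \<le> 1 \<longrightarrow> pser n a r (C * r) f" unfolding psmall_def by auto
  have "pser n a r (\<bar>c\<bar> * C * r) (\<lambda>x. c * f x)" if "0 < r" "r \<le> 1" for r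
    using pser_mult[OF that(1) pser_const[of c "\<bar>c\<bar>"], of n a "C * r" f] * that by (simp add: mult.assoc)
  thus ?thesis unfolding psmall_def using * by (intro exI[of _ "\<bar>c\<bar> * C"]) auto
qed

lemma psmall_poly_fun:
  assumes "poly_fun n p"
  shows "psmall n a (\<lambda>x. p x - p a)"
  using assms
proof induction
  case (pf_const c)
  thus ?case unfolding psmall_def by (intro exI[of _ 0]) (auto intro: pser_const)
next
  case (pf_var i)
  thus ?case unfolding psmall_def by (intro exI[of _ 1]) (auto intro: pser_var)
next
  case (pf_add p q)
  from psmall_add[OF pf_add.IH] show ?case by (simp add: algebra_simps)
next
  case (pf_mult p q)
  have "psmall n a (\<lambda>x. ((p x - p a) * (q x - q a) + p a * (q x - q a)) + q a * (p x - p a))"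
    by (intro psmall_add psmall_mult psmall_cmult pf_mult.IH)
  thus ?case by (simp add: algebra_simps)
qed

lemma psmall_radius:
  assumes "psmall n a f" "0 < e"
  obtains r0 where "0 < r0" "\<forall>r. 0 < r \<and> r \<le> r0 \<longrightarrow> pser n a r e f"
proof -
  obtain C where *: "0 \<le> C" "\<forall>r. 0 < r \<and> r \<le> 1 \<longrightarrow> pser n a r (C * r) f"
    using assms(1) unfolding psmall_def by auto
  define r0 where "r0 = min 1 (e / (C + 1))"
  have p: "0 < r0" using * assms by (simp add: r0_def)
  have "pser n a r e f" if "0 < r" "r \<le> r0" for r
  proof (rule pser_weaken)
    show "pser n a r (C * r) f" using * that by (simp add: r0_def)
    have "C * r \<le> (C + 1) * (e / (C + 1))" using * that assms by (intro mult_mono) (auto simp: r0_def)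
    thus "C * r \<le> e" using * by simp
  qed
  thus thesis using that p by blast
qed

section \<open>Lueroth's theorem\<close>

definition cst :: "real \<Rightarrow> real poly fract" where "cst c = to_fract [:c:]"
definition tvar :: "real poly fract" where "tvar = to_fract [:0, 1:]"

abbreviation lift_poly :: "real poly \<Rightarrow> real poly fract poly" where
  "lift_poly \<equiv> map_poly cst"

lemma cst_hom [simp]: "cst 0 = 0" "cst 1 = 1" "cst (a + b) = cst a + cst b" "cst (a * b) = cst a * cst b"
  "cst (- a) = - cst a" "cst (a - b) = cst a - cst b"
proof -
  show "cst 0 = 0" "cst 1 = 1" by (simp_all add: cst_def one_pCons[symmetric])
  show "cst (a + b) = cst a + cst b" unfolding cst_def to_fract_add[symmetric] by simp
  show "cst (a * b) = cst a * cst b" unfolding cst_def to_fract_mult[symmetric] by simp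
  show "cst (- a) = - cst a" unfolding cst_def to_fract_uminus[symmetric] by simp
  show "cst (a - b) = cst a - cst b" unfolding cst_def to_fract_diff[symmetric] by simp
qed

lemma cst_eq_0_iff [simp]: "cst c = 0 \<longleftrightarrow> c = 0"
  by (simp add: cst_def)

lemma cst_divide: "cst (a / b) = cst a / cst b"
proof (cases "b = 0")
  case False
  have "cst (a / b) * cst b = cst a" using False by (simp flip: cst_hom(4))
  thus ?thesis using False by (simp add: field_simps)
qed simp

lemma lift_poly_hom:
  "lift_poly (p + q) = lift_poly p + lift_poly q" "lift_poly (p * q) = lift_poly p * lift_poly q"
  "lift_poly (- p) = - lift_poly p"
proof -
  have s: "cst (sum f A) = (\<Sum>x\<in>A. cst (f x))" for f :: pt and A
    by (induction A rule: infinite_finite_induct) simp_all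
  show "lift_poly (p + q) = lift_poly p + lift_poly q" "lift_poly (- p) = - lift_poly p"
    by (intro poly_eqI; simp add: coeff_map_poly)+
  show "lift_poly (p * q) = lift_poly p * lift_poly q"
    by (intro poly_eqI) (simp add: coeff_map_poly coeff_mult s)
qed

lemma poly_lift_poly_tvar: "poly (lift_poly p) tvar = to_fract p"
proof (induction p)
  case (pCons c p)
  have "pCons c p = [:c:] + [:0, 1:] * p" by simp
  hence "to_fract (pCons c p) = cst c + tvar * to_fract p"
    unfolding cst_def tvar_def to_fract_mult[symmetric] to_fract_add[symmetric] by simp
  thus ?case using pCons by (simp add: map_poly_pCons)
qed simp

text \<open>Intermediate fields between R and R(t). The convention \<open>inverse 0 = 0\<close>
  spares an exception for 0.\<close>

definition subfield_consts :: "real poly fract set \<Rightarrow> bool" where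
  "subfield_consts K \<longleftrightarrow> (\<forall>c. cst c \<in> K) \<and> (\<forall>x\<in>K. \<forall>y\<in>K. x + y \<in> K \<and> x * y \<in> K) \<and> (\<forall>x\<in>K. - x \<in> K \<and> inverse x \<in> K)"

lemma subfield_constsD:
  assumes "subfield_consts K"
  shows "cst c \<in> K" "0 \<in> K" "1 \<in> K" "x \<in> K \<Longrightarrow> y \<in> K \<Longrightarrow> x + y \<in> K" "x \<in> K \<Longrightarrow> y \<in> K \<Longrightarrow> x * y \<in> K"
    "x \<in> K \<Longrightarrow> - x \<in> K" "x \<in> K \<Longrightarrow> inverse x \<in> K"
    "x \<in> K \<Longrightarrow> y \<in> K \<Longrightarrow> x - y \<in> K" "x \<in> K \<Longrightarrow> y \<in> K \<Longrightarrow> x / y \<in> K"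
proof -
  show c: "cst c \<in> K" for c using assms by (simp add: subfield_consts_def)
  show "0 \<in> K" "1 \<in> K" using c[of 0] c[of 1] by simp_all
  show p: "x \<in> K \<Longrightarrow> y \<in> K \<Longrightarrow> x + y \<in> K" and m: "x \<in> K \<Longrightarrow> y \<in> K \<Longrightarrow> x * y \<in> K"
    and u: "x \<in> K \<Longrightarrow> - x \<in> K" and i: "x \<in> K \<Longrightarrow> inverse x \<in> K" for x y
    using assms unfolding subfield_consts_def by blast+
  show "x \<in> K \<Longrightarrow> y \<in> K \<Longrightarrow> x - y \<in> K" using p[of x "- y"] u[of y] by simp
  show "x \<in> K \<Longrightarrow> y \<in> K \<Longrightarrow> x / y \<in> K" using m[of x "inverse y"] i[of y] by (simp add: divide_inverse)
qed

definition coeffs_in :: "real poly fract set \<Rightarrow> real poly fract poly set" where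
  "coeffs_in K = {p. \<forall>i. coeff p i \<in> K}"

lemma coeffs_in_closed:
  assumes "subfield_consts K"
  shows "p \<in> coeffs_in K \<Longrightarrow> q \<in> coeffs_in K \<Longrightarrow> p + q \<in> coeffs_in K"
    "p \<in> coeffs_in K \<Longrightarrow> q \<in> coeffs_in K \<Longrightarrow> p - q \<in> coeffs_in K"
    "p \<in> coeffs_in K \<Longrightarrow> q \<in> coeffs_in K \<Longrightarrow> p * q \<in> coeffs_in K"
    "a \<in> K \<Longrightarrow> p \<in> coeffs_in K \<Longrightarrow> smult a p \<in> coeffs_in K"
    "a \<in> K \<Longrightarrow> monom a n \<in> coeffs_in K" "lift_poly r \<in> coeffs_in K" "0 \<in> coeffs_in K"
proof -
  note K = subfield_constsD[OF assms]
  have s: "sum f A \<in> K" if "\<forall>x\<in>A. f x \<in> K" for f :: "nat \<Rightarrow> _" and A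
    using that by (induction A rule: infinite_finite_induct) (auto intro: K)
  show "p \<in> coeffs_in K \<Longrightarrow> q \<in> coeffs_in K \<Longrightarrow> p + q \<in> coeffs_in K"
    "p \<in> coeffs_in K \<Longrightarrow> q \<in> coeffs_in K \<Longrightarrow> p - q \<in> coeffs_in K"
    "a \<in> K \<Longrightarrow> p \<in> coeffs_in K \<Longrightarrow> smult a p \<in> coeffs_in K"
    "a \<in> K \<Longrightarrow> monom a n \<in> coeffs_in K" "lift_poly r \<in> coeffs_in K" "0 \<in> coeffs_in K"
    by (auto simp: coeffs_in_def coeff_map_poly intro: K)
  show "p \<in> coeffs_in K \<Longrightarrow> q \<in> coeffs_in K \<Longrightarrow> p * q \<in> coeffs_in K"
    by (simp only: coeffs_in_def mem_Collect_eq coeff_mult) (intro allI s ballI K(5); blast)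
qed

text \<open>The intermediate field is a set inside the type of rational functions, so the division
  algorithm has to be followed step by step to see that quotient and remainder keep their
  coefficients in \<open>K\<close>.\<close>

lemma coeffs_in_division:
  assumes K: "subfield_consts K" and f: "f \<in> coeffs_in K" "f \<noteq> 0" and "h \<in> coeffs_in K"
  shows "\<exists>q\<in>coeffs_in K. \<exists>r\<in>coeffs_in K. h = f * q + r \<and> (r = 0 \<or> degree r < degree f)"
  using assms(4)
proof (induction "if h = 0 then 0 else Suc (degree h)" arbitrary: h rule: less_induct)
  case less
  note cl = coeffs_in_closed[OF K]
  show ?case
  proof (cases "h = 0 \<or> degree h < degree f")
    case True
    thus ?thesis using less.prems cl(7) by (intro bexI[of _ 0] bexI[of _ h]) auto
  next
    case False
    hence h: "h \<noteq> 0" "degree f \<le> degree h" by auto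
    define c where "c = lead_coeff h / lead_coeff f"
    define g where "g = monom c (degree h - degree f)"
    define h' where "h' = h - f * g"
    have c: "c \<in> K" "c \<noteq> 0" unfolding c_def using less.prems f h
      by (auto intro!: subfield_constsD(9)[OF K] simp: coeffs_in_def)
    have g: "g \<in> coeffs_in K" unfolding g_def using cl(5) c by simp
    have h'K: "h' \<in> coeffs_in K" unfolding h'_def using less.prems f g cl by simp
    have "degree (f * g) = degree h"
      using f c h by (subst degree_mult_eq) (auto simp: g_def degree_monom_eq)
    hence d: "degree h' \<le> degree h" unfolding h'_def by (intro degree_diff_le) auto
    have "coeff (f * g) (degree h) = lead_coeff f * c"
      using h by (simp add: g_def mult.commute[of f] coeff_monom_mult)
    hence "coeff h' (degree h) = 0" using f by (simp add: h'_def c_def)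
    hence "h' = 0 \<or> degree h' < degree h"
      using d by (metis le_neq_implies_less leading_coeff_0_iff)
    hence "(if h' = 0 then 0 else Suc (degree h')) < (if h = 0 then 0 else Suc (degree h))"
      using h by auto
    from less.hyps[OF this h'K] obtain q r where qr: "q \<in> coeffs_in K" "r \<in> coeffs_in K"
      "h' = f * q + r" "r = 0 \<or> degree r < degree f" by blast
    have "h = f * (g + q) + r" using qr(3) by (simp add: h'_def algebra_simps)
    thus ?thesis using qr g cl(1) by blast
  qed
qed

text \<open>Exchanges the two variables: the coefficient of the n-th power of the inner variable, as
  a polynomial in the outer one.\<close>

definition slice :: "nat \<Rightarrow> real poly poly \<Rightarrow> real poly" where
  "slice n g = map_poly (\<lambda>p. coeff p n) g"

lemma coeff_slice: "coeff (slice n g) i = coeff (coeff g i) n"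
  by (simp add: slice_def coeff_map_poly)

lemma coeff_poly_const: "coeff (poly g [:x:]) n = poly (slice n g) x"
proof (induction g)
  case (pCons c g)
  thus ?case by (simp add: slice_def map_poly_pCons)
qed (simp add: slice_def)

lemma maximal_coefficient:
  assumes "(g :: real poly poly) \<noteq> 0"
  shows "\<exists>i. coeff g i \<noteq> 0 \<and> (\<forall>j. degree (coeff g j) \<le> degree (coeff g i))"
proof -
  have "\<exists>i. coeff g i \<noteq> 0 \<and> (\<forall>j. coeff g j \<noteq> 0 \<longrightarrow> degree (coeff g j) \<le> degree (coeff g i))"
  proof (rule ex_has_greatest_nat[where P = "\<lambda>i. coeff g i \<noteq> 0" and f = "\<lambda>i. degree (coeff g i)" and b = "Suc (Max ((\<lambda>i. degree (coeff g i)) ` {..degree g}))" and k = "degree g"])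
    show "coeff g (degree g) \<noteq> 0" using assms by simp
    show "\<forall>i. coeff g i \<noteq> 0 \<longrightarrow> degree (coeff g i) < Suc (Max ((\<lambda>i. degree (coeff g i)) ` {..degree g}))"
      by (auto intro!: Max_ge simp: le_degree less_Suc_eq_le)
  qed
  thus ?thesis by (metis degree_0 le0)
qed

text \<open>The inner degree is additive: specialise the outer variable to a generic real number.\<close>
lemma inner_degree_mult:
  fixes g h N :: "real poly poly"
  assumes N: "N = g * h" and "N \<noteq> 0" and D: "\<And>i. degree (coeff N i) \<le> D" and g: "D \<le> degree (coeff g i0)"
  shows "degree (coeff h j) = 0"
proof -
  have "g \<noteq> 0" "h \<noteq> 0" using assms by auto
  obtain i where i: "coeff g i \<noteq> 0" "\<forall>j. degree (coeff g j) \<le> degree (coeff g i)"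
    using maximal_coefficient[OF \<open>g \<noteq> 0\<close>] by blast
  obtain k where k: "coeff h k \<noteq> 0" "\<forall>j. degree (coeff h j) \<le> degree (coeff h k)"
    using maximal_coefficient[OF \<open>h \<noteq> 0\<close>] by blast
  let ?a = "slice (degree (coeff g i)) g" and ?b = "slice (degree (coeff h k)) h"
  have "coeff ?a i \<noteq> 0" "coeff ?b k \<noteq> 0" using i k by (auto simp: coeff_slice)
  hence "?a * ?b \<noteq> 0" by auto
  then obtain x where x: "poly (?a * ?b) x \<noteq> 0" using poly_all_0_iff_0 by blast
  have 1: "degree (coeff g i) \<le> degree (poly g [:x:])"
    by (rule le_degree) (use x in \<open>simp add: coeff_poly_const\<close>)
  have 2: "degree (coeff h k) \<le> degree (poly h [:x:])"
    by (rule le_degree) (use x in \<open>simp add: coeff_poly_const\<close>)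
  have "poly g [:x:] \<noteq> 0" "poly h [:x:] \<noteq> 0"
    using x coeff_poly_const[of g x] coeff_poly_const[of h x] by fastforce+
  hence "degree (poly N [:x:]) = degree (poly g [:x:]) + degree (poly h [:x:])"
    by (simp add: N degree_mult_eq)
  moreover have "degree (poly N [:x:]) \<le> D"
  proof (rule degree_le, intro allI impI)
    fix n assume "D < n"
    hence "slice n N = 0" by (intro poly_eqI) (simp add: coeff_slice coeff_eq_0 le_less_trans[OF D])
    thus "coeff (poly N [:x:]) n = 0" by (simp add: coeff_poly_const)
  qed
  moreover have "D \<le> degree (coeff g i)" using g i(2) le_trans by blast
  ultimately have "degree (coeff h k) = 0" using 1 2 by linarith
  thus ?thesis using k(2) by (metis le_zero_eq)
qed

text \<open>For nonconstant \<eta> this is the degree of R(t) over R(\<eta>).\<close>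

definition height :: "real poly fract \<Rightarrow> nat" where
  "height \<eta> = max (degree (fst (quot_of_fract \<eta>))) (degree (snd (quot_of_fract \<eta>)))"

lemma height_le:
  assumes "h = to_fract p / to_fract q" "q \<noteq> 0"
  shows "height h \<le> max (degree p) (degree q)"
proof -
  define a b where "a = fst (quot_of_fract h)" and "b = snd (quot_of_fract h)"
  have ab: "h = to_fract a / to_fract b" "b \<noteq> 0"
    using Fract_quot_of_fract[of h] by (simp_all add: a_def b_def Fract_conv_to_fract)
  have cop: "coprime a b" by (simp add: a_def b_def coprime_quot_of_fract)
  have "to_fract (a * q) = to_fract (p * b)"
    using ab assms by (simp add: field_simps)
  hence e: "a * q = p * b" by (simp only: to_fract_eq_iff)
  have "b dvd q" using cop e by (metis coprime_commute coprime_dvd_mult_right_iff dvd_triv_right)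
  hence 1: "degree b \<le> degree q" using assms(2) by (simp add: dvd_imp_degree_le)
  have "a dvd p" using cop e by (metis coprime_dvd_mult_left_iff dvd_triv_left)
  hence 2: "degree a \<le> degree p \<or> p = 0" using dvd_imp_degree_le by blast
  have "p = 0 \<Longrightarrow> a = 0" using e assms(2) by auto
  thus ?thesis using 1 2 by (auto simp: height_def a_def[symmetric] b_def[symmetric])
qed

text \<open>Lueroth's theorem. Take \<open>\<theta>\<close> of minimal height in \<open>K\<close>. A minimal annihilating polynomial of the
  variable over \<open>K\<close> divides \<open>a(T) - \<theta> b(T)\<close>, where \<open>\<theta> = a/b\<close>; by minimality of the height and Gauss' lemma
  the cofactor is constant.\<close>
theorem lueroth:
  assumes K: "subfield_consts K" and \<eta>0: "\<eta>0 \<in> K" "\<eta>0 \<notin> range cst"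
  shows "\<exists>\<theta>. \<theta> \<in> K \<and> \<theta> \<notin> range cst \<and>
    (\<forall>\<eta>\<in>K. \<exists>P Q. poly (lift_poly Q) \<theta> \<noteq> 0 \<and> \<eta> = poly (lift_poly P) \<theta> / poly (lift_poly Q) \<theta>)"
proof -
  note Kc = subfield_constsD[OF K] and KP = coeffs_in_closed[OF K]
  have "\<exists>\<theta>. (\<theta> \<in> K \<and> \<theta> \<notin> range cst) \<and> (\<forall>\<eta>. \<eta> \<in> K \<and> \<eta> \<notin> range cst \<longrightarrow> height \<theta> \<le> height \<eta>)"
    by (rule ex_has_least_nat[where k = \<eta>0]) (use \<eta>0 in simp)
  then obtain \<theta> where \<theta>: "\<theta> \<in> K" "\<theta> \<notin> range cst" and min: "\<forall>\<eta>. \<eta> \<in> K \<and> \<eta> \<notin> range cst \<longrightarrow> height \<theta> \<le> height \<eta>"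
    by blast
  define a b where "a = fst (quot_of_fract \<theta>)" and "b = snd (quot_of_fract \<theta>)"
  have ab: "\<theta> = to_fract a / to_fract b" "b \<noteq> 0"
    using Fract_quot_of_fract[of \<theta>] by (simp_all add: a_def b_def Fract_conv_to_fract)
  have cop: "coprime a b" by (simp add: a_def b_def coprime_quot_of_fract)
  define D where "D = height \<theta>"
  have Dab: "D = max (degree a) (degree b)" by (simp add: D_def height_def a_def b_def)
  define A where "A = lift_poly a - smult \<theta> (lift_poly b)"
  have A_coeff: "coeff A i = cst (coeff a i) - \<theta> * cst (coeff b i)" for i
    by (simp add: A_def coeff_map_poly)
  \<comment> \<open>1 and \<theta> are linearly independent over R, so no cancellation occurs in the
    coefficients of \<open>A\<close>.\<close>
  have comb0: "cst x - \<theta> * cst y = 0 \<longleftrightarrow> x = 0 \<and> y = 0" for x y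
  proof
    assume *: "cst x - \<theta> * cst y = 0"
    have "y = 0"
    proof (rule ccontr)
      assume "y \<noteq> 0"
      hence "\<theta> = cst (x / y)" using * by (simp add: cst_divide field_simps)
      thus False using \<theta>(2) by blast
    qed
    thus "x = 0 \<and> y = 0" using * by simp
  qed simp
  have degA: "degree A = D"
  proof (rule antisym)
    show "degree A \<le> D" by (rule degree_le) (simp add: A_coeff Dab coeff_eq_0)
    have "coeff a D \<noteq> 0 \<or> coeff b D \<noteq> 0"
    proof (cases "degree a \<le> degree b")
      case True thus ?thesis using ab(2) by (simp add: Dab max_def)
    next
      case False
      hence "a \<noteq> 0" by auto
      thus ?thesis using False by (simp add: Dab max_def)
    qed
    thus "D \<le> degree A" using comb0[of "coeff a D" "coeff b D"] by (intro le_degree) (auto simp: A_coeff)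
  qed
  have D1: "1 \<le> D"
  proof (rule ccontr)
    assume "\<not> 1 \<le> D"
    hence "degree a = 0" "degree b = 0" by (auto simp: Dab)
    then obtain x y where "a = [:x:]" "b = [:y:]" by (meson degree_eq_zeroE)
    hence "\<theta> = cst x / cst y" using ab(1) unfolding cst_def by simp
    hence "\<theta> = cst (x / y)" by (simp only: cst_divide)
    thus False using \<theta> by blast
  qed
  have A0: "A \<noteq> 0" using degA D1 by auto
  have AX: "poly A tvar = 0" using ab by (simp add: A_def poly_lift_poly_tvar)
  have AK: "A \<in> coeffs_in K" unfolding A_def by (intro KP(2,4,6) \<theta>(1))
  have "\<exists>f. (f \<in> coeffs_in K \<and> f \<noteq> 0 \<and> poly f tvar = 0) \<and>
      (\<forall>h. h \<in> coeffs_in K \<and> h \<noteq> 0 \<and> poly h tvar = 0 \<longrightarrow> degree f \<le> degree h)"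
    by (rule ex_has_least_nat[where k = A]) (use AK A0 AX in simp)
  then obtain f where f: "f \<in> coeffs_in K" "f \<noteq> 0" "poly f tvar = 0"
    and fmin: "\<forall>h. h \<in> coeffs_in K \<and> h \<noteq> 0 \<and> poly h tvar = 0 \<longrightarrow> degree f \<le> degree h" by blast
  have fdvd: "f dvd h" if hh: "h \<in> coeffs_in K" "poly h tvar = 0" for h
  proof -
    obtain q r where qr: "q \<in> coeffs_in K" "r \<in> coeffs_in K" "h = f * q + r" "r = 0 \<or> degree r < degree f"
      using coeffs_in_division[OF K f(1,2) hh(1)] by (elim bexE conjE) (rule that)
    have rX: "poly r tvar = 0" using arg_cong[OF qr(3), of "\<lambda>p. poly p tvar"] hh(2) f(3) by simp
    have "r = 0"
    proof (rule ccontr)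
      assume "r \<noteq> 0"
      hence "degree f \<le> degree r" using fmin qr(2) rX by blast
      thus False using qr(4) \<open>r \<noteq> 0\<close> by simp
    qed
    thus ?thesis using qr by simp
  qed
  \<comment> \<open>Being primitive over R[t], \<open>g\<close> divides in R[t][T] whatever it
    divides over the fraction field (Gauss' lemma).\<close>
  define g where "g = primitive_part_fract f"
  define fc where "fc = fract_content f"
  have gf: "smult fc (fract_poly g) = f" unfolding g_def fc_def by (rule content_times_primitive_part_fract)
  have fc: "fc \<noteq> 0" using f(2) by (simp add: fc_def)
  have cg: "content g = 1" using f(2) by (simp add: g_def)
  have degg: "degree g = degree f" by (simp add: g_def)
  define lft :: "real poly \<Rightarrow> real poly poly" where "lft = map_poly (\<lambda>c. [:c:])"
  have lft: "fract_poly (lft p) = lift_poly p" for p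
    by (rule poly_eqI) (simp add: lft_def coeff_map_poly cst_def)
  \<comment> \<open>\<open>b(t) a(T) - a(t) b(T)\<close>, which is \<open>A\<close> with its
    denominator cleared; its degree is at most \<open>D\<close> in each variable.\<close>
  define N where "N = smult b (lft a) - smult a (lft b)"
  have N_coeff: "coeff N i = smult (coeff a i) b - smult (coeff b i) a" for i
    by (simp add: N_def lft_def coeff_map_poly)
  have NA: "fract_poly N = smult (to_fract b) A"
    using ab by (simp add: N_def A_def lft smult_diff_right)
  have "fract_poly g dvd f" by (metis gf dvd_smult dvd_refl)
  hence "fract_poly g dvd fract_poly N" unfolding NA
    using fdvd[OF AK AX] by (meson dvd_smult dvd_trans)
  hence "g dvd N" using cg by (rule fract_poly_dvdD)
  then obtain h where h: "N = g * h" by (elim dvdE)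
  have N0: "N \<noteq> 0" using NA A0 ab by auto
  have "degree (coeff N i) \<le> D" for i
    unfolding N_coeff Dab by (intro degree_diff_le order_trans[OF degree_smult_le]) auto
  \<comment> \<open>Otherwise all ratios of coefficients of \<open>f\<close> would have height less
    than that of \<theta>, hence be constants, and t would be a root of a nonzero real
    polynomial.\<close>
  moreover have "\<exists>i. D \<le> degree (coeff g i)"
  proof (rule ccontr)
    assume "\<not> ?thesis"
    hence lt: "degree (coeff g i) < D" for i by (simp add: not_le)
    define k where "k = degree f"
    have gk: "coeff g k \<noteq> 0" using f degg by (simp add: k_def flip: degg) (metis degree_0 f(2) gf leading_coeff_0_iff map_poly_0 smult_0_right)
    have fg: "coeff f i = fc * to_fract (coeff g i)" for i
      by (subst gf[symmetric]) (simp add: coeff_map_poly)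
    have "\<exists>c. coeff f i = cst c * coeff f k" for i
    proof -
      define \<eta> where "\<eta> = coeff f i / coeff f k"
      have "\<eta> \<in> K" unfolding \<eta>_def using f by (intro Kc) (auto simp: coeffs_in_def)
      have "\<eta> = to_fract (coeff g i) / to_fract (coeff g k)" using fc by (simp add: \<eta>_def fg)
      hence "height \<eta> \<le> max (degree (coeff g i)) (degree (coeff g k))" using gk by (rule height_le)
      hence "height \<eta> < height \<theta>" using lt[of i] lt[of k] by (simp add: D_def)
      hence "\<eta> \<in> range cst" using min \<open>\<eta> \<in> K\<close> by (meson not_le)
      then obtain c where "\<eta> = cst c" by blast
      thus ?thesis using f by (intro exI[of _ c]) (simp add: \<eta>_def k_def field_simps)
    qed
    then obtain c where c: "\<And>i. coeff f i = cst (c i) * coeff f k" by metis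
    have ck: "c k = 1"
    proof -
      have "cst (c k - 1) * coeff f k = 0" using c[of k] by (simp add: left_diff_distrib)
      thus ?thesis using f by (simp add: k_def del: cst_hom)
    qed
    define r where "r = (\<Sum>i\<le>k. monom (c i) i)"
    have cr: "coeff r i = (if i \<le> k then c i else 0)" for i
      by (simp add: r_def coeff_sum)
    have "f = smult (coeff f k) (lift_poly r)"
    proof (rule poly_eqI)
      fix i show "coeff f i = coeff (smult (coeff f k) (lift_poly r)) i"
        using c[of i] by (cases "i \<le> k") (simp_all add: coeff_map_poly cr k_def coeff_eq_0 mult.commute)
    qed
    hence "poly f tvar = coeff f k * to_fract r"
      by (metis poly_smult poly_lift_poly_tvar)
    hence "r = 0" using f by (simp add: k_def)
    thus False using cr[of k] ck by simp
  qed
  ultimately have hdeg: "degree (coeff h j) = 0" for j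
    using inner_degree_mult[OF h N0] by blast
  \<comment> \<open>The cofactor \<open>h\<close> does not involve t, so it is a real polynomial
    \<open>h0\<close> in T. Comparing coefficients of powers of t in \<open>N = g * h\<close>, it
    divides all combinations \<open>b_j a - a_j b\<close>.\<close>
  define h0 where "h0 = slice 0 h"
  have h_coeff: "coeff h j = [:coeff h0 j:]" for j
    using hdeg[of j] by (metis coeff_slice degree_eq_zeroE h0_def coeff_pCons_0)
  have sliceN: "slice j N = slice j g * h0" for j
    by (rule poly_eqI) (simp add: coeff_slice h coeff_mult h_coeff coeff_sum, simp add: mult.commute)
  have sliceN': "slice j N = smult (coeff b j) a - smult (coeff a j) b" for j
    by (rule poly_eqI) (simp add: coeff_slice N_coeff)
  have h0dvd: "h0 dvd smult (coeff b j) a - smult (coeff a j) b" for j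
    unfolding sliceN'[symmetric] sliceN by simp
  \<comment> \<open>Since \<theta> is not constant, \<open>a\<close> and \<open>b\<close> are not
    proportional, so some 2 by 2 minor of their coefficients is nonzero. Inverting it shows that
    \<open>h0\<close> divides \<open>a\<close> and \<open>b\<close>, which are coprime.\<close>
  have "\<exists>j l. coeff a j * coeff b l \<noteq> coeff a l * coeff b j"
  proof (rule ccontr)
    assume *: "\<not> ?thesis"
    define l where "l = degree b"
    have eq: "coeff a j * coeff b l = coeff a l * coeff b j" for j
    proof (rule ccontr)
      assume "coeff a j * coeff b l \<noteq> coeff a l * coeff b j"
      hence "\<exists>j l. coeff a j * coeff b l \<noteq> coeff a l * coeff b j" by (intro exI)
      with * show False by (rule notE)
    qed
    define x where "x = coeff a l / coeff b l"
    have "coeff b l \<noteq> 0" using ab(2) by (simp add: l_def)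
    hence "coeff a j = x * coeff b j" for j using eq[of j] unfolding x_def by (simp add: field_simps)
    hence "a = [:x:] * b" by (intro poly_eqI) simp
    hence "\<theta> = cst x" using ab by (simp only: to_fract_mult cst_def) simp
    thus False using \<theta> by blast
  qed
  then obtain j l where jl: "coeff a j * coeff b l - coeff a l * coeff b j \<noteq> 0" by auto
  let ?\<delta> = "coeff a j * coeff b l - coeff a l * coeff b j"
  let ?u = "\<lambda>j. smult (coeff b j) a - smult (coeff a j) b"
  have "smult (coeff a j) (?u l) - smult (coeff a l) (?u j) = smult ?\<delta> a"
    "smult (coeff b j) (?u l) - smult (coeff b l) (?u j) = smult ?\<delta> b"
    by (simp_all add: smult_diff_right smult_diff_left mult_ac)
  hence "h0 dvd smult ?\<delta> a" "h0 dvd smult ?\<delta> b"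
    using h0dvd by (metis dvd_diff dvd_smult)+
  hence "h0 dvd a" "h0 dvd b" using jl by (simp_all add: dvd_smult_iff)
  hence "h0 dvd 1" using cop by (meson coprime_def)
  hence "degree h0 = 0" using dvd_imp_degree_le[of h0 1] by simp
  hence "degree h = 0"
    using h_coeff by (metis coeff_eq_0 degree_le h0_def le_zero_eq pCons_0_0 zero_less_iff_neq_zero)
  have "degree (fract_poly N) = degree N" by (rule degree_map_poly) simp
  hence "degree N = D" unfolding NA using degA ab(2) by simp
  moreover have "degree N = degree g + degree h" using h N0 by (metis degree_mult_eq mult_eq_0_iff)
  ultimately have degf: "degree f = D" using \<open>degree h = 0\<close> degg by simp
  \<comment> \<open>This is R(\<theta>). The polynomial \<open>A\<close> has coefficients in it, and
    its degree \<open>D\<close> is now known to be minimal among annihilators of t over the larger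
    field \<open>K\<close>.\<close>
  define K0 where "K0 = {poly (lift_poly P) \<theta> / poly (lift_poly Q) \<theta> | P Q. poly (lift_poly Q) \<theta> \<noteq> 0}"
  have K0I: "poly (lift_poly P) \<theta> / poly (lift_poly Q) \<theta> \<in> K0" if "poly (lift_poly Q) \<theta> \<noteq> 0" for P Q
    unfolding K0_def using that by blast
  have K0c: "cst c \<in> K0" for c using K0I[of 1 "[:c:]"] by (simp add: map_poly_pCons)
  have "subfield_consts K0"
    unfolding subfield_consts_def
  proof (intro conjI ballI allI)
    show "cst c \<in> K0" for c by (rule K0c)
    fix x assume "x \<in> K0"
    then obtain P Q where x: "x = poly (lift_poly P) \<theta> / poly (lift_poly Q) \<theta>" "poly (lift_poly Q) \<theta> \<noteq> 0"
      unfolding K0_def by blast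
    show "- x \<in> K0" using K0I[OF x(2), of "- P"] x(1) by (simp add: lift_poly_hom)
    show "inverse x \<in> K0"
    proof (cases "poly (lift_poly P) \<theta> = 0")
      case True thus ?thesis using x K0c[of 0] by simp
    next
      case False thus ?thesis using x K0I[OF False, of Q] by simp
    qed
    fix y assume "y \<in> K0"
    then obtain P' Q' where y: "y = poly (lift_poly P') \<theta> / poly (lift_poly Q') \<theta>" "poly (lift_poly Q') \<theta> \<noteq> 0"
      unfolding K0_def by blast
    have n: "poly (lift_poly (Q * Q')) \<theta> \<noteq> 0" using x y by (simp add: lift_poly_hom)
    show "x + y \<in> K0" using K0I[OF n, of "P * Q' + P' * Q"] x y by (simp add: lift_poly_hom add_frac_eq)
    show "x * y \<in> K0" using K0I[OF n, of "P * P'"] x y by (simp add: lift_poly_hom)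
  qed
  note K0 = this
  note K0P = coeffs_in_closed[OF K0]
  have pK: "poly p \<theta> \<in> K" if "p \<in> coeffs_in K" for p
    using that
  proof (induction p)
    case (pCons c p)
    have *: "\<forall>i. coeff (pCons c p) i \<in> K" using pCons.prems unfolding coeffs_in_def mem_Collect_eq .
    have "c \<in> K" using *[THEN spec, of 0] unfolding coeff_pCons_0 .
    moreover have "coeff p i \<in> K" for i using *[THEN spec, of "Suc i"] unfolding coeff_pCons_Suc .
    hence "p \<in> coeffs_in K" unfolding coeffs_in_def mem_Collect_eq by (rule allI)
    hence "poly p \<theta> \<in> K" by (rule pCons.IH)
    ultimately show ?case using Kc(4)[OF _ Kc(5)[OF \<theta>(1)]] by simp
  qed (simp add: Kc)
  have "K0 \<subseteq> K"
  proof
    fix x assume "x \<in> K0"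
    then obtain P Q where "x = poly (lift_poly P) \<theta> / poly (lift_poly Q) \<theta>" unfolding K0_def by blast
    thus "x \<in> K" using Kc(9)[OF pK[OF KP(6)] pK[OF KP(6)]] by simp
  qed
  hence K0K': "coeffs_in K0 \<subseteq> coeffs_in K" by (auto simp: coeffs_in_def)
  have "\<theta> \<in> K0" using K0I[of 1 "[:0,1:]"] by (simp add: map_poly_pCons)
  hence AK0: "A \<in> coeffs_in K0" unfolding A_def by (intro K0P(2,4,6))
  \<comment> \<open>Numerator and denominator of \<eta> are reduced modulo \<open>A\<close> over
    R(\<theta>). Then \<open>r1 - \<eta> * r2\<close> annihilates t over \<open>K\<close> and has
    degree less than \<open>D\<close>, so it is zero, and \<eta> is a quotient of two coefficients
    in R(\<theta>).\<close>
  have "\<exists>P Q. poly (lift_poly Q) \<theta> \<noteq> 0 \<and> \<eta> = poly (lift_poly P) \<theta> / poly (lift_poly Q) \<theta>" if \<eta>: "\<eta> \<in> K" for \<eta>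
  proof -
    define p q where "p = fst (quot_of_fract \<eta>)" and "q = snd (quot_of_fract \<eta>)"
    have pq: "\<eta> = to_fract p / to_fract q" "q \<noteq> 0"
      using Fract_quot_of_fract[of \<eta>] by (simp_all add: p_def q_def Fract_conv_to_fract)
    obtain u r1 where r1: "r1 \<in> coeffs_in K0" "lift_poly p = A * u + r1" "r1 = 0 \<or> degree r1 < degree A"
      using coeffs_in_division[OF K0 AK0 A0 K0P(6)[of p]] by (elim bexE conjE) (rule that)
    obtain v r2 where r2: "r2 \<in> coeffs_in K0" "lift_poly q = A * v + r2" "r2 = 0 \<or> degree r2 < degree A"
      using coeffs_in_division[OF K0 AK0 A0 K0P(6)[of q]] by (elim bexE conjE) (rule that)
    have x1: "poly r1 tvar = to_fract p" using arg_cong[OF r1(2), of "\<lambda>p. poly p tvar"] AX by (simp add: poly_lift_poly_tvar)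
    have x2: "poly r2 tvar = to_fract q" using arg_cong[OF r2(2), of "\<lambda>p. poly p tvar"] AX by (simp add: poly_lift_poly_tvar)
    define C where "C = r1 - smult \<eta> r2"
    have "C \<in> coeffs_in K" unfolding C_def by (intro KP(2,4) \<eta> subsetD[OF K0K'] r1(1) r2(1))
    moreover have "poly C tvar = 0" unfolding C_def using x1 x2 pq by simp
    moreover have "C = 0 \<or> degree C < D"
    proof -
      have "degree r1 < D" using r1(3) degA D1 by (cases "r1 = 0") simp_all
      moreover have "degree r2 < D" using r2(3) degA D1 by (cases "r2 = 0") simp_all
      ultimately have "degree C < D" unfolding C_def
        by (intro degree_diff_less le_less_trans[OF degree_smult_le])
      thus ?thesis ..
    qed
    ultimately have "C = 0" using fmin degf by (meson not_le)
    have "r2 \<noteq> 0" using x2 pq by auto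
    define i where "i = degree r2"
    have "coeff r2 i \<noteq> 0" using \<open>r2 \<noteq> 0\<close> by (simp add: i_def)
    moreover have "coeff r1 i = \<eta> * coeff r2 i" using arg_cong[OF \<open>C = 0\<close>, of "\<lambda>p. coeff p i"] by (simp add: C_def)
    ultimately have "\<eta> = coeff r1 i / coeff r2 i" by (simp only: nonzero_mult_div_cancel_right not_False_eq_True)
    moreover have "coeff r1 i / coeff r2 i \<in> K0"
      using r1(1) r2(1) by (intro subfield_constsD(9)[OF K0]) (auto simp: coeffs_in_def)
    ultimately show ?thesis unfolding K0_def by blast
  qed
  thus ?thesis using \<theta> by blast
qed

section \<open>Nash functions and rational curves\<close>

lemma pser_bound:
  assumes "pser n a r A f" "x \<in> Rn n" "\<forall>i<n. \<bar>x i - a i\<bar> \<le> r"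
  shows "\<bar>f x\<bar> \<le> A"
proof -
  obtain c where c: "pcoeff n a r A f c" using assms(1) by (auto simp: pser_def)
  let ?m = "mmon n (\<lambda>i. x i - a i)"
  have s: "((\<lambda>I. c I * ?m I) has_sum f x) (midx n)" using c assms by (simp add: pcoeff_def)
  have w: "(\<lambda>I. \<bar>c I\<bar> * r ^ mdeg n I) summable_on midx n" using c by (simp add: pcoeff_def)
  have m: "\<bar>?m I\<bar> \<le> r ^ mdeg n I" for I using assms by (intro mmon_bound) auto
  have le: "norm (c I * ?m I) \<le> \<bar>c I\<bar> * r ^ mdeg n I" for I
    using mult_left_mono[OF m[of I], of "\<bar>c I\<bar>"] by (simp add: abs_mult)
  have abs: "(\<lambda>I. norm (c I * ?m I)) summable_on midx n"
    by (rule summable_on_comparison_test[OF w le]) simp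
  have "\<bar>f x\<bar> \<le> infsum (\<lambda>I. norm (c I * ?m I)) (midx n)"
    using norm_infsum_bound[OF abs] infsumI[OF s] by simp
  also have "\<dots> \<le> cnorm n r c" by (rule infsum_mono[OF abs w le])
  also have "\<dots> \<le> A" using c by (simp add: pcoeff_def)
  finally show ?thesis .
qed

lemma real_analytic_onI:
  assumes "\<And>a. a \<in> U \<Longrightarrow> \<exists>r>0. \<exists>A. pser n a r A f"
  shows "real_analytic_on n U f"
  unfolding real_analytic_on_def
proof
  fix a assume "a \<in> U"
  then obtain r A where r: "0 < r" "pser n a r A f" using assms by blast
  then obtain c where c: "pcoeff n a r A f c" by (auto simp: pser_def)
  have "((\<lambda>I. c I * (\<Prod>i<n. (x i - a i) ^ I i)) has_sum f x) {I. \<forall>i\<ge>n. I i = 0}"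
    if x: "x \<in> Rn n" "sqnorm n (\<lambda>i. x i - a i) < r\<^sup>2" for x
  proof -
    have "\<bar>x i - a i\<bar> \<le> r" if "i < n" for i
    proof -
      have "(x i - a i)\<^sup>2 \<le> sqnorm n (\<lambda>i. x i - a i)"
        unfolding sqnorm_def by (rule member_le_sum) (use that in auto)
      hence "(x i - a i)\<^sup>2 \<le> r\<^sup>2" using x by simp
      thus ?thesis using r(1) by (simp add: abs_le_square_iff[symmetric])
    qed
    thus ?thesis using c x unfolding pcoeff_def mmon_def midx_def by blast
  qed
  thus "\<exists>\<epsilon>>0. \<exists>c. \<forall>x\<in>Rn n. sqnorm n (\<lambda>i. x i - a i) < \<epsilon>\<^sup>2 \<longrightarrow>
      ((\<lambda>I. c I * (\<Prod>i<n. (x i - a i) ^ I i)) has_sum f x) {I. \<forall>i\<ge>n. I i = 0}"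
    using r(1) by (intro exI[of _ r] conjI exI[of _ c] ballI impI)
qed

text \<open>The definition speaks of Euclidean balls and the norm of cubes; a cube of radius
  \<open>e / (n + 1)\<close> fits into the ball. Convergence at its corner, where each monomial
  equals the power of \<open>r\<close> given by its degree, is absolute and bounds the norm.\<close>

lemma real_analytic_onD:
  assumes "real_analytic_on n U f" "a \<in> U" "a \<in> Rn n"
  shows "\<exists>r>0. \<exists>A. pser n a r A f"
proof -
  obtain e c where e: "0 < e" and c: "\<forall>x\<in>Rn n. sqnorm n (\<lambda>i. x i - a i) < e\<^sup>2 \<longrightarrow>
      ((\<lambda>I. c I * mmon n (\<lambda>i. x i - a i) I) has_sum f x) (midx n)"
    using assms unfolding real_analytic_on_def mmon_def midx_def by blast
  define r where "r = e / (n + 1)"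
  have r: "0 < r" using e by (simp add: r_def)
  have ball: "sqnorm n (\<lambda>i. x i - a i) < e\<^sup>2" if "\<forall>i<n. \<bar>x i - a i\<bar> \<le> r" for x
  proof -
    have "sqnorm n (\<lambda>i. x i - a i) \<le> (\<Sum>i<n. r\<^sup>2)" unfolding sqnorm_def
      using that by (intro sum_mono) (auto simp: abs_le_square_iff[symmetric] abs_of_pos[OF r])
    also have "\<dots> = n * r\<^sup>2" by simp
    also have "\<dots> < (n + 1)\<^sup>2 * r\<^sup>2"
    proof (rule mult_strict_right_mono)
      show "real n < real ((n + 1)\<^sup>2)" by (simp add: power2_eq_square algebra_simps) (metis add_strict_increasing2 le_add_same_cancel1 of_nat_0_le_iff zero_le_mult_iff zero_less_one add_nonneg_nonneg add.commute)
    qed (use r in simp)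
    also have "\<dots> = e\<^sup>2" by (simp add: r_def power_divide add_nonneg_eq_0_iff)
    finally show ?thesis .
  qed
  define y where "y = (\<lambda>i. if i < n then a i + r else 0)"
  have "y \<in> Rn n" by (simp add: y_def Rn_def)
  moreover have "sqnorm n (\<lambda>i. y i - a i) < e\<^sup>2" by (rule ball) (use r in \<open>simp add: y_def\<close>)
  ultimately have "((\<lambda>I. c I * mmon n (\<lambda>i. y i - a i) I) has_sum f y) (midx n)" using c by blast
  moreover have "mmon n (\<lambda>i. y i - a i) I = r ^ mdeg n I" for I
    by (simp add: mmon_def y_def mdeg_def power_sum)
  ultimately have "(\<lambda>I. c I * r ^ mdeg n I) summable_on midx n" using has_sum_imp_summable by fastforce
  hence "(\<lambda>I. norm (c I * r ^ mdeg n I)) summable_on midx n"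
    by (rule iffD1[OF summable_on_iff_abs_summable_on_real])
  hence s: "(\<lambda>I. \<bar>c I\<bar> * r ^ mdeg n I) summable_on midx n"
    using r by (simp add: abs_mult power_abs)
  have "pcoeff n a r (cnorm n r c) f c"
    unfolding pcoeff_def using s c ball by blast
  thus ?thesis using r unfolding pser_def by blast
qed

text \<open>Substitution into a one-variable series with coefficients at most 1. The bound 2 is the
  sum of the powers of 1/2.\<close>

lemma pser_nat_sum:
  assumes r: "0 < r" and f: "pser n a r (1/2) f" and b: "\<And>k. \<bar>b k\<bar> \<le> 1"
    and F: "\<And>x. \<bar>f x\<bar> \<le> 1/2 \<Longrightarrow> (\<lambda>k. b k * f x ^ k) sums F x"
  shows "pser n a r 2 F"
proof -
  have s: "((\<lambda>k. (1/2 :: real) ^ k) has_sum 2) UNIV"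
    using geometric_sums[of "1/2::real"] by (intro norm_summable_imp_has_sum) (auto simp: summable_geometric)
  have "pser n a r (infsum (\<lambda>k. (1/2 :: real) ^ k) UNIV) F"
  proof (rule pser_infsum[OF r])
    show "pser n a r ((1/2) ^ k) (\<lambda>x. b k * f x ^ k)" for k
      using pser_mult[OF r pser_const[OF b[of k]] pser_power[OF r f]] by simp
    show "(\<lambda>k. (1/2 :: real) ^ k) summable_on UNIV" using s by (rule has_sum_imp_summable)
    fix x assume x: "x \<in> Rn n" "\<And>i. i < n \<Longrightarrow> \<bar>x i - a i\<bar> \<le> r"
    hence fx: "\<bar>f x\<bar> \<le> 1/2" by (intro pser_bound[OF f]) auto
    have "norm (b k * f x ^ k) \<le> (1/2) ^ k" for k
      using mult_mono[OF b[of k] power_mono[OF fx, of k]] by (simp add: abs_mult power_abs)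
    hence "summable (\<lambda>k. norm (b k * f x ^ k))"
      by (intro summable_comparison_test[OF _ summable_geometric[of "1/2::real"]]) auto
    thus "((\<lambda>k. b k * f x ^ k) has_sum F x) UNIV"
      using F[OF fx] by (rule norm_summable_imp_has_sum)
  qed
  thus ?thesis using infsumI[OF s] by simp
qed

lemma relative_increment_small:
  assumes "poly_fun n h" "h a \<noteq> 0"
  shows "\<exists>r0>0. \<forall>r. 0 < r \<and> r \<le> r0 \<longrightarrow> pser n a r (1/2) (\<lambda>x. (1 / h a) * (h x - h a))"
  using psmall_radius[OF psmall_cmult[OF psmall_poly_fun[OF assms(1)]], of "1/2" a "1 / h a"] by auto

lemma pser_poly_fun:
  assumes "poly_fun n p" "0 < r" "r \<le> 1"
  shows "\<exists>A. pser n a r A p"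
proof -
  obtain C where "pser n a r (C * r) (\<lambda>x. p x - p a)"
    using psmall_poly_fun[OF assms(1), of a] assms unfolding psmall_def by blast
  hence "pser n a r (C * r + \<bar>p a\<bar>) (\<lambda>x. (p x - p a) + p a)"
    using assms by (intro pser_add pser_const) auto
  thus ?thesis by auto
qed

lemma half_gchoose_bound: "\<bar>(1/2::real) gchoose k\<bar> \<le> 1"
proof (induction k)
  case (Suc k)
  have "((1/2::real) gchoose Suc k) * real (Suc k) = (1/2 - real k) * ((1/2) gchoose k)"
    using gbinomial_mult_1[of "1/2::real" k] by (simp add: algebra_simps)
  hence "\<bar>(1/2::real) gchoose Suc k\<bar> * real (Suc k) = \<bar>1/2 - real k\<bar> * \<bar>(1/2) gchoose k\<bar>"
    by (metis abs_mult abs_of_nat)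
  also have "\<dots> \<le> real (Suc k) * 1" using Suc by (intro mult_mono) auto
  finally show ?case by simp
qed simp

text \<open>\<open>sqrt D\<close> is \<open>sqrt (D a)\<close> times the binomial series with
  exponent 1/2 in the relative increment of \<open>D\<close>, whose norm is at most 1/2 on small
  cubes.\<close>

lemma pser_sqrt:
  assumes D: "poly_fun n D" "0 < D a"
  shows "\<exists>r0>0. \<forall>r. 0 < r \<and> r \<le> r0 \<longrightarrow> (\<exists>A. pser n a r A (\<lambda>x. sqrt (D x)))"
proof -
  let ?f = "\<lambda>x. (1 / D a) * (D x - D a)"
  obtain r0 where r0: "0 < r0" "\<forall>r. 0 < r \<and> r \<le> r0 \<longrightarrow> pser n a r (1/2) ?f"
    using relative_increment_small[OF D(1), of a] D(2) by auto
  have "\<exists>A. pser n a r A (\<lambda>x. sqrt (D x))" if r: "0 < r" "r \<le> r0" for r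
  proof -
    have f: "pser n a r (1/2) ?f" using r0 r by blast
    have "pser n a r 2 (\<lambda>x. (1 + ?f x) powr (1/2))"
    proof (rule pser_nat_sum[OF r(1) f half_gchoose_bound])
      fix x assume "\<bar>?f x\<bar> \<le> 1/2"
      hence "\<bar>?f x\<bar> < 1" by linarith
      thus "(\<lambda>k. ((1/2) gchoose k) * ?f x ^ k) sums (1 + ?f x) powr (1/2)"
        by (rule gen_binomial_real)
    qed
    from pser_mult[OF r(1) pser_const[of "sqrt (D a)" "sqrt (D a)"] this]
    have "pser n a r (sqrt (D a) * 2) (\<lambda>x. sqrt (D a) * (1 + ?f x) powr (1/2))" using D(2) by simp
    hence "pser n a r (sqrt (D a) * 2) (\<lambda>x. sqrt (D x))"
    proof (rule pser_cong)
      fix x assume x: "x \<in> Rn n" "\<And>i. i < n \<Longrightarrow> \<bar>x i - a i\<bar> \<le> r"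
      hence "\<bar>?f x\<bar> \<le> 1/2" by (intro pser_bound[OF f]) auto
      hence "0 \<le> 1 + ?f x" by linarith
      hence "(1 + ?f x) powr (1/2) = sqrt (1 + ?f x)" by (rule powr_half_sqrt)
      moreover have "D a * (1 + ?f x) = D x" using D(2) by (simp add: field_simps)
      ultimately show "sqrt (D a) * (1 + ?f x) powr (1/2) = sqrt (D x)"
        by (metis real_sqrt_mult)
    qed
    thus ?thesis by blast
  qed
  thus ?thesis using r0(1) by blast
qed

lemma pser_inverse:
  assumes h: "poly_fun n h" "h a \<noteq> 0"
  shows "\<exists>r0>0. \<forall>r. 0 < r \<and> r \<le> r0 \<longrightarrow> pser n a r (2 / \<bar>h a\<bar>) (\<lambda>x. 1 / h x)"
proof -
  let ?f = "\<lambda>x. (1 / h a) * (h x - h a)"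
  obtain r0 where r0: "0 < r0" "\<forall>r. 0 < r \<and> r \<le> r0 \<longrightarrow> pser n a r (1/2) ?f"
    using relative_increment_small[OF h] by auto
  have "pser n a r (2 / \<bar>h a\<bar>) (\<lambda>x. 1 / h x)" if r: "0 < r" "r \<le> r0" for r
  proof -
    have f: "pser n a r (1/2) ?f" using r0 r by blast
    have "pser n a r 2 (\<lambda>x. 1 / (1 + ?f x))"
    proof (rule pser_nat_sum[OF r(1) f, where b = "\<lambda>k. (-1) ^ k"])
      fix x assume "\<bar>?f x\<bar> \<le> 1/2"
      hence "norm (- ?f x) < 1" unfolding real_norm_def abs_minus_cancel by linarith
      moreover have "(\<lambda>k. (-1) ^ k * ?f x ^ k) = (\<lambda>k. (- ?f x) ^ k)"
        by (rule ext) (rule power_minus[symmetric])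
      ultimately show "(\<lambda>k. (-1) ^ k * ?f x ^ k) sums (1 / (1 + ?f x))"
        using geometric_sums[of "- ?f x"] by (simp only: diff_minus_eq_add)
    qed simp
    from pser_mult[OF r(1) pser_const[of "1 / h a" "1 / \<bar>h a\<bar>"] this]
    have "pser n a r (1 / \<bar>h a\<bar> * 2) (\<lambda>x. 1 / h a * (1 / (1 + ?f x)))" by simp
    hence "pser n a r (1 / \<bar>h a\<bar> * 2) (\<lambda>x. 1 / h x)"
    proof (rule pser_cong)
      fix x
      have e: "h a * (1 + ?f x) = h x" using h(2) by (simp add: field_simps)
      have "1 / h a * (1 / (1 + ?f x)) = 1 / (h a * (1 + ?f x))"
        by (simp only: times_divide_times_eq mult_1)
      also have "\<dots> = 1 / h x" by (simp only: e)
      finally show "1 / h a * (1 / (1 + ?f x)) = 1 / h x" .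
    qed
    thus ?thesis by simp
  qed
  thus ?thesis using r0(1) by blast
qed

text \<open>Over the denominator \<open>h\<close>, the increment has numerator
  \<open>g - (g a / h a) * h\<close>, which vanishes at \<open>a\<close>. An arbitrarily small norm
  is required of the inner functions in \<open>pser_compose\<close>.\<close>

lemma pser_rational_small:
  assumes g: "poly_fun n g" and h: "poly_fun n h" "h a \<noteq> 0" and e: "0 < e"
  shows "\<exists>\<rho>0>0. \<forall>\<rho>. 0 < \<rho> \<and> \<rho> \<le> \<rho>0 \<longrightarrow> pser n a \<rho> e (\<lambda>x. g x / h x - g a / h a)"
proof -
  let ?p = "\<lambda>x. g x - (g a / h a) * h x"
  have "poly_fun n ?p" by (intro poly_fun_intros g h)
  from psmall_poly_fun[OF this, of a] have ps: "psmall n a ?p" using h(2) by simp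
  have "0 < e * \<bar>h a\<bar> / 2" using e h(2) by simp
  from psmall_radius[OF ps this] obtain \<rho>1 where \<rho>1: "0 < \<rho>1"
    "\<forall>\<rho>. 0 < \<rho> \<and> \<rho> \<le> \<rho>1 \<longrightarrow> pser n a \<rho> (e * \<bar>h a\<bar> / 2) ?p" by auto
  obtain \<rho>0 where \<rho>0: "0 < \<rho>0" "\<forall>\<rho>. 0 < \<rho> \<and> \<rho> \<le> \<rho>0 \<longrightarrow> pser n a \<rho> (2 / \<bar>h a\<bar>) (\<lambda>x. 1 / h x)"
    using pser_inverse[OF h] by auto
  define r where "r = min \<rho>1 (min \<rho>0 1)"
  have r0: "0 < r" using \<rho>1 \<rho>0 by (simp add: r_def)
  obtain s where s: "0 < s" "\<forall>\<rho>. 0 < \<rho> \<and> \<rho> \<le> s \<longrightarrow> pser n a \<rho> (1/2) (\<lambda>x. (1 / h a) * (h x - h a))"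
    using relative_increment_small[OF h] by auto
  have "pser n a \<rho> e (\<lambda>x. g x / h x - g a / h a)" if \<rho>: "0 < \<rho>" "\<rho> \<le> min r s" for \<rho>
  proof -
    have "pser n a \<rho> ((e * \<bar>h a\<bar> / 2) * (2 / \<bar>h a\<bar>)) (\<lambda>x. ?p x * (1 / h x))"
      using \<rho>0 \<rho>1 \<rho> by (intro pser_mult[OF \<rho>(1)]) (auto simp: r_def)
    hence "pser n a \<rho> e (\<lambda>x. ?p x * (1 / h x))" using h(2) by simp
    thus ?thesis
    proof (rule pser_cong)
      fix x assume x: "x \<in> Rn n" "\<And>i. i < n \<Longrightarrow> \<bar>x i - a i\<bar> \<le> \<rho>"
      have "pser n a \<rho> (1/2) (\<lambda>x. (1 / h a) * (h x - h a))" using s \<rho> by simp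
      hence b: "\<bar>(1 / h a) * (h x - h a)\<bar> \<le> 1/2" using x by (intro pser_bound) auto
      have "h x \<noteq> 0"
      proof
        assume "h x = 0"
        hence "(1 / h a) * (h x - h a) = -1" using h(2) by simp
        thus False using b by linarith
      qed
      thus "?p x * (1 / h x) = g x / h x - g a / h a" by (simp add: field_simps)
    qed
  qed
  moreover have "0 < min r s" using r0 s by simp
  ultimately show ?thesis by blast
qed

lemma pser_compose:
  assumes f: "pser m b s A f" and r: "0 < r" "0 < s"
    and \<gamma>: "\<And>i. i < m \<Longrightarrow> pser n a r s (\<lambda>x. \<gamma> i x - b i)"
  shows "pser n a r A (\<lambda>x. f (\<lambda>i. if i < m then \<gamma> i x else 0))"
proof -
  obtain c where c: "pcoeff m b s A f c" using f by (auto simp: pser_def)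
  have c1: "(\<lambda>I. \<bar>c I\<bar> * s ^ mdeg m I) summable_on midx m"
    "infsum (\<lambda>I. \<bar>c I\<bar> * s ^ mdeg m I) (midx m) \<le> A" using c by (auto simp: pcoeff_def)
  have "pser n a r (infsum (\<lambda>I. \<bar>c I\<bar> * s ^ mdeg m I) (midx m)) (\<lambda>x. f (\<lambda>i. if i < m then \<gamma> i x else 0))"
  proof (rule pser_infsum[OF r(1)])
    show "pser n a r (\<bar>c I\<bar> * s ^ mdeg m I) (\<lambda>x. c I * (\<Prod>i<m. (\<gamma> i x - b i) ^ I i))" for I
    proof -
      have "pser n a r (\<Prod>i<m. s ^ I i) (\<lambda>x. \<Prod>i<m. (\<gamma> i x - b i) ^ I i)"
        by (intro pser_prod pser_power r \<gamma>) auto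
      hence "pser n a r (\<bar>c I\<bar> * (\<Prod>i<m. s ^ I i)) (\<lambda>x. c I * (\<Prod>i<m. (\<gamma> i x - b i) ^ I i))"
        by (intro pser_mult pser_const r) auto
      thus ?thesis by (simp add: mdeg_def power_sum)
    qed
    show "(\<lambda>I. \<bar>c I\<bar> * s ^ mdeg m I) summable_on midx m" by (rule c1)
    fix x assume x: "x \<in> Rn n" "\<And>i. i < n \<Longrightarrow> \<bar>x i - a i\<bar> \<le> r"
    define y where "y = (\<lambda>i. if i < m then \<gamma> i x else 0)"
    have "y \<in> Rn m" by (simp add: y_def Rn_def)
    moreover have "\<bar>y i - b i\<bar> \<le> s" if "i < m" for i
      using pser_bound[OF \<gamma>[OF that]] x that by (simp add: y_def)
    ultimately have "((\<lambda>I. c I * mmon m (\<lambda>i. y i - b i) I) has_sum f y) (midx m)"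
      using c by (simp add: pcoeff_def)
    moreover have "mmon m (\<lambda>i. y i - b i) I = (\<Prod>i<m. (\<gamma> i x - b i) ^ I i)" for I
      by (simp add: mmon_def y_def)
    ultimately show "((\<lambda>I. c I * (\<Prod>i<m. (\<gamma> i x - b i) ^ I i)) has_sum f (\<lambda>i. if i < m then \<gamma> i x else 0)) (midx m)"
      by (simp add: y_def)
  qed
  thus ?thesis using c1(2) by (rule pser_weaken)
qed

section \<open>Identity theorem for analytic functions of one real variable\<close>

definition locally_powser :: "(real \<Rightarrow> real) \<Rightarrow> bool" where
  "locally_powser F \<longleftrightarrow> (\<forall>t0. \<exists>r>0. \<exists>b. \<forall>t. \<bar>t - t0\<bar> \<le> r \<longrightarrow> (\<lambda>k. b k * (t - t0) ^ k) sums F t)"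

lemma pser_1_powser:
  assumes "pser 1 (\<lambda>i. if i = 0 then t0 else 0) r A (\<lambda>x. F (x 0))"
  shows "\<exists>b. \<forall>t. \<bar>t - t0\<bar> \<le> r \<longrightarrow> (\<lambda>k. b k * (t - t0) ^ k) sums F t"
proof -
  obtain c where c: "pcoeff 1 (\<lambda>i. if i = 0 then t0 else 0) r A (\<lambda>x. F (x 0)) c" using assms by (auto simp: pser_def)
  let ?e = "\<lambda>k i. if i = 0 then k else 0 :: nat"
  have inj: "inj ?e" by (auto simp: inj_def fun_eq_iff)
  have img: "?e ` UNIV = midx 1"
  proof (rule set_eqI, rule iffI)
    fix I assume "I \<in> midx 1"
    hence "I = ?e (I 0)" by (auto simp: midx_def fun_eq_iff)
    thus "I \<in> ?e ` UNIV" by (rule image_eqI) simp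
  qed (auto simp: midx_def)
  have "(\<lambda>k. c (?e k) * (t - t0) ^ k) sums F t" if "\<bar>t - t0\<bar> \<le> r" for t
  proof -
    define x where "x = (\<lambda>i::nat. if i = 0 then t else 0)"
    have "x \<in> Rn 1" "\<forall>i<1. \<bar>x i - (if i = 0 then t0 else 0)\<bar> \<le> r" using that by (auto simp: x_def Rn_def)
    hence "((\<lambda>I. c I * mmon 1 (\<lambda>i. x i - (if i = 0 then t0 else 0)) I) has_sum F (x 0)) (midx 1)"
      using c unfolding pcoeff_def by blast
    hence "((\<lambda>I. c I * (t - t0) ^ I 0) has_sum F t) (?e ` UNIV)"
      unfolding img by (simp add: mmon_def x_def)
    hence "((\<lambda>I. c I * (t - t0) ^ I 0) \<circ> ?e has_sum F t) UNIV"
      using has_sum_reindex[OF inj] by blast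
    hence "((\<lambda>k. c (?e k) * (t - t0) ^ k) has_sum F t) UNIV" by (simp add: o_def)
    thus ?thesis by (rule has_sum_imp_sums)
  qed
  thus ?thesis by (intro exI[of _ "\<lambda>k. c (?e k)"]) simp
qed

lemma powser_zero_or_isolated:
  fixes F :: "real \<Rightarrow> real"
  assumes r: "0 < r" and F: "\<forall>t. \<bar>t - t0\<bar> \<le> r \<longrightarrow> (\<lambda>k. b k * (t - t0) ^ k) sums F t"
  shows "(\<forall>t. \<bar>t - t0\<bar> \<le> r \<longrightarrow> F t = 0) \<or> (\<exists>s>0. \<forall>t. t \<noteq> t0 \<and> \<bar>t - t0\<bar> < s \<longrightarrow> F t \<noteq> 0)"
proof (cases "\<forall>k. b k = 0")
  case True
  have "F t = 0" if "\<bar>t - t0\<bar> \<le> r" for t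
    using F that True sums_unique2[of "\<lambda>k. 0" "F t" 0] by auto
  thus ?thesis by blast
next
  case False
  define k where "k = (LEAST k. b k \<noteq> 0)"
  have k: "b k \<noteq> 0" "\<And>j. j < k \<Longrightarrow> b j = 0"
    unfolding k_def using False LeastI_ex[of "\<lambda>k. b k \<noteq> 0"] not_less_Least by auto
  define g where "g = (\<lambda>x. if x = 0 then b k else F (t0 + x) / x ^ k)"
  have s: "(\<lambda>j. b (j + k) * x ^ j) sums g x" if "norm x < r" for x
  proof (cases "x = 0")
    case True
    thus ?thesis using powser_sums_zero[of "\<lambda>j. b (j + k)"] by (simp add: g_def)
  next
    case False
    have "(\<lambda>j. b j * x ^ j) sums F (t0 + x)" using F[rule_format, of "t0 + x"] that by simp
    hence "(\<lambda>j. b (j + k) * x ^ (j + k)) sums (F (t0 + x) - (\<Sum>j<k. b j * x ^ j))"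
      by (rule sums_split_initial_segment)
    hence "(\<lambda>j. b (j + k) * x ^ (j + k)) sums F (t0 + x)" using k(2) by simp
    from sums_divide[OF this, of "x ^ k"] show ?thesis using False by (simp add: g_def power_add)
  qed
  from powser_limit_0[OF r s] have "(g \<longlongrightarrow> b k) (at 0)" by simp
  hence "eventually (\<lambda>x. g x \<noteq> 0) (at 0)" using k(1) by (rule tendsto_imp_eventually_ne)
  then obtain s where s: "0 < s" "\<forall>x. x \<noteq> 0 \<and> \<bar>x\<bar> < s \<longrightarrow> g x \<noteq> 0"
    unfolding eventually_at by (auto simp: dist_real_def)
  have "F t \<noteq> 0" if "t \<noteq> t0" "\<bar>t - t0\<bar> < s" for t
    using s(2)[rule_format, of "t - t0"] that by (auto simp: g_def)
  thus ?thesis using s(1) by blast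
qed

lemma locally_powser_cases:
  assumes "locally_powser F"
  shows "(\<exists>s>0. \<forall>t. \<bar>t - t0\<bar> < s \<longrightarrow> F t = 0) \<or> (\<exists>s>0. \<forall>t. t \<noteq> t0 \<and> \<bar>t - t0\<bar> < s \<longrightarrow> F t \<noteq> 0)"
proof -
  obtain r b where r: "0 < r" "\<forall>t. \<bar>t - t0\<bar> \<le> r \<longrightarrow> (\<lambda>k. b k * (t - t0) ^ k) sums F t"
    using assms unfolding locally_powser_def by blast
  from powser_zero_or_isolated[OF this] show ?thesis
  proof
    assume "\<forall>t. \<bar>t - t0\<bar> \<le> r \<longrightarrow> F t = 0"
    thus ?thesis using r(1) by (intro disjI1 exI[of _ r]) auto
  qed blast
qed

lemma locally_powser_zero:
  assumes F: "locally_powser F" and z: "0 < s0" "\<forall>t. \<bar>t - t1\<bar> < s0 \<longrightarrow> F t = 0"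
  shows "F t = 0"
proof -
  define Z where "Z = {t0. \<exists>s>0. \<forall>t. \<bar>t - t0\<bar> < s \<longrightarrow> F t = 0}"
  have op: "open Z" unfolding open_dist
  proof
    fix t0 assume "t0 \<in> Z"
    then obtain s where s: "0 < s" "\<forall>t. \<bar>t - t0\<bar> < s \<longrightarrow> F t = 0" unfolding Z_def by blast
    have "y \<in> Z" if y: "dist y t0 < s" for y
    proof -
      have "\<forall>t. \<bar>t - y\<bar> < s - dist y t0 \<longrightarrow> F t = 0"
      proof (intro allI impI)
        fix t assume "\<bar>t - y\<bar> < s - dist y t0"
        hence "\<bar>t - t0\<bar> < s" unfolding dist_real_def by linarith
        thus "F t = 0" using s(2) by blast
      qed
      thus ?thesis unfolding Z_def using y by (intro CollectI exI[of _ "s - dist y t0"]) simp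
    qed
    thus "\<exists>e>0. \<forall>y. dist y t0 < e \<longrightarrow> y \<in> Z" using s(1) by blast
  qed
  have "open (- Z)" unfolding open_dist
  proof
    fix t0 assume t0: "t0 \<in> - Z"
    hence "\<not> (\<exists>s>0. \<forall>t. \<bar>t - t0\<bar> < s \<longrightarrow> F t = 0)" by (simp add: Z_def)
    then obtain s where s: "0 < s" "\<forall>t. t \<noteq> t0 \<and> \<bar>t - t0\<bar> < s \<longrightarrow> F t \<noteq> 0"
      using locally_powser_cases[OF F, of t0] by blast
    have "y \<in> - Z" if "dist y t0 < s" for y
    proof (cases "y = t0")
      case False
      hence "F y \<noteq> 0" using s(2) that by (simp add: dist_real_def)
      thus ?thesis unfolding Z_def by force
    qed (use t0 in simp)
    thus "\<exists>e>0. \<forall>y. dist y t0 < e \<longrightarrow> y \<in> - Z" using s(1) by blast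
  qed
  hence "closed Z" by (simp add: closed_def)
  moreover have "t1 \<in> Z" unfolding Z_def using z by blast
  ultimately have "Z = UNIV" using clopen op by blast
  hence "t \<in> Z" by simp
  thus ?thesis unfolding Z_def by force
qed

lemma locally_powser_mult_zero:
  assumes F: "locally_powser F" and G: "locally_powser G" and FG: "\<forall>t. F t * G t = 0"
  shows "(\<forall>t. F t = 0) \<or> (\<forall>t. G t = 0)"
proof -
  have "(\<exists>s>0. \<forall>t. \<bar>t - 0\<bar> < s \<longrightarrow> F t = 0) \<or> (\<exists>s>0. \<forall>t. \<bar>t - 0\<bar> < s \<longrightarrow> G t = 0)"
  proof (rule ccontr)
    assume "\<not> ?thesis"
    then obtain s s' where s: "0 < s" "\<forall>t. t \<noteq> 0 \<and> \<bar>t - 0\<bar> < s \<longrightarrow> F t \<noteq> 0"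
      and s': "0 < s'" "\<forall>t. t \<noteq> 0 \<and> \<bar>t - 0\<bar> < s' \<longrightarrow> G t \<noteq> 0"
      using locally_powser_cases[OF F, of 0] locally_powser_cases[OF G, of 0] by blast
    define t where "t = min s s' / 2"
    have t: "t \<noteq> 0" "\<bar>t - 0\<bar> < s" "\<bar>t - 0\<bar> < s'" using s(1) s'(1) by (auto simp: t_def)
    hence "F t \<noteq> 0" "G t \<noteq> 0" using s(2) s'(2) by blast+
    thus False using FG[rule_format, of t] by simp
  qed
  thus ?thesis using locally_powser_zero[OF F] locally_powser_zero[OF G] by blast
qed

text \<open>The representation of a coordinate as a quotient may depend on \<open>t0\<close>,
  because a fixed quotient can become 0/0 at a point where the curve itself is regular.\<close>

lemma locally_powser_compose:
  fixes \<Gamma> :: "real \<Rightarrow> pt"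
  assumes f: "real_analytic_on m U f" and \<Gamma>: "\<And>t. \<Gamma> t \<in> U" "\<And>t. \<Gamma> t \<in> Rn m"
    and rat: "\<And>(t0::real) i. i < m \<Longrightarrow> \<exists>G H. \<exists>e>0. poly H t0 \<noteq> 0 \<and> (\<forall>t. \<bar>t - t0\<bar> \<le> e \<longrightarrow> \<Gamma> t i = poly G t / poly H t)"
  shows "locally_powser (\<lambda>t. f (\<Gamma> t))"
  unfolding locally_powser_def
proof
  fix t0 :: real
  define a where "a = (\<lambda>i::nat. if i = 0 then t0 else 0)"
  obtain s A where s: "0 < s" "pser m (\<Gamma> t0) s A f"
    using real_analytic_onD[OF f \<Gamma>(1) \<Gamma>(2)] by blast
  have "\<forall>i\<in>{..<m}. \<exists>r. 0 < r \<and> (\<forall>\<rho>. 0 < \<rho> \<and> \<rho> \<le> r \<longrightarrow> pser 1 a \<rho> s (\<lambda>x. \<Gamma> (x 0) i - \<Gamma> t0 i))"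
  proof
    fix i assume "i \<in> {..<m}"
    hence "i < m" by simp
    from rat[OF this, of t0] obtain G H e where GH: "0 < e" "poly H t0 \<noteq> 0"
      "\<forall>t. \<bar>t - t0\<bar> \<le> e \<longrightarrow> \<Gamma> t i = poly G t / poly H t" by blast
    have pf: "poly_fun 1 (\<lambda>x. poly P (x 0))" for P :: "real poly"
      by (rule poly_fun_poly) (simp add: pf_var)
    have "poly H (a 0) \<noteq> 0" using GH by (simp add: a_def)
    from pser_rational_small[where a = a and h = "\<lambda>x. poly H (x 0)", OF pf[of G] pf[of H] this s(1)] obtain r where r: "0 < r"
      "\<forall>\<rho>. 0 < \<rho> \<and> \<rho> \<le> r \<longrightarrow> pser 1 a \<rho> s (\<lambda>x. poly G (x 0) / poly H (x 0) - poly G (a 0) / poly H (a 0))" by blast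
    have "pser 1 a \<rho> s (\<lambda>x. \<Gamma> (x 0) i - \<Gamma> t0 i)" if \<rho>: "0 < \<rho>" "\<rho> \<le> min r e" for \<rho>
    proof -
      have "pser 1 a \<rho> s (\<lambda>x. poly G (x 0) / poly H (x 0) - poly G (a 0) / poly H (a 0))" using r(2) \<rho> by simp
      thus ?thesis
      proof (rule pser_cong)
        fix x assume x: "x \<in> Rn 1" "\<And>i. i < 1 \<Longrightarrow> \<bar>x i - a i\<bar> \<le> \<rho>"
        have "\<bar>x 0 - t0\<bar> \<le> e" using x(2)[of 0] \<rho> by (simp add: a_def)
        thus "poly G (x 0) / poly H (x 0) - poly G (a 0) / poly H (a 0) = \<Gamma> (x 0) i - \<Gamma> t0 i"
          using GH(3)[rule_format, of "x 0"] GH(3)[rule_format, of t0] GH(1) by (simp add: a_def)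
      qed
    qed
    thus "\<exists>r. 0 < r \<and> (\<forall>\<rho>. 0 < \<rho> \<and> \<rho> \<le> r \<longrightarrow> pser 1 a \<rho> s (\<lambda>x. \<Gamma> (x 0) i - \<Gamma> t0 i))"
      using r(1) GH(1) by (intro exI[of _ "min r e"]) auto
  qed
  from bchoice[OF this] obtain r where
    r: "\<forall>i\<in>{..<m}. 0 < r i \<and> (\<forall>\<rho>. 0 < \<rho> \<and> \<rho> \<le> r i \<longrightarrow> pser 1 a \<rho> s (\<lambda>x. \<Gamma> (x 0) i - \<Gamma> t0 i))" by (elim exE)
  define \<rho> where "\<rho> = Min (insert 1 (r ` {..<m}))"
  have \<rho>0: "0 < \<rho>" unfolding \<rho>_def using r by (subst Min_gr_iff) auto
  have "pser 1 a \<rho> s (\<lambda>x. \<Gamma> (x 0) i - \<Gamma> t0 i)" if "i < m" for i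
  proof -
    have "\<rho> \<le> r i" unfolding \<rho>_def using that by (intro Min_le) auto
    thus ?thesis using r \<rho>0 that by simp
  qed
  from pser_compose[where \<gamma> = "\<lambda>i x. \<Gamma> (x 0) i", OF s(2) \<rho>0 s(1) this]
  have "pser 1 a \<rho> A (\<lambda>x. f (\<lambda>i. if i < m then \<Gamma> (x 0) i else 0))" by simp
  moreover have "(\<lambda>i. if i < m then \<Gamma> t i else 0) = \<Gamma> t" for t
    using \<Gamma>(2)[of t] by (auto simp: Rn_def fun_eq_iff)
  ultimately have "pser 1 a \<rho> A (\<lambda>x. (\<lambda>t. f (\<Gamma> t)) (x 0))" by simp
  from pser_1_powser[OF this[unfolded a_def]] \<rho>0
  show "\<exists>\<rho>>0. \<exists>b. \<forall>t. \<bar>t - t0\<bar> \<le> \<rho> \<longrightarrow> (\<lambda>k. b k * (t - t0) ^ k) sums f (\<Gamma> t)" by blast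
qed

text \<open>Analyticity comes from the binomial series on the open set where \<open>D\<close> is
  positive, and the algebraic equation is \<open>(z - p)\<^sup>2 = q\<^sup>2 D\<close>.\<close>

lemma nash_on_quadratic:
  assumes pf: "poly_fun n p" "poly_fun n q" "poly_fun n D" and S: "S \<subseteq> Rn n" "\<And>x. x \<in> S \<Longrightarrow> 0 < D x"
  shows "nash_on n S (\<lambda>x. p x + q x * sqrt (D x))"
proof -
  let ?f = "\<lambda>x. p x + q x * sqrt (D x)"
  define U where "U = {x \<in> Rn n. 0 < D x}"
  have sa: "semialg n U" unfolding U_def by (rule sa_pos[OF pf(3)])
  have "open {x. 0 < D x}" by (intro open_Collect_less continuous_on_const poly_fun_continuous[OF pf(3)])
  moreover have "U = Rn n \<inter> {x. 0 < D x}" by (auto simp: U_def)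
  ultimately have op: "openin (top_of_set (Rn n)) U" by (simp add: openin_open_Int)
  have an: "real_analytic_on n U ?f"
  proof (rule real_analytic_onI)
    fix a assume "a \<in> U"
    hence "0 < D a" by (simp add: U_def)
    from pser_sqrt[OF pf(3) this] obtain r0 where r0: "0 < r0" "\<forall>r. 0 < r \<and> r \<le> r0 \<longrightarrow> (\<exists>A. pser n a r A (\<lambda>x. sqrt (D x)))" by blast
    define r where "r = min r0 1"
    have r: "0 < r" "r \<le> 1" "r \<le> r0" using r0 by (auto simp: r_def)
    obtain A where A: "pser n a r A (\<lambda>x. sqrt (D x))" using r0 r by blast
    obtain B where B: "pser n a r B p" using pser_poly_fun[OF pf(1) r(1,2)] by blast
    obtain C where C: "pser n a r C q" using pser_poly_fun[OF pf(2) r(1,2)] by blast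
    have "pser n a r (B + C * A) ?f" by (intro pser_add pser_mult r A B C)
    thus "\<exists>r>0. \<exists>A. pser n a r A ?f" using r(1) by blast
  qed
  define P where "P = (\<lambda>z. (z n - p z)\<^sup>2 - (q z)\<^sup>2 * D z)"
  have pf': "poly_fun (Suc n) p" "poly_fun (Suc n) q" "poly_fun (Suc n) D"
    using pf by (auto intro: poly_fun_mono)
  have "poly_fun (Suc n) P" unfolding P_def by (intro poly_fun_intros pf') simp
  moreover have "\<exists>z\<in>Rn (Suc n). P z \<noteq> 0"
  proof -
    define z where "z = (\<lambda>t i. if i = n then t else (0::real))"
    have c: "p (z t) = p (z 0)" "q (z t) = q (z 0)" "D (z t) = D (z 0)" for t
      by (rule poly_fun_cong_coords[OF pf(1)], simp add: z_def)
        (rule poly_fun_cong_coords[OF pf(2)], simp add: z_def,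
         rule poly_fun_cong_coords[OF pf(3)], simp add: z_def)
    define K where "K = (q (z 0))\<^sup>2 * D (z 0)"
    \<comment> \<open>Chosen so that the square is that of \<open>\<bar>K\<bar> + 1\<close>, which
      exceeds \<open>K\<close>.\<close>
    define t where "t = p (z 0) + \<bar>K\<bar> + 1"
    have "P (z t) = (\<bar>K\<bar> + 1)\<^sup>2 - K"
      unfolding P_def c[of t] K_def[symmetric] by (simp add: z_def t_def K_def)
    moreover have "(\<bar>K\<bar> + 1)\<^sup>2 = \<bar>K\<bar>\<^sup>2 + 2 * \<bar>K\<bar> + 1" by (simp add: power2_eq_square algebra_simps)
    moreover have "0 \<le> \<bar>K\<bar>\<^sup>2" by simp
    ultimately have "P (z t) \<noteq> 0" by linarith
    moreover have "z t \<in> Rn (Suc n)" by (simp add: z_def Rn_def)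
    ultimately show ?thesis by blast
  qed
  moreover have "P (x(n := ?f x)) = 0" if "x \<in> U" for x
  proof -
    have "p (x(n := s)) = p x" "q (x(n := s)) = q x" "D (x(n := s)) = D x" for s
      by (rule poly_fun_cong_coords[OF pf(1)], simp)
        (rule poly_fun_cong_coords[OF pf(2)], simp, rule poly_fun_cong_coords[OF pf(3)], simp)
    thus ?thesis using that by (simp add: P_def U_def power_mult_distrib)
  qed
  ultimately have "nash_on_open n U ?f" unfolding nash_on_open_def using an by blast
  moreover have "S \<subseteq> U" using S by (auto simp: U_def)
  ultimately show ?thesis unfolding nash_on_def using sa op by (intro exI[of _ U] exI[of _ ?f]) simp
qed

text \<open>In the direction from the closure to the regular image, irreducibility of
  \<open>S\<close> is used only in this form: the two conjugate Nash functions have product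
  zero.\<close>

lemma nash_irreducible_sqrt:
  assumes irr: "nash_irreducible n S" and pf: "poly_fun n p" "poly_fun n q" "poly_fun n D"
    and S: "S \<subseteq> Rn n" "\<And>x. x \<in> S \<Longrightarrow> 0 < D x" and eq: "\<And>x. x \<in> S \<Longrightarrow> (p x)\<^sup>2 = (q x)\<^sup>2 * D x"
  shows "(\<forall>x\<in>S. p x = q x * sqrt (D x)) \<or> (\<forall>x\<in>S. p x = - q x * sqrt (D x))"
proof -
  have 1: "nash_on n S (\<lambda>x. p x + q x * sqrt (D x))" by (rule nash_on_quadratic[OF pf S])
  have "poly_fun n (\<lambda>x. - q x)" by (intro poly_fun_intros pf)
  from nash_on_quadratic[OF pf(1) this pf(3) S]
  have 2: "nash_on n S (\<lambda>x. p x + - q x * sqrt (D x))" by simp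
  have "(p x + q x * sqrt (D x)) * (p x + - q x * sqrt (D x)) = 0" if "x \<in> S" for x
  proof -
    have "(p x + q x * sqrt (D x)) * (p x + - q x * sqrt (D x)) = (p x)\<^sup>2 - (q x)\<^sup>2 * (sqrt (D x))\<^sup>2"
      by (simp add: power2_eq_square algebra_simps)
    thus ?thesis using eq[OF that] S(2)[OF that] by simp
  qed
  with irr 1 2 have "(\<forall>x\<in>S. p x + q x * sqrt (D x) = 0) \<or> (\<forall>x\<in>S. p x + - q x * sqrt (D x) = 0)"
    unfolding nash_irreducible_def by blast
  thus ?thesis by (auto simp: algebra_simps eq_neg_iff_add_eq_0)
qed

section \<open>Dimension, cones and binary forms\<close>

definition emb1 :: "real \<Rightarrow> pt" where
  "emb1 t = (\<lambda>i. if i = 0 then t else 0)"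

definition emb2 :: "real \<Rightarrow> real \<Rightarrow> pt" where
  "emb2 s t = (\<lambda>i. if i = 0 then s else if i = 1 then t else 0)"

lemma emb1_Rn: "emb1 t \<in> Rn 1" by (simp add: emb1_def Rn_def)
lemma emb2_Rn: "emb2 s t \<in> Rn 2" by (simp add: emb2_def Rn_def)
lemma emb2_simps [simp]: "emb2 s t 0 = s" "emb2 s t (Suc 0) = t" "emb2 s t 1 = t" by (simp_all add: emb2_def)
lemma emb1_simps [simp]: "emb1 t 0 = t" by (simp add: emb1_def)

lemma Rn1_emb1: "x \<in> Rn 1 \<Longrightarrow> x = emb1 (x 0)"
  by (auto simp: emb1_def Rn_def fun_eq_iff)

lemma Rn2_emb2: "x \<in> Rn 2 \<Longrightarrow> x = emb2 (x 0) (x 1)"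
  by (auto simp: emb2_def Rn_def fun_eq_iff)

lemma emb2_eq_0_iff: "emb2 s t = (\<lambda>_. 0) \<longleftrightarrow> s = 0 \<and> t = 0"
proof
  assume "emb2 s t = (\<lambda>_. 0)"
  from fun_cong[OF this, of 0] fun_cong[OF this, of 1] show "s = 0 \<and> t = 0" by simp
qed (simp add: emb2_def fun_eq_iff)

lemma continuous_emb1: "continuous_on A emb1"
proof (rule continuous_on_coordinatewise_then_product)
  show "continuous_on A (\<lambda>x. emb1 x i)" for i
    by (cases "i = 0") (simp_all add: emb1_def)
qed

lemma continuous_emb2:
  assumes "continuous_on A f" "continuous_on A g"
  shows "continuous_on A (\<lambda>x. emb2 (f x) (g x))"
proof (rule continuous_on_coordinatewise_then_product)
  fix i :: nat
  consider "i = 0" | "i = 1" | "i \<noteq> 0" "i \<noteq> 1" by blast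
  thus "continuous_on A (\<lambda>x. emb2 (f x) (g x) i)"
    by cases (simp_all add: emb2_def assms)
qed

text \<open>Compactness of the interval makes the injective path a homeomorphism onto its image; the
  open interval inside it then gives the open domain that \<open>dim_ge\<close> asks for.\<close>

lemma contains_arc_imp_dim_ge:
  assumes "contains_arc X"
  shows "dim_ge X 1"
proof -
  obtain c a b where c: "a < b" "continuous_on {a..b} c" "inj_on c {a..b::real}" "c ` {a..b} \<subseteq> X"
    using assms unfolding contains_arc_def by blast
  from homeomorphism_compact[OF compact_Icc c(2) refl c(3)] obtain h where h: "homeomorphism {a..b} (c ` {a..b}) c h" ..
  define U where "U = {x \<in> Rn 1. a < x 0 \<and> x 0 < b}"
  have co: "continuous_on UNIV (\<lambda>x::pt. x 0)" by simp
  have "open {x::pt. a < x 0 \<and> x 0 < b}"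
    unfolding Collect_conj_eq by (intro open_Int open_Collect_less continuous_on_const co)
  moreover have "U = Rn 1 \<inter> {x. a < x 0 \<and> x 0 < b}" by (auto simp: U_def)
  ultimately have op: "openin (top_of_set (Rn 1)) U" by (simp add: openin_open_Int)
  have "emb1 ((a + b) / 2) \<in> U" using c(1) emb1_Rn by (auto simp: U_def)
  hence ne: "U \<noteq> {}" by blast
  have img: "(\<lambda>x. x 0) ` U \<subseteq> {a..b}" by (auto simp: U_def)
  define V where "V = (\<lambda>x. c (x 0)) ` U"
  have "homeomorphism U V (\<lambda>x. c (x 0)) (\<lambda>y. emb1 (h y))"
  proof (rule homeomorphismI)
    show "continuous_on U (\<lambda>x. c (x 0))"
      by (rule continuous_on_compose2[OF c(2) _ img]) (rule continuous_on_subset[OF co], simp)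
    have "V \<subseteq> c ` {a..b}" using img unfolding V_def by blast
    with homeomorphism_cont2[OF h] have hc: "continuous_on V h" by (rule continuous_on_subset)
    show "continuous_on V (\<lambda>y. emb1 (h y))"
      by (rule continuous_on_compose2[OF continuous_emb1[of UNIV] hc]) simp
    have inv: "h (c t) = t" if "t \<in> {a..b}" for t by (rule homeomorphism_apply1[OF h that])
    show e: "emb1 (h (c (x 0))) = x" if "x \<in> U" for x
    proof -
      have "x 0 \<in> {a..b}" using that img by blast
      hence "h (c (x 0)) = x 0" by (rule inv)
      moreover have "x \<in> Rn 1" using that by (simp add: U_def)
      ultimately show ?thesis using Rn1_emb1 by simp
    qed
    show "(\<lambda>x. c (x 0)) ` U \<subseteq> V" unfolding V_def by blast
    show "(\<lambda>y. emb1 (h y)) ` V \<subseteq> U" unfolding V_def using e by auto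
    show "c (emb1 (h y) 0) = y" if yV: "y \<in> V" for y
    proof -
      obtain x where "x \<in> U" "y = c (x 0)" using yV unfolding V_def by blast
      thus ?thesis using e by simp
    qed
  qed
  moreover have "V \<subseteq> X" using img c(4) unfolding V_def by blast
  ultimately show ?thesis unfolding dim_ge_def using op ne by blast
qed

lemma dim_ge_imp_contains_arc:
  assumes "dim_ge X 1"
  shows "contains_arc X"
proof -
  obtain U V g h where U: "openin (top_of_set (Rn 1)) U" "U \<noteq> {}" and V: "V \<subseteq> X" "homeomorphism U V g h"
    using assms unfolding dim_ge_def by blast
  obtain T where T: "open T" "U = Rn 1 \<inter> T" using U(1) unfolding openin_open by blast
  obtain u where u: "u \<in> U" using U(2) by blast
  have "open (emb1 -` T)" using continuous_emb1 T(1) by (intro open_vimage) auto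
  moreover have "u 0 \<in> emb1 -` T" using u T Rn1_emb1[of u] by auto
  ultimately obtain e where e: "0 < e" "cball (u 0) e \<subseteq> emb1 -` T" unfolding open_contains_cball by blast
  have sub: "emb1 ` {u 0 - e..u 0 + e} \<subseteq> U"
  proof
    fix y assume "y \<in> emb1 ` {u 0 - e..u 0 + e}"
    then obtain t where t: "y = emb1 t" "t \<in> {u 0 - e..u 0 + e}" by blast
    hence "t \<in> cball (u 0) e" by (auto simp: dist_real_def)
    thus "y \<in> U" using e T emb1_Rn t(1) by blast
  qed
  have g: "continuous_on U g" "inj_on g U" "g ` U = V"
    using homeomorphism_cont1[OF V(2)] homeomorphism_image1[OF V(2)] homeomorphism_apply1[OF V(2)]
    by (auto intro: inj_on_inverseI[of _ h])
  show ?thesis unfolding contains_arc_def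
  proof (intro exI conjI)
    show "u 0 - e < u 0 + e" using e by simp
    show "continuous_on {u 0 - e..u 0 + e} (\<lambda>t. g (emb1 t))"
      by (rule continuous_on_compose2[OF g(1) continuous_emb1 sub])
    show "inj_on (\<lambda>t. g (emb1 t)) {u 0 - e..u 0 + e}"
    proof (rule inj_onI)
      fix s t assume st: "s \<in> {u 0 - e..u 0 + e}" "t \<in> {u 0 - e..u 0 + e}" "g (emb1 s) = g (emb1 t)"
      hence "emb1 s = emb1 t" using inj_onD[OF g(2)] sub by blast
      from fun_cong[OF this, of 0] show "s = t" by simp
    qed
    show "(\<lambda>t. g (emb1 t)) ` {u 0 - e..u 0 + e} \<subseteq> X" using sub g(3) V(1) by blast
  qed
qed

lemma contains_arc_infinite:
  assumes "contains_arc X" "finite X" shows False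
proof -
  obtain c a b where c: "a < b" "inj_on c {a..b::real}" "c ` {a..b} \<subseteq> X"
    using assms unfolding contains_arc_def by blast
  hence "finite {a..b}" using assms(2) finite_imageD finite_subset by metis
  thus False using c(1) infinite_Icc by blast
qed

lemma subarc_in_open:
  assumes c: "a < b" "continuous_on {a..b} c" "inj_on c {a..b::real}" and t0: "t0 \<in> {a<..<b}"
    and V: "open V" "c t0 \<in> V" and X: "\<And>t. t \<in> {a..b} \<Longrightarrow> c t \<in> X"
  shows "contains_arc (X \<inter> V)"
proof -
  have "isCont c t0" using t0 by (intro continuous_on_interior[OF c(2)]) auto
  hence "eventually (\<lambda>t. c t \<in> V) (at t0)"
    using V topological_tendstoD unfolding isCont_def by blast
  then obtain e where e: "0 < e" "\<forall>t. t \<noteq> t0 \<and> dist t t0 < e \<longrightarrow> c t \<in> V"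
    unfolding eventually_at by auto
  define r where "r = min (e / 2) (min (t0 - a) (b - t0))"
  have r: "0 < r" using e t0 by (simp add: r_def)
  have sub: "{t0 - r..t0 + r} \<subseteq> {a..b}" by (auto simp: r_def)
  show ?thesis unfolding contains_arc_def
  proof (intro exI conjI)
    show "t0 - r < t0 + r" using r by simp
    show "continuous_on {t0 - r..t0 + r} c" by (rule continuous_on_subset[OF c(2) sub])
    show "inj_on c {t0 - r..t0 + r}" by (rule inj_on_subset[OF c(3) sub])
    show "c ` {t0 - r..t0 + r} \<subseteq> X \<inter> V"
    proof (rule image_subsetI)
      fix t assume t: "t \<in> {t0 - r..t0 + r}"
      hence "\<bar>t - t0\<bar> \<le> r" by auto
      hence "dist t t0 < e" using e(1) by (simp add: dist_real_def r_def)
      hence "c t \<in> V" using e(2) V(2) by (cases "t = t0") auto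
      moreover have "c t \<in> X" using X sub t by blast
      ultimately show "c t \<in> X \<inter> V" by simp
    qed
  qed
qed

lemma dim_ge_2I:
  fixes a b c d :: real and f :: "real \<times> real \<Rightarrow> pt"
  assumes ab: "a < b" "c < d" and f: "continuous_on ({a..b} \<times> {c..d}) f" "inj_on f ({a..b} \<times> {c..d})"
    and X: "f ` ({a..b} \<times> {c..d}) \<subseteq> X"
  shows "dim_ge X 2"
proof -
  let ?Q = "{a..b} \<times> {c..d::real}"
  have "compact ?Q" by (intro compact_Times compact_Icc)
  from homeomorphism_compact[OF this f(1) refl f(2)] obtain h where h: "homeomorphism ?Q (f ` ?Q) f h" ..
  define U where "U = {x \<in> Rn 2. a < x 0 \<and> x 0 < b \<and> c < x 1 \<and> x 1 < d}"
  let ?\<pi> = "\<lambda>x::pt. (x 0, x 1)"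
  have co: "continuous_on UNIV (\<lambda>x::pt. x i)" for i by simp
  have "open {x::pt. a < x 0 \<and> x 0 < b \<and> c < x 1 \<and> x 1 < d}"
    unfolding Collect_conj_eq by (intro open_Int open_Collect_less continuous_on_const co)
  moreover have "U = Rn 2 \<inter> {x. a < x 0 \<and> x 0 < b \<and> c < x 1 \<and> x 1 < d}" by (auto simp: U_def)
  ultimately have op: "openin (top_of_set (Rn 2)) U" by (simp add: openin_open_Int)
  have "emb2 ((a + b) / 2) ((c + d) / 2) \<in> U" using ab emb2_Rn by (auto simp: U_def)
  hence ne: "U \<noteq> {}" by blast
  have img: "?\<pi> ` U \<subseteq> ?Q" by (auto simp: U_def)
  define V where "V = (\<lambda>x. f (x 0, x 1)) ` U"
  have "homeomorphism U V (\<lambda>x. f (x 0, x 1)) (\<lambda>y. emb2 (fst (h y)) (snd (h y)))"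
  proof (rule homeomorphismI)
    have "continuous_on U ?\<pi>" by (intro continuous_on_Pair continuous_on_subset[OF co]) auto
    thus "continuous_on U (\<lambda>x. f (x 0, x 1))"
      by (rule continuous_on_compose2[OF f(1) _ img])
    have "V \<subseteq> f ` ?Q" using img unfolding V_def by blast
    with homeomorphism_cont2[OF h] have hc: "continuous_on V h" by (rule continuous_on_subset)
    show "continuous_on V (\<lambda>y. emb2 (fst (h y)) (snd (h y)))"
      by (intro continuous_emb2 continuous_on_fst continuous_on_snd hc)
    show e: "emb2 (fst (h (f (x 0, x 1)))) (snd (h (f (x 0, x 1)))) = x" if "x \<in> U" for x
    proof -
      have "(x 0, x 1) \<in> ?Q" using that img by blast
      from homeomorphism_apply1[OF h this] have "h (f (x 0, x 1)) = (x 0, x 1)" .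
      moreover have "x \<in> Rn 2" using that by (simp add: U_def)
      ultimately show ?thesis using Rn2_emb2[of x] by simp
    qed
    show "(\<lambda>x. f (x 0, x 1)) ` U \<subseteq> V" unfolding V_def by blast
    show "(\<lambda>y. emb2 (fst (h y)) (snd (h y))) ` V \<subseteq> U" unfolding V_def using e by auto
    show "f (emb2 (fst (h y)) (snd (h y)) 0, emb2 (fst (h y)) (snd (h y)) 1) = y" if yV: "y \<in> V" for y
    proof -
      obtain x where "x \<in> U" "y = f (x 0, x 1)" using yV unfolding V_def by blast
      thus ?thesis by (simp only: e)
    qed
  qed
  moreover have "V \<subseteq> X" using img X unfolding V_def by blast
  ultimately show ?thesis unfolding dim_ge_def using op ne by blast
qed

lemma homog_polyD:
  assumes "homog_poly k d p"
  shows "poly_fun k p" "x \<in> Rn k \<Longrightarrow> p (\<lambda>i. t * x i) = t ^ d * p x"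
  using assms unfolding homog_poly_def by blast+

lemma sqnorm_nonneg: "0 \<le> sqnorm k y"
  unfolding sqnorm_def by (simp add: sum_nonneg)

lemma sqnorm_pos: "y \<in> Rn k \<Longrightarrow> y \<noteq> (\<lambda>_. 0) \<Longrightarrow> 0 < sqnorm k y"
proof -
  assume y: "y \<in> Rn k" "y \<noteq> (\<lambda>_. 0)"
  then obtain i where i: "y i \<noteq> 0" by auto
  hence "i < k" using y(1) by (simp add: Rn_def) (metis not_le)
  hence "(y i)\<^sup>2 \<le> sqnorm k y" unfolding sqnorm_def by (intro member_le_sum) auto
  moreover have "0 < (y i)\<^sup>2" using i by simp
  ultimately show ?thesis by linarith
qed

lemma sqnorm_scale: "sqnorm k (\<lambda>i. t * y i) = t\<^sup>2 * sqnorm k y"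
  by (simp add: sqnorm_def power_mult_distrib sum_distrib_left)

lemma Rn_scale: "y \<in> Rn k \<Longrightarrow> (\<lambda>i. t * y i) \<in> Rn k"
  by (simp add: Rn_def)

lemma poly_fun_sqnorm: "poly_fun k (sqnorm k)"
proof -
  have "poly_fun k (\<lambda>x. \<Sum>i<k. (x i)\<^sup>2)" by (intro poly_fun_intros) simp
  thus ?thesis by (simp add: sqnorm_def[abs_def])
qed

lemma normalize_pt_scale: "normalize_pt k y = (\<lambda>i. (1 / sqrt (sqnorm k y)) * y i)"
  by (simp add: normalize_pt_def fun_eq_iff)

lemma sqnorm_normalize: "0 < sqnorm k y \<Longrightarrow> sqnorm k (normalize_pt k y) = 1"
  unfolding normalize_pt_scale sqnorm_scale by (simp add: power_divide)

lemma continuous_normalize: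
  assumes "continuous_on A f" "\<And>x. x \<in> A \<Longrightarrow> 0 < sqnorm k (f x)"
  shows "continuous_on A (\<lambda>x. normalize_pt k (f x))"
proof (rule continuous_on_coordinatewise_then_product)
  fix i
  have c: "continuous_on A (\<lambda>x. sqnorm k (f x))"
    by (rule continuous_on_compose2[OF poly_fun_continuous[OF poly_fun_sqnorm, of UNIV] assms(1)]) simp
  have "continuous_on A (\<lambda>x. f x i)" by (rule continuous_on_product_then_coordinatewise[OF assms(1)])
  thus "continuous_on A (\<lambda>x. normalize_pt k (f x) i)"
    unfolding normalize_pt_def using assms(2) by (intro continuous_intros c) force+
qed

lemma hom_emb_simps [simp]: "hom_emb m x 0 = 1" "i < m \<Longrightarrow> hom_emb m x (Suc i) = x i"
  by (simp_all add: hom_emb_def)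

lemma hom_emb_Rn: "hom_emb m x \<in> Rn (Suc m)"
  by (simp add: hom_emb_def Rn_def)

lemma hom_emb_pos: "0 < sqnorm (Suc m) (hom_emb m x)"
proof -
  have "hom_emb m x \<noteq> (\<lambda>_. 0)" by (metis hom_emb_simps(1) zero_neq_one)
  thus ?thesis by (rule sqnorm_pos[OF hom_emb_Rn])
qed

lemma continuous_hom_emb: "continuous_on A (hom_emb m)"
proof (rule continuous_on_coordinatewise_then_product)
  fix i
  show "continuous_on A (\<lambda>x. hom_emb m x i)"
  proof (cases "i \<noteq> 0 \<and> i \<le> m")
    case True
    thus ?thesis unfolding hom_emb_def
      by (simp add: continuous_on_subset[OF continuous_on_product_coordinates])
  next
    case False
    hence "(\<lambda>x. hom_emb m x i) = (\<lambda>x. if i = 0 then 1 else 0)" by (auto simp: hom_emb_def fun_eq_iff)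
    thus ?thesis by (simp only: continuous_on_const)
  qed
qed

lemma poly_fun_hom_emb:
  assumes "poly_fun (Suc m) p"
  shows "poly_fun m (\<lambda>x. p (hom_emb m x))"
proof -
  have "poly_fun m (\<lambda>x. p (\<lambda>i. hom_emb m x i))"
  proof (rule poly_fun_compose[OF assms])
    fix i assume "i < Suc m"
    show "poly_fun m (\<lambda>x. hom_emb m x i)"
    proof (cases i)
      case 0 thus ?thesis by (simp add: pf_const)
    next
      case (Suc j)
      thus ?thesis using \<open>i < Suc m\<close> by (simp add: hom_emb_def pf_var)
    qed
  qed
  thus ?thesis by simp
qed

text \<open>The unit representative of an affine point in the hemisphere where coordinate 0 is
  positive; dimensions of projective sets are measured on the sphere.\<close>

definition nrm :: "nat \<Rightarrow> pt \<Rightarrow> pt" where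
  "nrm m x = normalize_pt (Suc m) (hom_emb m x)"

lemma continuous_nrm: "continuous_on A (nrm m)"
proof -
  have "continuous_on A (\<lambda>x. normalize_pt (Suc m) (hom_emb m x))"
    by (rule continuous_normalize[OF continuous_hom_emb hom_emb_pos])
  thus ?thesis by (simp add: nrm_def[abs_def])
qed

lemma parallel_hom_emb:
  assumes "x \<in> Rn m" "y \<in> Rn m" "(\<lambda>i. c * hom_emb m x i) = (\<lambda>i. e * hom_emb m y i)" "c \<noteq> 0"
  shows "x = y" "c = e"
proof -
  show ce: "c = e" using fun_cong[OF assms(3), of 0] by simp
  show "x = y"
  proof
    fix i show "x i = y i"
    proof (cases "i < m")
      case True
      thus ?thesis using fun_cong[OF assms(3), of "Suc i"] ce assms(4) by simp
    next
      case False thus ?thesis using assms by (simp add: Rn_def)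
    qed
  qed
qed

lemma nrm_inj: "x \<in> Rn m \<Longrightarrow> y \<in> Rn m \<Longrightarrow> nrm m x = nrm m y \<Longrightarrow> x = y"
proof -
  assume *: "x \<in> Rn m" "y \<in> Rn m" "nrm m x = nrm m y"
  have "1 / sqrt (sqnorm (Suc m) (hom_emb m x)) \<noteq> 0" using hom_emb_pos[of m x] by simp
  thus "x = y" using parallel_hom_emb(1)[OF *(1,2)] *(3) unfolding nrm_def normalize_pt_scale by blast
qed

section \<open>Projective curves parametrized by binary forms\<close>

locale binary_forms =
  fixes k d :: nat and \<phi> :: "nat \<Rightarrow> pt \<Rightarrow> real"
  assumes hom: "\<forall>i<k. homog_poly 2 d (\<phi> i)"
    and nz: "\<forall>z\<in>Rn 2. z \<noteq> (\<lambda>_. 0) \<longrightarrow> (\<exists>i<k. \<phi> i z \<noteq> 0)"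
begin

definition \<Phi> :: "pt \<Rightarrow> pt" where
  "\<Phi> z = (\<lambda>i. if i < k then \<phi> i z else 0)"

definition cone :: "pt set" where
  "cone = {y. \<exists>c z. c \<noteq> 0 \<and> z \<in> Rn 2 \<and> z \<noteq> (\<lambda>_. 0) \<and> y = (\<lambda>i. c * \<Phi> z i)}"

lemma pf: "i < k \<Longrightarrow> poly_fun 2 (\<phi> i)"
  using hom homog_polyD(1) by blast

lemma \<Phi>_Rn: "\<Phi> z \<in> Rn k" by (simp add: \<Phi>_def Rn_def)

lemma \<Phi>_nz: "z \<in> Rn 2 \<Longrightarrow> z \<noteq> (\<lambda>_. 0) \<Longrightarrow> \<Phi> z \<noteq> (\<lambda>_. 0)"
proof
  assume z: "z \<in> Rn 2" "z \<noteq> (\<lambda>_. 0)" and 0: "\<Phi> z = (\<lambda>_. 0)"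
  then obtain i where "i < k" "\<phi> i z \<noteq> 0" using nz by blast
  thus False using fun_cong[OF 0, of i] by (simp add: \<Phi>_def)
qed

lemma \<Phi>_pos: "z \<in> Rn 2 \<Longrightarrow> z \<noteq> (\<lambda>_. 0) \<Longrightarrow> 0 < sqnorm k (\<Phi> z)"
  by (rule sqnorm_pos[OF \<Phi>_Rn \<Phi>_nz])

lemma \<Phi>_scale: "z \<in> Rn 2 \<Longrightarrow> \<Phi> (\<lambda>i. t * z i) = (\<lambda>i. t ^ d * \<Phi> z i)"
  using hom homog_polyD(2) by (auto simp: \<Phi>_def fun_eq_iff)

lemma continuous_\<Phi>: "continuous_on A f \<Longrightarrow> continuous_on A (\<lambda>x. \<Phi> (f x))"
proof (rule continuous_on_coordinatewise_then_product)
  fix i assume f: "continuous_on A f"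
  show "continuous_on A (\<lambda>x. \<Phi> (f x) i)"
  proof (cases "i < k")
    case True
    thus ?thesis unfolding \<Phi>_def
      using continuous_on_compose2[OF poly_fun_continuous[OF pf[OF True], of UNIV] f] by simp
  qed (simp add: \<Phi>_def)
qed

lemma cone_Rn: "y \<in> cone \<Longrightarrow> y \<in> Rn k"
  unfolding cone_def using Rn_scale[OF \<Phi>_Rn] by blast

lemma cone_scale: "y \<in> cone \<Longrightarrow> t \<noteq> 0 \<Longrightarrow> (\<lambda>i. t * y i) \<in> cone"
proof -
  assume "y \<in> cone" "t \<noteq> 0"
  then obtain c z where "c \<noteq> 0" "z \<in> Rn 2" "z \<noteq> (\<lambda>_. 0)" "y = (\<lambda>i. c * \<Phi> z i)" unfolding cone_def by blast
  thus ?thesis unfolding cone_def using \<open>t \<noteq> 0\<close>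
    by (intro CollectI exI[of _ "t * c"] exI[of _ z]) (simp add: mult.assoc)
qed

text \<open>The section is the normalized image of the unit circle together with its negative. Both
  signs are taken since for even \<open>d\<close> opposite points of the circle have the same image,
  whereas the section contains both unit representatives.\<close>

lemma compact_cone_section: "compact (sph_sec k cone)"
proof -
  define f where "f = (\<lambda>s \<theta>. (\<lambda>i. s * normalize_pt k (\<Phi> (emb2 (cos \<theta>) (sin \<theta>))) i))"
  have z: "emb2 (cos \<theta>) (sin \<theta>) \<in> Rn 2" "emb2 (cos \<theta>) (sin \<theta>) \<noteq> (\<lambda>_. 0)" for \<theta>
    using sin_zero_abs_cos_one[of \<theta>] by (auto simp: emb2_Rn emb2_eq_0_iff)
  have cf: "compact (f s ` {0..2*pi})" for s
  proof (rule compact_continuous_image[OF _ compact_Icc])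
    have c: "continuous_on {0..2*pi} (\<lambda>\<theta>. normalize_pt k (\<Phi> (emb2 (cos \<theta>) (sin \<theta>))))"
      by (intro continuous_normalize continuous_\<Phi> continuous_emb2 \<Phi>_pos z continuous_intros)
    show "continuous_on {0..2*pi} (f s)" unfolding f_def
      by (rule continuous_on_coordinatewise_then_product)
        (intro continuous_intros continuous_on_product_then_coordinatewise[OF c])
  qed
  have "sph_sec k cone = f 1 ` {0..2*pi} \<union> f (-1) ` {0..2*pi}"
  proof (rule set_eqI, rule iffI)
    fix y assume "y \<in> sph_sec k cone"
    then obtain c w where y: "c \<noteq> 0" "w \<in> Rn 2" "w \<noteq> (\<lambda>_. 0)" "y = (\<lambda>i. c * \<Phi> w i)" "sqnorm k y = 1"
      unfolding sph_sec_def cone_def by blast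
    define r where "r = sqrt ((w 0)\<^sup>2 + (w 1)\<^sup>2)"
    have "w 0 \<noteq> 0 \<or> w 1 \<noteq> 0" using y(2,3) Rn2_emb2[of w] emb2_eq_0_iff[of "w 0" "w 1"] by auto
    hence "0 < (w 0)\<^sup>2 + (w 1)\<^sup>2" by (simp add: sum_power2_gt_zero_iff)
    hence r: "0 < r" "r\<^sup>2 = (w 0)\<^sup>2 + (w 1)\<^sup>2" by (simp_all add: r_def)
    have "(w 0 / r)\<^sup>2 + (w 1 / r)\<^sup>2 = ((w 0)\<^sup>2 + (w 1)\<^sup>2) / r\<^sup>2"
      by (simp add: power_divide add_divide_distrib)
    also have "\<dots> = 1" unfolding r(2)[symmetric] using r(1) by simp
    finally have "(w 0 / r)\<^sup>2 + (w 1 / r)\<^sup>2 = 1" .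
    then obtain \<theta> where \<theta>: "0 \<le> \<theta>" "\<theta> < 2*pi" "w 0 / r = cos \<theta>" "w 1 / r = sin \<theta>"
      using sincos_total_2pi by metis
    have "w 0 = r * cos \<theta>" "w 1 = r * sin \<theta>" using \<theta>(3,4) r(1) by (simp_all add: field_simps)
    hence "emb2 (w 0) (w 1) = (\<lambda>i. r * emb2 (cos \<theta>) (sin \<theta>) i)"
      by (auto simp: emb2_def fun_eq_iff)
    with Rn2_emb2[OF y(2)] have weq: "w = (\<lambda>i. r * emb2 (cos \<theta>) (sin \<theta>) i)" by (rule trans)
    have \<Phi>w: "\<Phi> w = (\<lambda>i. r ^ d * \<Phi> (emb2 (cos \<theta>) (sin \<theta>)) i)"
      by (subst weq) (rule \<Phi>_scale[OF z(1)])
    define q where "q = \<Phi> (emb2 (cos \<theta>) (sin \<theta>))"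
    define e where "e = c * r ^ d"
    have e: "y = (\<lambda>i. e * q i)" by (simp add: y(4) \<Phi>w q_def e_def mult.assoc)
    have qp: "0 < sqnorm k q" unfolding q_def by (rule \<Phi>_pos[OF z])
    have "e\<^sup>2 * sqnorm k q = 1" using y(5) unfolding e sqnorm_scale .
    hence "(e * sqrt (sqnorm k q))\<^sup>2 = 1\<^sup>2" using qp by (simp add: power_mult_distrib)
    hence "e * sqrt (sqnorm k q) = 1 \<or> e * sqrt (sqnorm k q) = -1" by (simp only: power2_eq_iff)
    hence "e = 1 / sqrt (sqnorm k q) \<or> e = -1 / sqrt (sqnorm k q)" using qp by (auto simp: field_simps)
    moreover have "f s \<theta> = (\<lambda>i. (s / sqrt (sqnorm k q)) * q i)" for s
      by (simp add: f_def normalize_pt_scale q_def)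
    ultimately have "y = f 1 \<theta> \<or> y = f (-1) \<theta>" unfolding e by metis
    thus "y \<in> f 1 ` {0..2*pi} \<union> f (-1) ` {0..2*pi}" using \<theta>(1,2) by auto
  next
    fix y assume "y \<in> f 1 ` {0..2*pi} \<union> f (-1) ` {0..2*pi}"
    then obtain s \<theta> where y: "y = f s \<theta>" "s = 1 \<or> s = -1" by blast
    let ?q = "\<Phi> (emb2 (cos \<theta>) (sin \<theta>))"
    have qp: "0 < sqnorm k ?q" by (rule \<Phi>_pos[OF z])
    have e: "y = (\<lambda>i. (s / sqrt (sqnorm k ?q)) * ?q i)" by (simp add: y(1) f_def normalize_pt_scale)
    have "s / sqrt (sqnorm k ?q) \<noteq> 0" using y(2) qp by auto
    hence "y \<in> cone" unfolding cone_def e using z by blast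
    moreover have "sqnorm k y = 1" unfolding e sqnorm_scale using y(2) qp by (auto simp: power_divide)
    ultimately show "y \<in> sph_sec k cone" by (simp add: sph_sec_def)
  qed
  thus ?thesis using compact_Un[OF cf cf] by simp
qed

lemma cone_iff_normalize:
  assumes "y \<in> Rn k" "y \<noteq> (\<lambda>_. 0)"
  shows "normalize_pt k y \<in> sph_sec k cone \<longleftrightarrow> y \<in> cone"
proof
  have p: "0 < sqnorm k y" by (rule sqnorm_pos[OF assms])
  assume "normalize_pt k y \<in> sph_sec k cone"
  hence "normalize_pt k y \<in> cone" by (simp add: sph_sec_def)
  from cone_scale[OF this, of "sqrt (sqnorm k y)"] p
  show "y \<in> cone" by (simp add: normalize_pt_def)
next
  have p: "0 < sqnorm k y" by (rule sqnorm_pos[OF assms])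
  assume "y \<in> cone"
  hence "normalize_pt k y \<in> cone" unfolding normalize_pt_scale using p by (intro cone_scale) auto
  thus "normalize_pt k y \<in> sph_sec k cone" using sqnorm_normalize[OF p] by (simp add: sph_sec_def)
qed

end

section \<open>Elementary properties of the projective Zariski closure\<close>

lemma zar_closure_contains:
  "x \<in> S \<Longrightarrow> hom_emb m x \<in> zar_closure_proj m S"
proof -
  assume "x \<in> S"
  moreover have "hom_emb m x \<noteq> (\<lambda>_. 0)" by (metis hom_emb_simps(1) zero_neq_one)
  ultimately show ?thesis unfolding zar_closure_proj_def using hom_emb_Rn by blast
qed

lemma zar_closure_scale:
  assumes "y \<in> zar_closure_proj m S" "t \<noteq> 0"
  shows "(\<lambda>i. t * y i) \<in> zar_closure_proj m S"
proof -
  have y: "y \<in> Rn (Suc m)" "y \<noteq> (\<lambda>_. 0)"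
    "\<forall>p d. homog_poly (Suc m) d p \<and> (\<forall>x\<in>S. p (hom_emb m x) = 0) \<longrightarrow> p y = 0"
    using assms(1) unfolding zar_closure_proj_def by blast+
  have "(\<lambda>i. t * y i) \<noteq> (\<lambda>_. 0)" using y(2) assms(2) by (auto simp: fun_eq_iff)
  moreover have "p (\<lambda>i. t * y i) = 0" if p: "homog_poly (Suc m) d p" "\<forall>x\<in>S. p (hom_emb m x) = 0" for p d
  proof -
    have "p y = 0" using y(3) p by blast
    thus ?thesis using homog_polyD(2)[OF p(1) y(1)] by simp
  qed
  ultimately show ?thesis unfolding zar_closure_proj_def using Rn_scale[OF y(1)] by blast
qed

lemma nrm_in_section: "x \<in> S \<Longrightarrow> nrm m x \<in> sph_sec (Suc m) (zar_closure_proj m S)"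
proof -
  assume "x \<in> S"
  have "nrm m x \<in> zar_closure_proj m S" unfolding nrm_def normalize_pt_scale
    using hom_emb_pos[of m x] by (intro zar_closure_scale zar_closure_contains \<open>x \<in> S\<close>) simp
  thus ?thesis unfolding sph_sec_def nrm_def using sqnorm_normalize[OF hom_emb_pos] by blast
qed

section \<open>Compact irreducible sets on a rational curve\<close>

lemma poly_eq_cofinite:
  fixes p q :: "real poly"
  assumes "\<And>x. x \<noteq> 0 \<Longrightarrow> poly p x = poly q x"
  shows "p = q"
proof -
  have "poly ([:0, 1:] * (p - q)) x = 0" for x
    using assms[of x] by (cases "x = 0") simp_all
  hence "[:0, 1:] * (p - q) = 0" using poly_all_0_iff_0 by blast
  thus ?thesis by simp
qed

text \<open>By homogeneity \<open>P t = t ^ d * Q (1 / t)\<close>, where \<open>Q\<close> is the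
  form on the reversed line \<open>v + s u\<close>. Rewritten with \<open>reflect_poly\<close> this
  is a polynomial identity, from which the degree bound and the top coefficient \<open>Q 0\<close>,
  the value at the point at infinity, are read off.\<close>

lemma binary_form_on_line:
  assumes \<psi>: "homog_poly 2 d \<psi>" and uv: "u \<in> Rn 2" "v \<in> Rn 2"
  shows "\<exists>P::real poly. (\<forall>t. poly P t = \<psi> (\<lambda>i. u i + t * v i)) \<and> degree P \<le> d \<and> coeff P d = \<psi> v"
proof -
  have line: "\<exists>P::real poly. \<forall>t. poly P t = \<psi> (\<lambda>i. u i + t * v i)" for u v
  proof -
    obtain R where R: "\<forall>t. \<psi> (\<lambda>i. poly [:u i, v i:] t) = poly R t"
      using poly_fun_compose_poly[OF homog_polyD(1)[OF \<psi>], of "\<lambda>i. [:u i, v i:]"] by blast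
    thus ?thesis by (intro exI[of _ R]) simp
  qed
  obtain P where P: "\<forall>t. poly P t = \<psi> (\<lambda>i. u i + t * v i)" using line by blast
  obtain Q where Q: "\<forall>s. poly Q s = \<psi> (\<lambda>i. v i + s * u i)" using line by blast
  have PQ: "poly P t = t ^ d * poly Q (inverse t)" if "t \<noteq> 0" for t
  proof -
    have "(\<lambda>i. u i + t * v i) = (\<lambda>i. t * (v i + inverse t * u i))"
    proof
      fix i
      have "t * (inverse t * u i) = u i" using that by (simp flip: mult.assoc)
      thus "u i + t * v i = t * (v i + inverse t * u i)" by (simp add: distrib_left)
    qed
    moreover have "(\<lambda>i. v i + inverse t * u i) \<in> Rn 2" using uv by (simp add: Rn_def)
    ultimately have "\<psi> (\<lambda>i. u i + t * v i) = t ^ d * \<psi> (\<lambda>i. v i + inverse t * u i)"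
      using homog_polyD(2)[OF \<psi>, of "\<lambda>i. v i + inverse t * u i" t] by simp
    thus ?thesis by (simp only: P Q)
  qed
  define N where "N = degree Q"
  have eq: "monom 1 N * P = monom 1 d * reflect_poly Q"
  proof (rule poly_eq_cofinite)
    fix t :: real assume t: "t \<noteq> 0"
    show "poly (monom 1 N * P) t = poly (monom 1 d * reflect_poly Q) t"
      using PQ[OF t] poly_reflect_poly_nz[OF t, of Q] by (simp add: poly_monom N_def)
  qed
  have c: "coeff P n = (if d \<le> n + N then coeff (reflect_poly Q) (n + N - d) else 0)" for n
  proof -
    have "coeff (monom 1 N * P) (n + N) = coeff P n" by (simp add: coeff_monom_mult)
    thus ?thesis unfolding eq by (auto simp: coeff_monom_mult not_le split: if_splits)
  qed
  have "coeff P n = 0" if "d < n" for n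
    unfolding c using that by (simp add: coeff_reflect_poly N_def)
  hence "degree P \<le> d" by (intro degree_le) auto
  moreover have "coeff P d = \<psi> v"
  proof -
    have "coeff P d = coeff Q 0" unfolding c by (simp add: coeff_reflect_poly N_def)
    also have "\<dots> = poly Q 0" by (simp add: poly_0_coeff_0)
    also have "\<dots> = \<psi> v" using Q by simp
    finally show ?thesis .
  qed
  ultimately show ?thesis using P by blast
qed

lemma coeff_mult_top:
  fixes p q :: "real poly"
  assumes "degree p \<le> d" "degree q \<le> e"
  shows "coeff (p * q) (d + e) = coeff p d * coeff q e"
proof -
  have "coeff (p * q) (d + e) = (\<Sum>i\<le>d + e. if i = d then coeff p d * coeff q e else 0)"
    unfolding coeff_mult
  proof (rule sum.cong)
    fix i assume "i \<in> {..d + e}"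
    consider "i < d" | "i = d" | "d < i" by linarith
    thus "coeff p i * coeff q (d + e - i) = (if i = d then coeff p d * coeff q e else 0)"
    proof cases
      case 1 thus ?thesis using assms(2) by (simp add: coeff_eq_0)
    next
      case 3 thus ?thesis using assms(1) by (simp add: coeff_eq_0)
    qed simp
  qed simp
  thus ?thesis by simp
qed

text \<open>The roots in \<open>X\<close> are moved one by one into \<open>Q2\<close>, and what is
  left is \<open>Q1\<close>. Multiplying the Bezout relation of the smaller factorization by one
  between \<open>Q1\<close> and the new linear factor keeps the factors coprime.\<close>

lemma split_roots:
  fixes Q :: "real poly"
  assumes "Q \<noteq> 0"
  shows "\<exists>Q1 Q2 u v. Q = Q1 * Q2 \<and> (\<forall>r\<in>X. poly Q1 r \<noteq> 0) \<and> (\<forall>r. r \<notin> X \<longrightarrow> poly Q2 r \<noteq> 0) \<and> u * Q1 + v * Q2 = 1"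
  using assms
proof (induction "degree Q" arbitrary: Q rule: less_induct)
  case less
  show ?case
  proof (cases "\<exists>r\<in>X. poly Q r = 0")
    case False
    thus ?thesis by (intro exI[of _ Q] exI[of _ 1] exI[of _ 0]) auto
  next
    case True
    then obtain r where r: "r \<in> X" "poly Q r = 0" by blast
    then obtain Q' where Q': "Q = [:- r, 1:] * Q'" using poly_eq_0_iff_dvd by (metis dvdE)
    have "Q' \<noteq> 0" using less.prems Q' by auto
    hence "degree ([:- r, 1:] * Q') = degree [:- r, 1:] + degree Q'" by (intro degree_mult_eq) auto
    hence "degree Q' < degree Q" unfolding Q' by simp
    from less.hyps[OF this \<open>Q' \<noteq> 0\<close>] obtain Q1 Q2 u v where
      *: "Q' = Q1 * Q2 \<and> (\<forall>r\<in>X. poly Q1 r \<noteq> 0) \<and> (\<forall>r. r \<notin> X \<longrightarrow> poly Q2 r \<noteq> 0) \<and> u * Q1 + v * Q2 = 1"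
      by (elim exE)
    define c where "c = poly Q1 r"
    have c: "c \<noteq> 0" using * r by (simp add: c_def)
    have "poly (Q1 - [:c:]) r = 0" by (simp add: c_def)
    then obtain w where w: "Q1 - [:c:] = [:- r, 1:] * w" using poly_eq_0_iff_dvd by (metis dvdE)
    define l where "l = [:- r, 1:]"
    define \<kappa> where "\<kappa> = [:1/c:]"
    have 1: "\<kappa> * Q1 - \<kappa> * w * l = 1"
    proof -
      have "\<kappa> * Q1 - \<kappa> * w * l = \<kappa> * (Q1 - l * w)" by (simp add: algebra_simps)
      also have "Q1 - l * w = [:c:]" using w by (simp add: l_def algebra_simps)
      also have "\<kappa> * [:c:] = 1" using c by (simp add: \<kappa>_def one_pCons)
      finally show ?thesis .
    qed
    have "(u * Q1 + v * Q2) * (\<kappa> * Q1 - \<kappa> * w * l) = 1" using * 1 by simp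
    hence f1: "(u * (\<kappa> * Q1 - \<kappa> * w * l) + v * Q2 * \<kappa>) * Q1 + (- (v * \<kappa> * w)) * (l * Q2) = 1"
      by (simp add: algebra_simps)
    have f2: "Q = Q1 * (l * Q2)" using * by (simp only: Q' l_def mult_ac)
    have f3: "\<forall>s. s \<notin> X \<longrightarrow> poly (l * Q2) s \<noteq> 0"
      using * r by (auto simp: l_def)
    have f4: "\<forall>r\<in>X. poly Q1 r \<noteq> 0" using * by blast
    show ?thesis
      by (rule exI[of _ Q1], rule exI[of _ "l * Q2"],
          rule exI[of _ "u * (\<kappa> * Q1 - \<kappa> * w * l) + v * Q2 * \<kappa>"], rule exI[of _ "- (v * \<kappa> * w)"])
        (intro conjI f1 f2 f3 f4)
  qed
qed

lemma weierstrass_poly: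
  assumes "compact K" "continuous_on K (f :: real \<Rightarrow> real)" "0 < e"
  shows "\<exists>p::real poly. \<forall>x\<in>K. \<bar>f x - poly p x\<bar> < e"
proof -
  obtain g where g: "real_polynomial_function g" "\<And>x. x \<in> K \<Longrightarrow> \<bar>f x - g x\<bar> < e"
    using Stone_Weierstrass_real_polynomial_function[OF assms] by blast
  then obtain a n where "g = (\<lambda>x. \<Sum>i\<le>n. a i * x ^ i)" using real_polynomial_function_iff_sum by blast
  hence "poly (\<Sum>i\<le>n. monom (a i) i) x = g x" for x by (simp add: poly_sum poly_monom)
  thus ?thesis using g(2) by (intro exI[of _ "\<Sum>i\<le>n. monom (a i) i"]) simp
qed

text \<open>With \<open>Q = Q1 * Q2\<close> and \<open>u * Q1 + v * Q2 = 1\<close>, the polynomial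
  \<open>u * Q1\<close> is 0 modulo \<open>Q1\<close> and 1 modulo \<open>Q2\<close>. Any multiple
  of \<open>Q\<close> may be added without disturbing this, and Weierstrass approximation chooses
  one that brings the result near 0 on \<open>K1\<close> and near 1 on \<open>K2\<close>.\<close>

lemma separating_poly:
  fixes Q :: "real poly"
  assumes Q: "Q \<noteq> 0" and K: "compact K1" "compact K2" "K1 \<inter> K2 = {}"
  shows "\<exists>I. (\<forall>t\<in>K1. \<bar>poly I t\<bar> < 1/4) \<and> (\<forall>t\<in>K2. \<bar>poly I t - 1\<bar> < 1/4) \<and> Q dvd I * (1 - I)"
proof -
  obtain Q1 Q2 u v where s: "Q = Q1 * Q2 \<and> (\<forall>r\<in>K2. poly Q1 r \<noteq> 0) \<and> (\<forall>r. r \<notin> K2 \<longrightarrow> poly Q2 r \<noteq> 0) \<and> u * Q1 + v * Q2 = 1"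
    using split_roots[OF Q, of K2] by (elim exE)
  \<comment> \<open>The quotient by \<open>Q\<close> of the indicator function of \<open>K2\<close>
    minus \<open>u * Q1\<close>. It is continuous since the roots of \<open>Q\<close> in
    \<open>K2\<close> have been separated from those outside.\<close>
  define h where "h = (\<lambda>t. if t \<in> K2 then poly v t / poly Q1 t else - poly u t / poly Q2 t)"
  have n2: "poly Q2 t \<noteq> 0" if "t \<in> K1" for t using s K(3) that by blast
  have n1: "poly Q1 t \<noteq> 0" if "t \<in> K2" for t using s that by blast
  have "continuous_on (K2 \<union> K1) h" unfolding h_def
  proof (rule continuous_on_cases)
    show "closed K2" "closed K1" using K compact_imp_closed by blast+
    show "continuous_on K2 (\<lambda>t. poly v t / poly Q1 t)" using n1 by (intro continuous_intros) auto
    show "continuous_on K1 (\<lambda>t. - poly u t / poly Q2 t)" using n2 by (intro continuous_intros) auto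
    show "\<forall>t. t \<in> K2 \<and> t \<notin> K2 \<or> t \<in> K1 \<and> t \<in> K2 \<longrightarrow> poly v t / poly Q1 t = - poly u t / poly Q2 t"
      using K(3) by blast
  qed
  moreover have cK: "compact (K2 \<union> K1)" using K by blast
  have "compact (poly Q ` (K2 \<union> K1))" by (intro compact_continuous_image cK continuous_intros)
  then obtain B where B: "\<forall>x\<in>poly Q ` (K2 \<union> K1). norm x \<le> B" using compact_imp_bounded bounded_iff by blast
  \<comment> \<open>With |Q| at most |B| on both sets, this tolerance leaves an error below 1/4
    after multiplication by \<open>Q\<close>.\<close>
  define e where "e = 1 / (4 * (\<bar>B\<bar> + 1))"
  have e: "0 < e" by (simp add: e_def)
  obtain r where r: "\<forall>t\<in>K2 \<union> K1. \<bar>h t - poly r t\<bar> < e"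
    using weierstrass_poly[OF cK \<open>continuous_on (K2 \<union> K1) h\<close> e] by blast
  have b: "\<bar>poly Q t * (h t - poly r t)\<bar> < 1/4" if "t \<in> K2 \<union> K1" for t
  proof -
    have "\<bar>poly Q t\<bar> \<le> \<bar>B\<bar>" using B that by force
    moreover have "\<bar>h t - poly r t\<bar> < e" using r that by blast
    ultimately have "\<bar>poly Q t\<bar> * \<bar>h t - poly r t\<bar> \<le> \<bar>B\<bar> * e" by (intro mult_mono) auto
    also have "\<dots> < (\<bar>B\<bar> + 1) * e" using e by simp
    also have "\<dots> = 1/4" by (simp add: e_def)
    finally show ?thesis by (simp add: abs_mult)
  qed
  define I where "I = u * Q1 + Q1 * Q2 * r"
  have uv: "poly u t * poly Q1 t + poly v t * poly Q2 t = 1" for t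
    using s by (metis poly_1 poly_add poly_mult)
  have Qp: "poly Q t = poly Q1 t * poly Q2 t" for t using s by simp
  have "\<bar>poly I t\<bar> < 1/4" if t: "t \<in> K1" for t
  proof -
    have "h t = - poly u t / poly Q2 t" using t K(3) by (auto simp: h_def)
    hence "poly I t = - (poly Q t * (h t - poly r t))"
      using n2[OF t] by (simp add: I_def Qp field_simps)
    thus ?thesis using b[of t] t by simp
  qed
  moreover have "\<bar>poly I t - 1\<bar> < 1/4" if t: "t \<in> K2" for t
  proof -
    have "h t = poly v t / poly Q1 t" using t by (auto simp: h_def)
    hence "poly Q t * (h t - poly r t) = poly v t * poly Q2 t - poly Q1 t * poly Q2 t * poly r t"
      using n1[OF t] by (simp add: Qp field_simps)
    hence "poly I t - 1 = - (poly Q t * (h t - poly r t))"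
      using uv[of t] by (simp add: I_def)
    thus ?thesis using b[of t] t by simp
  qed
  moreover have "I * (1 - I) = Q * ((u + Q2 * r) * (v - Q1 * r))"
  proof -
    have f1: "I = Q1 * (u + Q2 * r)" by (simp add: I_def algebra_simps)
    have "1 - I = (u * Q1 + v * Q2) - I" using s by simp
    also have "\<dots> = Q2 * (v - Q1 * r)" by (simp add: I_def algebra_simps)
    finally have f2: "1 - I = Q2 * (v - Q1 * r)" .
    have "I * (1 - I) = (Q1 * (u + Q2 * r)) * (Q2 * (v - Q1 * r))" by (rule arg_cong2[OF f1 f2])
    also have "\<dots> = (Q1 * Q2) * ((u + Q2 * r) * (v - Q1 * r))" by (simp only: mult_ac)
    also have "Q1 * Q2 = Q" using s by simp
    finally show ?thesis .
  qed
  ultimately show ?thesis by (intro exI[of _ I]) simp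
qed

text \<open>The squared distance from \<open>p\<close>, minus half its minimum on the rest of
  \<open>S\<close>, is a polynomial \<open>g\<close> that is negative at \<open>p\<close> and
  positive elsewhere on \<open>S\<close>. Irreducibility applied to
  \<open>g\<^sup>2 = 1\<^sup>2 * g\<^sup>2\<close> would give \<open>g\<close> a constant
  sign.\<close>

lemma isolated_point_irreducible:
  assumes irr: "nash_irreducible m S" and S: "compact S" "S \<subseteq> Rn m" and U: "open U" "S \<inter> U = {p}"
  shows "S = {p}"
proof (rule ccontr)
  assume ne: "S \<noteq> {p}"
  define f where "f = (\<lambda>x. sqnorm m (\<lambda>i. x i - p i))"
  have pf: "poly_fun m f"
  proof -
    have "poly_fun m (\<lambda>x. \<Sum>i<m. (x i - p i)\<^sup>2)" by (intro poly_fun_intros) simp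
    thus ?thesis by (simp add: f_def sqnorm_def)
  qed
  have p: "p \<in> S" "p \<in> U" using U(2) by blast+
  have c: "compact (S - U)" using compact_diff[OF S(1) U(1)] .
  have "S - U \<noteq> {}" using ne U(2) p by blast
  then obtain q where q: "q \<in> S - U" "\<forall>x\<in>S - U. f q \<le> f x"
    using continuous_attains_inf[OF c _ poly_fun_continuous[OF pf]] by blast
  have "0 < f q"
  proof -
    have "q \<in> Rn m" "p \<in> Rn m" using q(1) p S(2) by blast+
    hence "(\<lambda>i. q i - p i) \<in> Rn m" by (simp add: Rn_def)
    moreover have "(\<lambda>i. q i - p i) \<noteq> (\<lambda>_. 0)"
    proof
      assume "(\<lambda>i. q i - p i) = (\<lambda>_. 0)"
      hence "q = p" by (simp add: fun_eq_iff)
      thus False using q(1) p by blast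
    qed
    ultimately show ?thesis unfolding f_def by (rule sqnorm_pos)
  qed
  define g where "g = (\<lambda>x. f x - f q / 2)"
  have pg: "poly_fun m g" unfolding g_def by (intro poly_fun_intros pf)
  have gp: "g p < 0" using \<open>0 < f q\<close> by (simp add: g_def f_def sqnorm_def)
  have gq: "0 < g x" if "x \<in> S - U" for x
  proof -
    have "f q \<le> f x" using q(2) that by blast
    thus ?thesis using \<open>0 < f q\<close> by (simp add: g_def)
  qed
  have g0: "g x \<noteq> 0" if "x \<in> S" for x
    using gp gq[of x] U(2) that by (cases "x \<in> U") force+
  have "(\<forall>x\<in>S. g x = 1 * sqrt ((g x)\<^sup>2)) \<or> (\<forall>x\<in>S. g x = - 1 * sqrt ((g x)\<^sup>2))"
    by (rule nash_irreducible_sqrt[OF irr pg pf_const poly_fun_power[OF pg] S(2)]) (use g0 in auto)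
  thus False
  proof
    assume "\<forall>x\<in>S. g x = 1 * sqrt ((g x)\<^sup>2)"
    hence "g p = 1 * sqrt ((g p)\<^sup>2)" using p(1) by blast
    thus False using gp by simp
  next
    assume "\<forall>x\<in>S. g x = - 1 * sqrt ((g x)\<^sup>2)"
    hence "g q = - 1 * sqrt ((g q)\<^sup>2)" using q(1) by blast
    thus False using gq[OF q(1)] by simp
  qed
qed

lemma regular_image_param:
  assumes bf: "binary_forms (Suc m) d \<phi>" and Z: "\<And>i. i < 2 \<Longrightarrow> poly_fun 1 (\<lambda>x. z (x 0) i)"
    and z: "\<And>t. t \<in> {-1..1} \<Longrightarrow> \<phi> 0 (z t) \<noteq> 0"
    and S: "S = (\<lambda>t i. if i < m then \<phi> (Suc i) (z t) / \<phi> 0 (z t) else 0) ` {-1..1}"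
  shows "regular_image 1 m (closed_ball_n 1) S"
proof -
  interpret binary_forms "Suc m" d \<phi> by (rule bf)
  have pfz: "poly_fun 1 (\<lambda>x. \<phi> i (z (x 0)))" if "i < Suc m" for i
    using poly_fun_compose[OF pf[OF that] Z] by simp
  have ball: "x \<in> closed_ball_n 1 \<longleftrightarrow> (\<exists>t\<in>{-1..1}. x = emb1 t)" for x
  proof
    assume "x \<in> closed_ball_n 1"
    hence x: "x \<in> Rn 1" "(x 0)\<^sup>2 \<le> 1" by (simp_all add: closed_ball_n_def sqnorm_def)
    hence "\<bar>x 0\<bar> \<le> 1" by (simp add: abs_square_le_1)
    hence "x 0 \<in> {-1..1}" by auto
    thus "\<exists>t\<in>{-1..1}. x = emb1 t" using Rn1_emb1[OF x(1)] by blast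
  next
    assume "\<exists>t\<in>{-1..1}. x = emb1 t"
    then obtain t where "t \<in> {-1..1}" "x = emb1 t" by blast
    thus "x \<in> closed_ball_n 1"
      using emb1_Rn abs_square_le_1[of t] by (auto simp: closed_ball_n_def sqnorm_def)
  qed
  let ?g = "\<lambda>i x. \<phi> (Suc i) (z (x 0))" and ?h = "\<lambda>(i::nat) x. \<phi> 0 (z (x 0))"
  have "rat_map 1 m ?g ?h" unfolding rat_map_def
  proof (intro allI impI conjI)
    fix i assume "i < m"
    thus "poly_fun 1 (?g i)" "poly_fun 1 (?h i)" using pfz by simp_all
    show "\<exists>x\<in>Rn 1. \<phi> 0 (z (x 0)) \<noteq> 0" using z[of 0] emb1_Rn[of 0] by (intro bexI[of _ "emb1 0"]) auto
  qed
  moreover have "\<forall>i<m. \<forall>x\<in>closed_ball_n 1. ?h i x \<noteq> 0" using z ball by auto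
  moreover have "S = (\<lambda>x i. if i < m then ?g i x / ?h i x else 0) ` closed_ball_n 1"
  proof -
    have "closed_ball_n 1 = emb1 ` {-1..1}" using ball by auto
    thus ?thesis unfolding S by (simp add: image_image cong: if_cong)
  qed
  ultimately show ?thesis unfolding regular_image_def by blast
qed

text \<open>Functions of the parameter that descend to a regular function N/M on \<open>S\<close>.
  As \<open>Y\<close> may identify parameters, this is a real restriction on
  \<open>p\<close>.\<close>

definition reg_on :: "nat \<Rightarrow> pt set \<Rightarrow> real set \<Rightarrow> (real \<Rightarrow> pt) \<Rightarrow> (real \<Rightarrow> real) \<Rightarrow> bool" where
  "reg_on m S K Y p \<longleftrightarrow> (\<exists>N M. poly_fun m N \<and> poly_fun m M \<and> (\<forall>x\<in>S. 0 < M x) \<and> (\<forall>t\<in>K. N (Y t) = M (Y t) * p t))"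

lemma reg_on_poly_fun: "poly_fun m N \<Longrightarrow> reg_on m S K Y (\<lambda>t. N (Y t))"
  unfolding reg_on_def by (intro exI[of _ N] exI[of _ "\<lambda>_. 1"]) (auto intro: pf_const)

lemma reg_on_cong: "reg_on m S K Y p \<Longrightarrow> (\<And>t. t \<in> K \<Longrightarrow> p t = q t) \<Longrightarrow> reg_on m S K Y q"
  unfolding reg_on_def by simp

lemma reg_on_mult:
  assumes "reg_on m S K Y p" "reg_on m S K Y q"
  shows "reg_on m S K Y (\<lambda>t. p t * q t)"
proof -
  obtain N M where 1: "poly_fun m N \<and> poly_fun m M \<and> (\<forall>x\<in>S. 0 < M x) \<and> (\<forall>t\<in>K. N (Y t) = M (Y t) * p t)"
    using assms(1) unfolding reg_on_def by (elim exE)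
  obtain N' M' where 2: "poly_fun m N' \<and> poly_fun m M' \<and> (\<forall>x\<in>S. 0 < M' x) \<and> (\<forall>t\<in>K. N' (Y t) = M' (Y t) * q t)"
    using assms(2) unfolding reg_on_def by (elim exE)
  have "\<forall>t\<in>K. N (Y t) * N' (Y t) = M (Y t) * M' (Y t) * (p t * q t)" using 1 2 by (simp add: mult_ac)
  moreover have "\<forall>x\<in>S. 0 < M x * M' x" using 1 2 by simp
  ultimately show ?thesis unfolding reg_on_def using 1 2
    by (intro exI[of _ "\<lambda>x. N x * N' x"] exI[of _ "\<lambda>x. M x * M' x"]) (auto intro: pf_mult)
qed

lemma reg_on_add:
  assumes "reg_on m S K Y p" "reg_on m S K Y q"
  shows "reg_on m S K Y (\<lambda>t. p t + q t)"
proof -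
  obtain N M where 1: "poly_fun m N \<and> poly_fun m M \<and> (\<forall>x\<in>S. 0 < M x) \<and> (\<forall>t\<in>K. N (Y t) = M (Y t) * p t)"
    using assms(1) unfolding reg_on_def by (elim exE)
  obtain N' M' where 2: "poly_fun m N' \<and> poly_fun m M' \<and> (\<forall>x\<in>S. 0 < M' x) \<and> (\<forall>t\<in>K. N' (Y t) = M' (Y t) * q t)"
    using assms(2) unfolding reg_on_def by (elim exE)
  have "\<forall>t\<in>K. N (Y t) * M' (Y t) + N' (Y t) * M (Y t) = M (Y t) * M' (Y t) * (p t + q t)"
    using 1 2 by (simp add: algebra_simps)
  moreover have "\<forall>x\<in>S. 0 < M x * M' x" using 1 2 by simp
  ultimately show ?thesis unfolding reg_on_def using 1 2
    by (intro exI[of _ "\<lambda>x. N x * M' x + N' x * M x"] exI[of _ "\<lambda>x. M x * M' x"]) (auto intro!: pf_mult pf_add)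
qed

lemma reg_on_const: "reg_on m S K Y (\<lambda>t. c)"
  using reg_on_poly_fun[OF pf_const] .

lemma reg_on_sum: "finite A \<Longrightarrow> (\<And>i. i \<in> A \<Longrightarrow> reg_on m S K Y (p i)) \<Longrightarrow> reg_on m S K Y (\<lambda>t. \<Sum>i\<in>A. p i t)"
proof (induction A rule: finite_induct)
  case empty
  thus ?case by (simp add: reg_on_const)
next
  case (insert i A)
  have "reg_on m S K Y (\<lambda>t. p i t + (\<Sum>i\<in>A. p i t))" by (intro reg_on_add insert) (use insert in auto)
  thus ?case using insert.hyps by simp
qed

lemma reg_on_inverse:
  assumes "poly_fun m M" "\<forall>x\<in>S. 0 < M x" "\<And>t. t \<in> K \<Longrightarrow> Y t \<in> S"
  shows "reg_on m S K Y (\<lambda>t. 1 / M (Y t))"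
  unfolding reg_on_def
proof (intro exI conjI ballI)
  show "poly_fun m (\<lambda>_. 1)" by (rule pf_const)
  show "poly_fun m M" by fact
  show "0 < M x" if "x \<in> S" for x using assms(2) that by blast
  show "1 = M (Y t) * (1 / M (Y t))" if "t \<in> K" for t
    using assms(2,3) that by (metis less_irrefl nonzero_mult_div_cancel_left times_divide_eq_right mult_1_right)
qed

text \<open>\<open>u0\<close> is a parameter point whose image misses \<open>S\<close>. It is placed
  at infinity: \<open>u1\<close> is \<open>u0\<close> turned by a right angle, and
  \<open>u1 + t * u0\<close> runs through all other points of the projective line. This choice makes
  the parameter set compact and the parameter integral over \<open>S\<close>.\<close>

locale line_chart = binary_forms "Suc m" d \<phi> for m d \<phi> +
  fixes S :: "pt set" and u0 u1 :: pt and a b :: "pt \<Rightarrow> real" and e :: nat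
  assumes S: "compact S" "S \<subseteq> Rn m"
    and u0: "u0 \<in> Rn 2" "u0 \<noteq> (\<lambda>_. 0)" and u1: "u1 = emb2 (- u0 1) (u0 0)"
    and u0_out: "\<phi> 0 u0 = 0 \<or> (\<lambda>i. if i < m then \<phi> (Suc i) u0 / \<phi> 0 u0 else 0) \<notin> S"
    and ab: "homog_poly (Suc m) e a" "homog_poly (Suc m) e b" "\<forall>z\<in>Rn 2. a (\<Phi> z) * z 1 = b (\<Phi> z) * z 0"
    and ab_nz: "\<exists>z\<in>Rn 2. a (\<Phi> z) \<noteq> 0 \<or> b (\<Phi> z) \<noteq> 0"
    and cover: "\<forall>x\<in>S. hom_emb m x \<in> cone"
begin

definition aff :: "pt \<Rightarrow> pt" where
  "aff z = (\<lambda>i. if i < m then \<phi> (Suc i) z / \<phi> 0 z else 0)"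

definition inS :: "pt \<Rightarrow> bool" where
  "inS z \<longleftrightarrow> \<phi> 0 z \<noteq> 0 \<and> aff z \<in> S"

lemma \<phi>_scale: "i < Suc m \<Longrightarrow> z \<in> Rn 2 \<Longrightarrow> \<phi> i (\<lambda>i. t * z i) = t ^ d * \<phi> i z"
  using hom homog_polyD(2) by blast

lemma aff_scale: "z \<in> Rn 2 \<Longrightarrow> t \<noteq> 0 \<Longrightarrow> aff (\<lambda>i. t * z i) = aff z"
  unfolding aff_def by (rule ext) (simp add: \<phi>_scale)

lemma inS_scale: "z \<in> Rn 2 \<Longrightarrow> t \<noteq> 0 \<Longrightarrow> inS (\<lambda>i. t * z i) \<longleftrightarrow> inS z"
  unfolding inS_def by (simp add: \<phi>_scale aff_scale)

lemma \<Phi>_aff: "\<phi> 0 z \<noteq> 0 \<Longrightarrow> \<Phi> z = (\<lambda>i. \<phi> 0 z * hom_emb m (aff z) i)"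
proof
  fix i assume nz0: "\<phi> 0 z \<noteq> 0"
  show "\<Phi> z i = \<phi> 0 z * hom_emb m (aff z) i"
  proof (cases i)
    case 0 thus ?thesis by (simp add: \<Phi>_def)
  next
    case (Suc j)
    thus ?thesis using nz0 by (cases "j < m") (auto simp: \<Phi>_def aff_def hom_emb_def)
  qed
qed

lemma cone_aff:
  assumes "x \<in> S"
  obtains z where "z \<in> Rn 2" "z \<noteq> (\<lambda>_. 0)" "inS z" "aff z = x"
proof -
  obtain c z where z: "c \<noteq> 0" "z \<in> Rn 2" "z \<noteq> (\<lambda>_. 0)" "hom_emb m x = (\<lambda>i. c * \<Phi> z i)"
    using cover assms unfolding cone_def by blast
  have 0: "c * \<phi> 0 z = 1" using fun_cong[OF z(4), of 0] by (simp add: \<Phi>_def)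
  hence n: "\<phi> 0 z \<noteq> 0" by auto
  have "aff z = x"
  proof
    fix i show "aff z i = x i"
    proof (cases "i < m")
      case True
      hence "x i = c * \<phi> (Suc i) z" using fun_cong[OF z(4), of "Suc i"] by (simp add: \<Phi>_def)
      moreover have "c = 1 / \<phi> 0 z" using 0 n by (simp add: field_simps)
      ultimately show ?thesis using True by (simp add: aff_def)
    next
      case False
      thus ?thesis using assms S(2) by (auto simp: aff_def Rn_def)
    qed
  qed
  thus thesis using that z n assms by (simp add: inS_def)
qed

text \<open>The affine image is discontinuous at zeros of \<open>\<phi> 0\<close>. Normalized
  homogeneous coordinates are continuous everywhere, and in them the condition is membership in a
  compact set, the unit representatives of \<open>S\<close> with both signs.\<close>

lemma closed_inS_line:
  assumes uv: "u \<in> Rn 2" "v \<in> Rn 2" and nz: "\<And>s. (\<lambda>i. u i + s * v i) \<noteq> (\<lambda>_. 0)"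
  shows "closed {s. inS (\<lambda>i. u i + s * v i)}"
proof -
  let ?z = "\<lambda>s i. u i + s * v i"
  have zR: "?z s \<in> Rn 2" for s using uv by (simp add: Rn_def)
  have cz: "continuous_on UNIV ?z"
    by (rule continuous_on_coordinatewise_then_product) (intro continuous_intros)
  define f where "f = (\<lambda>s. normalize_pt (Suc m) (\<Phi> (?z s)))"
  have cf: "continuous_on UNIV f" unfolding f_def
    by (intro continuous_normalize continuous_\<Phi> cz \<Phi>_pos zR nz)
  define N where "N = nrm m ` S \<union> (\<lambda>x i. - nrm m x i) ` S"
  have "compact (nrm m ` S)" by (rule compact_continuous_image[OF continuous_nrm S(1)])
  moreover have "compact ((\<lambda>x i. - nrm m x i) ` S)"
  proof (rule compact_continuous_image[OF _ S(1)])
    show "continuous_on S (\<lambda>x i. - nrm m x i)"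
      by (rule continuous_on_coordinatewise_then_product)
        (intro continuous_intros continuous_on_product_then_coordinatewise[OF continuous_nrm])
  qed
  ultimately have "closed N" unfolding N_def by (intro compact_imp_closed compact_Un)
  hence "closed (f -` N)" using cf by (rule closed_vimage)
  moreover have "f s \<in> N \<longleftrightarrow> inS (?z s)" for s
  proof
    assume "f s \<in> N"
    then obtain x \<sigma> where x: "x \<in> S" "\<sigma> = 1 \<or> \<sigma> = -1" "f s = (\<lambda>i. \<sigma> * nrm m x i)"
      unfolding N_def by fastforce
    have p: "0 < sqnorm (Suc m) (\<Phi> (?z s))" by (rule \<Phi>_pos[OF zR nz])
    define c where "c = \<sigma> * sqrt (sqnorm (Suc m) (\<Phi> (?z s))) / sqrt (sqnorm (Suc m) (hom_emb m x))"
    have c: "c \<noteq> 0" using x(2) p hom_emb_pos[of m x] by (auto simp: c_def)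
    have eq: "\<Phi> (?z s) i = c * hom_emb m x i" for i
      using fun_cong[OF x(3), of i] p
      by (simp add: f_def nrm_def normalize_pt_def c_def field_simps)
    have 0: "\<phi> 0 (?z s) = c" using eq[of 0] by (simp add: \<Phi>_def)
    have "aff (?z s) = x"
    proof
      fix i show "aff (?z s) i = x i"
      proof (cases "i < m")
        case True
        thus ?thesis using eq[of "Suc i"] 0 c by (simp add: \<Phi>_def aff_def)
      next
        case False
        thus ?thesis using x(1) S(2) by (auto simp: aff_def Rn_def)
      qed
    qed
    thus "inS (?z s)" using 0 c x(1) by (simp add: inS_def)
  next
    assume *: "inS (?z s)"
    define c where "c = \<phi> 0 (?z s)"
    have c: "c \<noteq> 0" "aff (?z s) \<in> S" using * by (simp_all add: inS_def c_def)
    have eq: "\<Phi> (?z s) = (\<lambda>i. c * hom_emb m (aff (?z s)) i)" unfolding c_def by (rule \<Phi>_aff) (use c in \<open>simp add: c_def\<close>)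
    have "f s = (\<lambda>i. sgn c * nrm m (aff (?z s)) i)"
    proof
      fix i
      have "sqrt (sqnorm (Suc m) (\<Phi> (?z s))) = \<bar>c\<bar> * sqrt (sqnorm (Suc m) (hom_emb m (aff (?z s))))"
        unfolding eq sqnorm_scale by (simp add: real_sqrt_mult)
      thus "f s i = sgn c * nrm m (aff (?z s)) i"
        using c(1) by (simp add: f_def nrm_def normalize_pt_def eq sgn_if abs_if)
    qed
    moreover have "sgn c = 1 \<or> sgn c = -1" using c(1) by (simp add: sgn_if)
    ultimately show "f s \<in> N" using c(2) unfolding N_def by auto
  qed
  hence "f -` N = {s. inS (?z s)}" by blast
  ultimately show ?thesis by simp
qed

definition zl :: "real \<Rightarrow> pt" where "zl t = (\<lambda>i. u1 i + t * u0 i)"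
definition K :: "real set" where "K = {t. inS (zl t)}"
definition Y :: "real \<Rightarrow> pt" where "Y t = aff (zl t)"

lemma u1_Rn: "u1 \<in> Rn 2" unfolding u1 by (rule emb2_Rn)

lemma zl_Rn: "zl t \<in> Rn 2" using u0(1) u1_Rn by (simp add: zl_def Rn_def)

lemma u0_sq: "0 < (u0 0)\<^sup>2 + (u0 1)\<^sup>2"
proof -
  have "u0 0 \<noteq> 0 \<or> u0 1 \<noteq> 0" using u0 Rn2_emb2[of u0] emb2_eq_0_iff[of "u0 0" "u0 1"] by auto
  thus ?thesis by (simp add: sum_power2_gt_zero_iff)
qed

lemma combination_nz: "p \<noteq> 0 \<or> q \<noteq> 0 \<Longrightarrow> (\<lambda>i. p * u1 i + q * u0 i) \<noteq> (\<lambda>_. 0)"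
proof
  assume pq: "p \<noteq> 0 \<or> q \<noteq> 0" and *: "(\<lambda>i. p * u1 i + q * u0 i) = (\<lambda>_. 0)"
  have 0: "- p * u0 1 + q * u0 0 = 0" using fun_cong[OF *, of 0] by (simp add: u1)
  have 1: "p * u0 0 + q * u0 1 = 0" using fun_cong[OF *, of 1] by (simp add: u1)
  have "p * ((u0 0)\<^sup>2 + (u0 1)\<^sup>2) = (p * u0 0 + q * u0 1) * u0 0 - (- p * u0 1 + q * u0 0) * u0 1"
    by (simp add: power2_eq_square algebra_simps)
  hence "p * ((u0 0)\<^sup>2 + (u0 1)\<^sup>2) = 0" unfolding 0 1 by simp
  hence "p = 0" using u0_sq by (metis mult_eq_0_iff less_irrefl)
  have "q * ((u0 0)\<^sup>2 + (u0 1)\<^sup>2) = (p * u0 0 + q * u0 1) * u0 1 + (- p * u0 1 + q * u0 0) * u0 0"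
    by (simp add: power2_eq_square algebra_simps)
  hence "q * ((u0 0)\<^sup>2 + (u0 1)\<^sup>2) = 0" unfolding 0 1 by simp
  hence "q = 0" using u0_sq by (metis mult_eq_0_iff less_irrefl)
  with \<open>p = 0\<close> pq show False by simp
qed

lemma combination_ex:
  assumes "z \<in> Rn 2"
  obtains p q where "z = (\<lambda>i. p * u1 i + q * u0 i)"
proof -
  let ?r = "(u0 0)\<^sup>2 + (u0 1)\<^sup>2"
  define p q where "p = (z 1 * u0 0 - z 0 * u0 1) / ?r" and "q = (z 0 * u0 0 + z 1 * u0 1) / ?r"
  have r: "?r \<noteq> 0" using u0_sq by linarith
  have 0: "p * (- u0 1) + q * u0 0 = z 0"
  proof -
    have "p * (- u0 1) + q * u0 0 = ((z 1 * u0 0 - z 0 * u0 1) * (- u0 1) + (z 0 * u0 0 + z 1 * u0 1) * u0 0) / ?r"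
      by (simp only: p_def q_def times_divide_eq_left add_divide_distrib[symmetric])
    also have "\<dots> = (z 0 * ?r) / ?r" by (simp add: power2_eq_square algebra_simps)
    finally show ?thesis unfolding nonzero_mult_div_cancel_right[OF r] .
  qed
  have 1: "p * u0 0 + q * u0 1 = z 1"
  proof -
    have "p * u0 0 + q * u0 1 = ((z 1 * u0 0 - z 0 * u0 1) * u0 0 + (z 0 * u0 0 + z 1 * u0 1) * u0 1) / ?r"
      by (simp only: p_def q_def times_divide_eq_left add_divide_distrib[symmetric])
    also have "\<dots> = (z 1 * ?r) / ?r" by (simp add: power2_eq_square algebra_simps)
    finally show ?thesis unfolding nonzero_mult_div_cancel_right[OF r] .
  qed
  have "z i = p * u1 i + q * u0 i" for i
  proof -
    consider "i = 0" | "i = 1" | "2 \<le> i" by linarith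
    thus ?thesis
    proof cases
      case 3 thus ?thesis using assms u0(1) u1_Rn by (simp add: Rn_def)
    qed (use 0 1 in \<open>simp_all add: u1\<close>)
  qed
  thus thesis using that by blast
qed

lemma zl_nz: "zl t \<noteq> (\<lambda>_. 0)"
  using combination_nz[of 1 t] by (simp add: zl_def)

lemma not_inS_u0: "\<not> inS u0"
  using u0_out by (auto simp: inS_def aff_def)

lemma S_eq: "S = Y ` K"
proof
  show "Y ` K \<subseteq> S" by (auto simp: K_def Y_def inS_def)
  show "S \<subseteq> Y ` K"
  proof
    fix x assume "x \<in> S"
    then obtain z where z: "z \<in> Rn 2" "z \<noteq> (\<lambda>_. 0)" "inS z" "aff z = x" by (rule cone_aff)
    obtain p q where pq: "z = (\<lambda>i. p * u1 i + q * u0 i)" using combination_ex[OF z(1)] .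
    have "p \<noteq> 0"
    proof
      assume "p = 0"
      hence zq: "z = (\<lambda>i. q * u0 i)" using pq by simp
      hence "q \<noteq> 0" using z(2) by auto
      thus False using z(3) inS_scale[OF u0(1)] not_inS_u0 zq by simp
    qed
    hence "z = (\<lambda>i. p * zl (q / p) i)" unfolding pq by (simp add: zl_def distrib_left)
    hence "inS (zl (q / p))" "aff (zl (q / p)) = x"
      using z(3,4) inS_scale[OF zl_Rn \<open>p \<noteq> 0\<close>] aff_scale[OF zl_Rn \<open>p \<noteq> 0\<close>] by simp_all
    thus "x \<in> Y ` K" unfolding K_def Y_def by blast
  qed
qed

text \<open>Boundedness is seen in the chart \<open>1 / t\<close> at infinity: the closed condition
  fails at its origin, hence in a neighbourhood of it.\<close>

lemma compact_K: "compact K"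
proof -
  have "closed K" unfolding K_def zl_def
    using closed_inS_line[OF u1_Rn u0(1)] combination_nz[of 1] by simp
  have "closed {s. inS (\<lambda>i. u0 i + s * u1 i)}"
    using combination_nz[of _ 1] by (intro closed_inS_line u1_Rn u0) (simp add: add.commute)
  hence "open (- {s. inS (\<lambda>i. u0 i + s * u1 i)})" by (rule open_Compl)
  moreover have "0 \<in> - {s. inS (\<lambda>i. u0 i + s * u1 i)}" using not_inS_u0 by simp
  ultimately obtain r where r: "0 < r" "ball 0 r \<subseteq> - {s. inS (\<lambda>i. u0 i + s * u1 i)}" unfolding open_contains_ball by blast
  have "\<bar>t\<bar> \<le> 1 / r" if t: "t \<in> K" for t
  proof (rule ccontr)
    assume "\<not> \<bar>t\<bar> \<le> 1 / r"
    hence big: "1 / r < \<bar>t\<bar>" by simp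
    hence "t \<noteq> 0" using r(1) by auto
    have "\<bar>1 / t\<bar> < r" using big r(1) \<open>t \<noteq> 0\<close> by (simp add: field_simps)
    hence "1 / t \<in> ball 0 r" by (simp add: dist_real_def)
    hence n: "\<not> inS (\<lambda>i. u0 i + 1 / t * u1 i)" using r(2) by blast
    have "zl t = (\<lambda>i. t * (u0 i + 1 / t * u1 i))" using \<open>t \<noteq> 0\<close> by (simp add: zl_def fun_eq_iff distrib_left)
    moreover have "(\<lambda>i. u0 i + 1 / t * u1 i) \<in> Rn 2" using u0(1) u1_Rn by (simp add: Rn_def)
    ultimately have "\<not> inS (zl t)" using n inS_scale[OF _ \<open>t \<noteq> 0\<close>] by simp
    thus False using t by (simp add: K_def)
  qed
  hence "bounded K" unfolding bounded_iff by (intro exI[of _ "1 / r"]) simp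
  thus ?thesis using \<open>closed K\<close> compact_eq_bounded_closed by blast
qed

lemma continuous_Y: "continuous_on K Y"
proof -
  have cz: "continuous_on K zl" unfolding zl_def
    by (rule continuous_on_coordinatewise_then_product) (intro continuous_intros)
  have c: "continuous_on K (\<lambda>t. \<phi> i (zl t))" if "i < Suc m" for i
    by (rule continuous_on_compose2[OF poly_fun_continuous[OF pf[OF that], of UNIV] cz]) simp
  have "continuous_on K (\<lambda>t. aff (zl t))"
  proof (rule continuous_on_coordinatewise_then_product)
    fix i
    show "continuous_on K (\<lambda>t. aff (zl t) i)"
    proof (cases "i < m")
      case True
      have "continuous_on K (\<lambda>t. \<phi> (Suc i) (zl t) / \<phi> 0 (zl t))"
        by (intro continuous_on_divide c) (use True in \<open>auto simp: K_def inS_def\<close>)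
      thus ?thesis using True by (simp add: aff_def)
    qed (simp add: aff_def)
  qed
  thus ?thesis by (simp add: Y_def[abs_def])
qed

end

section \<open>The conductor and the separation of parameters\<close>

lemma poly_as_sum_le: "degree p \<le> n \<Longrightarrow> poly p (x::'a::comm_semiring_1) = (\<Sum>i\<le>n. coeff p i * x ^ i)"
  unfolding poly_altdef by (intro sum.mono_neutral_left) (auto simp: coeff_eq_0)

context line_chart
begin

text \<open>Denominator of the inverse map in the chart: solving \<open>a * z 1 = b * z 0\<close> at
  \<open>z = u1 + t * u0\<close> for t gives \<open>t = Bx / Ax\<close>.\<close>

definition Ax :: "pt \<Rightarrow> real" where
  "Ax x = a (hom_emb m x) * u0 1 - b (hom_emb m x) * u0 0"

definition Bx :: "pt \<Rightarrow> real" where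
  "Bx x = - (b (hom_emb m x) * u0 1 + a (hom_emb m x) * u0 0)"

lemma pf_Ax: "poly_fun m Ax" and pf_Bx: "poly_fun m Bx"
proof -
  note pa = poly_fun_hom_emb[OF homog_polyD(1)[OF ab(1)]] and pb = poly_fun_hom_emb[OF homog_polyD(1)[OF ab(2)]]
  have "poly_fun m (\<lambda>x. a (hom_emb m x) * u0 1 - b (hom_emb m x) * u0 0)" by (intro poly_fun_intros pa pb)
  thus "poly_fun m Ax" by (simp add: Ax_def[abs_def])
  have "poly_fun m (\<lambda>x. - (b (hom_emb m x) * u0 1 + a (hom_emb m x) * u0 0))" by (intro poly_fun_intros pa pb)
  thus "poly_fun m Bx" by (simp add: Bx_def[abs_def])
qed

lemma zl_coords: "zl t 0 = - u0 1 + t * u0 0" "zl t 1 = u0 0 + t * u0 1"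
  unfolding zl_def by (simp_all add: u1)

lemma chart_relation: "t * (a (\<Phi> (zl t)) * u0 1 - b (\<Phi> (zl t)) * u0 0) = - (b (\<Phi> (zl t)) * u0 1 + a (\<Phi> (zl t)) * u0 0)"
proof -
  have "a (\<Phi> (zl t)) * zl t 1 = b (\<Phi> (zl t)) * zl t 0" using ab(3) zl_Rn by blast
  thus ?thesis unfolding zl_coords by (simp add: algebra_simps)
qed

lemma ab_chart:
  assumes "t \<in> K"
  shows "a (\<Phi> (zl t)) = (\<phi> 0 (zl t)) ^ e * a (hom_emb m (Y t))" "b (\<Phi> (zl t)) = (\<phi> 0 (zl t)) ^ e * b (hom_emb m (Y t))"
proof -
  have "\<phi> 0 (zl t) \<noteq> 0" using assms by (simp add: K_def inS_def)
  from \<Phi>_aff[OF this] have e: "\<Phi> (zl t) = (\<lambda>i. \<phi> 0 (zl t) * hom_emb m (Y t) i)" by (simp add: Y_def)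
  show "a (\<Phi> (zl t)) = (\<phi> 0 (zl t)) ^ e * a (hom_emb m (Y t))"
    unfolding e by (rule homog_polyD(2)[OF ab(1) hom_emb_Rn])
  show "b (\<Phi> (zl t)) = (\<phi> 0 (zl t)) ^ e * b (hom_emb m (Y t))"
    unfolding e by (rule homog_polyD(2)[OF ab(2) hom_emb_Rn])
qed

lemma Ax_chart: "t \<in> K \<Longrightarrow> a (\<Phi> (zl t)) * u0 1 - b (\<Phi> (zl t)) * u0 0 = (\<phi> 0 (zl t)) ^ e * Ax (Y t)"
  by (simp add: ab_chart Ax_def algebra_simps)

lemma Bx_Ax:
  assumes "t \<in> K"
  shows "Bx (Y t) = t * Ax (Y t)"
proof -
  have n: "(\<phi> 0 (zl t)) ^ e \<noteq> 0" using assms by (simp add: K_def inS_def)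
  have "(\<phi> 0 (zl t)) ^ e * (t * Ax (Y t)) = (\<phi> 0 (zl t)) ^ e * Bx (Y t)"
    using chart_relation[of t, unfolded Ax_chart[OF assms]]
    by (simp add: ab_chart[OF assms] Bx_def algebra_simps)
  with n show ?thesis by (metis mult_cancel_left)
qed

text \<open>Scaling reaches all points except the multiples of \<open>u0\<close>. A line that
  approaches such a point carries a polynomial that vanishes off one value and hence also
  there.\<close>

lemma pullback_zero:
  assumes \<psi>: "homog_poly (Suc m) e \<psi>" and 0: "\<And>t. \<psi> (\<Phi> (zl t)) = 0" and z: "z \<in> Rn 2"
  shows "\<psi> (\<Phi> z) = 0"
proof -
  have nonzero: "\<psi> (\<Phi> (\<lambda>i. p * u1 i + q * u0 i)) = 0" if "p \<noteq> 0" for p q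
  proof -
    have "(\<lambda>i. p * u1 i + q * u0 i) = (\<lambda>i. p * zl (q / p) i)" using that by (simp add: zl_def distrib_left)
    hence "\<Phi> (\<lambda>i. p * u1 i + q * u0 i) = (\<lambda>i. p ^ d * \<Phi> (zl (q / p)) i)" using \<Phi>_scale[OF zl_Rn] by simp
    thus ?thesis using homog_polyD(2)[OF \<psi> \<Phi>_Rn, of "p ^ d" "zl (q / p)"] 0 by simp
  qed
  obtain p q where pq: "z = (\<lambda>i. p * u1 i + q * u0 i)" using combination_ex[OF z] .
  show ?thesis
  proof (cases "p = 0")
    case False thus ?thesis using nonzero pq by simp
  next
    case True
    have "poly_fun 2 (\<lambda>x. \<psi> (\<lambda>i. \<Phi> x i))"
    proof (rule poly_fun_compose[OF homog_polyD(1)[OF \<psi>]])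
      fix i assume "i < Suc m"
      thus "poly_fun 2 (\<lambda>x. \<Phi> x i)" using pf[of i] by (simp add: \<Phi>_def)
    qed
    from poly_fun_compose_poly[OF this, of "\<lambda>i. [:q * u0 i, u1 i:]"]
    obtain R where R: "\<forall>s. \<psi> (\<Phi> (\<lambda>i. q * u0 i + s * u1 i)) = poly R s" by auto
    have "R = 0"
    proof (rule poly_eq_cofinite)
      fix s :: real assume "s \<noteq> 0"
      moreover have "(\<lambda>i. q * u0 i + s * u1 i) = (\<lambda>i. s * u1 i + q * u0 i)" by (rule ext) (rule add.commute)
      ultimately show "poly R s = poly 0 s" using R[rule_format, of s] nonzero[of s q] by simp
    qed
    thus ?thesis using R[rule_format, of 0] pq True by simp
  qed
qed

text \<open>\<open>L\<close> is the denominator \<open>Ax\<close> along the parametrization, before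
  dehomogenization. If it were zero then so would be the numerator, and since \<open>u0\<close> and
  its rotation form a basis, \<open>a\<close> and \<open>b\<close> would both vanish on the
  curve.\<close>

lemma L_ex: "\<exists>L::real poly. L \<noteq> 0 \<and> (\<forall>t. poly L t = a (\<Phi> (zl t)) * u0 1 - b (\<Phi> (zl t)) * u0 0)"
proof -
  have c: "\<exists>R::real poly. \<forall>t. \<psi> (\<Phi> (zl t)) = poly R t" if \<psi>: "homog_poly (Suc m) e \<psi>" for \<psi>
  proof -
    have "poly_fun 2 (\<lambda>x. \<psi> (\<lambda>i. \<Phi> x i))"
    proof (rule poly_fun_compose[OF homog_polyD(1)[OF \<psi>]])
      fix i assume "i < Suc m"
      thus "poly_fun 2 (\<lambda>x. \<Phi> x i)" using pf[of i] by (simp add: \<Phi>_def)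
    qed
    from poly_fun_compose_poly[OF this, of "\<lambda>i. [:u1 i, u0 i:]"] show ?thesis by (simp add: zl_def)
  qed
  obtain RA where RA: "\<forall>t. a (\<Phi> (zl t)) = poly RA t" using c[OF ab(1)] by blast
  obtain RB where RB: "\<forall>t. b (\<Phi> (zl t)) = poly RB t" using c[OF ab(2)] by blast
  define L where "L = smult (u0 1) RA - smult (u0 0) RB"
  have L: "poly L t = a (\<Phi> (zl t)) * u0 1 - b (\<Phi> (zl t)) * u0 0" for t
    by (simp add: L_def RA RB mult.commute)
  have "L \<noteq> 0"
  proof
    assume "L = 0"
    hence 0: "a (\<Phi> (zl t)) * u0 1 - b (\<Phi> (zl t)) * u0 0 = 0" for t using L[of t] by simp
    have 1: "b (\<Phi> (zl t)) * u0 1 + a (\<Phi> (zl t)) * u0 0 = 0" for t using chart_relation[of t] unfolding 0 by simp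
    have az: "a (\<Phi> (zl t)) = 0" for t
    proof -
      let ?x = "a (\<Phi> (zl t))" and ?y = "b (\<Phi> (zl t))"
      have "?x * ((u0 0)\<^sup>2 + (u0 1)\<^sup>2) = (?y * u0 1 + ?x * u0 0) * u0 0 + (?x * u0 1 - ?y * u0 0) * u0 1"
        by (simp add: power2_eq_square algebra_simps)
      hence "?x * ((u0 0)\<^sup>2 + (u0 1)\<^sup>2) = 0" unfolding 0 1 by simp
      thus ?thesis using u0_sq by (metis mult_eq_0_iff less_irrefl)
    qed
    have bz: "b (\<Phi> (zl t)) = 0" for t
    proof -
      let ?x = "a (\<Phi> (zl t))" and ?y = "b (\<Phi> (zl t))"
      have "?y * ((u0 0)\<^sup>2 + (u0 1)\<^sup>2) = (?y * u0 1 + ?x * u0 0) * u0 1 - (?x * u0 1 - ?y * u0 0) * u0 0"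
        by (simp add: power2_eq_square algebra_simps)
      hence "?y * ((u0 0)\<^sup>2 + (u0 1)\<^sup>2) = 0" unfolding 0 1 by simp
      thus ?thesis using u0_sq by (metis mult_eq_0_iff less_irrefl)
    qed
    show False using ab_nz pullback_zero[OF ab(1) az] pullback_zero[OF ab(2) bz] by blast
  qed
  thus ?thesis using L by blast
qed

lemma finite_Ax_zeros: "finite {t \<in> K. Ax (Y t) = 0}"
proof -
  obtain L where L: "L \<noteq> 0" "\<forall>t. poly L t = a (\<Phi> (zl t)) * u0 1 - b (\<Phi> (zl t)) * u0 0" using L_ex by blast
  have "{t \<in> K. Ax (Y t) = 0} \<subseteq> {t. poly L t = 0}" 
  proof safe
    fix t assume "t \<in> K" "Ax (Y t) = 0"
    thus "poly L t = 0" using L(2)[rule_format, of t] Ax_chart[of t] by simp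
  qed
  thus ?thesis using poly_roots_finite[OF L(1)] finite_subset by blast
qed

lemma P_ex: "\<exists>P::nat \<Rightarrow> real poly. \<forall>i\<in>{..m}. (\<forall>t. poly (P i) t = \<phi> i (zl t)) \<and> degree (P i) \<le> d \<and> coeff (P i) d = \<phi> i u0"
proof (rule bchoice, rule ballI)
  fix i assume "i \<in> {..m}"
  hence "homog_poly 2 d (\<phi> i)" using hom by auto
  from binary_form_on_line[OF this u1_Rn u0(1)]
  show "\<exists>P::real poly. (\<forall>t. poly P t = \<phi> i (zl t)) \<and> degree P \<le> d \<and> coeff P d = \<phi> i u0" by (simp add: zl_def)
qed

text \<open>The parameter is integral over the regular functions on \<open>S\<close>: it is a root of
  \<open>\<Sum>\<^sub>i (\<phi>\<^sub>i - x\<^sub>i \<phi>\<^sub>0)^2\<close>, whose leading coefficient \<open>LC\<close> is positive since the point at infinity of the chart is not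
  mapped into \<open>S\<close>.\<close>
lemma integral_equation:
  "\<exists>LC g. poly_fun m LC \<and> (\<forall>x\<in>S. 0 < LC x) \<and> (\<forall>j. poly_fun m (g j)) \<and>
     (\<forall>t\<in>K. LC (Y t) * t ^ (2 * d) = (\<Sum>j<2 * d. - g j (Y t) * t ^ j))"
proof -
  obtain P where P: "\<forall>i\<in>{..m}. (\<forall>t. poly (P i) t = \<phi> i (zl t)) \<and> degree (P i) \<le> d \<and> coeff (P i) d = \<phi> i u0"
    using P_ex by (elim exE)
  hence Pt: "poly (P i) t = \<phi> i (zl t)" and Pd: "degree (P i) \<le> d" and Pc: "coeff (P i) d = \<phi> i u0" if "i \<le> m" for i t
    using that by auto
  define G where "G = (\<lambda>x::pt. \<Sum>i<m. P (Suc i) * P (Suc i) - smult (2 * x i) (P (Suc i) * P 0) + smult ((x i)\<^sup>2) (P 0 * P 0))"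
  have Gpoly: "poly (G x) t = (\<Sum>i<m. (\<phi> (Suc i) (zl t) - x i * \<phi> 0 (zl t))\<^sup>2)" for x t
    unfolding G_def poly_sum by (rule sum.cong) (auto simp: Pt power2_eq_square algebra_simps)
  have Gdeg: "degree (G x) \<le> 2 * d" for x
  proof -
    have "degree (P i * P j) \<le> 2 * d" if "i \<le> m" "j \<le> m" for i j
      using degree_mult_le[of "P i" "P j"] Pd[OF that(1)] Pd[OF that(2)] by linarith
    thus ?thesis unfolding G_def
      by (intro degree_sum_le degree_add_le degree_diff_le order_trans[OF degree_smult_le]) auto
  qed
  define LC where "LC = (\<lambda>x. coeff (G x) (2 * d))"
  have top: "coeff (P i * P j) (2 * d) = \<phi> i u0 * \<phi> j u0" if "i \<le> m" "j \<le> m" for i j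
    using coeff_mult_top[OF Pd[OF that(1)] Pd[OF that(2)]] Pc that by (simp add: mult_2)
  have LC: "LC x = (\<Sum>i<m. (\<phi> (Suc i) u0 - x i * \<phi> 0 u0)\<^sup>2)" for x
    unfolding LC_def G_def coeff_sum
  proof (rule sum.cong)
    fix i assume "i \<in> {..<m}"
    hence 1: "Suc i \<le> m" by simp
    show "coeff (P (Suc i) * P (Suc i) - smult (2 * x i) (P (Suc i) * P 0) + smult ((x i)\<^sup>2) (P 0 * P 0)) (2 * d)
      = (\<phi> (Suc i) u0 - x i * \<phi> 0 u0)\<^sup>2"
      unfolding coeff_add coeff_diff coeff_smult top[OF 1 1] top[OF 1 le0] top[OF le0 le0]
      by (simp add: power2_eq_square algebra_simps)
  qed simp
  define g where "g = (\<lambda>j x. coeff (G x) j)"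
  have pg: "poly_fun m (g j)" for j
  proof -
    have "poly_fun m (\<lambda>x. \<Sum>i<m. coeff (P (Suc i) * P (Suc i)) j - 2 * x i * coeff (P (Suc i) * P 0) j + (x i)\<^sup>2 * coeff (P 0 * P 0) j)"
      by (intro poly_fun_intros) auto
    moreover have "g j = (\<lambda>x. \<Sum>i<m. coeff (P (Suc i) * P (Suc i)) j - 2 * x i * coeff (P (Suc i) * P 0) j + (x i)\<^sup>2 * coeff (P 0 * P 0) j)"
      by (simp add: g_def G_def coeff_sum)
    ultimately show ?thesis by simp
  qed
  have pLC: "poly_fun m LC" using pg[of "2 * d"] by (simp add: g_def LC_def)
  have LCpos: "0 < LC x" if x: "x \<in> S" for x
  proof (rule ccontr)
    assume "\<not> 0 < LC x"
    moreover have "0 \<le> LC x" unfolding LC by (simp add: sum_nonneg)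
    ultimately have "LC x = 0" by simp
    hence "\<forall>i\<in>{..<m}. (\<phi> (Suc i) u0 - x i * \<phi> 0 u0)\<^sup>2 = 0"
      unfolding LC by (subst (asm) sum_nonneg_eq_0_iff) auto
    hence eq: "\<phi> (Suc i) u0 = x i * \<phi> 0 u0" if "i < m" for i using that by simp
    show False
    proof (cases "\<phi> 0 u0 = 0")
      case True
      hence "\<phi> i u0 = 0" if "i < Suc m" for i using eq that by (cases i) auto
      thus False using nz u0 by blast
    next
      case False
      have "aff u0 = x"
      proof
        fix i show "aff u0 i = x i"
          using eq False x S(2) by (cases "i < m") (auto simp: aff_def Rn_def)
      qed
      thus False using not_inS_u0 False x by (simp add: inS_def)
    qed
  qed
  have rel: "LC (Y t) * t ^ (2 * d) = (\<Sum>j<2 * d. - g j (Y t) * t ^ j)" if "t \<in> K" for t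
  proof -
    have n: "\<phi> 0 (zl t) \<noteq> 0" using that by (simp add: K_def inS_def)
    have "poly (G (Y t)) t = 0" unfolding Gpoly
      by (rule sum.neutral) (use n in \<open>simp add: Y_def aff_def\<close>)
    moreover have "poly (G (Y t)) t = (\<Sum>j\<le>2 * d. g j (Y t) * t ^ j)"
      unfolding g_def by (rule poly_as_sum_le[OF Gdeg])
    moreover have "(\<Sum>j\<le>2 * d. g j (Y t) * t ^ j) = (\<Sum>j<2 * d. g j (Y t) * t ^ j) + LC (Y t) * t ^ (2 * d)"
      by (simp add: g_def LC_def flip: lessThan_Suc_atMost)
    ultimately show ?thesis by (simp add: sum_negf)
  qed
  show ?thesis using pLC LCpos pg rel by (intro exI[of _ LC], intro exI[of _ g]) blast
qed

lemma Y_in_S: "t \<in> K \<Longrightarrow> Y t \<in> S"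
  using S_eq by blast

text \<open>For exponents below \<open>2 * d\<close> the powers of \<open>Ax\<close> absorb the
  parameter, as \<open>t * Ax = Bx\<close>. Higher exponents are lowered by the integral equation,
  whose leading coefficient is positive on \<open>S\<close>.\<close>

lemma conductor_power: "reg_on m S K Y (\<lambda>t. Ax (Y t) ^ (2 * d) * t ^ N)"
proof -
  obtain LC g where G: "poly_fun m LC \<and> (\<forall>x\<in>S. 0 < LC x) \<and> (\<forall>j. poly_fun m (g j)) \<and>
     (\<forall>t\<in>K. LC (Y t) * t ^ (2 * d) = (\<Sum>j<2 * d. - g j (Y t) * t ^ j))"
    using integral_equation by (elim exE)
  have inv: "reg_on m S K Y (\<lambda>t. 1 / LC (Y t))" using G by (intro reg_on_inverse Y_in_S) auto
  show ?thesis
  proof (induction N rule: less_induct)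
    case (less N)
    show ?case
    proof (cases "N < 2 * d")
      case True
      have "reg_on m S K Y (\<lambda>t. (\<lambda>x. Ax x ^ (2 * d - N) * Bx x ^ N) (Y t))"
        by (intro reg_on_poly_fun poly_fun_intros pf_Ax pf_Bx)
      thus ?thesis
      proof (rule reg_on_cong)
        fix t assume "t \<in> K"
        have "Ax (Y t) ^ (2 * d) = Ax (Y t) ^ (2 * d - N) * Ax (Y t) ^ N" using True by (simp flip: power_add)
        thus "Ax (Y t) ^ (2 * d - N) * Bx (Y t) ^ N = Ax (Y t) ^ (2 * d) * t ^ N"
          using Bx_Ax[OF \<open>t \<in> K\<close>] by (simp add: power_mult_distrib mult_ac)
      qed
    next
      case False
      define k where "k = N - 2 * d"
      have k: "N = 2 * d + k" using False by (simp add: k_def)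
      have "reg_on m S K Y (\<lambda>t. \<Sum>j<2 * d. 1 / LC (Y t) * ((\<lambda>x. - g j x) (Y t) * (Ax (Y t) ^ (2 * d) * t ^ (k + j))))"
        using G k by (intro reg_on_sum reg_on_mult inv reg_on_poly_fun poly_fun_uminus less.IH) auto
      thus ?thesis
      proof (rule reg_on_cong)
        fix t assume t: "t \<in> K"
        have L: "LC (Y t) \<noteq> 0" using G Y_in_S[OF t] by (metis less_irrefl)
        have "(\<Sum>j<2 * d. 1 / LC (Y t) * (- g j (Y t) * (Ax (Y t) ^ (2 * d) * t ^ (k + j))))
          = 1 / LC (Y t) * Ax (Y t) ^ (2 * d) * t ^ k * (\<Sum>j<2 * d. - g j (Y t) * t ^ j)"
          unfolding sum_distrib_left by (rule sum.cong) (simp_all add: power_add mult_ac)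
        also have "(\<Sum>j<2 * d. - g j (Y t) * t ^ j) = LC (Y t) * t ^ (2 * d)" using G t by simp
        also have "1 / LC (Y t) * Ax (Y t) ^ (2 * d) * t ^ k * (LC (Y t) * t ^ (2 * d)) = Ax (Y t) ^ (2 * d) * t ^ N"
          using L by (simp add: k power_add mult_ac)
        finally show "(\<Sum>j<2 * d. 1 / LC (Y t) * (- g j (Y t) * (Ax (Y t) ^ (2 * d) * t ^ (k + j)))) = Ax (Y t) ^ (2 * d) * t ^ N" .
      qed
    qed
  qed
qed

lemma conductor_poly: "reg_on m S K Y (\<lambda>t. Ax (Y t) ^ (2 * d) * poly p t)"
proof -
  have "reg_on m S K Y (\<lambda>t. \<Sum>i\<le>degree p. coeff p i * (Ax (Y t) ^ (2 * d) * t ^ i))"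
    by (intro reg_on_sum reg_on_mult reg_on_const conductor_power) simp
  thus ?thesis
    by (rule reg_on_cong) (simp only: poly_altdef sum_distrib_left mult.left_commute)
qed

text \<open>\<open>\<beta>\<close> is negative on \<open>K1\<close> and positive on
  \<open>K2\<close>. If \<open>c * \<beta> = c * \<bar>\<beta>\<bar>\<close> on the parameter set,
  the conductor \<open>c\<close> vanishes on \<open>K1\<close>; with the opposite sign it vanishes
  on \<open>K2\<close>. Denominators \<open>M1\<close> and \<open>M2\<close> are carried along to
  stay with polynomials.\<close>

lemma clopen_split:
  assumes irr: "nash_irreducible m S" and K12: "K = K1 \<union> K2" "K1 \<inter> K2 = {}" "compact K1" "compact K2"
  shows "(\<forall>t\<in>K1. Ax (Y t) = 0) \<or> (\<forall>t\<in>K2. Ax (Y t) = 0)"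
proof -
  obtain L where L: "L \<noteq> 0" "\<forall>t. poly L t = a (\<Phi> (zl t)) * u0 1 - b (\<Phi> (zl t)) * u0 0" using L_ex by blast
  obtain P where P: "\<forall>i\<in>{..m}. (\<forall>t. poly (P i) t = \<phi> i (zl t)) \<and> degree (P i) \<le> d \<and> coeff (P i) d = \<phi> i u0"
    using P_ex by (elim exE)
  have "L ^ (2 * d) \<noteq> 0" using L(1) by simp
  from separating_poly[OF this K12(3,4,2)] obtain \<alpha> where
    \<alpha>1: "\<forall>t\<in>K1. \<bar>poly \<alpha> t\<bar> < 1/4" and \<alpha>2: "\<forall>t\<in>K2. \<bar>poly \<alpha> t - 1\<bar> < 1/4" and dv: "L ^ (2 * d) dvd \<alpha> * (1 - \<alpha>)" by blast
  obtain q where q: "\<alpha> * (1 - \<alpha>) = L ^ (2 * d) * q" using dv by (elim dvdE)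
  define c where "c = (\<lambda>x. Ax x ^ (2 * d))"
  have pc: "poly_fun m c" unfolding c_def by (intro poly_fun_intros pf_Ax)
  \<comment> \<open>The power of \<open>P 0\<close> is the factor by which
    \<open>L ^ (2 * d)\<close> differs from the conductor, since \<open>L\<close> equals
    \<open>\<phi> 0\<close> to the power \<open>e\<close> times \<open>Ax\<close>.\<close>
  have "reg_on m S K Y (\<lambda>t. c (Y t) * poly (P 0 ^ (e * (2 * d)) * q) t)" unfolding c_def by (rule conductor_poly)
  hence "reg_on m S K Y (\<lambda>t. poly \<alpha> t * (1 - poly \<alpha> t))"
  proof (rule reg_on_cong)
    fix t assume t: "t \<in> K"
    have "poly \<alpha> t * (1 - poly \<alpha> t) = poly (\<alpha> * (1 - \<alpha>)) t" by simp
    also have "\<dots> = poly L t ^ (2 * d) * poly q t" unfolding q by simp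
    also have "poly L t = (\<phi> 0 (zl t)) ^ e * Ax (Y t)" using L(2) Ax_chart[OF t] by simp
    also have "\<phi> 0 (zl t) = poly (P 0) t" using P by simp
    finally show "c (Y t) * poly (P 0 ^ (e * (2 * d)) * q) t = poly \<alpha> t * (1 - poly \<alpha> t)"
      by (simp add: c_def power_mult_distrib mult_ac flip: power_mult)
  qed
  then obtain N2 M2 where 2: "poly_fun m N2 \<and> poly_fun m M2 \<and> (\<forall>x\<in>S. 0 < M2 x) \<and>
      (\<forall>t\<in>K. N2 (Y t) = M2 (Y t) * (poly \<alpha> t * (1 - poly \<alpha> t)))" unfolding reg_on_def by (elim exE)
  have "reg_on m S K Y (\<lambda>t. c (Y t) * poly (2 * \<alpha> - 1) t)" unfolding c_def by (rule conductor_poly)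
  then obtain N1 M1 where 1: "poly_fun m N1 \<and> poly_fun m M1 \<and> (\<forall>x\<in>S. 0 < M1 x) \<and>
      (\<forall>t\<in>K. N1 (Y t) = M1 (Y t) * (c (Y t) * poly (2 * \<alpha> - 1) t))" unfolding reg_on_def by (elim exE)
  define \<beta> where "\<beta> = (\<lambda>t. 2 * poly \<alpha> t - 1)"
  have N1: "N1 (Y t) = M1 (Y t) * c (Y t) * \<beta> t" if "t \<in> K" for t using 1 that by (simp add: \<beta>_def mult_ac)
  \<comment> \<open>On the curve this is \<open>(M2 * \<beta>)\<^sup>2\<close>, by the identity
    between the square of \<open>2\<alpha> - 1\<close> and
    \<open>1 - 4\<alpha>(1 - \<alpha>)\<close>.\<close>
  define D where "D = (\<lambda>x. M2 x * (M2 x - 4 * N2 x))"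
  have pD: "poly_fun m D" unfolding D_def using 2 by (intro poly_fun_intros) auto
  have D: "D (Y t) = (M2 (Y t) * \<beta> t)\<^sup>2" if "t \<in> K" for t
  proof -
    have "N2 (Y t) = M2 (Y t) * (poly \<alpha> t * (1 - poly \<alpha> t))" using 2 that by blast
    thus ?thesis unfolding D_def \<beta>_def by algebra
  qed
  have \<beta>1: "\<beta> t < 0" if "t \<in> K1" for t using \<alpha>1 that by (force simp: \<beta>_def abs_if split: if_splits)
  have \<beta>2: "0 < \<beta> t" if "t \<in> K2" for t using \<alpha>2 that by (force simp: \<beta>_def abs_if split: if_splits)
  have M: "0 < M1 (Y t)" "0 < M2 (Y t)" if "t \<in> K" for t using 1 2 Y_in_S[OF that] by blast+
  have Dpos: "0 < D x" if "x \<in> S" for x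
  proof -
    obtain t where t: "t \<in> K" "x = Y t" using \<open>x \<in> S\<close> S_eq by blast
    hence "\<beta> t \<noteq> 0" using \<beta>1[of t] \<beta>2[of t] K12(1) by auto
    thus ?thesis using M(2)[OF t(1)] D[OF t(1)] t(2) by simp
  qed
  have sq: "(N1 x * M2 x)\<^sup>2 = (M1 x * c x)\<^sup>2 * D x" if "x \<in> S" for x
  proof -
    obtain t where t: "t \<in> K" "x = Y t" using \<open>x \<in> S\<close> S_eq by blast
    show ?thesis unfolding t(2) N1[OF t(1)] D[OF t(1)] by (simp add: power_mult_distrib mult_ac)
  qed
  have sD: "sqrt (D (Y t)) = M2 (Y t) * \<bar>\<beta> t\<bar>" if "t \<in> K" for t
    unfolding D[OF that] using M(2)[OF that] by (simp add: abs_mult)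
  have "(\<forall>x\<in>S. N1 x * M2 x = (M1 x * c x) * sqrt (D x)) \<or> (\<forall>x\<in>S. N1 x * M2 x = - (M1 x * c x) * sqrt (D x))"
    using 1 2 by (intro nash_irreducible_sqrt[OF irr _ _ pD S(2) Dpos sq] poly_fun_intros pc) auto
  thus ?thesis
  proof
    assume *: "\<forall>x\<in>S. N1 x * M2 x = (M1 x * c x) * sqrt (D x)"
    have "Ax (Y t) = 0" if t1: "t \<in> K1" for t
    proof -
      have t: "t \<in> K" using t1 K12 by blast
      have "N1 (Y t) * M2 (Y t) = (M1 (Y t) * c (Y t)) * sqrt (D (Y t))" using * Y_in_S[OF t] by blast
      hence "M1 (Y t) * c (Y t) * \<beta> t * M2 (Y t) = (M1 (Y t) * c (Y t)) * (M2 (Y t) * (- \<beta> t))"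
        unfolding N1[OF t] sD[OF t] using \<beta>1[OF t1] by simp
      hence "M1 (Y t) * M2 (Y t) * \<beta> t * c (Y t) = 0" by (simp add: mult_ac)
      hence "c (Y t) = 0" using M[OF t] \<beta>1[OF t1] by simp
      thus ?thesis by (simp add: c_def)
    qed
    thus ?thesis by blast
  next
    assume *: "\<forall>x\<in>S. N1 x * M2 x = - (M1 x * c x) * sqrt (D x)"
    have "Ax (Y t) = 0" if t2: "t \<in> K2" for t
    proof -
      have t: "t \<in> K" using t2 K12 by blast
      have "N1 (Y t) * M2 (Y t) = - (M1 (Y t) * c (Y t)) * sqrt (D (Y t))" using * Y_in_S[OF t] by blast
      hence "M1 (Y t) * c (Y t) * \<beta> t * M2 (Y t) = - (M1 (Y t) * c (Y t)) * (M2 (Y t) * \<beta> t)"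
        unfolding N1[OF t] sD[OF t] using \<beta>2[OF t2] by simp
      hence "M1 (Y t) * M2 (Y t) * \<beta> t * c (Y t) = 0" by (simp add: mult_ac)
      hence "c (Y t) = 0" using M[OF t] \<beta>2[OF t2] by simp
      thus ?thesis by (simp add: c_def)
    qed
    thus ?thesis by blast
  qed
qed

text \<open>Take the component of the parameter set through a point where \<open>Ax\<close> is
  nonzero. Any other parameter is separated from it by a gap, so it lies in the finite zero set of
  \<open>Ax\<close>. A point of \<open>S\<close> reached only by such parameters would be isolated
  in \<open>S\<close>.\<close>

lemma interval_parametrization:
  assumes irr: "nash_irreducible m S" and inf: "infinite S"
  shows "\<exists>\<alpha> \<beta>. \<alpha> \<le> \<beta> \<and> {\<alpha>..\<beta>} \<subseteq> K \<and> S = Y ` {\<alpha>..\<beta>}"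
proof -
  define Z where "Z = {t \<in> K. Ax (Y t) = 0}"
  have fZ: "finite Z" unfolding Z_def by (rule finite_Ax_zeros)
  have "infinite K" by (metis S_eq finite_imageI inf)
  hence "K - Z \<noteq> {}" using fZ by (metis Diff_eq_empty_iff finite_subset)
  then obtain t0 where t0: "t0 \<in> K" "Ax (Y t0) \<noteq> 0" unfolding Z_def by blast
  define C where "C = connected_component_set K t0"
  have cC: "connected C" "closed C" "C \<subseteq> K" "t0 \<in> C"
    unfolding C_def using closed_connected_component[OF compact_imp_closed[OF compact_K]] t0(1)
    by (auto simp: connected_component_subset)
  have "compact C" using cC compact_K by (meson closed_subset compact_Int_closed inf.absorb_iff2 compact_eq_bounded_closed bounded_subset)
  with cC(1) obtain \<alpha> \<beta> where C: "C = {\<alpha>..\<beta>}" using connected_compact_interval_1 by (metis)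
  have split: "s \<notin> K \<Longrightarrow> (\<forall>t\<in>K \<inter> {..s}. Ax (Y t) = 0) \<or> (\<forall>t\<in>K \<inter> {s..}. Ax (Y t) = 0)" for s
  proof -
    assume s: "s \<notin> K"
    show ?thesis
    proof (rule clopen_split[OF irr])
      show "K \<inter> {..s} \<inter> (K \<inter> {s..}) = {}" using s by (auto dest: order_antisym)
      show "compact (K \<inter> {..s})" "compact (K \<inter> {s..})" using compact_K by (intro compact_Int_closed; simp)+
    qed auto
  qed
  have KC: "K - C \<subseteq> Z"
  proof
    fix k assume k: "k \<in> K - C"
    have nsub: "\<not> closed_segment k t0 \<subseteq> K"
    proof
      assume "closed_segment k t0 \<subseteq> K"
      hence "closed_segment k t0 \<subseteq> C" unfolding C_def
        by (intro connected_component_maximal) auto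
      thus False using k by auto
    qed
    show "k \<in> Z"
    proof (cases "k \<le> t0")
      case True
      then obtain s where "s \<in> {k..t0}" "s \<notin> K" using nsub by (auto simp: closed_segment_eq_real_ivl subset_iff)
      thus ?thesis using split[of s] k t0 unfolding Z_def by auto
    next
      case False
      then obtain s where "s \<in> {t0..k}" "s \<notin> K" using nsub by (auto simp: closed_segment_eq_real_ivl subset_iff)
      thus ?thesis using split[of s] k t0 unfolding Z_def by auto
    qed
  qed
  have "S \<subseteq> Y ` C"
  proof
    fix p assume p: "p \<in> S"
    show "p \<in> Y ` C"
    proof (rule ccontr)
      assume np: "p \<notin> Y ` C"
      define F where "F = Y ` (K - C) - {p}"
      have "finite F" unfolding F_def using finite_subset[OF KC fZ] by simp
      moreover have "compact (Y ` C)" using continuous_on_subset[OF continuous_Y cC(3)] \<open>compact C\<close> by (rule compact_continuous_image)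
      ultimately have "closed (Y ` C \<union> F)" by (simp add: closed_Un compact_imp_closed finite_imp_compact)
      hence "open (- (Y ` C \<union> F))" by (rule open_Compl)
      moreover have "S \<inter> - (Y ` C \<union> F) = {p}" using p np S_eq by (auto simp: F_def)
      ultimately have "S = {p}" by (rule isolated_point_irreducible[OF irr S])
      thus False using inf by simp
    qed
  qed
  hence "S = Y ` C" using cC(3) S_eq by blast
  thus ?thesis using C cC(3,4) by (intro exI[of _ \<alpha>] exI[of _ \<beta>]) auto
qed

lemma regular_image_chart:
  assumes irr: "nash_irreducible m S" and inf: "infinite S"
  shows "regular_image 1 m (closed_ball_n 1) S"
proof -
  obtain \<alpha> \<beta> where ab': "\<alpha> \<le> \<beta>" "{\<alpha>..\<beta>} \<subseteq> K" "S = Y ` {\<alpha>..\<beta>}" using interval_parametrization[OF assms] by blast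
  define h where "h = (\<lambda>t. (\<alpha> + \<beta>) / 2 + t * ((\<beta> - \<alpha>) / 2))"
  have img: "h ` {-1..1} = {\<alpha>..\<beta>}"
  proof
    show "h ` {-1..1} \<subseteq> {\<alpha>..\<beta>}"
    proof (rule image_subsetI)
      fix t :: real assume "t \<in> {-1..1}"
      hence "- 1 * ((\<beta> - \<alpha>) / 2) \<le> t * ((\<beta> - \<alpha>) / 2)" "t * ((\<beta> - \<alpha>) / 2) \<le> 1 * ((\<beta> - \<alpha>) / 2)"
        using ab'(1) by (intro mult_right_mono; simp)+
      thus "h t \<in> {\<alpha>..\<beta>}" by (simp add: h_def field_simps)
    qed
    show "{\<alpha>..\<beta>} \<subseteq> h ` {-1..1}"
    proof
      fix x assume x: "x \<in> {\<alpha>..\<beta>}"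
      show "x \<in> h ` {-1..1}"
      proof (cases "\<alpha> = \<beta>")
        case True thus ?thesis using x by (intro image_eqI[of _ _ 0]) (auto simp: h_def)
      next
        case False
        hence "0 < \<beta> - \<alpha>" using ab'(1) by simp
        hence 0: "(2 * x - \<alpha> - \<beta>) / (\<beta> - \<alpha>) * ((\<beta> - \<alpha>) / 2) = (2 * x - \<alpha> - \<beta>) / 2" by simp
        have "x = h ((2 * x - \<alpha> - \<beta>) / (\<beta> - \<alpha>))" unfolding h_def 0 by (simp add: field_simps)
        moreover have "(2 * x - \<alpha> - \<beta>) / (\<beta> - \<alpha>) \<in> {-1..1}"
          using x \<open>0 < \<beta> - \<alpha>\<close> by (simp add: divide_le_eq le_divide_eq)
        ultimately show ?thesis by blast
      qed
    qed
  qed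
  show ?thesis
  proof (rule regular_image_param[OF binary_forms_axioms, where z = "\<lambda>t. zl (h t)"])
    show "poly_fun 1 (\<lambda>x. zl (h (x 0)) i)" for i
      unfolding zl_def h_def by (intro poly_fun_intros) simp
    show "\<phi> 0 (zl (h t)) \<noteq> 0" if "t \<in> {-1..1}" for t
      using img ab'(2) that by (auto simp: K_def inS_def)
    show "S = (\<lambda>t i. if i < m then \<phi> (Suc i) (zl (h t)) / \<phi> 0 (zl (h t)) else 0) ` {-1..1}"
      unfolding ab'(3) img[symmetric] by (simp add: image_image Y_def aff_def)
  qed
qed

end

section \<open>From a rational Zariski closure to a regular image of the interval\<close>

lemma semialg_subset_Rn: "semialg k X \<Longrightarrow> X \<subseteq> Rn k"
  by (induction rule: semialg.induct) auto

lemma parallel_2: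
  assumes "z \<in> Rn 2" "z \<noteq> (\<lambda>_. 0)" "w \<in> Rn 2" "w \<noteq> (\<lambda>_. 0)" and c: "w 0 * z 1 = w 1 * z 0"
  shows "\<exists>s. s \<noteq> 0 \<and> z = (\<lambda>i. s * w i)"
proof -
  have ze: "z = emb2 (z 0) (z 1)" and we: "w = emb2 (w 0) (w 1)" using Rn2_emb2 assms by blast+
  have zn: "z 0 \<noteq> 0 \<or> z 1 \<noteq> 0" using ze assms(2) emb2_eq_0_iff by metis
  have wn: "w 0 \<noteq> 0 \<or> w 1 \<noteq> 0" using we assms(4) emb2_eq_0_iff by metis
  have "\<exists>s. s \<noteq> 0 \<and> z 0 = s * w 0 \<and> z 1 = s * w 1"
  proof (cases "w 0 = 0")
    case True
    hence "z 0 = 0" "w 1 \<noteq> 0" "z 1 \<noteq> 0" using c wn zn by auto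
    thus ?thesis using True by (intro exI[of _ "z 1 / w 1"]) simp
  next
    case False
    have "z 1 = z 0 / w 0 * w 1" using False c by (simp add: field_simps)
    moreover have "z 0 \<noteq> 0" using False c zn by auto
    ultimately show ?thesis using False by (intro exI[of _ "z 0 / w 0"]) simp
  qed
  then obtain s where s: "s \<noteq> 0" "z 0 = s * w 0" "z 1 = s * w 1" by blast
  have "z i = s * w i" for i
  proof -
    consider "i = 0" | "i = 1" | "2 \<le> i" by linarith
    thus ?thesis using s assms(1,3) by cases (auto simp: Rn_def)
  qed
  thus ?thesis using s(1) by blast
qed

text \<open>The curve \<open>(1 - 2t\<^sup>2, t)\<close>, \<open>-1 \<le> t \<le> 1\<close>, meets every line through the origin.\<close>
lemma parabola_covers:
  assumes "z \<in> Rn 2" "z \<noteq> (\<lambda>_. 0)"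
  shows "\<exists>t\<in>{-1..1}. \<exists>s. s \<noteq> 0 \<and> z = (\<lambda>i. s * emb2 (1 - 2 * t\<^sup>2) t i)"
proof -
  define g where "g = (\<lambda>t. (1 - 2 * t\<^sup>2) * z 1 - t * z 0)"
  have cg: "continuous_on A g" for A unfolding g_def by (intro continuous_intros)
  have "\<exists>t\<in>{-1..1}. g t = 0"
  \<comment> \<open>The values at t = -1, 0, 1 are \<open>z 0 - z 1\<close>, \<open>z 1\<close> and
    \<open>- z 1 - z 0\<close>; the sign of the product decides on which half the sign
    changes.\<close>
  proof (cases "0 \<le> z 0 * z 1")
    case True
    have "g 1 = - z 1 - z 0" "g 0 = z 1" by (simp_all add: g_def)
    then consider "g 0 \<le> 0 \<and> 0 \<le> g 1" | "g 1 \<le> 0 \<and> 0 \<le> g 0" using True by (auto simp: zero_le_mult_iff)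
    thus ?thesis
    proof cases
      case 1
      hence "\<exists>t. 0 \<le> t \<and> t \<le> 1 \<and> g t = 0" by (intro IVT') (use cg in auto)
      thus ?thesis by force
    next
      case 2
      hence "\<exists>t. 0 \<le> t \<and> t \<le> 1 \<and> g t = 0" by (intro IVT2') (use cg in auto)
      thus ?thesis by force
    qed
  next
    case False
    have "g (-1) = - z 1 + z 0" "g 0 = z 1" by (simp_all add: g_def)
    then consider "g (-1) \<le> 0 \<and> 0 \<le> g 0" | "g 0 \<le> 0 \<and> 0 \<le> g (-1)" using False by (auto simp: zero_le_mult_iff)
    thus ?thesis
    proof cases
      case 1
      hence "\<exists>t. -1 \<le> t \<and> t \<le> 0 \<and> g t = 0" by (intro IVT') (use cg in auto)
      thus ?thesis by force
    next
      case 2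
      hence "\<exists>t. -1 \<le> t \<and> t \<le> 0 \<and> g t = 0" by (intro IVT2') (use cg in auto)
      thus ?thesis by force
    qed
  qed
  then obtain t where t: "t \<in> {-1..1}" "g t = 0" by blast
  have "emb2 (1 - 2 * t\<^sup>2) t \<noteq> (\<lambda>_. 0)" unfolding emb2_eq_0_iff by auto
  from parallel_2[OF assms emb2_Rn this] t show ?thesis by (auto simp: g_def mult_ac)
qed

text \<open>The points of \<open>S\<close> off the compact parametrized curve form an open part of
  \<open>S\<close>. An arc in it would consist of points at which the closure has local dimension 1,
  and these lie on the curve; an isolated point is excluded by irreducibility.\<close>

lemma rational_curve_cover:
  assumes sa: "semialg m S" and dim: "dim_eq S 1" and irr: "nash_irreducible m S" and cp: "compact S"
    and bf: "binary_forms (Suc m) d \<phi>"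
    and C: "proj_dim_eq (Suc m) (zar_closure_proj m S) 1"
      "proj_local_dim_set (Suc m) (zar_closure_proj m S) 1 = binary_forms.cone (Suc m) \<phi>"
    and x: "x \<in> S"
  shows "hom_emb m x \<in> binary_forms.cone (Suc m) \<phi>"
proof (rule ccontr)
  interpret binary_forms "Suc m" d \<phi> by (rule bf)
  assume no: "hom_emb m x \<notin> cone"
  have SR: "S \<subseteq> Rn m" using sa semialg_subset_Rn by blast
  have nz: "hom_emb m y \<noteq> (\<lambda>_. 0)" for y using hom_emb_simps(1)[of m y] by (metis zero_neq_one)
  have iff: "nrm m y \<in> sph_sec (Suc m) cone \<longleftrightarrow> hom_emb m y \<in> cone" for y
    unfolding nrm_def by (rule cone_iff_normalize[OF hom_emb_Rn nz])
  define V where "V = - (nrm m -` sph_sec (Suc m) cone)"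
  have V: "open V" unfolding V_def
    using closed_vimage[OF compact_imp_closed[OF compact_cone_section] continuous_nrm] by (rule open_Compl)
  have "x \<in> S \<inter> V" using x no iff by (simp add: V_def)
  hence "has_isolated_point (S \<inter> V) \<or> contains_arc (S \<inter> V)" by (intro arc_or_isolated[OF sa V]) auto
  thus False
  proof
    assume "has_isolated_point (S \<inter> V)"
    then obtain p U where U: "open U" "S \<inter> V \<inter> U = {p}" unfolding has_isolated_point_def by blast
    have "S = {p}"
      by (rule isolated_point_irreducible[OF irr cp SR open_Int[OF V U(1)]]) (use U(2) in \<open>simp add: Int_assoc\<close>)
    moreover have "contains_arc S" using dim dim_ge_imp_contains_arc by (simp add: dim_eq_def)
    ultimately show False using contains_arc_infinite by (metis finite.emptyI finite_insert)
  next
    assume "contains_arc (S \<inter> V)"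
    then obtain c a b where c: "a < b" "continuous_on {a..b} c" "inj_on c {a..b::real}" "c ` {a..b} \<subseteq> S \<inter> V"
      unfolding contains_arc_def by blast
    define t0 where "t0 = (a + b) / 2"
    have t0: "t0 \<in> {a<..<b}" "t0 \<in> {a..b}" using c(1) by (auto simp: t0_def)
    let ?C = "zar_closure_proj m S"
    have cS: "c t \<in> S" if "t \<in> {a..b}" for t using c(4) that by blast
    have cn: "continuous_on {a..b} (\<lambda>t. nrm m (c t))"
      by (rule continuous_on_compose2[OF continuous_nrm[of UNIV] c(2)]) auto
    have inj: "inj_on (\<lambda>t. nrm m (c t)) {a..b}"
      using c(3) cS SR by (auto simp: inj_on_def dest!: nrm_inj[rotated 2])
    have "nrm m (c t0) \<in> local_dim_set (sph_sec (Suc m) ?C) 1"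
      unfolding local_dim_set_def
    proof (intro CollectI conjI allI impI)
      show "nrm m (c t0) \<in> sph_sec (Suc m) ?C" using nrm_in_section cS t0 by blast
      show "dim_ge (sph_sec (Suc m) ?C \<inter> U) 1" if "open U \<and> nrm m (c t0) \<in> U" for U
        by (rule contains_arc_imp_dim_ge, rule subarc_in_open[OF c(1) cn inj t0(1)])
           (use that nrm_in_section cS in auto)
      show "\<exists>U. open U \<and> nrm m (c t0) \<in> U \<and> \<not> dim_ge (sph_sec (Suc m) ?C \<inter> U) (Suc 1)"
        using C(1) by (intro exI[of _ UNIV]) (simp add: proj_dim_eq_def dim_eq_def)
    qed
    moreover have "hom_emb m (c t0) \<in> ?C" using zar_closure_contains cS t0 by blast
    ultimately have "hom_emb m (c t0) \<in> proj_local_dim_set (Suc m) ?C 1"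
      by (simp add: proj_local_dim_set_def nrm_def)
    hence "c t0 \<notin> V" using C(2) iff by (simp add: V_def)
    thus False using c(4) t0 by blast
  qed
qed

text \<open>If some parameter point misses \<open>S\<close>, it is put at infinity and the chart
  applies. Otherwise \<open>S\<close> is the image of the whole projective line, no such chart
  exists, and the parabola of \<open>parabola_covers\<close> replaces it.\<close>

lemma regular_image_of_rational_curve:
  assumes sa: "semialg m S" and dim: "dim_eq S 1" and irr: "nash_irreducible m S" and cp: "compact S"
    and rc: "real_rational_curve (Suc m) (zar_closure_proj m S)"
  shows "regular_image 1 m (closed_ball_n 1) S"
proof -
  let ?C = "zar_closure_proj m S"
  have pd: "proj_dim_eq (Suc m) ?C 1" using rc by (simp add: real_rational_curve_def)
  have ex: "\<exists>\<phi> d. (\<forall>i<Suc m. homog_poly 2 d (\<phi> i))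
          \<and> (\<forall>z\<in>Rn 2. z \<noteq> (\<lambda>_. 0) \<longrightarrow> (\<exists>i<Suc m. \<phi> i z \<noteq> 0))
          \<and> (let \<Phi> = (\<lambda>z. \<lambda>i. if i < Suc m then \<phi> i z else 0) in
              (\<exists>a b e. homog_poly (Suc m) e a \<and> homog_poly (Suc m) e b
                 \<and> (\<forall>z\<in>Rn 2. a (\<Phi> z) * z 1 = b (\<Phi> z) * z 0)
                 \<and> (\<exists>z\<in>Rn 2. a (\<Phi> z) \<noteq> 0 \<or> b (\<Phi> z) \<noteq> 0))
            \<and> proj_local_dim_set (Suc m) ?C 1
                = {y. \<exists>c z. c \<noteq> 0 \<and> z \<in> Rn 2 \<and> z \<noteq> (\<lambda>_. 0) \<and> y = (\<lambda>i. c * \<Phi> z i)})"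
    using rc unfolding real_rational_curve_def by (elim conjE)
  obtain \<phi> d where \<phi>: "\<forall>i<Suc m. homog_poly 2 d (\<phi> i)" "\<forall>z\<in>Rn 2. z \<noteq> (\<lambda>_. 0) \<longrightarrow> (\<exists>i<Suc m. \<phi> i z \<noteq> 0)"
    and rest: "let \<Phi> = (\<lambda>z. \<lambda>i. if i < Suc m then \<phi> i z else 0) in
              (\<exists>a b e. homog_poly (Suc m) e a \<and> homog_poly (Suc m) e b
                 \<and> (\<forall>z\<in>Rn 2. a (\<Phi> z) * z 1 = b (\<Phi> z) * z 0)
                 \<and> (\<exists>z\<in>Rn 2. a (\<Phi> z) \<noteq> 0 \<or> b (\<Phi> z) \<noteq> 0))
            \<and> proj_local_dim_set (Suc m) ?C 1
                = {y. \<exists>c z. c \<noteq> 0 \<and> z \<in> Rn 2 \<and> z \<noteq> (\<lambda>_. 0) \<and> y = (\<lambda>i. c * \<Phi> z i)}"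
    using ex by (elim exE conjE)
  interpret binary_forms "Suc m" d \<phi> using \<phi> by unfold_locales
  have \<Phi>e: "(\<lambda>z. \<lambda>i. if i < Suc m then \<phi> i z else 0) = \<Phi>" by (simp add: \<Phi>_def fun_eq_iff)
  note rest' = rest[unfolded \<Phi>e Let_def]
  have C: "proj_local_dim_set (Suc m) ?C 1 = cone" using rest' by (simp add: cone_def)
  obtain a b e where ab: "homog_poly (Suc m) e a" "homog_poly (Suc m) e b"
    "\<forall>z\<in>Rn 2. a (\<Phi> z) * z 1 = b (\<Phi> z) * z 0" "\<exists>z\<in>Rn 2. a (\<Phi> z) \<noteq> 0 \<or> b (\<Phi> z) \<noteq> 0"
    using conjunct1[OF rest'] by (elim exE conjE)
  have cover: "\<forall>x\<in>S. hom_emb m x \<in> cone"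
    using rational_curve_cover[OF sa dim irr cp binary_forms_axioms pd C] by blast
  have SR: "S \<subseteq> Rn m" using sa semialg_subset_Rn by blast
  have inf: "infinite S" using dim dim_ge_imp_contains_arc contains_arc_infinite by (auto simp: dim_eq_def)
  let ?aff = "\<lambda>z i. if i < m then \<phi> (Suc i) z / \<phi> 0 z else 0"
  show ?thesis
  proof (cases "\<forall>z\<in>Rn 2. z \<noteq> (\<lambda>_. 0) \<longrightarrow> \<phi> 0 z \<noteq> 0 \<and> ?aff z \<in> S")
    case True
    define w where "w = (\<lambda>t::real. emb2 (1 - 2 * t\<^sup>2) t)"
    have w: "w t \<in> Rn 2" "w t \<noteq> (\<lambda>_. 0)" for t
      unfolding w_def emb2_eq_0_iff by (auto intro: emb2_Rn)
    show ?thesis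
    proof (rule regular_image_param[OF binary_forms_axioms, where z = w])
      show "poly_fun 1 (\<lambda>x. w (x 0) i)" if "i < 2" for i
      proof -
        have "poly_fun 1 (\<lambda>x. 1 - 2 * (x 0)\<^sup>2)" "poly_fun 1 (\<lambda>x. x 0)" by (intro poly_fun_intros; simp)+
        moreover have "i = 0 \<or> i = 1" using that by auto
        ultimately show ?thesis by (auto simp: w_def)
      qed
      show "\<phi> 0 (w t) \<noteq> 0" for t using True w by blast
      show "S = (\<lambda>t i. if i < m then \<phi> (Suc i) (w t) / \<phi> 0 (w t) else 0) ` {-1..1}"
      proof
        show "(\<lambda>t i. if i < m then \<phi> (Suc i) (w t) / \<phi> 0 (w t) else 0) ` {-1..1} \<subseteq> S"
          using True w by blast
        show "S \<subseteq> (\<lambda>t i. if i < m then \<phi> (Suc i) (w t) / \<phi> 0 (w t) else 0) ` {-1..1}"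
        proof
          fix x assume x: "x \<in> S"
          obtain c z where z: "c \<noteq> 0" "z \<in> Rn 2" "z \<noteq> (\<lambda>_. 0)" "hom_emb m x = (\<lambda>i. c * \<Phi> z i)"
            using cover x unfolding cone_def by blast
          obtain t s where t: "t \<in> {-1..1}" "s \<noteq> 0" "z = (\<lambda>i. s * w t i)"
            using parabola_covers[OF z(2,3)] unfolding w_def by blast
          define c' where "c' = c * s ^ d"
          have h: "hom_emb m x i = c' * \<Phi> (w t) i" for i
            using fun_cong[OF z(4), of i] \<Phi>_scale[OF w(1)] by (simp add: t(3) c'_def)
          have c'0: "c' * \<phi> 0 (w t) = 1" using h[of 0] by (simp add: \<Phi>_def)
          have "x = ?aff (w t)"
          proof
            fix i show "x i = ?aff (w t) i"
            proof (cases "i < m")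
              case True
              have "\<phi> 0 (w t) \<noteq> 0" "c' \<noteq> 0" using c'0 by auto
              moreover have "x i = c' * \<phi> (Suc i) (w t)" using h[of "Suc i"] True by (simp add: \<Phi>_def)
              moreover have "c' = 1 / \<phi> 0 (w t)" using c'0 \<open>\<phi> 0 (w t) \<noteq> 0\<close> by (simp add: field_simps)
              ultimately show ?thesis using True by simp
            next
              case False thus ?thesis using x SR by (auto simp: Rn_def)
            qed
          qed
          thus "x \<in> (\<lambda>t i. if i < m then \<phi> (Suc i) (w t) / \<phi> 0 (w t) else 0) ` {-1..1}" using t(1) by blast
        qed
      qed
    qed
  next
    case False
    then obtain u0 where u0: "u0 \<in> Rn 2" "u0 \<noteq> (\<lambda>_. 0)" "\<phi> 0 u0 = 0 \<or> ?aff u0 \<notin> S" by blast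
    interpret line_chart m d \<phi> S u0 "emb2 (- u0 1) (u0 0)" a b e
      by unfold_locales (use cp SR u0 ab cover in auto)
    show ?thesis by (rule regular_image_chart[OF irr inf])
  qed
qed

section \<open>From regular to regulous images and from the interval to the circle\<close>

lemma regular_imp_regulous:
  assumes T: "T \<subseteq> Rn n" and r: "regular_image n m T S"
  shows "regulous_image n m T S"
proof -
  obtain g h where gh: "rat_map n m g h" "\<forall>i<m. \<forall>x\<in>T. h i x \<noteq> 0"
    "S = (\<lambda>x. \<lambda>i. if i < m then g i x / h i x else 0) ` T" using r unfolding regular_image_def by blast
  define F where "F = (\<lambda>x. \<lambda>i. if i < m then g i x / h i x else 0)"
  have pf: "poly_fun n (g i)" "poly_fun n (h i)" if "i < m" for i using gh(1) that by (auto simp: rat_map_def)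
  have "T \<subseteq> rat_dom n m g h"
  proof
    fix x assume x: "x \<in> T"
    have "\<exists>g' h'. rat_repr n (g i) (h i) g' h' \<and> h' x \<noteq> 0" if "i < m" for i
      using pf[OF that] gh(2) that x by (intro exI[of _ "g i"] exI[of _ "h i"]) (auto simp: rat_repr_def)
    thus "x \<in> rat_dom n m g h" using x T by (auto simp: rat_dom_def)
  qed
  hence 1: "T \<subseteq> closure (T \<inter> rat_dom n m g h)" by (metis Int_absorb2 closure_subset)
  have "continuous_on T (\<lambda>x. F x i)" for i
    unfolding F_def by (cases "i < m")
      (auto intro!: continuous_on_divide poly_fun_continuous[OF pf(1)] poly_fun_continuous[OF pf(2)] simp: gh(2))
  hence 2: "continuous_on T F" by (rule continuous_on_coordinatewise_then_product)
  have 3: "\<forall>x\<in>T. F x \<in> Rn m" by (simp add: F_def Rn_def)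
  have 4: "F x i = g' x / h' x" if "x \<in> T" "i < m" "rat_repr n (g i) (h i) g' h'" "h' x \<noteq> 0" for x i g' h'
    using that gh(2) T by (auto simp: F_def rat_repr_def frac_eq_eq subset_iff)
  show ?thesis unfolding regulous_image_def
    by (intro exI[of _ g] exI[of _ h] exI[of _ F] conjI gh(1) 1 2 3) (use 4 gh(3) in \<open>auto simp: F_def\<close>)
qed

text \<open>Composition with the first coordinate, which maps the circle onto the interval.\<close>

lemma regular_image_circle:
  assumes "regular_image 1 m (closed_ball_n 1) S"
  shows "regular_image 2 m (sphere_n 1) S"
proof -
  obtain g h where gh: "rat_map 1 m g h" "\<forall>i<m. \<forall>x\<in>closed_ball_n 1. h i x \<noteq> 0"
    "S = (\<lambda>x. \<lambda>i. if i < m then g i x / h i x else 0) ` closed_ball_n 1" using assms unfolding regular_image_def by blast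
  let ?e = "\<lambda>x::pt. emb1 (x 0)"
  have B: "x \<in> closed_ball_n 1 \<longleftrightarrow> x \<in> Rn 1 \<and> (x 0)\<^sup>2 \<le> 1" for x
    unfolding closed_ball_n_def sqnorm_def by simp
  have Sp: "x \<in> sphere_n 1 \<longleftrightarrow> x \<in> Rn 2 \<and> (x 0)\<^sup>2 + (x 1)\<^sup>2 = 1" for x
    unfolding sphere_n_def sqnorm_def One_nat_def Suc_1[symmetric] lessThan_Suc by (simp add: add.commute)
  have e: "?e ` sphere_n 1 = closed_ball_n 1"
  proof
    show "?e ` sphere_n 1 \<subseteq> closed_ball_n 1"
    proof (rule image_subsetI)
      fix x assume "x \<in> sphere_n 1"
      hence "(x 0)\<^sup>2 + (x 1)\<^sup>2 = 1" unfolding Sp by blast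
      hence "(x 0)\<^sup>2 \<le> 1" using zero_le_power2[of "x 1"] by linarith
      thus "?e x \<in> closed_ball_n 1" unfolding B emb1_simps using emb1_Rn by blast
    qed
    show "closed_ball_n 1 \<subseteq> ?e ` sphere_n 1"
    proof
      fix x assume x: "x \<in> closed_ball_n 1"
      hence "x \<in> Rn 1" "(x 0)\<^sup>2 \<le> 1" unfolding B by blast+
      hence "(x 0)\<^sup>2 + (sqrt (1 - (x 0)\<^sup>2))\<^sup>2 = 1" by simp
      hence "emb2 (x 0) (sqrt (1 - (x 0)\<^sup>2)) \<in> sphere_n 1" unfolding Sp emb2_simps using emb2_Rn by blast
      moreover have "x = ?e (emb2 (x 0) (sqrt (1 - (x 0)\<^sup>2)))" using Rn1_emb1[OF \<open>x \<in> Rn 1\<close>] by simp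
      ultimately show "x \<in> ?e ` sphere_n 1" by blast
    qed
  qed
  have pe: "poly_fun 2 (\<lambda>x. p (?e x))" if "poly_fun 1 p" for p
    by (rule poly_fun_compose[OF that]) (auto intro: poly_fun_intros)
  show ?thesis unfolding regular_image_def
  proof (intro exI conjI)
    show "rat_map 2 m (\<lambda>i x. g i (?e x)) (\<lambda>i x. h i (?e x))"
      unfolding rat_map_def
    proof (intro allI impI conjI)
      fix i assume i: "i < m"
      thus "poly_fun 2 (\<lambda>x. g i (?e x))" "poly_fun 2 (\<lambda>x. h i (?e x))"
        using gh(1) by (auto simp: rat_map_def intro!: pe)
      obtain x where x: "x \<in> Rn 1" "h i x \<noteq> 0" using gh(1) i unfolding rat_map_def by blast
      hence "h i (?e (emb2 (x 0) 0)) \<noteq> 0" using Rn1_emb1[OF x(1)] by simp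
      thus "\<exists>x\<in>Rn 2. h i (?e x) \<noteq> 0" using emb2_Rn by blast
    qed
    show "\<forall>i<m. \<forall>x\<in>sphere_n 1. h i (?e x) \<noteq> 0" using gh(2) e by blast
    show "S = (\<lambda>x. \<lambda>i. if i < m then g i (?e x) / h i (?e x) else 0) ` sphere_n 1"
      unfolding gh(3) e[symmetric] image_image ..
  qed
qed

section \<open>Regulous images\<close>

definition line :: "pt \<Rightarrow> pt \<Rightarrow> real \<Rightarrow> pt" where
  "line p q t = (\<lambda>i. p i + t * (q i - p i))"

lemma line_simps [simp]: "line p q 0 = p" "line p q 1 = q"
  by (simp_all add: line_def)

lemma line_Rn: "p \<in> Rn n \<Longrightarrow> q \<in> Rn n \<Longrightarrow> line p q t \<in> Rn n"
  by (simp add: line_def Rn_def)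

lemma continuous_line: "continuous_on A (line p q)"
  unfolding line_def by (intro continuous_on_coordinatewise_then_product continuous_intros)

lemma poly_fun_on_line:
  assumes "poly_fun n f"
  shows "\<exists>P::real poly. \<forall>t. poly P t = f (line p q t)"
proof -
  obtain R where R: "\<forall>t. f (\<lambda>i. poly [:p i, q i - p i:] t) = poly R t"
    using poly_fun_compose_poly[OF assms, of "\<lambda>i. [:p i, q i - p i:]"] by blast
  thus ?thesis by (intro exI[of _ R]) (simp add: line_def)
qed

lemma zero_at_limit:
  fixes f :: "real \<Rightarrow> real"
  assumes f: "continuous_on UNIV f" and P: "(P::real poly) \<noteq> 0" and z: "\<And>t. poly P t \<noteq> 0 \<Longrightarrow> f t = 0"
  shows "f t0 = 0"
proof (rule ccontr)
  assume "f t0 \<noteq> 0"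
  moreover have "open {t. f t \<noteq> 0}" using open_Collect_neq[OF f continuous_on_const[of _ 0]] .
  ultimately obtain e where e: "0 < e" "ball t0 e \<subseteq> {t. f t \<noteq> 0}" using open_contains_ball by blast
  have "{t0<..<t0 + e} \<subseteq> {t. f t \<noteq> 0}" by (rule subset_trans[OF _ e(2)]) (auto simp: ball_def dist_real_def)
  moreover have "infinite {t0<..<t0 + e}" using e(1) by (intro infinite_Ioo) simp
  ultimately have "infinite {t. f t \<noteq> 0}" using finite_subset by blast
  moreover have "{t. f t \<noteq> 0} \<subseteq> {t. poly P t = 0}" using z by blast
  ultimately show False using poly_roots_finite[OF P] finite_subset by blast
qed

lemma continuous_coord: "continuous_on A f \<Longrightarrow> continuous_on A (\<lambda>x. f x i)" for f :: "'a::topological_space \<Rightarrow> pt"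
  by (rule continuous_on_product_then_coordinatewise)

text \<open>On the line from \<open>x\<close> to \<open>x1\<close> the denominator is a nonzero
  polynomial, so continuity carries the identity over its finitely many zeros.\<close>

lemma rational_extension:
  assumes f: "continuous_on (Rn n) f" and pf: "poly_fun n D" "poly_fun n R"
    and D: "x1 \<in> Rn n" "D x1 \<noteq> 0" and eq: "\<And>x. x \<in> Rn n \<Longrightarrow> D x \<noteq> 0 \<Longrightarrow> f x * D x = R x"
    and x: "x \<in> Rn n"
  shows "f x * D x = (R x :: real)"
proof -
  obtain P where P: "\<forall>t. poly P t = D (line x x1 t)" using poly_fun_on_line[OF pf(1)] by blast
  have "P \<noteq> 0" using P[rule_format, of 1] D(2) by auto
  define F where "F = (\<lambda>t. f (line x x1 t) * D (line x x1 t) - R (line x x1 t))"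
  have l: "line x x1 t \<in> Rn n" for t using line_Rn[OF x D(1)] .
  have "continuous_on UNIV F" unfolding F_def
    by (intro continuous_intros continuous_on_compose2[OF f continuous_line]
        continuous_on_compose2[OF poly_fun_continuous[OF pf(1), of UNIV] continuous_line]
        continuous_on_compose2[OF poly_fun_continuous[OF pf(2), of UNIV] continuous_line])
       (use l in auto)
  from zero_at_limit[OF this \<open>P \<noteq> 0\<close>, of 0] have "F 0 = 0" using P eq[OF l] by (simp add: F_def)
  thus ?thesis by (simp add: F_def)
qed

lemma clear_denominators:
  assumes "poly_fun k p" and pf: "\<And>i. i < k \<Longrightarrow> poly_fun n (\<rho> i)" "poly_fun n w"
  shows "\<exists>N q. poly_fun n q \<and> (\<forall>x. w x \<noteq> 0 \<longrightarrow> p (\<lambda>i. \<rho> i x / w x) * w x ^ N = q x)"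
  using assms(1)
proof induction
  case (pf_const c)
  show ?case by (intro exI[of _ 0] exI[of _ "\<lambda>_. c"]) (auto intro: poly_fun.pf_const)
next
  case (pf_var i)
  thus ?case by (intro exI[of _ 1] exI[of _ "\<rho> i"]) (auto intro: pf)
next
  case (pf_add p q)
  then obtain N r M s where "poly_fun n r" "\<forall>x. w x \<noteq> 0 \<longrightarrow> p (\<lambda>i. \<rho> i x / w x) * w x ^ N = r x"
    "poly_fun n s" "\<forall>x. w x \<noteq> 0 \<longrightarrow> q (\<lambda>i. \<rho> i x / w x) * w x ^ M = s x" by blast
  thus ?case
    by (intro exI[of _ "N + M"] exI[of _ "\<lambda>x. r x * w x ^ M + s x * w x ^ N"] conjI poly_fun_intros pf)
      (auto simp: power_add algebra_simps)
next
  case (pf_mult p q)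
  then obtain N r M s where rs: "poly_fun n r" "\<forall>x. w x \<noteq> 0 \<longrightarrow> p (\<lambda>i. \<rho> i x / w x) * w x ^ N = r x"
    "poly_fun n s" "\<forall>x. w x \<noteq> 0 \<longrightarrow> q (\<lambda>i. \<rho> i x / w x) * w x ^ M = s x" by blast
  thus ?case
  proof (intro exI[of _ "N + M"] exI[of _ "\<lambda>x. r x * s x"] conjI poly_fun_intros allI impI)
    fix x assume x: "w x \<noteq> 0"
    have "p (\<lambda>i. \<rho> i x / w x) * q (\<lambda>i. \<rho> i x / w x) * w x ^ (N + M)
      = (p (\<lambda>i. \<rho> i x / w x) * w x ^ N) * (q (\<lambda>i. \<rho> i x / w x) * w x ^ M)"
      by (simp only: power_add mult_ac)
    with rs x show "p (\<lambda>i. \<rho> i x / w x) * q (\<lambda>i. \<rho> i x / w x) * w x ^ (N + M) = r x * s x" by simp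
  qed (use rs in auto)
qed

text \<open>A continuous curve with rational coordinates. The relation is stated without division
  because \<open>h\<close> may vanish; at its zeros the curve is determined by continuity.\<close>

locale rat_curve =
  fixes m :: nat and \<gamma> :: "real \<Rightarrow> pt" and h :: "real poly" and r :: "nat \<Rightarrow> real poly"
  assumes h: "h \<noteq> 0" and rel: "i < m \<Longrightarrow> \<gamma> t i * poly h t = poly (r i) t"
    and cont: "continuous_on UNIV \<gamma>" and \<gamma>_Rn: "\<gamma> t \<in> Rn m"

text \<open>If the denominator vanishes at \<open>t0\<close> then so does the numerator, and
  continuity allows the common linear factor to be cancelled. So a continuous rational function of
  one variable is regular, which fails in several variables and is why the arguments pass to
  lines.\<close>

lemma cancel_continuous:
  fixes f :: "real \<Rightarrow> real"
  assumes f: "continuous_on UNIV f"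
  shows "(h::real poly) \<noteq> 0 \<Longrightarrow> (\<forall>t. f t * poly h t = poly g t) \<Longrightarrow>
    \<exists>g1 h1::real poly. poly h1 t0 \<noteq> 0 \<and> (\<forall>t. f t * poly h1 t = poly g1 t)"
proof (induction "degree h" arbitrary: h g rule: less_induct)
  case less
  show ?case
  proof (cases "poly h t0 = 0")
    case False thus ?thesis using less.prems by blast
  next
    case True
    hence "poly g t0 = 0" using less.prems(2)[rule_format, of t0] by simp
    then obtain g' where g': "g = [:- t0, 1:] * g'" by (auto simp: poly_eq_0_iff_dvd elim: dvdE)
    obtain h' where h': "h = [:- t0, 1:] * h'" using True by (auto simp: poly_eq_0_iff_dvd elim: dvdE)
    have h'0: "h' \<noteq> 0" using h' less.prems(1) by auto
    have deg: "degree h' < degree h" unfolding h' using h'0 by (subst degree_mult_eq) auto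
    define F where "F = (\<lambda>t. f t * poly h' t - poly g' t)"
    have "continuous_on UNIV F" unfolding F_def by (intro continuous_intros f)
    moreover have "F t = 0" if "poly [:- t0, 1:] t \<noteq> 0" for t
    proof -
      have "(t - t0) * F t = 0"
        using less.prems(2)[rule_format, of t] unfolding g' h' F_def by (simp add: algebra_simps)
      thus ?thesis using that by simp
    qed
    ultimately have "F t = 0" for t using zero_at_limit[of F "[:- t0, 1:]" t] by simp
    hence "\<forall>t. f t * poly h' t = poly g' t" by (simp add: F_def)
    thus ?thesis using less.hyps[OF deg h'0] by blast
  qed
qed

context rat_curve
begin

lemma locally_powser:
  assumes "real_analytic_on m U f" "\<And>t. \<gamma> t \<in> U"
  shows "locally_powser (\<lambda>t. f (\<gamma> t))"
proof (rule locally_powser_compose[OF assms(1)])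
  show "\<gamma> t \<in> U" for t by fact
  show "\<gamma> t \<in> Rn m" for t by (rule \<gamma>_Rn)
  fix t0 i assume i: "i < m"
  have "\<forall>t. \<gamma> t i * poly h t = poly (r i) t" using rel[OF i] by blast
  from cancel_continuous[OF continuous_coord[OF cont] h this, of t0]
  obtain g1 h1 where 1: "poly h1 t0 \<noteq> 0" "\<forall>t. \<gamma> t i * poly h1 t = poly g1 t" by blast
  have "open {t. poly h1 t \<noteq> 0}" by (intro open_Collect_neq continuous_intros)
  then obtain e where e: "0 < e" "cball t0 e \<subseteq> {t. poly h1 t \<noteq> 0}"
    using 1(1) open_contains_cball by blast
  have "\<gamma> t i = poly g1 t / poly h1 t" if "\<bar>t - t0\<bar> \<le> e" for t
  proof -
    have "poly h1 t \<noteq> 0" using e(2) that by (auto simp: dist_real_def abs_minus_commute)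
    thus ?thesis using 1(2)[rule_format, of t] by (simp add: field_simps)
  qed
  thus "\<exists>G H. \<exists>e>0. poly H t0 \<noteq> 0 \<and> (\<forall>t. \<bar>t - t0\<bar> \<le> e \<longrightarrow> \<gamma> t i = poly G t / poly H t)"
    using 1(1) e(1) by blast
qed

end

text \<open>The common shape of regulous images of balls and spheres: a continuous map on an affine
  space with rational coordinates over one denominator \<open>D\<close>, which may have zeros.
  Affine spaces have the advantage that any two points are joined by a line.\<close>

locale rat_param =
  fixes n m :: nat and \<Gamma> :: "pt \<Rightarrow> pt" and D :: "pt \<Rightarrow> real"
    and R :: "nat \<Rightarrow> pt \<Rightarrow> real" and S :: "pt set"
  assumes pD: "poly_fun n D" and pR: "i < m \<Longrightarrow> poly_fun n (R i)" and D_nz: "\<exists>x\<in>Rn n. D x \<noteq> 0"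
    and rel: "x \<in> Rn n \<Longrightarrow> i < m \<Longrightarrow> \<Gamma> x i * D x = R i x"
    and cont: "continuous_on (Rn n) \<Gamma>" and \<Gamma>_Rn: "x \<in> Rn n \<Longrightarrow> \<Gamma> x \<in> Rn m" and S: "S = \<Gamma> ` Rn n"
begin

lemma rat_curve_on_line:
  assumes "p \<in> Rn n" "q \<in> Rn n" "D p \<noteq> 0 \<or> D q \<noteq> 0"
  shows "\<exists>h r. rat_curve m (\<lambda>t. \<Gamma> (line p q t)) h r"
proof -
  obtain h where h: "\<forall>t. poly h t = D (line p q t)" using poly_fun_on_line[OF pD] by blast
  have "\<forall>i\<in>{..<m}. \<exists>P::real poly. \<forall>t. poly P t = R i (line p q t)" using poly_fun_on_line[OF pR] by blast
  then obtain r where r: "\<forall>i\<in>{..<m}. \<forall>t. poly (r i) t = R i (line p q t)" using bchoice by (metis (no_types))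
  have l: "line p q t \<in> Rn n" for t using line_Rn[OF assms(1,2)] .
  have "rat_curve m (\<lambda>t. \<Gamma> (line p q t)) h r"
  proof
    show "h \<noteq> 0" using h[rule_format, of 0] h[rule_format, of 1] assms(3) by auto
    show "\<Gamma> (line p q t) i * poly h t = poly (r i) t" if "i < m" for i t
      using rel[OF l that] h r that by simp
    show "continuous_on UNIV (\<lambda>t. \<Gamma> (line p q t))"
      by (rule continuous_on_compose2[OF cont continuous_line]) (use l in auto)
  qed (rule \<Gamma>_Rn[OF l])
  thus ?thesis by blast
qed

text \<open>On the line to a point where \<open>D\<close> is nonzero, \<open>f\<close> stays nonzero
  at small positive times by analyticity, while \<open>D\<close> has only finitely many zeros
  there.\<close>

lemma nonzero_nearby:
  assumes f: "real_analytic_on m U f" "S \<subseteq> U" and x: "x \<in> Rn n" "f (\<Gamma> x) \<noteq> 0"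
  shows "\<exists>y\<in>Rn n. D y \<noteq> 0 \<and> f (\<Gamma> y) \<noteq> 0"
proof -
  obtain x1 where x1: "x1 \<in> Rn n" "D x1 \<noteq> 0" using D_nz by blast
  obtain h r where c: "rat_curve m (\<lambda>t. \<Gamma> (line x x1 t)) h r" using rat_curve_on_line[OF x(1) x1(1)] x1(2) by blast
  interpret c: rat_curve m "\<lambda>t. \<Gamma> (line x x1 t)" h r by (rule c)
  have l: "line x x1 t \<in> Rn n" for t using line_Rn[OF x(1) x1(1)] .
  have "locally_powser (\<lambda>t. f (\<Gamma> (line x x1 t)))"
    by (rule c.locally_powser[OF f(1)]) (use l S f(2) in auto)
  from locally_powser_cases[OF this, of 0]
  obtain s where s: "0 < s" "\<forall>t. t \<noteq> 0 \<and> \<bar>t\<bar> < s \<longrightarrow> f (\<Gamma> (line x x1 t)) \<noteq> 0"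
  proof
    assume "\<exists>s>0. \<forall>t. \<bar>t - 0\<bar> < s \<longrightarrow> f (\<Gamma> (line x x1 t)) = 0"
    hence "f (\<Gamma> (line x x1 0)) = 0" by (metis abs_zero diff_zero)
    thus ?thesis using x(2) by simp
  next
    assume "\<exists>s>0. \<forall>t. t \<noteq> 0 \<and> \<bar>t - 0\<bar> < s \<longrightarrow> f (\<Gamma> (line x x1 t)) \<noteq> 0"
    thus ?thesis using that by auto
  qed
  obtain P where P: "\<forall>t. poly P t = D (line x x1 t)" using poly_fun_on_line[OF pD] by blast
  have "P \<noteq> 0" using P[rule_format, of 1] x1(2) by auto
  have "infinite {0<..<s}" using s(1) by (rule infinite_Ioo)
  hence "\<not> {0<..<s} \<subseteq> {t. poly P t = 0}" using poly_roots_finite[OF \<open>P \<noteq> 0\<close>] finite_subset by blast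
  then obtain t where t: "t \<in> {0<..<s}" "poly P t \<noteq> 0" by blast
  hence "D (line x x1 t) \<noteq> 0" "f (\<Gamma> (line x x1 t)) \<noteq> 0" using P s(2) by auto
  thus ?thesis using l by blast
qed

text \<open>Join a point where the first function is nonzero to one where the second is. The first
  point is moved off the zeros of \<open>D\<close> so that the line carries a rational curve, along
  which two analytic functions of one variable have product zero.\<close>

lemma irreducible: "nash_irreducible m S"
  unfolding nash_irreducible_def
proof (intro conjI allI impI)
  show "S \<noteq> {}" using D_nz S by auto
  fix f g assume "nash_on m S f \<and> nash_on m S g \<and> (\<forall>x\<in>S. f x * g x = 0)"
  hence fg: "nash_on m S f" "nash_on m S g" "\<forall>x\<in>S. f x * g x = 0" by blast+
  obtain U F where F: "S \<subseteq> U" "real_analytic_on m U F" "\<forall>x\<in>S. F x = f x"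
    using fg(1) unfolding nash_on_def nash_on_open_def by blast
  obtain V G where G: "S \<subseteq> V" "real_analytic_on m V G" "\<forall>x\<in>S. G x = g x"
    using fg(2) unfolding nash_on_def nash_on_open_def by blast
  show "(\<forall>x\<in>S. f x = 0) \<or> (\<forall>x\<in>S. g x = 0)"
  proof (rule ccontr)
    assume "\<not> ?thesis"
    then obtain p q where pq: "p \<in> Rn n" "f (\<Gamma> p) \<noteq> 0" "q \<in> Rn n" "g (\<Gamma> q) \<noteq> 0" using S by auto
    have \<Gamma>S: "\<Gamma> x \<in> S" if "x \<in> Rn n" for x using that S by blast
    have "F (\<Gamma> p) \<noteq> 0" using F(3) \<Gamma>S pq by simp
    from nonzero_nearby[OF F(2,1) pq(1) this] obtain p' where p': "p' \<in> Rn n" "D p' \<noteq> 0" "F (\<Gamma> p') \<noteq> 0" by blast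
    obtain h r where c: "rat_curve m (\<lambda>t. \<Gamma> (line p' q t)) h r" using rat_curve_on_line[OF p'(1) pq(3)] p'(2) by blast
    interpret c: rat_curve m "\<lambda>t. \<Gamma> (line p' q t)" h r by (rule c)
    have l: "\<Gamma> (line p' q t) \<in> S" for t using line_Rn[OF p'(1) pq(3)] \<Gamma>S by blast
    have "locally_powser (\<lambda>t. F (\<Gamma> (line p' q t)))" "locally_powser (\<lambda>t. G (\<Gamma> (line p' q t)))"
      by (rule c.locally_powser[OF F(2)] c.locally_powser[OF G(2)]; use l F(1) G(1) in blast)+
    from locally_powser_mult_zero[OF this]
    have "(\<forall>t. F (\<Gamma> (line p' q t)) = 0) \<or> (\<forall>t. G (\<Gamma> (line p' q t)) = 0)" using F(3) G(3) fg(3) l by simp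
    hence "F (\<Gamma> (line p' q 0)) = 0 \<or> G (\<Gamma> (line p' q 1)) = 0" by blast
    thus False using p'(3) pq(3,4) G(3) \<Gamma>S by simp
  qed
qed

end

text \<open>A point of the domain fixes, for each coordinate, a fraction whose denominator is
  nonzero at that point. The composition with \<open>\<sigma>\<close> then has a denominator that is
  not identically zero; the product over all coordinates serves as \<open>D\<close>, and the
  relations extend over its zeros by continuity.\<close>

lemma regulous_image_rat_param:
  assumes r: "regulous_image k m T S" and T: "T = \<sigma> ` Rn n" "T \<subseteq> Rn k" "T \<noteq> {}"
    and \<sigma>: "\<And>x. \<sigma> x = (\<lambda>i. if i < k then \<rho> i x / \<omega> x else 0)"
    and pf: "\<And>i. i < k \<Longrightarrow> poly_fun n (\<rho> i)" "poly_fun n \<omega>" and \<omega>: "\<And>x. x \<in> Rn n \<Longrightarrow> 0 < \<omega> x"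
  shows "\<exists>\<Gamma> D R. rat_param n m \<Gamma> D R S"
proof -
  obtain g h F where gh: "T \<subseteq> closure (T \<inter> rat_dom k m g h)" "continuous_on T F" "\<forall>x\<in>T. F x \<in> Rn m"
      "\<forall>x\<in>T. \<forall>i<m. \<forall>g' h'. rat_repr k (g i) (h i) g' h' \<and> h' x \<noteq> 0 \<longrightarrow> F x i = g' x / h' x" "S = F ` T"
    using r unfolding regulous_image_def by (elim exE conjE)
  have "T \<inter> rat_dom k m g h \<noteq> {}" using gh(1) T(3) by auto
  then obtain x0 where x0: "x0 \<in> Rn n" "\<sigma> x0 \<in> rat_dom k m g h" using T(1) by blast
  have "\<forall>i\<in>{..<m}. \<exists>gh. rat_repr k (g i) (h i) (fst gh) (snd gh) \<and> snd gh (\<sigma> x0) \<noteq> 0"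
    using x0(2) by (auto simp: rat_dom_def)
  hence "\<exists>gh. \<forall>i\<in>{..<m}. rat_repr k (g i) (h i) (fst (gh i)) (snd (gh i)) \<and> snd (gh i) (\<sigma> x0) \<noteq> 0" by (rule bchoice)
  then obtain gh' where gh': "\<forall>i\<in>{..<m}. rat_repr k (g i) (h i) (fst (gh' i)) (snd (gh' i)) \<and> snd (gh' i) (\<sigma> x0) \<noteq> 0"
    by (elim exE)
  have Fi: "F y i = fst (gh' i) y / snd (gh' i) y" if "y \<in> T" "i < m" "snd (gh' i) y \<noteq> 0" for y i
    using gh(4) gh' that by blast
  have cl: "\<exists>N q. poly_fun n q \<and> (\<forall>x\<in>Rn n. p (\<sigma> x) * \<omega> x ^ N = q x)" if p: "poly_fun k p" for p
  proof -
    obtain N q where q: "poly_fun n q" "\<forall>x. \<omega> x \<noteq> 0 \<longrightarrow> p (\<lambda>i. \<rho> i x / \<omega> x) * \<omega> x ^ N = q x"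
      using clear_denominators[OF p, of n \<rho> \<omega>] pf by blast
    have "p (\<sigma> x) = p (\<lambda>i. \<rho> i x / \<omega> x)" for x by (rule poly_fun_cong_coords[OF p]) (simp add: \<sigma>)
    moreover have "\<omega> x \<noteq> 0" if "x \<in> Rn n" for x using \<omega>[OF that] by simp
    ultimately have "\<forall>x\<in>Rn n. p (\<sigma> x) * \<omega> x ^ N = q x" using q(2) by simp
    thus ?thesis using q(1) by blast
  qed
  have "\<forall>i\<in>{..<m}. \<exists>GH. poly_fun n (fst GH) \<and> poly_fun n (snd GH) \<and> snd GH x0 \<noteq> 0 \<and>
      (\<forall>x\<in>Rn n. snd GH x \<noteq> 0 \<longrightarrow> F (\<sigma> x) i * snd GH x = fst GH x)"
  proof
    fix i assume i: "i \<in> {..<m}"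
    have pp: "poly_fun k (fst (gh' i))" "poly_fun k (snd (gh' i))" and nz: "snd (gh' i) (\<sigma> x0) \<noteq> 0"
      using gh' i by (auto simp: rat_repr_def)
    obtain N q where q: "poly_fun n q" "\<forall>x\<in>Rn n. fst (gh' i) (\<sigma> x) * \<omega> x ^ N = q x" using cl[OF pp(1)] by blast
    obtain M s where s: "poly_fun n s" "\<forall>x\<in>Rn n. snd (gh' i) (\<sigma> x) * \<omega> x ^ M = s x" using cl[OF pp(2)] by blast
    have "F (\<sigma> x) i * (s x * \<omega> x ^ N) = q x * \<omega> x ^ M" if x: "x \<in> Rn n" "s x * \<omega> x ^ N \<noteq> 0" for x
    proof -
      have "snd (gh' i) (\<sigma> x) \<noteq> 0" using s(2)[rule_format, OF x(1)] x(2) by auto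
      moreover from this have "F (\<sigma> x) i = fst (gh' i) (\<sigma> x) / snd (gh' i) (\<sigma> x)" using Fi x(1) T(1) i by blast
      ultimately show ?thesis
        using q(2)[rule_format, OF x(1), symmetric] s(2)[rule_format, OF x(1), symmetric] by (simp add: mult_ac)
    qed
    moreover have "s x0 * \<omega> x0 ^ N \<noteq> 0" using s(2)[rule_format, OF x0(1), symmetric] nz \<omega>[OF x0(1)] by simp
    ultimately show "\<exists>GH. poly_fun n (fst GH) \<and> poly_fun n (snd GH) \<and> snd GH x0 \<noteq> 0 \<and>
      (\<forall>x\<in>Rn n. snd GH x \<noteq> 0 \<longrightarrow> F (\<sigma> x) i * snd GH x = fst GH x)"
      using q(1) s(1) pf(2)
      by (intro exI[of _ "(\<lambda>x. q x * \<omega> x ^ M, \<lambda>x. s x * \<omega> x ^ N)"]) (auto intro!: poly_fun_intros)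
  qed
  hence "\<exists>GH. \<forall>i\<in>{..<m}. poly_fun n (fst (GH i)) \<and> poly_fun n (snd (GH i)) \<and> snd (GH i) x0 \<noteq> 0 \<and>
      (\<forall>x\<in>Rn n. snd (GH i) x \<noteq> 0 \<longrightarrow> F (\<sigma> x) i * snd (GH i) x = fst (GH i) x)" by (rule bchoice)
  then obtain GH where GH: "\<forall>i\<in>{..<m}. poly_fun n (fst (GH i)) \<and> poly_fun n (snd (GH i)) \<and> snd (GH i) x0 \<noteq> 0 \<and>
      (\<forall>x\<in>Rn n. snd (GH i) x \<noteq> 0 \<longrightarrow> F (\<sigma> x) i * snd (GH i) x = fst (GH i) x)" by (elim exE)
  define D where "D = (\<lambda>x. \<Prod>i<m. snd (GH i) x)"
  define R where "R = (\<lambda>i x. fst (GH i) x * (\<Prod>j\<in>{..<m} - {i}. snd (GH j) x))"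
  have pD: "poly_fun n D" unfolding D_def using GH by (intro poly_fun_prod) blast
  have pR: "poly_fun n (R i)" if "i < m" for i unfolding R_def
    using GH that by (intro pf_mult poly_fun_prod) auto
  have Dx0: "D x0 \<noteq> 0" unfolding D_def using GH by auto
  have c\<sigma>: "continuous_on (Rn n) \<sigma>"
  proof (rule continuous_on_coordinatewise_then_product)
    fix i show "continuous_on (Rn n) (\<lambda>x. \<sigma> x i)"
    proof (cases "i < k")
      case True
      have "continuous_on (Rn n) (\<lambda>x. \<rho> i x / \<omega> x)"
        using \<omega> by (intro continuous_on_divide poly_fun_continuous[OF pf(1)[OF True]] poly_fun_continuous[OF pf(2)]) force
      thus ?thesis using True by (simp add: \<sigma>)
    qed (simp add: \<sigma>)
  qed
  have c: "continuous_on (Rn n) (\<lambda>x. F (\<sigma> x))"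
    by (rule continuous_on_compose2[OF gh(2) c\<sigma>]) (simp add: T(1))
  have "rat_param n m (\<lambda>x. F (\<sigma> x)) D R S"
  proof
    show "\<exists>x\<in>Rn n. D x \<noteq> 0" using x0(1) Dx0 by blast
    show "F (\<sigma> x) i * D x = R i x" if x: "x \<in> Rn n" and i: "i < m" for x i
    proof (rule rational_extension[OF continuous_coord[OF c] pD pR[OF i] x0(1) Dx0 _ x])
      fix x assume x: "x \<in> Rn n" "D x \<noteq> 0"
      have 1: "D x = snd (GH i) x * (\<Prod>j\<in>{..<m} - {i}. snd (GH j) x)"
        unfolding D_def using i by (subst prod.remove[of _ i]) auto
      hence "snd (GH i) x \<noteq> 0" using x(2) by auto
      hence "F (\<sigma> x) i * snd (GH i) x = fst (GH i) x" using GH i x(1) by blast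
      thus "F (\<sigma> x) i * D x = R i x" unfolding 1 R_def by (metis mult.assoc)
    qed
    show "F (\<sigma> x) \<in> Rn m" if "x \<in> Rn n" for x using gh(3) T(1) that by blast
    show "S = (\<lambda>x. F (\<sigma> x)) ` Rn n" unfolding gh(5) T(1) by (simp add: image_image)
  qed (use pD pR c in auto)
  thus ?thesis by blast
qed

section \<open>Compactness and rational parametrization of balls and spheres\<close>

lemma sqnorm_cong: "(\<And>i. i < n \<Longrightarrow> x i = y i) \<Longrightarrow> sqnorm n x = sqnorm n y"
  by (simp add: sqnorm_def)

lemma closed_Rn: "closed (Rn n)"
proof -
  have "Rn n = (\<Inter>i\<in>{n..}. {x. x i = 0})" by (auto simp: Rn_def)
  moreover have "closed {x::pt. x i = 0}" for i
    by (intro closed_Collect_eq continuous_intros continuous_on_coordinatewise_then_product) simp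
  ultimately show ?thesis by auto
qed

lemma compact_closed_ball_n: "compact (closed_ball_n n)"
proof -
  let ?B = "Pi\<^sub>E UNIV (\<lambda>i::nat. if i < n then {-1..1::real} else {0})"
  have "compactin (product_topology (\<lambda>_. euclidean) UNIV) ?B"
    unfolding compactin_PiE by (simp add: compactin_euclidean_iff)
  hence B: "compact ?B" by (simp add: euclidean_product_topology compactin_euclidean_iff)
  have "closed_ball_n n = ?B \<inter> (Rn n \<inter> {x. sqnorm n x \<le> 1})"
  proof -
    have "\<bar>x i\<bar> \<le> 1" if "sqnorm n x \<le> 1" "i < n" for x i
    proof -
      have "(x i)\<^sup>2 \<le> sqnorm n x" unfolding sqnorm_def using that(2) by (intro member_le_sum) auto
      hence "(x i)\<^sup>2 \<le> 1" using that(1) by linarith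
      thus ?thesis by (simp add: abs_le_square_iff[of "x i" 1, simplified])
    qed
    thus ?thesis by (auto simp: closed_ball_n_def PiE_iff Rn_def abs_le_iff)
  qed
  moreover have "closed {x. sqnorm n x \<le> 1}"
    by (intro closed_Collect_le continuous_intros poly_fun_continuous[OF poly_fun_sqnorm])
  ultimately show ?thesis using compact_Int_closed[OF B closed_Int[OF closed_Rn]] by simp
qed

lemma compact_sphere_n: "compact (sphere_n n)"
proof -
  have "sphere_n n = closed_ball_n (Suc n) \<inter> {x. sqnorm (Suc n) x = 1}"
    by (auto simp: sphere_n_def closed_ball_n_def)
  moreover have "closed {x. sqnorm (Suc n) x = 1}"
    by (intro closed_Collect_eq continuous_intros poly_fun_continuous[OF poly_fun_sqnorm])
  ultimately show ?thesis using compact_Int_closed[OF compact_closed_ball_n] by simp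
qed

text \<open>Inverse stereographic projection followed by the projection of the sphere onto the
  equatorial ball. A preimage of y is \<open>y / (1 + w)\<close> with
  \<open>w = sqrt (1 - |y|^2)\<close>.\<close>

lemma ball_rational_image:
  assumes \<sigma>: "\<sigma> = (\<lambda>x i. if i < n then 2 * x i / (1 + sqnorm n x) else 0)"
  shows "closed_ball_n n = \<sigma> ` Rn n"
proof
  have s\<sigma>: "sqnorm n (\<sigma> x) = (2 / (1 + sqnorm n x))\<^sup>2 * sqnorm n x" for x
  proof -
    have "sqnorm n (\<sigma> x) = sqnorm n (\<lambda>i. 2 / (1 + sqnorm n x) * x i)" by (rule sqnorm_cong) (simp add: \<sigma>)
    thus ?thesis by (simp only: sqnorm_scale)
  qed
  show "\<sigma> ` Rn n \<subseteq> closed_ball_n n"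
  proof (rule image_subsetI)
    fix x
    let ?N = "sqnorm n x"
    have N: "0 \<le> ?N" by (rule sqnorm_nonneg)
    have "2\<^sup>2 * ?N \<le> (1 + ?N)\<^sup>2" using zero_le_power2[of "1 - ?N"] by (simp add: power2_eq_square algebra_simps)
    moreover have "0 < (1 + ?N)\<^sup>2" using N by simp
    ultimately have "sqnorm n (\<sigma> x) \<le> 1" unfolding s\<sigma> power_divide times_divide_eq_left by (simp add: divide_le_eq)
    thus "\<sigma> x \<in> closed_ball_n n" by (simp add: closed_ball_n_def Rn_def \<sigma>)
  qed
  show "closed_ball_n n \<subseteq> \<sigma> ` Rn n"
  proof
    fix y assume y: "y \<in> closed_ball_n n"
    define w where "w = sqrt (1 - sqnorm n y)"
    have w: "0 \<le> w" "sqnorm n y = 1 - w\<^sup>2" using y by (simp_all add: w_def closed_ball_n_def)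
    define c where "c = 1 / (1 + w)"
    define x where "x = (\<lambda>i. c * y i)"
    have "sqnorm n x = c\<^sup>2 * (1 - w\<^sup>2)" unfolding x_def sqnorm_scale w(2) ..
    also have "1 - w\<^sup>2 = (1 + w) * (1 - w)" by (simp add: power2_eq_square algebra_simps)
    also have "c\<^sup>2 * ((1 + w) * (1 - w)) = c * (1 - w)" using w(1) by (simp add: c_def power2_eq_square)
    finally have N: "1 + sqnorm n x = 2 * c" using w(1) by (simp add: c_def field_simps)
    have c: "c \<noteq> 0" using w(1) by (simp add: c_def)
    have "\<sigma> x i = y i" for i
      using y c unfolding \<sigma> N by (simp add: x_def closed_ball_n_def Rn_def)
    hence "\<sigma> x = y" by (rule ext)
    moreover have "x \<in> Rn n" using y unfolding x_def by (intro Rn_scale) (simp add: closed_ball_n_def)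
    ultimately show "y \<in> \<sigma> ` Rn n" by blast
  qed
qed

text \<open>The inverse stereographic projection of \<open>x / (1 - x\<^sub>0\<^sup>2)\<close>; the denominator makes the pole attained,
  so that the sphere is the image of an affine space and not only of a projective one.\<close>
lemma sphere_rational_image:
  assumes n: "1 \<le> n" and \<omega>: "\<omega> = (\<lambda>x. sqnorm n x + (1 - (x 0)\<^sup>2)\<^sup>2)"
    and r: "r = (\<lambda>i x. if i = n then sqnorm n x - (1 - (x 0)\<^sup>2)\<^sup>2 else 2 * (1 - (x 0)\<^sup>2) * x i)"
    and \<sigma>: "\<sigma> = (\<lambda>x i. if i < Suc n then r i x / \<omega> x else 0)"
  shows "\<And>x. x \<in> Rn n \<Longrightarrow> 0 < \<omega> x" "sphere_n n = \<sigma> ` Rn n"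
proof -
  show pos: "0 < \<omega> x" if "x \<in> Rn n" for x
  proof (cases "x = (\<lambda>_. 0)")
    case True thus ?thesis by (simp add: \<omega> sqnorm_def)
  next
    case False
    from sqnorm_pos[OF that this] show ?thesis unfolding \<omega> using zero_le_power2[of "1 - (x 0)\<^sup>2"] by linarith
  qed
  have s\<sigma>: "sqnorm (Suc n) (\<sigma> x) = (2 * (1 - (x 0)\<^sup>2) / \<omega> x)\<^sup>2 * sqnorm n x + ((sqnorm n x - (1 - (x 0)\<^sup>2)\<^sup>2) / \<omega> x)\<^sup>2" for x
  proof -
    have "sqnorm n (\<sigma> x) = sqnorm n (\<lambda>i. 2 * (1 - (x 0)\<^sup>2) / \<omega> x * x i)" by (rule sqnorm_cong) (simp add: \<sigma> r)
    hence "sqnorm n (\<sigma> x) = (2 * (1 - (x 0)\<^sup>2) / \<omega> x)\<^sup>2 * sqnorm n x" by (simp only: sqnorm_scale)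
    moreover have "sqnorm (Suc n) (\<sigma> x) = sqnorm n (\<sigma> x) + (\<sigma> x n)\<^sup>2" by (simp add: sqnorm_def)
    ultimately show ?thesis by (simp add: \<sigma> r)
  qed
  show "sphere_n n = \<sigma> ` Rn n"
  proof
    show "\<sigma> ` Rn n \<subseteq> sphere_n n"
    proof (rule image_subsetI)
      fix x assume x: "x \<in> Rn n"
      let ?s = "1 - (x 0)\<^sup>2"
      have "sqnorm (Suc n) (\<sigma> x) = ((2 * ?s)\<^sup>2 * sqnorm n x + (sqnorm n x - ?s\<^sup>2)\<^sup>2) / (\<omega> x)\<^sup>2"
        unfolding s\<sigma> by (simp only: power_divide times_divide_eq_left add_divide_distrib)
      also have "(2 * ?s)\<^sup>2 * sqnorm n x + (sqnorm n x - ?s\<^sup>2)\<^sup>2 = (\<omega> x)\<^sup>2" unfolding \<omega> by algebra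
      finally have "sqnorm (Suc n) (\<sigma> x) = 1" using pos[OF x] by simp
      thus "\<sigma> x \<in> sphere_n n" by (simp add: sphere_n_def Rn_def \<sigma>)
    qed
    show "sphere_n n \<subseteq> \<sigma> ` Rn n"
    proof
      fix y assume "y \<in> sphere_n n"
      hence yR: "y \<in> Rn (Suc n)" and yn: "sqnorm n y + (y n)\<^sup>2 = 1" by (simp_all add: sphere_n_def sqnorm_def)
      define w where "w = y n"
      have Ny: "sqnorm n y = 1 - w\<^sup>2" using yn by (simp add: w_def)
      have "w \<le> 1" using Ny sqnorm_nonneg[of n y] by (smt (verit) one_le_power power2_eq_square mult_le_cancel_right1)
      show "y \<in> \<sigma> ` Rn n"
      proof (cases "w = 1")
        case True
        have y0: "y i = 0" if "i < n" for i
        proof -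
          have "(y i)\<^sup>2 \<le> sqnorm n y" unfolding sqnorm_def using that by (intro member_le_sum) auto
          thus ?thesis using Ny True by simp
        qed
        \<comment> \<open>Here \<open>1 - (x 0)\<^sup>2\<close> vanishes, and the value is the
          pole.\<close>
        let ?x = "emb1 1"
        have N: "sqnorm n ?x = 1"
        proof -
          have "sqnorm n ?x = (\<Sum>i<n. if i = 0 then 1 else 0)" unfolding sqnorm_def by (rule sum.cong) (auto simp: emb1_def)
          thus ?thesis using n by simp
        qed
        have "\<sigma> ?x i = y i" for i
        proof -
          consider "i < n" | "i = n" | "Suc n \<le> i" by linarith
          thus ?thesis using N y0 yR True by cases (simp_all add: \<sigma> r \<omega> w_def Rn_def)
        qed
        hence "\<sigma> ?x = y" by (rule ext)
        moreover have "?x \<in> Rn n" using n by (simp add: Rn_def emb1_def)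
        ultimately show ?thesis by blast
      next
        case False
        hence w1: "0 < 1 - w" using \<open>w \<le> 1\<close> by simp
        \<comment> \<open>The scaling \<open>s\<close> of the stereographic preimage has to satisfy
          \<open>1 - (s * u0)\<^sup>2 = s\<close>. Its positive solution is written as
          \<open>2 / (1 + v)\<close>, a form that is also valid for \<open>u0 = 0\<close>.\<close>
        define u0 where "u0 = y 0 / (1 - w)"
        define v where "v = sqrt (1 + 4 * u0\<^sup>2)"
        define s where "s = 2 / (1 + v)"
        define x where "x = (\<lambda>i. if i < n then s / (1 - w) * y i else 0)"
        have v: "1 \<le> v" "v\<^sup>2 = 1 + 4 * u0\<^sup>2" by (simp_all add: v_def)
        have s0: "s \<noteq> 0" using v(1) by (simp add: s_def)
        have x0: "x 0 = s * u0" using n by (simp add: x_def u0_def)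
        have "4 * (x 0)\<^sup>2 = s\<^sup>2 * (v\<^sup>2 - 1)" unfolding x0 v(2) by (simp add: power_mult_distrib)
        also have "v\<^sup>2 - 1 = (1 + v) * (v - 1)" by (simp add: power2_eq_square algebra_simps)
        also have "s\<^sup>2 * ((1 + v) * (v - 1)) = 2 * s * (v - 1)" using v(1) by (simp add: s_def power2_eq_square)
        also have "\<dots> = 4 * (1 - s)" using v(1) by (simp add: s_def field_simps)
        finally have s: "1 - (x 0)\<^sup>2 = s" by simp
        have "sqnorm n x = sqnorm n (\<lambda>i. s / (1 - w) * y i)" by (rule sqnorm_cong) (simp add: x_def)
        also have "\<dots> = (s / (1 - w))\<^sup>2 * ((1 - w) * (1 + w))"
          unfolding sqnorm_scale Ny by (simp add: power2_eq_square algebra_simps)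
        also have "\<dots> = s\<^sup>2 * (1 + w) / (1 - w)" using w1 by (simp add: power2_eq_square)
        finally have Nx: "sqnorm n x = s\<^sup>2 * (1 + w) / (1 - w)" .
        have \<omega>x: "\<omega> x = 2 * s\<^sup>2 / (1 - w)" unfolding \<omega> Nx s using w1 by (simp add: field_simps)
        have rn: "r n x = 2 * s\<^sup>2 * w / (1 - w)" unfolding r Nx s using w1 by (simp add: field_simps)
        have "\<sigma> x i = y i" for i
        proof -
          consider "i < n" | "i = n" | "Suc n \<le> i" by linarith
          thus ?thesis
          proof cases
            case 1
            have "\<sigma> x i = 2 * s * (s / (1 - w) * y i) / (2 * s\<^sup>2 / (1 - w))"
            proof -
              have "\<sigma> x i = 2 * (1 - (x 0)\<^sup>2) * x i / \<omega> x" using 1 by (simp add: \<sigma> r)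
              moreover have "x i = s / (1 - w) * y i" using 1 by (simp add: x_def)
              ultimately show ?thesis unfolding s \<omega>x by presburger
            qed
            also have "\<dots> = y i" using s0 w1 by (simp add: power2_eq_square)
            finally show ?thesis .
          next
            case 2
            hence "\<sigma> x i = (2 * s\<^sup>2 * w / (1 - w)) / (2 * s\<^sup>2 / (1 - w))" unfolding \<sigma> \<omega>x using rn by simp
            also have "\<dots> = w" using s0 w1 by simp
            finally show ?thesis using 2 by (simp add: w_def)
          next
            case 3 thus ?thesis using yR by (simp add: \<sigma> Rn_def)
          qed
        qed
        hence "\<sigma> x = y" by (rule ext)
        moreover have "x \<in> Rn n" by (simp add: x_def Rn_def)
        ultimately show ?thesis by blast
      qed
    qed
  qed
qed

lemma regulous_image_ball:
  assumes "regulous_image n m (closed_ball_n n) S"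
  shows "\<exists>\<Gamma> D R. rat_param n m \<Gamma> D R S"
proof (rule regulous_image_rat_param[OF assms ball_rational_image[OF refl], where \<rho> = "\<lambda>i x. 2 * x i" and \<omega> = "\<lambda>x. 1 + sqnorm n x"])
  show "closed_ball_n n \<subseteq> Rn n" by (auto simp: closed_ball_n_def)
  show "closed_ball_n n \<noteq> {}" unfolding ball_rational_image[OF refl] by (auto simp: Rn_def)
  show "poly_fun n (\<lambda>x. 2 * x i)" if "i < n" for i using that by (intro poly_fun_intros)
  show "poly_fun n (\<lambda>x. 1 + sqnorm n x)" by (intro poly_fun_intros poly_fun_sqnorm)
  show "0 < 1 + sqnorm n x" for x using sqnorm_nonneg[of n x] by linarith
qed simp

lemma regulous_image_sphere:
  assumes r: "regulous_image (Suc n) m (sphere_n n) S" and n: "1 \<le> n"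
  shows "\<exists>\<Gamma> D R. rat_param n m \<Gamma> D R S"
proof (rule regulous_image_rat_param[OF r sphere_rational_image(2)[OF n refl refl refl]])
  show "sphere_n n \<subseteq> Rn (Suc n)" by (auto simp: sphere_n_def)
  show "sphere_n n \<noteq> {}" unfolding sphere_rational_image(2)[OF n refl refl refl] by (auto simp: Rn_def)
  have v: "poly_fun n (\<lambda>x. x 0)" using n by (intro poly_fun_intros) simp
  show "poly_fun n (\<lambda>x. if i = n then sqnorm n x - (1 - (x 0)\<^sup>2)\<^sup>2 else 2 * (1 - (x 0)\<^sup>2) * x i)" if "i < Suc n" for i
  proof (cases "i = n")
    case True
    have "poly_fun n (\<lambda>x. sqnorm n x - (1 - (x 0)\<^sup>2)\<^sup>2)" by (intro poly_fun_intros poly_fun_sqnorm v)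
    thus ?thesis using True by simp
  next
    case False
    hence "poly_fun n (\<lambda>x. 2 * (1 - (x 0)\<^sup>2) * x i)" using that by (intro poly_fun_intros v) simp
    thus ?thesis using False by simp
  qed
  show "poly_fun n (\<lambda>x. sqnorm n x + (1 - (x 0)\<^sup>2)\<^sup>2)" by (intro poly_fun_intros poly_fun_sqnorm v)
  show "0 < sqnorm n x + (1 - (x 0)\<^sup>2)\<^sup>2" if "x \<in> Rn n" for x using sphere_rational_image(1)[OF n refl refl refl that] .
qed simp

lemma compact_regulous_image: "compact T \<Longrightarrow> regulous_image n m T S \<Longrightarrow> compact S"
  unfolding regulous_image_def using compact_continuous_image by blast

section \<open>Degenerating surfaces\<close>

abbreviation dist1 :: "pt \<Rightarrow> pt \<Rightarrow> real" where
  "dist1 x y \<equiv> \<bar>x 0 - y 0\<bar> + \<bar>x 1 - y 1\<bar>"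

text \<open>Bounded Lipschitz functions for the 1-norm of the plane; the bound is part of the notion
  so that products are again of this kind.\<close>

definition lip :: "pt set \<Rightarrow> (pt \<Rightarrow> real) \<Rightarrow> bool" where
  "lip B f \<longleftrightarrow> (\<exists>L M. 0 \<le> L \<and> 0 \<le> M \<and> (\<forall>x\<in>B. \<bar>f x\<bar> \<le> M) \<and>
     (\<forall>x\<in>B. \<forall>y\<in>B. \<bar>f x - f y\<bar> \<le> L * dist1 x y))"

lemma lip_const: "lip B (\<lambda>_. c)"
  unfolding lip_def by (intro exI[of _ 0] exI[of _ "\<bar>c\<bar>"]) auto

lemma lip_coord: "i < 2 \<Longrightarrow> (\<And>x. x \<in> B \<Longrightarrow> \<bar>x i\<bar> \<le> M) \<Longrightarrow> lip B (\<lambda>x. x i)"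
proof -
  assume i: "i < 2" and M: "\<And>x. x \<in> B \<Longrightarrow> \<bar>x i\<bar> \<le> M"
  have "\<bar>x i\<bar> \<le> \<bar>M\<bar>" if "x \<in> B" for x using M[OF that] by linarith
  moreover have "\<bar>x i - y i\<bar> \<le> 1 * dist1 x y" for x y :: pt
    using i by (cases "i = 0") (auto simp: less_2_cases_iff)
  ultimately show ?thesis unfolding lip_def by (intro exI[of _ 1] exI[of _ "\<bar>M\<bar>"]) auto
qed

lemma lip_add: "lip B f \<Longrightarrow> lip B g \<Longrightarrow> lip B (\<lambda>x. f x + g x)"
proof -
  assume "lip B f" "lip B g"
  then obtain L M L' M' where f: "0 \<le> L" "0 \<le> M" "\<forall>x\<in>B. \<bar>f x\<bar> \<le> M"
      "\<forall>x\<in>B. \<forall>y\<in>B. \<bar>f x - f y\<bar> \<le> L * dist1 x y"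
    and g: "0 \<le> L'" "0 \<le> M'" "\<forall>x\<in>B. \<bar>g x\<bar> \<le> M'"
      "\<forall>x\<in>B. \<forall>y\<in>B. \<bar>g x - g y\<bar> \<le> L' * dist1 x y" unfolding lip_def by (elim exE conjE)
  have "\<bar>f x + g x - (f y + g y)\<bar> \<le> (L + L') * dist1 x y" if "x \<in> B" "y \<in> B" for x y
  proof -
    have "\<bar>f x - f y\<bar> \<le> L * dist1 x y" "\<bar>g x - g y\<bar> \<le> L' * dist1 x y"
      using f g that by blast+
    thus ?thesis unfolding distrib_right[of L L'] by linarith
  qed
  moreover have "\<bar>f x + g x\<bar> \<le> M + M'" if "x \<in> B" for x
    using f(3) g(3) that abs_triangle_ineq[of "f x" "g x"] by fastforce
  ultimately show ?thesis unfolding lip_def using f(1,2) g(1,2)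
    by (intro exI[of _ "L + L'"] exI[of _ "M + M'"]) auto
qed

lemma lip_mult: "lip B f \<Longrightarrow> lip B g \<Longrightarrow> lip B (\<lambda>x. f x * g x)"
proof -
  assume "lip B f" "lip B g"
  then obtain L M L' M' where f: "0 \<le> L" "0 \<le> M" "\<forall>x\<in>B. \<bar>f x\<bar> \<le> M"
      "\<forall>x\<in>B. \<forall>y\<in>B. \<bar>f x - f y\<bar> \<le> L * dist1 x y"
    and g: "0 \<le> L'" "0 \<le> M'" "\<forall>x\<in>B. \<bar>g x\<bar> \<le> M'"
      "\<forall>x\<in>B. \<forall>y\<in>B. \<bar>g x - g y\<bar> \<le> L' * dist1 x y" unfolding lip_def by (elim exE conjE)
  have "\<bar>f x * g x - f y * g y\<bar> \<le> (M * L' + M' * L) * dist1 x y" if xy: "x \<in> B" "y \<in> B" for x y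
  proof -
    let ?d = "dist1 x y"
    have 1: "\<bar>f x * (g x - g y)\<bar> \<le> M * (L' * ?d)" unfolding abs_mult
      using f(2,3) g(4) xy by (intro mult_mono) auto
    have 2: "\<bar>g y * (f x - f y)\<bar> \<le> M' * (L * ?d)" unfolding abs_mult
      using g(2,3) f(4) xy by (intro mult_mono) auto
    have "f x * g x - f y * g y = f x * (g x - g y) + g y * (f x - f y)" by algebra
    moreover have "(M * L' + M' * L) * ?d = M * (L' * ?d) + M' * (L * ?d)" by algebra
    ultimately show ?thesis using 1 2 by linarith
  qed
  moreover have "\<bar>f x * g x\<bar> \<le> M * M'" if "x \<in> B" for x
    unfolding abs_mult using f(2,3) g(2,3) that by (intro mult_mono) auto
  ultimately show ?thesis unfolding lip_def using f(1,2) g(1,2)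
    by (intro exI[of _ "M * L' + M' * L"] exI[of _ "M * M'"]) auto
qed

lemma lip_inverse:
  assumes "lip B f" and c: "0 < c" "\<And>x. x \<in> B \<Longrightarrow> c \<le> \<bar>f x\<bar>"
  shows "lip B (\<lambda>x. inverse (f x))"
proof -
  obtain L M where f: "0 \<le> L" "0 \<le> M" "\<forall>x\<in>B. \<bar>f x\<bar> \<le> M"
      "\<forall>x\<in>B. \<forall>y\<in>B. \<bar>f x - f y\<bar> \<le> L * dist1 x y" using assms(1) unfolding lip_def by (elim exE conjE)
  have b: "\<bar>inverse (f x)\<bar> \<le> inverse c" if "x \<in> B" for x
    using c that by (simp add: abs_inverse le_imp_inverse_le)
  have "\<bar>inverse (f x) - inverse (f y)\<bar> \<le> (inverse c * L * inverse c) * dist1 x y"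
    if xy: "x \<in> B" "y \<in> B" for x y
  proof -
    let ?d = "dist1 x y"
    have nz: "f x \<noteq> 0" "f y \<noteq> 0" using c xy by force+
    have "inverse (f x) - inverse (f y) = - (inverse (f x) * (f x - f y) * inverse (f y))"
      by (rule inverse_diff_inverse[OF nz])
    hence "\<bar>inverse (f x) - inverse (f y)\<bar> = \<bar>inverse (f x)\<bar> * \<bar>f x - f y\<bar> * \<bar>inverse (f y)\<bar>"
      by (simp only: abs_minus_cancel abs_mult)
    also have "\<dots> \<le> inverse c * (L * ?d) * inverse c"
      using b xy f(1,4) c(1) by (intro mult_mono) auto
    finally show ?thesis by (simp only: mult_ac)
  qed
  moreover have "0 \<le> inverse c * L * inverse c" using f(1) c(1) by simp
  ultimately show ?thesis unfolding lip_def using b c(1)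
    by (intro exI[of _ "inverse c * L * inverse c"] exI[of _ "inverse c"]) auto
qed

lemma lip_poly_fun:
  assumes "poly_fun 2 p" and B: "\<And>x i. x \<in> B \<Longrightarrow> i < 2 \<Longrightarrow> \<bar>x i\<bar> \<le> M"
  shows "lip B p"
  using assms(1) by induction (auto intro: lip_const lip_coord lip_add lip_mult B)

text \<open>\<open>s\<close> is the outer variable, so that the order of vanishing along
  \<open>s = 0\<close> can be read off from the coefficients.\<close>

lemma poly_fun_2_bivariate:
  assumes "poly_fun 2 q"
  shows "\<exists>Q::real poly poly. \<forall>s t. q (emb2 s t) = poly (poly Q [:s:]) t"
  using assms
proof induction
  case (pf_const c)
  show ?case by (rule exI[of _ "[:[:c:]:]"]) simp
next
  case (pf_var i)
  hence "i = 0 \<or> i = 1" by auto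
  thus ?case
  proof
    assume "i = 0" thus ?thesis by (intro exI[of _ "[:0, 1:]"]) simp
  next
    assume "i = 1" thus ?thesis by (intro exI[of _ "[:[:0, 1:]:]"]) simp
  qed
next
  case (pf_add p q)
  then obtain P Q :: "real poly poly" where
    "\<forall>s t. p (emb2 s t) = poly (poly P [:s:]) t" "\<forall>s t. q (emb2 s t) = poly (poly Q [:s:]) t" by blast
  thus ?case by (intro exI[of _ "P + Q"]) simp
next
  case (pf_mult p q)
  then obtain P Q :: "real poly poly" where
    "\<forall>s t. p (emb2 s t) = poly (poly P [:s:]) t" "\<forall>s t. q (emb2 s t) = poly (poly Q [:s:]) t" by blast
  thus ?case by (intro exI[of _ "P * Q"]) simp
qed

lemma bivariate_poly_fun: "poly_fun 2 (\<lambda>x. poly (poly Q [:x 0:]) (x 1))"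
proof (induction Q)
  case 0 show ?case by (simp add: pf_const)
next
  case (pCons a Q)
  have "poly_fun 2 (\<lambda>x. poly a (x 1) + x 0 * poly (poly Q [:x 0:]) (x 1))"
    by (intro poly_fun_intros poly_fun_poly pCons.IH) auto
  thus ?case by simp
qed

lemma split_power:
  assumes "(Q::real poly poly) \<noteq> 0"
  shows "\<exists>k Q1. poly Q1 0 \<noteq> 0 \<and> (\<forall>s t. poly (poly Q [:s:]) t = s ^ k * poly (poly Q1 [:s:]) t)"
  using assms
proof (induction Q)
  case (pCons a Q)
  show ?case
  proof (cases "a = 0")
    case False
    thus ?thesis by (intro exI[of _ 0] exI[of _ "pCons a Q"]) simp
  next
    case True
    hence "Q \<noteq> 0" using pCons.hyps by auto
    then obtain k Q1 where "poly Q1 0 \<noteq> 0" "\<forall>s t. poly (poly Q [:s:]) t = s ^ k * poly (poly Q1 [:s:]) t"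
      using pCons.IH by blast
    thus ?thesis using True by (intro exI[of _ "Suc k"] exI[of _ Q1]) (simp add: mult_ac)
  qed
qed simp

lemma emb2_upd: "(emb2 s t)(1 := t') = emb2 s t'"
  by (auto simp: emb2_def fun_eq_iff)

text \<open>A surface degenerating to a curve along \<open>s = 0\<close>: one coordinate \<open>R / D\<close> separates the points of the curve, and
  a polynomial \<open>f\<close> vanishes on it exactly to the order \<open>k\<close>. Near the curve the two functions together are
  injective for \<open>s > 0\<close>.\<close>
lemma surface_dim_ge_2:
  assumes pf: "poly_fun 2 D" "poly_fun 2 R" "poly_fun 2 q"
    and W: "W = (\<lambda>x. partial_deriv 1 R x * D x - R x * partial_deriv 1 D x)"
    and nz: "D (emb2 0 t0) \<noteq> 0" "q (emb2 0 t0) \<noteq> 0" "W (emb2 0 t0) \<noteq> 0" and k: "1 \<le> k"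
    and \<Psi>: "continuous_on (Rn 2) \<Psi>" "\<And>x. x \<in> Rn 2 \<Longrightarrow> \<Psi> x \<in> X"
    and R: "\<And>x. x \<in> Rn 2 \<Longrightarrow> D x \<noteq> 0 \<Longrightarrow> g (\<Psi> x) * D x = R x"
    and f: "\<And>x. x \<in> Rn 2 \<Longrightarrow> D x \<noteq> 0 \<Longrightarrow> f (\<Psi> x) * D x ^ N = x 0 ^ k * q x"
  shows "dim_ge X 2"
proof -
  have pW: "poly_fun 2 W" unfolding W by (intro poly_fun_intros pf poly_fun_partial_deriv)
  have ce: "continuous_on UNIV (\<lambda>(s, t). \<bar>p (emb2 s t)\<bar>)" if "poly_fun 2 p" for p
    unfolding case_prod_beta
    by (intro continuous_intros continuous_on_compose2[OF poly_fun_continuous[OF that, of UNIV] continuous_emb2]) auto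
  define cD cq cW where "cD = \<bar>D (emb2 0 t0)\<bar> / 2" and "cq = \<bar>q (emb2 0 t0)\<bar> / 2" and "cW = \<bar>W (emb2 0 t0)\<bar> / 2"
  have cpos: "0 < cD" "0 < cq" "0 < cW" using nz by (simp_all add: cD_def cq_def cW_def)
  let ?O = "\<lambda>p c. {x. c < (\<lambda>(s, t). \<bar>p (emb2 s t)\<bar>) x}"
  have "open (?O D cD \<inter> ?O q cq \<inter> ?O W cW)"
    by (intro open_Int open_Collect_less continuous_on_const ce pf pW)
  moreover have "(0, t0) \<in> ?O D cD \<inter> ?O q cq \<inter> ?O W cW" using nz by (simp add: cD_def cq_def cW_def)
  ultimately obtain A A' where A: "open A" "open A'" "(0, t0) \<in> A \<times> A'" "A \<times> A' \<subseteq> ?O D cD \<inter> ?O q cq \<inter> ?O W cW"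
    using open_prod_elim by metis
  obtain r1 where r1: "0 < r1" "cball 0 r1 \<subseteq> A" using A(1,3) open_contains_cball by blast
  obtain r2 where r2: "0 < r2" "cball t0 r2 \<subseteq> A'" using A(2,3) open_contains_cball by blast
  define B where "B = (\<lambda>(s, t). emb2 s t) ` ({0..r1} \<times> {t0 - r2..t0 + r2})"
  have BI: "emb2 s t \<in> B" if "s \<in> {0..r1}" "t \<in> {t0 - r2..t0 + r2}" for s t using that unfolding B_def by blast
  have bnd: "cD \<le> \<bar>D x\<bar>" "cq \<le> \<bar>q x\<bar>" "cW \<le> \<bar>W x\<bar>" if "x \<in> B" for x
  proof -
    obtain s t where st: "x = emb2 s t" "s \<in> {0..r1}" "t \<in> {t0 - r2..t0 + r2}" using \<open>x \<in> B\<close> unfolding B_def by auto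
    have "s \<in> A" "t \<in> A'" using r1(2) r2(2) st(2,3) by (auto simp: dist_real_def subset_iff abs_le_iff)
    hence "(s, t) \<in> ?O D cD \<inter> ?O q cq \<inter> ?O W cW" using A(4) by blast
    thus "cD \<le> \<bar>D x\<bar>" "cq \<le> \<bar>q x\<bar>" "cW \<le> \<bar>W x\<bar>" by (simp_all add: st(1))
  qed
  have Bb: "\<bar>x i\<bar> \<le> r1 + \<bar>t0\<bar> + r2" if "x \<in> B" "i < 2" for x i
  proof -
    obtain s t where st: "x = emb2 s t" "s \<in> {0..r1}" "t \<in> {t0 - r2..t0 + r2}" using \<open>x \<in> B\<close> unfolding B_def by auto
    have "i = 0 \<or> i = 1" using that(2) by auto
    thus ?thesis using st r1(1) r2(1) by auto
  qed
  have lp: "lip B p" if "poly_fun 2 p" for p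
    using lip_poly_fun[OF that, of B "r1 + \<bar>t0\<bar> + r2"] Bb by blast
  have lD: "lip B (\<lambda>x. inverse (D x))" by (rule lip_inverse[OF lp[OF pf(1)] cpos(1) bnd(1)])
  have lDN: "lip B (\<lambda>x. inverse (D x ^ N))"
    by (rule lip_inverse[OF lp[OF poly_fun_power[OF pf(1)]], of "cD ^ N"])
      (use cpos bnd(1) in \<open>auto simp: power_abs intro!: power_mono\<close>)
  \<comment> \<open>In these terms the two functions are \<open>s ^ k * u\<close> and
    \<open>v\<close>, where \<open>u\<close> is bounded away from 0 and, for fixed s,
    \<open>v\<close> separates values of t at least at rate \<open>c\<close>.\<close>
  define u v where "u = (\<lambda>x. q x * inverse (D x ^ N))" and "v = (\<lambda>x. R x * inverse (D x))"
  have "lip B u" "lip B v" unfolding u_def v_def by (intro lip_mult lp pf lD lDN)+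
  then obtain L M L' M' where u: "0 \<le> L" "\<forall>x\<in>B. \<forall>y\<in>B. \<bar>u x - u y\<bar> \<le> L * dist1 x y"
    and v: "0 \<le> L'" "\<forall>x\<in>B. \<forall>y\<in>B. \<bar>v x - v y\<bar> \<le> L' * dist1 x y"
    unfolding lip_def by (elim exE conjE)
  have "lip B D" by (rule lp[OF pf(1)])
  then obtain MD where MD: "\<forall>x\<in>B. \<bar>D x\<bar> \<le> MD" unfolding lip_def by blast
  have MD0: "0 < MD" using MD bnd(1) cpos(1) BI[of 0 t0] r1(1) r2(1) by force
  define c1 where "c1 = cq / MD ^ N"
  have c1: "0 < c1" using cpos MD0 by (simp add: c1_def)
  have ulow: "c1 \<le> \<bar>u x\<bar>" if x: "x \<in> B" for x
  proof -
    have "\<bar>D x\<bar> ^ N \<le> MD ^ N" using MD x by (intro power_mono) auto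
    moreover have "0 < \<bar>D x\<bar> ^ N" using bnd(1)[OF x] cpos(1) by simp
    ultimately have "cq / MD ^ N \<le> \<bar>q x\<bar> / \<bar>D x\<bar> ^ N" using bnd(2)[OF x] cpos by (intro frac_le) auto
    thus ?thesis by (simp add: c1_def u_def abs_mult abs_inverse power_abs divide_inverse)
  qed
  define c where "c = cW / MD\<^sup>2"
  have c: "0 < c" using cpos MD0 by (simp add: c_def)
  have vlow: "c * \<bar>t - t'\<bar> \<le> \<bar>v (emb2 s t) - v (emb2 s t')\<bar>"
    if s: "s \<in> {0..r1}" and t: "t \<in> {t0 - r2..t0 + r2}" "t' \<in> {t0 - r2..t0 + r2}" and tt: "t < t'" for s t t'
  proof -
    have der: "((\<lambda>t. v (emb2 s t)) has_field_derivative W (emb2 s z) / (D (emb2 s z))\<^sup>2) (at z)" if z: "t \<le> z" "z \<le> t'" for z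
    proof -
      have "emb2 s z \<in> B" using z t s by (intro BI) auto
      hence Dz: "D (emb2 s z) \<noteq> 0" using bnd(1) cpos(1) by force
      have 1: "((\<lambda>t. D (emb2 s t)) has_field_derivative partial_deriv 1 D (emb2 s z)) (at z)"
        "((\<lambda>t. R (emb2 s t)) has_field_derivative partial_deriv 1 R (emb2 s z)) (at z)"
        using poly_fun_line_derivative[OF pf(1), of "emb2 s z" 1] poly_fun_line_derivative[OF pf(2), of "emb2 s z" 1]
        by (simp_all only: emb2_upd emb2_simps)
      from DERIV_divide[OF 1(2,1) Dz] show ?thesis
        unfolding v_def W by (simp only: divide_inverse[symmetric] power2_eq_square)
    qed
    obtain z where z: "t < z" "z < t'" "v (emb2 s t') - v (emb2 s t) = (t' - t) * (W (emb2 s z) / (D (emb2 s z))\<^sup>2)"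
      using MVT2[OF tt, of "\<lambda>t. v (emb2 s t)" "\<lambda>z. W (emb2 s z) / (D (emb2 s z))\<^sup>2"] der by blast
    have zB: "emb2 s z \<in> B" using z t s by (intro BI) auto
    have "0 < \<bar>D (emb2 s z)\<bar>" using bnd(1)[OF zB] cpos(1) by linarith
    hence "cW / MD\<^sup>2 \<le> \<bar>W (emb2 s z)\<bar> / \<bar>D (emb2 s z)\<bar>\<^sup>2"
      using bnd(3)[OF zB] cpos MD zB by (intro frac_le power_mono) auto
    hence "c \<le> \<bar>W (emb2 s z) / (D (emb2 s z))\<^sup>2\<bar>" by (simp add: c_def)
    hence "\<bar>t - t'\<bar> * c \<le> \<bar>t' - t\<bar> * \<bar>W (emb2 s z) / (D (emb2 s z))\<^sup>2\<bar>" using tt c by (intro mult_mono) auto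
    also have "\<dots> = \<bar>v (emb2 s t') - v (emb2 s t)\<bar>" unfolding z(3) abs_mult ..
    finally show ?thesis by (simp add: abs_minus_commute mult.commute)
  qed
  have vlow': "c * \<bar>t - t'\<bar> \<le> \<bar>v (emb2 s t) - v (emb2 s t')\<bar>"
    if "s \<in> {0..r1}" "t \<in> {t0 - r2..t0 + r2}" "t' \<in> {t0 - r2..t0 + r2}" for s t t'
    using vlow[OF that] vlow[OF that(1,3,2)] by (cases t t' rule: linorder_cases) (auto simp: abs_minus_commute)
  \<comment> \<open>Equal values of \<open>v\<close> force
    \<open>|t - t'| \<le> (L' / c) * |s - s'|\<close>, so between such points \<open>u\<close>
    changes by at most \<open>K * |s - s'|\<close>. The bound on \<epsilon> makes
    \<open>\<epsilon> * K\<close> less than the lower bound \<open>c1\<close> of |u|.\<close>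
  define K where "K = L * (1 + L' / c) + 1"
  have K: "0 < K" using u(1) v(1) c by (simp add: K_def add_nonneg_pos)
  define \<epsilon> where "\<epsilon> = min r1 (c1 / (2 * K))"
  have \<epsilon>: "0 < \<epsilon>" "\<epsilon> \<le> r1" "\<epsilon> * K < c1"
  proof -
    show "0 < \<epsilon>" "\<epsilon> \<le> r1" using r1(1) c1 K by (simp_all add: \<epsilon>_def)
    have "\<epsilon> * K \<le> c1 / (2 * K) * K" using K by (intro mult_right_mono) (auto simp: \<epsilon>_def)
    also have "\<dots> = c1 / 2" using K by simp
    also have "\<dots> < c1" using c1 by simp
    finally show "\<epsilon> * K < c1" .
  qed
  have val: "f (\<Psi> x) = x 0 ^ k * u x" "g (\<Psi> x) = v x" if x: "x \<in> B" for x
  proof -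
    have Dx: "D x \<noteq> 0" using bnd(1)[OF x] cpos(1) by force
    have xR: "x \<in> Rn 2" using x emb2_Rn unfolding B_def by auto
    show "f (\<Psi> x) = x 0 ^ k * u x" using f[OF xR Dx] Dx by (simp add: u_def field_simps)
    show "g (\<Psi> x) = v x" using R[OF xR Dx] Dx by (simp add: v_def field_simps)
  qed
  have inj: "s = s' \<and> t = t'"
    if s: "s \<in> {\<epsilon> / 2..\<epsilon>}" "s' \<in> {\<epsilon> / 2..\<epsilon>}" and t: "t \<in> {t0 - r2..t0 + r2}" "t' \<in> {t0 - r2..t0 + r2}"
      and eq: "\<Psi> (emb2 s t) = \<Psi> (emb2 s' t')" and ss: "s \<le> s'" for s s' t t'
  proof -
    have sB: "s \<in> {0..r1}" "s' \<in> {0..r1}" using s \<epsilon> by auto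
    note B1 = BI[OF sB(1) t(1)] and B2 = BI[OF sB(2) t(2)] and B3 = BI[OF sB(2) t(1)]
    have ve: "v (emb2 s t) = v (emb2 s' t')" using val(2)[OF B1] val(2)[OF B2] eq by simp
    have ue: "s ^ k * u (emb2 s t) = s' ^ k * u (emb2 s' t')" using val(1)[OF B1] val(1)[OF B2] eq by simp
    have "c * \<bar>t - t'\<bar> \<le> \<bar>v (emb2 s' t) - v (emb2 s' t')\<bar>" by (rule vlow'[OF sB(2) t])
    also have "\<dots> = \<bar>v (emb2 s' t) - v (emb2 s t)\<bar>" unfolding ve ..
    also have "\<dots> \<le> L' * (\<bar>s' - s\<bar> + \<bar>t - t\<bar>)" using v(2)[rule_format, OF B3 B1] by simp
    finally have tb: "c * \<bar>t - t'\<bar> \<le> L' * (s' - s)" using ss by simp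
    show ?thesis
    proof (cases "s = s'")
      case True
      hence "c * \<bar>t - t'\<bar> \<le> 0" using tb by simp
      hence "t = t'" using c by (simp add: mult_le_0_iff)
      thus ?thesis using True by blast
    next
      case False
      hence lt: "s < s'" using ss by simp
      have s0: "0 < s" using s \<epsilon>(1) by auto
      have tb': "\<bar>t - t'\<bar> \<le> L' / c * (s' - s)" using tb c by (simp add: field_simps)
      have "\<bar>u (emb2 s t) - u (emb2 s' t')\<bar> \<le> L * (\<bar>s - s'\<bar> + \<bar>t - t'\<bar>)" using u(2)[rule_format, OF B1 B2] by simp
      also have "\<dots> \<le> L * ((s' - s) + L' / c * (s' - s))" using tb' lt u(1) by (intro mult_left_mono) auto
      also have "\<dots> = (K - 1) * (s' - s)" unfolding K_def by (simp add: algebra_simps)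
      also have "\<dots> \<le> K * (s' - s)" using lt by (simp add: algebra_simps)
      finally have du: "\<bar>u (emb2 s t) - u (emb2 s' t')\<bar> \<le> K * (s' - s)" .
      obtain j where j: "k = Suc j" using k by (cases k) auto
      \<comment> \<open>For s < s' the growth of the power must be compensated by a change of
        \<open>u\<close>. That change contributes one more factor s, so
        \<open>c1 \<le> s * K\<close>, which is impossible for small s.\<close>
      have sp: "s ^ j * (s' - s) \<le> s' ^ k - s ^ k"
      proof -
        have "s ^ j * s' \<le> s' ^ j * s'" using lt s0 by (intro mult_right_mono power_mono) auto
        thus ?thesis unfolding j by (simp add: algebra_simps)
      qed
      have "(s' ^ k - s ^ k) * u (emb2 s' t') = s ^ k * (u (emb2 s t) - u (emb2 s' t'))" using ue by (simp add: algebra_simps)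
      hence "(s' ^ k - s ^ k) * \<bar>u (emb2 s' t')\<bar> = s ^ k * \<bar>u (emb2 s t) - u (emb2 s' t')\<bar>"
        using s0 lt power_mono[of s s' k] by (metis abs_mult abs_of_nonneg diff_ge_0_iff_ge less_imp_le zero_le_power)
      also have "\<dots> \<le> s ^ k * (K * (s' - s))" using du s0 by (intro mult_left_mono) auto
      finally have "s ^ j * (s' - s) * c1 \<le> s ^ k * (K * (s' - s))"
        using mult_mono[OF sp ulow[OF B2]] c1 s0 lt power_mono[of s s' k] by (smt (verit) zero_le_power)
      hence "(s ^ j * (s' - s)) * c1 \<le> (s ^ j * (s' - s)) * (s * K)" unfolding j by (simp add: mult_ac)
      moreover have "0 < s ^ j * (s' - s)" using s0 lt by simp
      ultimately have "c1 \<le> s * K" by (rule mult_left_le_imp_le)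
      also have "\<dots> \<le> \<epsilon> * K" using s(1) K by (intro mult_right_mono) auto
      finally show ?thesis using \<epsilon>(3) by simp
    qed
  qed
  show ?thesis
  proof (rule dim_ge_2I[where f = "\<lambda>(s, t). \<Psi> (emb2 s t)"])
    show "\<epsilon> / 2 < \<epsilon>" "t0 - r2 < t0 + r2" using \<epsilon> r2 by auto
    show "continuous_on ({\<epsilon> / 2..\<epsilon>} \<times> {t0 - r2..t0 + r2}) (\<lambda>(s, t). \<Psi> (emb2 s t))"
      unfolding case_prod_beta
      by (rule continuous_on_compose2[OF \<Psi>(1) continuous_emb2]) (auto intro!: continuous_intros emb2_Rn)
    show "inj_on (\<lambda>(s, t). \<Psi> (emb2 s t)) ({\<epsilon> / 2..\<epsilon>} \<times> {t0 - r2..t0 + r2})"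
    proof (rule inj_onI, clarify)
      fix s t s' t' assume a: "s \<in> {\<epsilon> / 2..\<epsilon>}" "t \<in> {t0 - r2..t0 + r2}" "s' \<in> {\<epsilon> / 2..\<epsilon>}" "t' \<in> {t0 - r2..t0 + r2}"
        "\<Psi> (emb2 s t) = \<Psi> (emb2 s' t')"
      show "s = s' \<and> t = t'"
        using inj[OF a(1,3,2,4,5)] inj[OF a(3,1,4,2) a(5)[symmetric]] by (cases "s \<le> s'") auto
    qed
    show "(\<lambda>(s, t). \<Psi> (emb2 s t)) ` ({\<epsilon> / 2..\<epsilon>} \<times> {t0 - r2..t0 + r2}) \<subseteq> X" using \<Psi>(2) emb2_Rn by auto
  qed
qed

text \<open>The quotient \<open>r / h\<close> has derivative zero on an interval without zeros of
  \<open>h\<close>, so \<open>r\<close> minus a multiple of \<open>h\<close> has infinitely many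
  roots.\<close>

lemma wronskian_zero:
  fixes r h :: "real poly"
  assumes h: "h \<noteq> 0" and W: "pderiv r * h = r * pderiv h"
  shows "\<exists>c. r = smult c h"
proof -
  obtain t1 where t1: "poly h t1 \<noteq> 0" using h poly_all_0_iff_0 by blast
  have "open {t. poly h t \<noteq> 0}" by (intro open_Collect_neq continuous_intros)
  then obtain e where e: "0 < e" "ball t1 e \<subseteq> {t. poly h t \<noteq> 0}" using t1 open_contains_ball by blast
  have der: "((\<lambda>t. poly r t / poly h t) has_field_derivative 0) (at t within ball t1 e)" if "t \<in> ball t1 e" for t
  proof -
    have ht: "poly h t \<noteq> 0" using e(2) that by blast
    have "poly (pderiv r) t * poly h t - poly r t * poly (pderiv h) t = poly (pderiv r * h - r * pderiv h) t" by simp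
    also have "\<dots> = 0" using W by simp
    finally have e: "poly (pderiv r) t * poly h t - poly r t * poly (pderiv h) t = 0" .
    show ?thesis
      using DERIV_divide[OF poly_DERIV[of r t] poly_DERIV[of h t] ht, unfolded e div_0] by (rule has_field_derivative_at_within)
  qed
  have "\<exists>c. \<forall>t\<in>ball t1 e. poly r t / poly h t = c"
    by (rule has_field_derivative_zero_constant[OF convex_ball der])
  then obtain c where c: "\<forall>t\<in>ball t1 e. poly r t / poly h t = c" by (elim exE)
  have "ball t1 e \<subseteq> {t. poly (r - smult c h) t = 0}"
  proof
    fix t assume t: "t \<in> ball t1 e"
    have "poly h t \<noteq> 0" using t e(2) by blast
    moreover have "poly r t / poly h t = c" using t c by blast
    ultimately show "t \<in> {t. poly (r - smult c h) t = 0}" by (auto simp: field_simps)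
  qed
  moreover have "infinite (ball t1 e)"
  proof -
    have "{t1<..<t1 + e} \<subseteq> ball t1 e" by (auto simp: dist_real_def)
    moreover have "infinite {t1<..<t1 + e}" using e(1) by (intro infinite_Ioo) simp
    ultimately show ?thesis using finite_subset by blast
  qed
  ultimately have "r - smult c h = 0" using poly_roots_finite finite_subset by blast
  thus ?thesis by (intro exI[of _ c]) simp
qed

lemma (in rat_curve) coordinate_const:
  assumes "i < m" "r i = smult c h"
  shows "\<gamma> t i = c"
proof -
  have "continuous_on UNIV (\<lambda>t. \<gamma> t i - c)" by (rule continuous_on_diff[OF continuous_coord[OF cont] continuous_on_const])
  moreover have "\<gamma> t i - c = 0" if "poly h t \<noteq> 0" for t
    using rel[OF assms(1), of t] assms(2) that by simp
  ultimately have "\<gamma> t i - c = 0" by (rule zero_at_limit[OF _ h])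
  thus ?thesis by simp
qed

lemma real_analytic_poly_fun: "poly_fun n f \<Longrightarrow> real_analytic_on n U f"
  by (rule real_analytic_onI) (use pser_poly_fun[of n f 1] zero_less_one in blast)

context rat_param
begin

text \<open>In the plane through the line and a point \<open>w\<close> with \<open>f\<close>
  nonzero, \<open>f\<close> vanishes along the line to a finite positive order, and a coordinate
  that is not constant on the line has nonzero Wronskian. Near a generic point of the line this is
  the situation of \<open>surface_dim_ge_2\<close>.\<close>

lemma vanish_from_line:
  assumes nd: "\<not> dim_ge S 2" and p: "p0 \<in> Rn n" "p1 \<in> Rn n" "D p0 \<noteq> 0"
    and nc: "\<Gamma> (line p0 p1 t1) \<noteq> \<Gamma> p0"
    and f: "poly_fun m f" "\<And>t. f (\<Gamma> (line p0 p1 t)) = 0" and y: "y \<in> S"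
  shows "f y = 0"
proof (rule ccontr)
  assume fy: "f y \<noteq> 0"
  obtain x where x: "x \<in> Rn n" "y = \<Gamma> x" using y S by blast
  obtain w where w: "w \<in> Rn n" "D w \<noteq> 0" "f (\<Gamma> w) \<noteq> 0"
    using nonzero_nearby[OF real_analytic_poly_fun[OF f(1)] subset_UNIV x(1)] fy x(2) by blast
  \<comment> \<open>\<open>s = 0\<close> gives the line and (1, 0) gives \<open>w\<close>, where
    both \<open>D\<close> and \<open>f\<close> are nonzero; hence the numerator \<open>q\<close> is
    not identically zero.\<close>
  define \<Lambda> where "\<Lambda> = (\<lambda>(x::pt) i. line p0 p1 (x 1) i + x 0 * (w i - p0 i))"
  have \<Lambda>_Rn: "\<Lambda> x \<in> Rn n" for x using p(1,2) w(1) by (simp add: \<Lambda>_def line_def Rn_def)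
  have \<Lambda>0: "\<Lambda> (emb2 0 t) = line p0 p1 t" for t by (simp add: \<Lambda>_def)
  have \<Lambda>w: "\<Lambda> (emb2 1 0) = w" by (simp add: \<Lambda>_def)
  have p\<Lambda>: "poly_fun 2 (\<lambda>x. \<Lambda> x i)" for i unfolding \<Lambda>_def line_def by (intro poly_fun_intros) auto
  have comp: "poly_fun 2 (\<lambda>x. P (\<Lambda> x))" if "poly_fun n P" for P
    using poly_fun_compose[OF that p\<Lambda>] by simp
  define D' where "D' = (\<lambda>x. D (\<Lambda> x))"
  have pD': "poly_fun 2 D'" unfolding D'_def by (rule comp[OF pD])
  have pR': "poly_fun 2 (\<lambda>x. R i (\<Lambda> x))" if "i < m" for i by (rule comp[OF pR[OF that]])
  obtain N q where q: "poly_fun 2 q" "\<forall>x. D' x \<noteq> 0 \<longrightarrow> f (\<lambda>i. R i (\<Lambda> x) / D' x) * D' x ^ N = q x"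
    using clear_denominators[OF f(1), of 2 "\<lambda>i x. R i (\<Lambda> x)" D'] pD' pR' by blast
  have fq: "f (\<Gamma> (\<Lambda> x)) * D' x ^ N = q x" if "D' x \<noteq> 0" for x
  proof -
    have "f (\<Gamma> (\<Lambda> x)) = f (\<lambda>i. R i (\<Lambda> x) / D' x)"
      by (rule poly_fun_cong_coords[OF f(1)]) (use rel[OF \<Lambda>_Rn] that in \<open>simp add: D'_def field_simps\<close>)
    thus ?thesis using q(2) that by simp
  qed
  obtain Q :: "real poly poly" where Q: "\<forall>s t. q (emb2 s t) = poly (poly Q [:s:]) t"
    using poly_fun_2_bivariate[OF q(1)] by blast
  have "q (emb2 1 0) \<noteq> 0" using fq[of "emb2 1 0"] w(2,3) by (auto simp: D'_def \<Lambda>w)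
  hence "Q \<noteq> 0" using Q by auto
  then obtain k Q1 where Q1: "poly Q1 0 \<noteq> 0" "\<forall>s t. poly (poly Q [:s:]) t = s ^ k * poly (poly Q1 [:s:]) t"
    using split_power by blast
  define q1 where "q1 = (\<lambda>x::pt. poly (poly Q1 [:x 0:]) (x 1))"
  have pq1: "poly_fun 2 q1" unfolding q1_def by (rule bivariate_poly_fun)
  have qq1: "q (emb2 s t) = s ^ k * q1 (emb2 s t)" for s t using Q Q1(2) by (simp add: q1_def)
  obtain i where "\<Gamma> (line p0 p1 t1) i \<noteq> \<Gamma> p0 i" using nc by blast
  moreover from this have i: "i < m"
    using \<Gamma>_Rn[OF p(1)] \<Gamma>_Rn[OF line_Rn[OF p(1,2)], of t1] by (cases "i < m") (auto simp: Rn_def)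
  ultimately have nci: "\<Gamma> (line p0 p1 t1) i \<noteq> \<Gamma> (line p0 p1 0) i" by simp
  define R' where "R' = (\<lambda>x. R i (\<Lambda> x))"
  have pR'i: "poly_fun 2 R'" unfolding R'_def by (rule pR'[OF i])
  obtain h0 where h0: "\<forall>t. poly h0 t = D (line p0 p1 t)" using poly_fun_on_line[OF pD] by blast
  obtain r0 where r0: "\<forall>t. poly r0 t = R i (line p0 p1 t)" using poly_fun_on_line[OF pR[OF i]] by blast
  have h0n: "h0 \<noteq> 0" using h0[rule_format, of 0] p(3) by auto
  define W where "W = (\<lambda>x. partial_deriv 1 R' x * D' x - R' x * partial_deriv 1 D' x)"
  have pd: "partial_deriv 1 P (emb2 0 t) = poly (pderiv g) t" if P: "poly_fun 2 P" "\<And>t. P (emb2 0 t) = poly g t" for P g t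
  proof -
    have "((\<lambda>s. P (emb2 0 s)) has_field_derivative partial_deriv 1 P (emb2 0 t)) (at t)"
      using poly_fun_line_derivative[OF P(1), of "emb2 0 t" 1] by (simp only: emb2_upd emb2_simps)
    thus ?thesis unfolding P(2) using poly_DERIV DERIV_unique by blast
  qed
  have W0: "W (emb2 0 t) = poly (pderiv r0 * h0 - r0 * pderiv h0) t" for t
  proof -
    have "D' (emb2 0 t) = poly h0 t" "R' (emb2 0 t) = poly r0 t" for t using h0 r0 by (simp_all add: D'_def R'_def \<Lambda>0)
    thus ?thesis unfolding W_def using pd[OF pR'i, of r0] pd[OF pD', of h0] by simp
  qed
  have Wn: "pderiv r0 * h0 - r0 * pderiv h0 \<noteq> 0"
  proof
    assume "pderiv r0 * h0 - r0 * pderiv h0 = 0"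
    then obtain c where c: "r0 = smult c h0" using wronskian_zero[OF h0n, of r0] by auto
    obtain h r where rc: "rat_curve m (\<lambda>t. \<Gamma> (line p0 p1 t)) h r" using rat_curve_on_line[OF p(1,2)] p(3) by blast
    have "continuous_on UNIV (\<lambda>t. \<Gamma> (line p0 p1 t) i - c)"
      by (rule continuous_on_diff[OF continuous_coord[OF rat_curve.cont[OF rc]] continuous_on_const])
    moreover have "\<Gamma> (line p0 p1 t) i - c = 0" if "poly h0 t \<noteq> 0" for t
      
    proof -
      have "\<Gamma> (line p0 p1 t) i * poly h0 t = c * poly h0 t"
        using rel[OF line_Rn[OF p(1,2)] i, of t] h0 r0 c by simp
      thus ?thesis using that by simp
    qed
    ultimately have "\<And>t. \<Gamma> (line p0 p1 t) i - c = 0" by (rule zero_at_limit[OF _ h0n])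
    from this[of t1] this[of 0] show False using nci by simp
  qed
  \<comment> \<open>A parameter at which the denominator, the leading factor of \<open>f\<close> and
    the Wronskian are nonzero at once.\<close>
  have "h0 * poly Q1 0 * (pderiv r0 * h0 - r0 * pderiv h0) \<noteq> 0" using h0n Q1(1) Wn by simp
  then obtain t0 where "poly (h0 * poly Q1 0 * (pderiv r0 * h0 - r0 * pderiv h0)) t0 \<noteq> 0"
    using poly_all_0_iff_0 by blast
  hence t0: "poly h0 t0 \<noteq> 0" "poly (poly Q1 0) t0 \<noteq> 0" "poly (pderiv r0 * h0 - r0 * pderiv h0) t0 \<noteq> 0"
    unfolding poly_mult mult_eq_0_iff by blast+
  have D0: "D' (emb2 0 t0) \<noteq> 0" using t0(1) h0 by (simp add: D'_def \<Lambda>0)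
  have q0: "q1 (emb2 0 t0) \<noteq> 0" using t0(2) by (simp add: q1_def)
  have "k \<noteq> 0"
  proof
    assume "k = 0"
    hence "q (emb2 0 t0) \<noteq> 0" using q0 qq1 by simp
    moreover have "q (emb2 0 t0) = 0" using fq[OF D0] f(2) by (simp add: \<Lambda>0)
    ultimately show False by blast
  qed
  have "dim_ge S 2"
  proof (rule surface_dim_ge_2[OF pD' pR'i pq1 W_def D0 q0, where \<Psi> = "\<lambda>x. \<Gamma> (\<Lambda> x)" and f = f and g = "\<lambda>y. y i" and N = N and k = k])
    show "W (emb2 0 t0) \<noteq> 0" unfolding W0 by (rule t0(3))
    show "1 \<le> k" using \<open>k \<noteq> 0\<close> by simp
    have "continuous_on (Rn 2) \<Lambda>"
      by (rule continuous_on_coordinatewise_then_product) (rule poly_fun_continuous[OF p\<Lambda>])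
    thus "continuous_on (Rn 2) (\<lambda>x. \<Gamma> (\<Lambda> x))" by (rule continuous_on_compose2[OF cont]) (use \<Lambda>_Rn in auto)
    show "\<Gamma> (\<Lambda> x) \<in> S" for x using S \<Lambda>_Rn by blast
    show "\<Gamma> (\<Lambda> x) i * D' x = R' x" for x unfolding D'_def R'_def by (rule rel[OF \<Lambda>_Rn i])
    show "f (\<Gamma> (\<Lambda> x)) * D' x ^ N = x 0 ^ k * q1 x" if "x \<in> Rn 2" "D' x \<noteq> 0" for x
      using fq[OF that(2)] qq1[of "x 0" "x 1", folded Rn2_emb2[OF that(1)]] by simp
  qed
  thus False using nd by blast
qed

lemma nonconstant_line:
  assumes "infinite S"
  shows "\<exists>p0 p1 t1. p0 \<in> Rn n \<and> p1 \<in> Rn n \<and> D p0 \<noteq> 0 \<and> \<Gamma> (line p0 p1 t1) \<noteq> \<Gamma> p0"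
proof -
  obtain p0 where p0: "p0 \<in> Rn n" "D p0 \<noteq> 0" using D_nz by blast
  have "\<not> S \<subseteq> {\<Gamma> p0}" using assms finite_subset by blast
  then obtain p1 where "p1 \<in> Rn n" "\<Gamma> p1 \<noteq> \<Gamma> p0" using S by blast
  thus ?thesis using p0 by (intro exI[of _ p0] exI[of _ p1] exI[of _ 1]) simp
qed

end

section \<open>Parametrization of the Zariski closure\<close>

lemma to_fract_hom:
  "to_fract (\<Sum>i\<in>A. f i) = (\<Sum>i\<in>A. to_fract (f i))" "to_fract (p ^ n) = to_fract p ^ n"
  "to_fract (smult c q) = cst c * to_fract q"
proof -
  show "to_fract (\<Sum>i\<in>A. f i) = (\<Sum>i\<in>A. to_fract (f i))"
    by (induction A rule: infinite_finite_induct) simp_all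
  show "to_fract (p ^ n) = to_fract p ^ n" by (induction n) simp_all
  have "smult c q = [:c:] * q" by simp
  thus "to_fract (smult c q) = cst c * to_fract q" unfolding cst_def by (simp only: to_fract_mult)
qed

text \<open>Homogenization to degree \<open>d\<close> with affine parameter
  \<open>T = z 1 / z 0\<close>; fixing \<open>d\<close> gives all coordinates of the curve the same
  degree.\<close>

definition form_of :: "nat \<Rightarrow> real poly \<Rightarrow> pt \<Rightarrow> real" where
  "form_of d Q z = (\<Sum>j\<le>d. coeff Q j * z 1 ^ j * z 0 ^ (d - j))"

lemma homog_form_of: "homog_poly 2 d (form_of d Q)"
  unfolding homog_poly_def
proof (intro conjI allI ballI)
  have "poly_fun 2 (\<lambda>z. \<Sum>j\<le>d. coeff Q j * z 1 ^ j * z 0 ^ (d - j))" by (intro poly_fun_intros) auto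
  thus "poly_fun 2 (form_of d Q)" by (simp add: form_of_def[abs_def])
  fix t :: real and x :: pt
  have "coeff Q j * (t * x 1) ^ j * (t * x 0) ^ (d - j) = t ^ d * (coeff Q j * x 1 ^ j * x 0 ^ (d - j))" if "j \<le> d" for j
  proof -
    have "t ^ j * t ^ (d - j) = t ^ d" using that by (simp flip: power_add)
    thus ?thesis by (simp add: power_mult_distrib algebra_simps)
  qed
  thus "form_of d Q (\<lambda>i. t * x i) = t ^ d * form_of d Q x"
    unfolding form_of_def sum_distrib_left by (intro sum.cong) auto
qed

lemma form_of_affine: "degree Q \<le> d \<Longrightarrow> form_of d Q (emb2 1 T) = poly Q T"
  unfolding form_of_def by (simp add: poly_as_sum_le)

lemma form_of_infinity: "form_of d Q (emb2 0 T) = coeff Q d * T ^ d"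
proof -
  have "form_of d Q (emb2 0 T) = (\<Sum>j\<le>d. if j = d then coeff Q d * T ^ d else 0)"
    unfolding form_of_def by (rule sum.cong) auto
  thus ?thesis by simp
qed

text \<open>\<open>q ^ d * Q (p / q)\<close> written without division.\<close>

definition hpoly :: "nat \<Rightarrow> real poly \<Rightarrow> real poly \<Rightarrow> real poly \<Rightarrow> real poly" where
  "hpoly d p q Q = (\<Sum>j\<le>d. smult (coeff Q j) (p ^ j * q ^ (d - j)))"

lemma poly_hpoly: "poly (hpoly d p q Q) t = form_of d Q (emb2 (poly q t) (poly p t))"
  unfolding hpoly_def form_of_def poly_sum by (rule sum.cong) (simp_all add: mult.assoc)

lemma to_fract_hpoly:
  assumes "degree Q \<le> d" "q \<noteq> 0"
  shows "to_fract (hpoly d p q Q) = poly (lift_poly Q) (to_fract p / to_fract q) * to_fract q ^ d"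
proof -
  have "degree (lift_poly Q) \<le> d"
    by (rule degree_le) (use assms(1) in \<open>simp add: coeff_map_poly coeff_eq_0\<close>)
  hence "poly (lift_poly Q) (to_fract p / to_fract q) = (\<Sum>j\<le>d. coeff (lift_poly Q) j * (to_fract p / to_fract q) ^ j)"
    by (rule poly_as_sum_le)
  hence "poly (lift_poly Q) (to_fract p / to_fract q) * to_fract q ^ d
    = (\<Sum>j\<le>d. cst (coeff Q j) * (to_fract p / to_fract q) ^ j * to_fract q ^ d)"
    by (simp add: sum_distrib_right coeff_map_poly)
  also have "\<dots> = (\<Sum>j\<le>d. cst (coeff Q j) * (to_fract p ^ j * to_fract q ^ (d - j)))"
  proof (rule sum.cong)
    fix j assume "j \<in> {..d}"
    hence "to_fract q ^ d = to_fract q ^ j * to_fract q ^ (d - j)" by (simp flip: power_add)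
    moreover have "to_fract q ^ j \<noteq> 0" using assms(2) by simp
    ultimately show "cst (coeff Q j) * (to_fract p / to_fract q) ^ j * to_fract q ^ d
      = cst (coeff Q j) * (to_fract p ^ j * to_fract q ^ (d - j))"
      using assms(2) by (simp add: power_divide)
  qed simp
  also have "\<dots> = to_fract (hpoly d p q Q)" by (simp add: hpoly_def to_fract_hom)
  finally show ?thesis ..
qed

lemma lift_poly_prod: "poly (lift_poly (\<Prod>i\<in>A. Q i)) x = (\<Prod>i\<in>A. poly (lift_poly (Q i)) x)"
proof (induction A rule: infinite_finite_induct)
  case (insert i A)
  thus ?case by (simp add: lift_poly_hom)
qed (simp_all add: map_poly_1')

lemma lift_poly_linear: "poly (lift_poly [:- c, 1:]) x = x - cst c"
  by (simp add: map_poly_pCons)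

lemma homogenize:
  assumes "poly_fun m p"
  shows "\<exists>e p'. homog_poly (Suc m) e p' \<and> (\<forall>x. p' (hom_emb m x) = p x)"
proof -
  have mult: "homog_poly (Suc m) (d1 + d2) (\<lambda>y. a y * b y)" if "homog_poly (Suc m) d1 a" "homog_poly (Suc m) d2 b" for a b d1 d2
    using that by (auto simp: homog_poly_def power_add algebra_simps intro: pf_mult)
  have pw: "homog_poly (Suc m) d (\<lambda>y. y 0 ^ d)" for d
    unfolding homog_poly_def by (auto simp: power_mult_distrib intro!: poly_fun_intros)
  have add: "homog_poly (Suc m) d (\<lambda>y. a y + b y)" if "homog_poly (Suc m) d a" "homog_poly (Suc m) d b" for a b d
    using that by (auto simp: homog_poly_def algebra_simps intro: pf_add)
  show ?thesis using assms
  proof induction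
    case (pf_const c)
    show ?case by (intro exI[of _ 0] exI[of _ "\<lambda>_. c"]) (auto simp: homog_poly_def intro: poly_fun.pf_const)
  next
    case (pf_var i)
    thus ?case by (intro exI[of _ 1] exI[of _ "\<lambda>y. y (Suc i)"]) (auto simp: homog_poly_def intro: poly_fun.pf_var)
  next
    case (pf_add p q)
    then obtain d1 p1 d2 q1 where "homog_poly (Suc m) d1 p1" "\<forall>x. p1 (hom_emb m x) = p x"
      "homog_poly (Suc m) d2 q1" "\<forall>x. q1 (hom_emb m x) = q x" by blast
    thus ?case using mult[OF pw[of d2], of d1 p1] mult[OF pw[of d1], of d2 q1]
      by (intro exI[of _ "d1 + d2"] exI[of _ "\<lambda>y. y 0 ^ d2 * p1 y + y 0 ^ d1 * q1 y"] conjI add) (auto simp: add.commute)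
  next
    case (pf_mult p q)
    then obtain d1 p1 d2 q1 where "homog_poly (Suc m) d1 p1" "\<forall>x. p1 (hom_emb m x) = p x"
      "homog_poly (Suc m) d2 q1" "\<forall>x. q1 (hom_emb m x) = q x" by blast
    thus ?case by (intro exI[of _ "d1 + d2"] exI[of _ "\<lambda>y. p1 y * q1 y"] conjI mult) auto
  qed
qed

lemma homogenize_pair:
  assumes "poly_fun m p" "poly_fun m q"
  shows "\<exists>e p' q'. homog_poly (Suc m) e p' \<and> homog_poly (Suc m) e q' \<and>
    (\<forall>x. p' (hom_emb m x) = p x \<and> q' (hom_emb m x) = q x)"
proof -
  obtain d1 p1 d2 q1 where 1: "homog_poly (Suc m) d1 p1" "\<forall>x. p1 (hom_emb m x) = p x"
    "homog_poly (Suc m) d2 q1" "\<forall>x. q1 (hom_emb m x) = q x"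
    using homogenize[OF assms(1)] homogenize[OF assms(2)] by blast
  have pw: "homog_poly (Suc m) (d + d') (\<lambda>y. y 0 ^ d * a y)" if "homog_poly (Suc m) d' a" for d d' a
    using that by (auto simp: homog_poly_def power_add power_mult_distrib algebra_simps intro!: poly_fun_intros)
  show ?thesis
    using pw[OF 1(1), of d2] pw[OF 1(3), of d1] 1(2,4)
    by (intro exI[of _ "d1 + d2"] exI[of _ "\<lambda>y. y 0 ^ d2 * p1 y"] exI[of _ "\<lambda>y. y 0 ^ d1 * q1 y"]) (simp add: add.commute)
qed

lemma infinite_ratios:
  fixes p q :: "real poly"
  assumes q: "q \<noteq> 0" and r: "\<And>T. p \<noteq> smult T q" and F: "finite F"
  shows "infinite ((\<lambda>t. poly p t / poly q t) ` ({t. poly q t \<noteq> 0} - F))"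
proof
  let ?X = "{t. poly q t \<noteq> 0} - F"
  assume fin: "finite ((\<lambda>t. poly p t / poly q t) ` ?X)"
  have "UNIV \<subseteq> {t. poly q t = 0} \<union> F \<union> (\<Union>T\<in>(\<lambda>t. poly p t / poly q t) ` ?X. {t. poly (p - smult T q) t = 0})"
    by auto
  moreover have "finite \<dots>"
  proof (intro finite_UnI finite_UN_I fin F poly_roots_finite[OF q])
    show "finite {t. poly (p - smult T q) t = 0}" for T by (rule poly_roots_finite) (use r[of T] in simp)
  qed
  ultimately have "finite (UNIV::real set)" using finite_subset by blast
  thus False using infinite_UNIV_char_0 by blast
qed

text \<open>A nonconstant ratio \<open>p / q\<close> takes infinitely many values, so the form
  vanishes on the line \<open>z 0 = 1\<close>, then by scaling wherever \<open>z 0\<close> is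
  nonzero, and finally everywhere since it is a polynomial in \<open>z 0\<close> for fixed
  \<open>z 1\<close>.\<close>

lemma form_vanishing:
  assumes \<psi>: "homog_poly 2 d \<psi>" and q: "q \<noteq> 0" and r: "\<And>T. p \<noteq> smult T q" and F: "finite F"
    and 0: "\<And>t. t \<notin> F \<Longrightarrow> \<psi> (emb2 (poly q t) (poly p t)) = 0" and z: "z \<in> Rn 2"
  shows "\<psi> z = 0"
proof -
  have line: "\<exists>P::real poly. \<forall>s. \<psi> (\<lambda>i. poly (X i) s) = poly P s" for X
    by (rule poly_fun_compose_poly[OF homog_polyD(1)[OF \<psi>]])
  have e1: "(\<lambda>i. poly ((\<lambda>i. if i = 0 then 1 else if i = 1 then [:0, 1:] else 0) i) T) = emb2 1 T" for T :: real
    by (auto simp: emb2_def fun_eq_iff)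
  have e2: "(\<lambda>i. poly ((\<lambda>i. if i = 0 then [:0, 1:] else if i = 1 then [:c:] else 0) i) s) = emb2 s c" for s c :: real
    by (auto simp: emb2_def fun_eq_iff)
  obtain P where P: "\<forall>T. \<psi> (emb2 1 T) = poly P T" using line[of "\<lambda>i. if i = 0 then 1 else if i = 1 then [:0, 1:] else 0"] unfolding e1 by blast
  have sc: "emb2 (s * a) (s * b) = (\<lambda>i. s * emb2 a b i)" for s a b by (auto simp: emb2_def fun_eq_iff)
  have "(\<lambda>t. poly p t / poly q t) ` ({t. poly q t \<noteq> 0} - F) \<subseteq> {T. poly P T = 0}"
  proof (rule image_subsetI)
    fix t assume t: "t \<in> {t. poly q t \<noteq> 0} - F"
    have "emb2 (poly q t) (poly p t) = (\<lambda>i. poly q t * emb2 1 (poly p t / poly q t) i)" using t sc[of "poly q t" 1 "poly p t / poly q t"] by simp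
    hence "poly q t ^ d * \<psi> (emb2 1 (poly p t / poly q t)) = 0"
      using 0[of t] t homog_polyD(2)[OF \<psi> emb2_Rn] by simp
    thus "poly p t / poly q t \<in> {T. poly P T = 0}" using t P by simp
  qed
  hence "P = 0" using infinite_ratios[OF q r F] poly_roots_finite finite_subset by blast
  hence 1: "\<psi> (emb2 1 T) = 0" for T using P by simp
  have 2: "\<psi> (emb2 s c) = 0" if "s \<noteq> 0" for s c
  proof -
    have "emb2 s c = (\<lambda>i. s * emb2 1 (c / s) i)" using that sc[of s 1 "c / s"] by simp
    thus ?thesis using homog_polyD(2)[OF \<psi> emb2_Rn] 1 by simp
  qed
  obtain P2 where P2: "\<forall>s. \<psi> (emb2 s (z 1)) = poly P2 s"
    using line[of "\<lambda>i. if i = 0 then [:0, 1:] else if i = 1 then [:z 1:] else 0"] unfolding e2 by blast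
  have "P2 = 0"
  proof (rule poly_eq_cofinite)
    fix s :: real assume "s \<noteq> 0"
    from 2[OF this, of "z 1"] show "poly P2 s = poly 0 s" unfolding P2[rule_format] by simp
  qed
  hence "\<psi> (emb2 (z 0) (z 1)) = 0" using P2 by simp
  thus ?thesis by (simp only: Rn2_emb2[OF z, symmetric])
qed

text \<open>The outcome of Lueroth's theorem: in the parameter \<open>p / q\<close> the forms
  reproduce the curve, and conversely \<open>p / q = M / N\<close> is a rational function of the
  point of the curve. Together these make the parametrization birational.\<close>

locale curve_param = binary_forms "Suc m" d \<phi> + rat_curve m \<gamma> h r
  for m d :: nat and \<phi> \<gamma> h r +
  fixes p q :: "real poly" and N M :: "pt \<Rightarrow> real"
  assumes q: "q \<noteq> 0" and nonconst: "p \<noteq> smult T q"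
    and proportional: "i < m \<Longrightarrow> \<phi> 0 (emb2 (poly q t) (poly p t)) * poly (r i) t = poly h t * \<phi> (Suc i) (emb2 (poly q t) (poly p t))"
    and nondeg: "\<exists>t. \<phi> 0 (emb2 (poly q t) (poly p t)) \<noteq> 0"
    and NM: "poly_fun m N" "poly_fun m M" "finite {t. N (\<gamma> t) = 0}" "poly p t * N (\<gamma> t) = poly q t * M (\<gamma> t)"

text \<open>The function field of the curve inside R(t): the rational functions of t that are
  quotients M/N of polynomials in the point. That N has finitely many zeros along the curve
  expresses that N is not zero on it.\<close>

definition (in rat_curve) curve_field :: "real poly fract set" where
  "curve_field = {\<eta>. \<exists>p q M N. \<eta> = to_fract p / to_fract q \<and> q \<noteq> 0 \<and> poly_fun m M \<and> poly_fun m N \<and>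
     finite {t. N (\<gamma> t) = 0} \<and> (\<forall>t. poly p t * N (\<gamma> t) = poly q t * M (\<gamma> t))}"

context rat_curve
begin

lemma curve_fieldI:
  "q \<noteq> 0 \<Longrightarrow> poly_fun m M \<Longrightarrow> poly_fun m N \<Longrightarrow> finite {t. N (\<gamma> t) = 0} \<Longrightarrow>
    (\<And>t. poly p t * N (\<gamma> t) = poly q t * M (\<gamma> t)) \<Longrightarrow> to_fract p / to_fract q \<in> curve_field"
  unfolding curve_field_def by blast

lemma curve_fieldD:
  assumes "\<eta> \<in> curve_field"
  shows "\<exists>p q M N. \<eta> = to_fract p / to_fract q \<and> q \<noteq> 0 \<and> poly_fun m M \<and> poly_fun m N \<and>
     finite {t. N (\<gamma> t) = 0} \<and> (\<forall>t. poly p t * N (\<gamma> t) = poly q t * M (\<gamma> t))"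
  using assms unfolding curve_field_def by blast

lemma subfield_curve_field: "subfield_consts curve_field"
  unfolding subfield_consts_def
proof (intro conjI allI ballI)
  fix c
  have "to_fract [:c:] / to_fract 1 \<in> curve_field"
    by (rule curve_fieldI[of 1 "\<lambda>_. c" "\<lambda>_. 1"]) (auto intro: pf_const)
  thus "cst c \<in> curve_field" by (simp add: cst_def)
next
  fix x y assume xy: "x \<in> curve_field" "y \<in> curve_field"
  from curve_fieldD[OF xy(1)] obtain p q M N where
    x: "x = to_fract p / to_fract q" "q \<noteq> 0" "poly_fun m M" "poly_fun m N" "finite {t. N (\<gamma> t) = 0}" "\<forall>t. poly p t * N (\<gamma> t) = poly q t * M (\<gamma> t)"
    by (elim exE conjE) (rule that)
  from curve_fieldD[OF xy(2)] obtain p' q' M' N' where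
    y: "y = to_fract p' / to_fract q'" "q' \<noteq> 0" "poly_fun m M'" "poly_fun m N'" "finite {t. N' (\<gamma> t) = 0}" "\<forall>t. poly p' t * N' (\<gamma> t) = poly q' t * M' (\<gamma> t)"
    by (elim exE conjE) (rule that)
  have fin: "finite {t. N (\<gamma> t) * N' (\<gamma> t) = 0}"
    using finite_UnI[OF x(5) y(5)] by (rule rev_finite_subset) auto
  have "to_fract (p * q' + p' * q) / to_fract (q * q') \<in> curve_field"
  proof (rule curve_fieldI[where M = "\<lambda>x. M x * N' x + M' x * N x" and N = "\<lambda>x. N x * N' x"])
    fix t
    have "poly (p * q' + p' * q) t * (N (\<gamma> t) * N' (\<gamma> t))
      = (poly p t * N (\<gamma> t)) * poly q' t * N' (\<gamma> t) + (poly p' t * N' (\<gamma> t)) * poly q t * N (\<gamma> t)" by (simp add: algebra_simps)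
    thus "poly (p * q' + p' * q) t * (N (\<gamma> t) * N' (\<gamma> t)) = poly (q * q') t * (M (\<gamma> t) * N' (\<gamma> t) + M' (\<gamma> t) * N (\<gamma> t))"
      unfolding x(6)[rule_format] y(6)[rule_format] by (simp add: algebra_simps)
  qed (use x y fin in \<open>auto intro!: poly_fun_intros\<close>)
  thus "x + y \<in> curve_field" using x(1,2) y(1,2) by (simp add: add_frac_eq)
  have "to_fract (p * p') / to_fract (q * q') \<in> curve_field"
  proof (rule curve_fieldI[where M = "\<lambda>x. M x * M' x" and N = "\<lambda>x. N x * N' x"])
    fix t
    have "poly (p * p') t * (N (\<gamma> t) * N' (\<gamma> t)) = (poly p t * N (\<gamma> t)) * (poly p' t * N' (\<gamma> t))" by (simp add: algebra_simps)
    thus "poly (p * p') t * (N (\<gamma> t) * N' (\<gamma> t)) = poly (q * q') t * (M (\<gamma> t) * M' (\<gamma> t))"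
      unfolding x(6)[rule_format] y(6)[rule_format] by (simp add: algebra_simps)
  qed (use x y fin in \<open>auto intro!: poly_fun_intros\<close>)
  thus "x * y \<in> curve_field" using x(1) y(1) by simp
next
  fix x assume "x \<in> curve_field"
  from curve_fieldD[OF this] obtain p q M N where
    x: "x = to_fract p / to_fract q" "q \<noteq> 0" "poly_fun m M" "poly_fun m N" "finite {t. N (\<gamma> t) = 0}" "\<forall>t. poly p t * N (\<gamma> t) = poly q t * M (\<gamma> t)"
    by (elim exE conjE) (rule that)
  have "to_fract (- p) / to_fract q \<in> curve_field"
    by (rule curve_fieldI[where M = "\<lambda>x. - M x" and N = N]) (use x in \<open>auto intro!: poly_fun_intros\<close>)
  thus "- x \<in> curve_field" using x(1) by simp
  show "inverse x \<in> curve_field"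
  proof (cases "p = 0")
    case True
    have "to_fract 0 / to_fract 1 \<in> curve_field"
      by (rule curve_fieldI[of 1 "\<lambda>_. 0" "\<lambda>_. 1"]) (auto intro: pf_const)
    thus ?thesis using True x(1) by simp
  next
    case False
    have "{t. M (\<gamma> t) = 0} \<subseteq> {t. poly p t = 0} \<union> {t. N (\<gamma> t) = 0}"
    proof
      fix t assume "t \<in> {t. M (\<gamma> t) = 0}"
      hence "poly p t * N (\<gamma> t) = 0" using x(6)[rule_format, of t] by simp
      thus "t \<in> {t. poly p t = 0} \<union> {t. N (\<gamma> t) = 0}" by auto
    qed
    hence "finite {t. M (\<gamma> t) = 0}" using x(5) poly_roots_finite[OF False] finite_subset by blast
    hence "to_fract q / to_fract p \<in> curve_field"
      using False x(3,4,6) by (intro curve_fieldI[where M = N and N = M]) auto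
    thus ?thesis using x(1) by simp
  qed
qed

lemma coordinate_in_curve_field: "i < m \<Longrightarrow> to_fract (r i) / to_fract h \<in> curve_field"
  by (rule curve_fieldI[where M = "\<lambda>x. x i" and N = "\<lambda>_. 1"])
    (auto simp: h rel mult.commute[of "poly h _"] intro: poly_fun.intros)

text \<open>All coordinates are rational in the Lueroth generator \<theta>, which gives homogeneous
  coordinates \<open>Q 0, ..., Q m\<close> in \<theta>. A choice with \<open>Q 0\<close> of least
  degree has no common real root, because a common linear factor could be cancelled; so the forms
  are defined on the whole projective line.\<close>

lemma curve_param_exists:
  assumes nc: "\<gamma> t1 \<noteq> \<gamma> t2"
  shows "\<exists>d \<phi> p q N M. curve_param m d \<phi> \<gamma> h r p q N M"
proof -
  obtain i0 where i0: "i0 < m" "\<gamma> t1 i0 \<noteq> \<gamma> t2 i0"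
  proof -
    obtain i where "\<gamma> t1 i \<noteq> \<gamma> t2 i" using nc by blast
    moreover from this have "i < m" using \<gamma>_Rn[of t1] \<gamma>_Rn[of t2] by (cases "i < m") (auto simp: Rn_def)
    ultimately show ?thesis using that by blast
  qed
  have th: "to_fract h \<noteq> 0" using h by simp
  have nr: "to_fract (r i0) / to_fract h \<notin> range cst"
  proof
    assume "to_fract (r i0) / to_fract h \<in> range cst"
    then obtain c where "to_fract (r i0) / to_fract h = cst c" by blast
    hence "to_fract (r i0) = to_fract (smult c h)" using th by (simp add: to_fract_hom field_simps)
    hence "r i0 = smult c h" by simp
    thus False using coordinate_const[OF i0(1)] i0(2) by metis
  qed
  have "\<exists>\<theta>. \<theta> \<in> curve_field \<and> \<theta> \<notin> range cst \<and> (\<forall>\<eta>\<in>curve_field. \<exists>P Q. poly (lift_poly Q) \<theta> \<noteq> 0 \<and>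
      \<eta> = poly (lift_poly P) \<theta> / poly (lift_poly Q) \<theta>)"
    by (rule lueroth[OF subfield_curve_field coordinate_in_curve_field[OF i0(1)] nr])
  then obtain \<theta> where \<theta>: "\<theta> \<in> curve_field" "\<theta> \<notin> range cst" "\<forall>\<eta>\<in>curve_field. \<exists>P Q. poly (lift_poly Q) \<theta> \<noteq> 0 \<and>
      \<eta> = poly (lift_poly P) \<theta> / poly (lift_poly Q) \<theta>" by (elim exE conjE)
  obtain p q M N where pq: "\<theta> = to_fract p / to_fract q" "q \<noteq> 0" "poly_fun m M" "poly_fun m N" "finite {t. N (\<gamma> t) = 0}"
      "\<forall>t. poly p t * N (\<gamma> t) = poly q t * M (\<gamma> t)"
    using curve_fieldD[OF \<theta>(1)] by (elim exE conjE) (rule that)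
  have tq: "to_fract q \<noteq> 0" using pq(2) by simp
  have nonconst: "p \<noteq> smult T q" for T
  proof
    assume "p = smult T q"
    hence "\<theta> = cst T" using tq by (simp add: pq(1) to_fract_hom)
    thus False using \<theta>(2) by blast
  qed
  define ev where "ev = (\<lambda>Q. poly (lift_poly Q) \<theta>)"
  \<comment> \<open>\<open>Q 0 : ... : Q m\<close>, evaluated at \<theta>, are the homogeneous
    coordinates of the curve.\<close>
  define good where "good = (\<lambda>Q. ev (Q 0) \<noteq> 0 \<and> (\<forall>i<m. ev (Q 0) * (to_fract (r i) / to_fract h) = ev (Q (Suc i))))"
  have ex: "\<exists>Q. good Q"
  proof -
    have "\<forall>i\<in>{..<m}. \<exists>PQ. ev (snd PQ) \<noteq> 0 \<and> to_fract (r i) / to_fract h = ev (fst PQ) / ev (snd PQ)"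
    proof
      fix i assume "i \<in> {..<m}"
      hence "to_fract (r i) / to_fract h \<in> curve_field" using coordinate_in_curve_field by simp
      then obtain P Q where "poly (lift_poly Q) \<theta> \<noteq> 0 \<and> to_fract (r i) / to_fract h = poly (lift_poly P) \<theta> / poly (lift_poly Q) \<theta>"
        using \<theta>(3) by blast
      thus "\<exists>PQ. ev (snd PQ) \<noteq> 0 \<and> to_fract (r i) / to_fract h = ev (fst PQ) / ev (snd PQ)"
        unfolding ev_def by (intro exI[of _ "(P, Q)"]) simp
    qed
    hence "\<exists>PQ. \<forall>i\<in>{..<m}. ev (snd (PQ i)) \<noteq> 0 \<and> to_fract (r i) / to_fract h = ev (fst (PQ i)) / ev (snd (PQ i))" by (rule bchoice)
    then obtain PQ where PQ: "\<forall>i\<in>{..<m}. ev (snd (PQ i)) \<noteq> 0 \<and> to_fract (r i) / to_fract h = ev (fst (PQ i)) / ev (snd (PQ i))" by (elim exE)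
    define Q where "Q = (\<lambda>n. case n of 0 \<Rightarrow> \<Prod>j<m. snd (PQ j) | Suc i \<Rightarrow> fst (PQ i) * (\<Prod>j\<in>{..<m} - {i}. snd (PQ j)))"
    have ep: "ev (\<Prod>j\<in>A. snd (PQ j)) = (\<Prod>j\<in>A. ev (snd (PQ j)))" for A unfolding ev_def by (rule lift_poly_prod)
    have em: "ev (A * B) = ev A * ev B" for A B unfolding ev_def by (simp add: lift_poly_hom)
    have "ev (Q 0) \<noteq> 0" using PQ by (simp add: Q_def ep)
    moreover have "ev (Q 0) * (to_fract (r i) / to_fract h) = ev (Q (Suc i))" if i: "i < m" for i
    proof -
      have "ev (Q 0) = ev (snd (PQ i)) * (\<Prod>j\<in>{..<m} - {i}. ev (snd (PQ j)))"
        using i by (simp add: Q_def ep em prod.remove[of "{..<m}" i])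
      moreover have "ev (snd (PQ i)) \<noteq> 0" "to_fract (r i) / to_fract h = ev (fst (PQ i)) / ev (snd (PQ i))" using PQ i by auto
      ultimately show ?thesis by (simp add: Q_def em ep)
    qed
    ultimately show ?thesis unfolding good_def by blast
  qed
  define Q where "Q = arg_min (\<lambda>Q. degree (Q 0)) good"
  have gQ: "good Q" and minQ: "\<And>Q'. good Q' \<Longrightarrow> degree (Q 0) \<le> degree (Q' 0)"
  proof -
    obtain Q1 where "good Q1" using ex by (elim exE)
    from arg_min_nat_lemma[of good, OF this, of "\<lambda>Q. degree (Q 0)"]
    show "good Q" "\<And>Q'. good Q' \<Longrightarrow> degree (Q 0) \<le> degree (Q' 0)" unfolding Q_def by blast+
  qed
  have Q0: "Q 0 \<noteq> 0" using gQ by (auto simp: good_def ev_def)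
  have nocommon: "\<exists>i\<le>m. poly (Q i) T \<noteq> 0" for T
  proof (rule ccontr)
    assume "\<not> ?thesis"
    hence "\<forall>i\<in>{..m}. \<exists>Q'. Q i = [:- T, 1:] * Q'" unfolding poly_eq_0_iff_dvd dvd_def by auto
    hence "\<exists>Q'. \<forall>i\<in>{..m}. Q i = [:- T, 1:] * Q' i" by (rule bchoice)
    then obtain Q' where Q': "\<forall>i\<in>{..m}. Q i = [:- T, 1:] * Q' i" by (elim exE)
    have e: "ev (Q i) = (\<theta> - cst T) * ev (Q' i)" if "i \<le> m" for i
    proof -
      have "Q i = [:- T, 1:] * Q' i" using Q' that by simp
      thus ?thesis unfolding ev_def by (simp only: lift_poly_hom poly_mult lift_poly_linear)
    qed
    have nz: "\<theta> - cst T \<noteq> 0" using \<theta>(2) by auto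
    have "good Q'"
      unfolding good_def
    proof (intro conjI allI impI)
      show "ev (Q' 0) \<noteq> 0" using gQ e[of 0] by (auto simp: good_def)
      fix i assume "i < m"
      hence "(\<theta> - cst T) * (ev (Q' 0) * (to_fract (r i) / to_fract h)) = (\<theta> - cst T) * ev (Q' (Suc i))"
        using gQ e[of 0] e[of "Suc i"] unfolding good_def by (metis Suc_leI le0 mult.assoc)
      thus "ev (Q' 0) * (to_fract (r i) / to_fract h) = ev (Q' (Suc i))" using nz by (metis mult_left_cancel)
    qed
    hence "degree (Q 0) \<le> degree (Q' 0)" by (rule minQ)
    moreover have "Q 0 = [:- T, 1:] * Q' 0" using Q' by simp
    moreover from this have "Q' 0 \<noteq> 0" using Q0 by auto
    moreover have "degree ([:- T, 1:] * Q' 0) = Suc (degree (Q' 0))" using \<open>Q' 0 \<noteq> 0\<close> by (subst degree_mult_eq) auto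
    ultimately show False by simp
  qed
  \<comment> \<open>The exact maximum of the degrees, so that some top coefficient is nonzero and
    the forms have no common zero at infinity either.\<close>
  define d where "d = Max ((\<lambda>i. degree (Q i)) ` {..m})"
  have deg: "degree (Q i) \<le> d" if "i \<le> m" for i unfolding d_def using that by (intro Max_ge) auto
  have top: "\<exists>i\<le>m. coeff (Q i) d \<noteq> 0"
  proof -
    have "d \<in> (\<lambda>i. degree (Q i)) ` {..m}" unfolding d_def by (intro Max_in) auto
    then obtain i where i: "i \<le> m" "degree (Q i) = d" by auto
    show ?thesis
    proof (cases "Q i = 0")
      case True
      hence "degree (Q 0) = d" using i deg[of 0] by simp
      thus ?thesis using Q0 leading_coeff_neq_0[OF Q0] by (intro exI[of _ 0]) simp
    next
      case False
      thus ?thesis using i leading_coeff_neq_0[OF False] by auto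
    qed
  qed
  define \<phi> where "\<phi> = (\<lambda>i. form_of d (Q i))"
  have hp: "hpoly d p q (Q 0) * r i = h * hpoly d p q (Q (Suc i))" if i: "i < m" for i
  proof -
    have "ev (Q 0) * (to_fract (r i) / to_fract h) = ev (Q (Suc i))" using gQ i by (auto simp: good_def)
    hence "ev (Q 0) * to_fract q ^ d * to_fract (r i) = to_fract h * (ev (Q (Suc i)) * to_fract q ^ d)"
      using th by (simp add: field_simps)
    hence "to_fract (hpoly d p q (Q 0) * r i) = to_fract (h * hpoly d p q (Q (Suc i)))"
      using to_fract_hpoly[OF deg[of 0] pq(2)] to_fract_hpoly[OF deg[of "Suc i"] pq(2)] i
      by (simp add: ev_def pq(1))
    thus ?thesis by (simp only: to_fract_eq_iff)
  qed
  have hp0: "hpoly d p q (Q 0) \<noteq> 0"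
  proof
    assume "hpoly d p q (Q 0) = 0"
    hence "ev (Q 0) * to_fract q ^ d = 0" using to_fract_hpoly[OF deg[of 0] pq(2), where p = p] by (simp add: ev_def pq(1))
    thus False using gQ tq by (simp add: good_def)
  qed
  have "curve_param m d \<phi> \<gamma> h r p q N M"
  proof unfold_locales
    show "\<forall>i<Suc m. homog_poly 2 d (\<phi> i)" by (simp add: \<phi>_def homog_form_of)
    show "\<forall>z\<in>Rn 2. z \<noteq> (\<lambda>_. 0) \<longrightarrow> (\<exists>i<Suc m. \<phi> i z \<noteq> 0)"
    proof (intro ballI impI)
      fix z :: pt assume z: "z \<in> Rn 2" "z \<noteq> (\<lambda>_. 0)"
      have ze: "z = emb2 (z 0) (z 1)" by (rule Rn2_emb2[OF z(1)])
      show "\<exists>i<Suc m. \<phi> i z \<noteq> 0"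
      proof (cases "z 0 = 0")
        case True
        hence "z 1 \<noteq> 0" using z(2) ze emb2_eq_0_iff by metis
        obtain i where "i \<le> m" "coeff (Q i) d \<noteq> 0" using top by blast
        moreover have "\<phi> i z = coeff (Q i) d * z 1 ^ d" for i
          using form_of_infinity[of d "Q i" "z 1"] ze True by (simp add: \<phi>_def)
        ultimately show ?thesis using \<open>z 1 \<noteq> 0\<close> by (intro exI[of _ i]) simp
      next
        case False
        obtain i where i: "i \<le> m" "poly (Q i) (z 1 / z 0) \<noteq> 0" using nocommon by blast
        have zs: "z = (\<lambda>j. z 0 * emb2 1 (z 1 / z 0) j)" using False by (subst ze) (auto simp: emb2_def fun_eq_iff)
        have "\<phi> i (\<lambda>j. z 0 * emb2 1 (z 1 / z 0) j) = z 0 ^ d * poly (Q i) (z 1 / z 0)"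
          unfolding \<phi>_def homog_polyD(2)[OF homog_form_of emb2_Rn] form_of_affine[OF deg[OF i(1)]] ..
        hence "\<phi> i z \<noteq> 0" using zs i(2) False by (metis mult_eq_0_iff power_eq_0_iff)
        thus ?thesis using i(1) by (intro exI[of _ i]) simp
      qed
    qed
    show "\<phi> 0 (emb2 (poly q t) (poly p t)) * poly (r i) t = poly h t * \<phi> (Suc i) (emb2 (poly q t) (poly p t))" if "i < m" for i t
      using arg_cong[OF hp[OF that], of "\<lambda>P. poly P t"] by (simp add: \<phi>_def poly_hpoly)
    obtain t where "poly (hpoly d p q (Q 0)) t \<noteq> 0" using hp0 poly_all_0_iff_0 by blast
    thus "\<exists>t. \<phi> 0 (emb2 (poly q t) (poly p t)) \<noteq> 0" by (auto simp: \<phi>_def poly_hpoly)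
  qed (use pq nonconst in auto)
  thus ?thesis by blast
qed

end

text \<open>Elimination of the coefficient of index n with one member of the family as pivot. The
  family is indexed, so equal polynomials count separately.\<close>

lemma linear_dependence:
  fixes f :: "'a \<Rightarrow> real poly"
  assumes "finite I" "n < card I" "\<And>x k. x \<in> I \<Longrightarrow> n \<le> k \<Longrightarrow> coeff (f x) k = 0"
  shows "\<exists>c. (\<exists>x\<in>I. c x \<noteq> 0) \<and> (\<Sum>x\<in>I. smult (c x) (f x)) = 0"
  using assms
proof (induction n arbitrary: I f)
  case 0
  hence "f x = 0" if "x \<in> I" for x using that by (simp add: poly_eq_iff)
  moreover have "I \<noteq> {}" using 0 by auto
  ultimately show ?case by (intro exI[of _ "\<lambda>_. 1"]) auto
next
  case (Suc n)
  show ?case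
  proof (cases "\<forall>x\<in>I. coeff (f x) n = 0")
    case True
    have "coeff (f x) k = 0" if "x \<in> I" "n \<le> k" for x k
      using True Suc.prems(3)[of x k] that by (cases "k = n") auto
    thus ?thesis using Suc.IH[of I f] Suc.prems by simp
  next
    case False
    then obtain x0 where x0: "x0 \<in> I" "coeff (f x0) n \<noteq> 0" by blast
    define r where "r = (\<lambda>x. coeff (f x) n / coeff (f x0) n)"
    define g where "g = (\<lambda>x. f x - smult (r x) (f x0))"
    have g: "coeff (g x) k = 0" if "x \<in> I - {x0}" "n \<le> k" for x k
      using Suc.prems(3)[of x k] Suc.prems(3)[of x0 k] that x0 by (cases "k = n") (auto simp: g_def r_def)
    have "n < card (I - {x0})" using Suc.prems(1,2) x0(1) by simp
    have "\<exists>c. (\<exists>x\<in>I - {x0}. c x \<noteq> 0) \<and> (\<Sum>x\<in>I - {x0}. smult (c x) (g x)) = 0"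
    proof (rule Suc.IH)
      show "finite (I - {x0})" using Suc.prems(1) by simp
      show "n < card (I - {x0})" by fact
      show "coeff (g x) k = 0" if "x \<in> I - {x0}" "n \<le> k" for x k by (rule g[OF that])
    qed
    then obtain c where c: "\<exists>x\<in>I - {x0}. c x \<noteq> 0" "(\<Sum>x\<in>I - {x0}. smult (c x) (g x)) = 0" by (elim exE conjE)
    define c' where "c' = (\<lambda>x. if x = x0 then - (\<Sum>x\<in>I - {x0}. c x * r x) else c x)"
    have "(\<Sum>x\<in>I. smult (c' x) (f x)) = smult (c' x0) (f x0) + (\<Sum>x\<in>I - {x0}. smult (c x) (f x))"
      using Suc.prems(1) x0(1) by (subst sum.remove[of _ x0]) (auto simp: c'_def intro!: sum.cong)
    also have "(\<Sum>x\<in>I - {x0}. smult (c x) (f x)) = (\<Sum>x\<in>I - {x0}. smult (c x) (g x) + smult (c x * r x) (f x0))"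
      by (rule sum.cong) (auto simp: g_def smult_diff_right)
    also have "\<dots> = smult (\<Sum>x\<in>I - {x0}. c x * r x) (f x0)"
      by (simp add: sum.distrib c(2) smult_sum)
    also have "smult (c' x0) (f x0) + smult (\<Sum>x\<in>I - {x0}. c x * r x) (f x0) = 0"
      by (simp add: c'_def flip: smult_add_left)
    finally have "(\<Sum>x\<in>I. smult (c' x) (f x)) = 0" .
    moreover have "\<exists>x\<in>I. c' x \<noteq> 0" using c(1) by (auto simp: c'_def)
    ultimately show ?thesis by blast
  qed
qed

lemma homog_poly_nz_scale: "homog_poly k d P \<Longrightarrow> y \<in> Rn k \<Longrightarrow> t \<noteq> 0 \<Longrightarrow> P (\<lambda>i. t * y i) = 0 \<longleftrightarrow> P y = 0"
  using homog_polyD(2)[of k d P y t] by simp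

text \<open>The assumption \<open>vanish\<close> is what the surface argument provides: polynomials
  vanishing on the curve vanish on \<open>S\<close>, so the closure \<open>C\<close> of
  \<open>S\<close> is the closure of the curve. The forms \<open>a\<close>, \<open>b\<close>
  homogenize \<open>N\<close>, \<open>M\<close> and give the inverse map.\<close>

locale curve_closure = curve_param m d \<phi> \<gamma> h r p q N M
  for m d \<phi> \<gamma> h r p q N M +
  fixes S :: "pt set" and a b :: "pt \<Rightarrow> real" and e :: nat
  assumes \<gamma>_S: "\<gamma> t \<in> S" and S_Rn: "S \<subseteq> Rn m"
    and vanish: "poly_fun m f \<Longrightarrow> (\<And>t. f (\<gamma> t) = 0) \<Longrightarrow> y \<in> S \<Longrightarrow> f y = 0"
    and ab: "homog_poly (Suc m) e a" "homog_poly (Suc m) e b"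
      "\<forall>x. a (hom_emb m x) = N x \<and> b (hom_emb m x) = M x"
begin

abbreviation C :: "pt set" where "C \<equiv> zar_closure_proj m S"

definition zz :: "real \<Rightarrow> pt" where "zz t = emb2 (poly q t) (poly p t)"

lemma CD: "y \<in> C \<Longrightarrow> y \<in> Rn (Suc m)" "y \<in> C \<Longrightarrow> y \<noteq> (\<lambda>_. 0)"
  by (simp_all add: zar_closure_proj_def)

lemma \<Phi>_zz:
  assumes "poly h t \<noteq> 0"
  shows "\<Phi> (zz t) = (\<lambda>i. \<phi> 0 (zz t) * hom_emb m (\<gamma> t) i)"
proof
  fix i show "\<Phi> (zz t) i = \<phi> 0 (zz t) * hom_emb m (\<gamma> t) i"
  proof (cases i)
    case 0 thus ?thesis by (simp add: \<Phi>_def)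
  next
    case (Suc j)
    show ?thesis
    proof (cases "j < m")
      case True
      have "poly h t * \<phi> (Suc j) (zz t) = poly h t * (\<phi> 0 (zz t) * \<gamma> t j)"
        unfolding zz_def proportional[OF True, symmetric] rel[OF True, symmetric] by (simp only: mult_ac)
      thus ?thesis using assms True Suc by (simp add: \<Phi>_def)
    qed (simp add: Suc \<Phi>_def hom_emb_def)
  qed
qed

text \<open>Continuity fills in the finitely many excluded parameters, \<open>vanish\<close> passes
  from the curve to \<open>S\<close>, and the definition of the closure does the rest.\<close>

lemma closure_test:
  assumes P: "homog_poly (Suc m) k P" and X: "X \<noteq> 0" and 0: "\<And>t. poly X t \<noteq> 0 \<Longrightarrow> P (hom_emb m (\<gamma> t)) = 0"
    and y: "y \<in> C"
  shows "P y = 0"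
proof -
  have pf: "poly_fun m (\<lambda>x. P (hom_emb m x))" by (rule poly_fun_hom_emb[OF homog_polyD(1)[OF P]])
  have "continuous_on UNIV (\<lambda>t. P (hom_emb m (\<gamma> t)))"
    by (rule continuous_on_compose2[OF poly_fun_continuous[OF pf, of UNIV] cont]) auto
  from zero_at_limit[OF this X 0] have "P (hom_emb m (\<gamma> t)) = 0" for t by blast
  hence "\<forall>x\<in>S. P (hom_emb m x) = 0" using vanish[OF pf] by blast
  thus ?thesis using y P unfolding zar_closure_proj_def by blast
qed

lemma homog_\<Phi>:
  assumes P: "homog_poly (Suc m) k P"
  shows "homog_poly 2 (d * k) (\<lambda>z. P (\<Phi> z))"
  unfolding homog_poly_def
proof (intro conjI allI ballI)
  have "poly_fun 2 (\<lambda>z. P (\<lambda>i. \<Phi> z i))"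
  proof (rule poly_fun_compose[OF homog_polyD(1)[OF P]])
    show "poly_fun 2 (\<lambda>z. \<Phi> z i)" if "i < Suc m" for i using pf[OF that] that by (simp add: \<Phi>_def)
  qed
  thus "poly_fun 2 (\<lambda>z. P (\<Phi> z))" by simp
  fix t :: real and z assume "z \<in> Rn 2"
  thus "P (\<Phi> (\<lambda>i. t * z i)) = t ^ (d * k) * P (\<Phi> z)"
    by (simp add: \<Phi>_scale homog_polyD(2)[OF P \<Phi>_Rn] power_mult)
qed

lemma form_test:
  assumes \<psi>: "homog_poly 2 k \<psi>" and X: "X \<noteq> 0" and 0: "\<And>t. poly X t \<noteq> 0 \<Longrightarrow> \<psi> (zz t) = 0" and z: "z \<in> Rn 2"
  shows "\<psi> z = 0"
  by (rule form_vanishing[OF \<psi> q nonconst poly_roots_finite[OF X] _ z]) (use 0 in \<open>auto simp: zz_def\<close>)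

lemma cone_subset: "cone \<subseteq> C"
proof
  fix y assume y: "y \<in> cone"
  then obtain c z where z: "c \<noteq> 0" "z \<in> Rn 2" "z \<noteq> (\<lambda>_. 0)" "y = (\<lambda>i. c * \<Phi> z i)" unfolding cone_def by blast
  have "y \<noteq> (\<lambda>_. 0)" using \<Phi>_nz[OF z(2,3)] z(1) unfolding z(4) by (auto simp: fun_eq_iff)
  moreover have "P y = 0" if P: "homog_poly (Suc m) k P" "\<forall>x\<in>S. P (hom_emb m x) = 0" for P k
  proof -
    have "P (\<Phi> z) = 0"
    proof (rule form_test[OF homog_\<Phi>[OF P(1)] h _ z(2)])
      fix t assume "poly h t \<noteq> 0"
      thus "P (\<Phi> (zz t)) = 0" using P(2) \<gamma>_S homog_polyD(2)[OF P(1) hom_emb_Rn] by (simp add: \<Phi>_zz)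
    qed
    thus ?thesis unfolding z(4) homog_polyD(2)[OF P(1) \<Phi>_Rn] by simp
  qed
  ultimately show "y \<in> C" using cone_Rn[OF y] unfolding zar_closure_proj_def by blast
qed

lemma a_nz: "\<exists>t. poly h t \<noteq> 0 \<and> N (\<gamma> t) \<noteq> 0 \<and> \<phi> 0 (zz t) \<noteq> 0"
proof -
  have "poly_fun 2 (\<phi> 0)" by (rule pf) simp
  from poly_fun_compose_poly[OF this, of "\<lambda>i. if i = 0 then q else if i = 1 then p else 0"]
  obtain X where X: "\<forall>t. \<phi> 0 (\<lambda>i. poly (if i = 0 then q else if i = 1 then p else 0) t) = poly X t" by blast
  have "(\<lambda>i. poly (if i = 0 then q else if i = 1 then p else 0) t) = zz t" for t
    by (auto simp: zz_def emb2_def fun_eq_iff)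
  hence X: "\<phi> 0 (zz t) = poly X t" for t using X by simp
  have "X \<noteq> 0" using nondeg X by (auto simp: zz_def)
  have "finite ({t. poly h t = 0} \<union> {t. N (\<gamma> t) = 0} \<union> {t. poly X t = 0})"
    using poly_roots_finite[OF h] poly_roots_finite[OF \<open>X \<noteq> 0\<close>] NM(3) by blast
  from ex_new_if_finite[OF infinite_UNIV_char_0 this] show ?thesis unfolding X by blast
qed

lemma ab_\<Phi>: "z \<in> Rn 2 \<Longrightarrow> a (\<Phi> z) * z 1 = b (\<Phi> z) * z 0"
proof -
  assume z: "z \<in> Rn 2"
  have "homog_poly 2 (d * e + 1) (\<lambda>z. a (\<Phi> z) * z 1 - b (\<Phi> z) * z 0)"
    using homog_\<Phi>[OF ab(1)] homog_\<Phi>[OF ab(2)] unfolding homog_poly_def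
    by (auto simp: algebra_simps intro!: poly_fun_intros)
  hence "a (\<Phi> z) * z 1 - b (\<Phi> z) * z 0 = 0"
  proof (rule form_test[OF _ h _ z])
    fix t assume t: "poly h t \<noteq> 0"
    have "a (\<Phi> (zz t)) = \<phi> 0 (zz t) ^ e * N (\<gamma> t)" "b (\<Phi> (zz t)) = \<phi> 0 (zz t) ^ e * M (\<gamma> t)"
      using homog_polyD(2)[OF ab(1) hom_emb_Rn] homog_polyD(2)[OF ab(2) hom_emb_Rn] ab(3) by (simp_all add: \<Phi>_zz[OF t])
    thus "a (\<Phi> (zz t)) * zz t 1 - b (\<Phi> (zz t)) * zz t 0 = 0"
      using NM(4)[of t] by (simp add: zz_def mult_ac)
  qed
  thus ?thesis by simp
qed

lemma a_\<Phi>_nz: "\<exists>z\<in>Rn 2. a (\<Phi> z) \<noteq> 0"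
proof -
  obtain t where t: "poly h t \<noteq> 0" "N (\<gamma> t) \<noteq> 0" "\<phi> 0 (zz t) \<noteq> 0" using a_nz by blast
  have "a (\<Phi> (zz t)) = \<phi> 0 (zz t) ^ e * N (\<gamma> t)"
    using homog_polyD(2)[OF ab(1) hom_emb_Rn] ab(3) by (simp add: \<Phi>_zz[OF t(1)])
  thus ?thesis using t emb2_Rn unfolding zz_def by (intro bexI[of _ "emb2 (poly q t) (poly p t)"]) auto
qed

text \<open>That y is parallel to the image of \<open>(a y, b y)\<close> is expressed by the
  vanishing of 2 by 2 minors. These are homogeneous and vanish along the curve, hence on all of
  \<open>C\<close>.\<close>

lemma in_cone:
  assumes y: "y \<in> C" and nz: "a y \<noteq> 0 \<or> b y \<noteq> 0"
  shows "\<exists>c. c \<noteq> 0 \<and> y = (\<lambda>i. c * \<Phi> (emb2 (a y) (b y)) i)"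
proof -
  let ?w = "\<lambda>y. \<Phi> (emb2 (a y) (b y))"
  have pair: "?w y i * y j = ?w y j * y i" if ij: "i < Suc m" "j < Suc m" for i j
  proof -
    have pw: "poly_fun (Suc m) (\<lambda>y. ?w y i)" if "i < Suc m" for i
    proof -
      have "poly_fun (Suc m) (\<lambda>y. \<phi> i (\<lambda>j. emb2 (a y) (b y) j))"
      proof (rule poly_fun_compose[OF pf[OF that]])
        fix j :: nat assume "j < 2"
        hence "j = 0 \<or> j = 1" by auto
        thus "poly_fun (Suc m) (\<lambda>y. emb2 (a y) (b y) j)" using homog_polyD(1)[OF ab(1)] homog_polyD(1)[OF ab(2)] by auto
      qed
      thus ?thesis using that by (simp add: \<Phi>_def)
    qed
    have sw: "?w (\<lambda>i. t * y i) i = t ^ (e * d) * ?w y i" if "y \<in> Rn (Suc m)" for t y i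
    proof -
      have "emb2 (a (\<lambda>i. t * y i)) (b (\<lambda>i. t * y i)) = (\<lambda>i. t ^ e * emb2 (a y) (b y) i)"
        using homog_polyD(2)[OF ab(1) that] homog_polyD(2)[OF ab(2) that] by (auto simp: emb2_def fun_eq_iff)
      thus ?thesis by (simp add: \<Phi>_scale[OF emb2_Rn] power_mult)
    qed
    have hom: "homog_poly (Suc m) (e * d + 1) (\<lambda>y. ?w y i * y j - ?w y j * y i)"
      unfolding homog_poly_def
    proof (intro conjI allI ballI)
      show "poly_fun (Suc m) (\<lambda>y. ?w y i * y j - ?w y j * y i)" by (intro poly_fun_intros pw ij)
      show "?w (\<lambda>i. t * y i) i * (t * y j) - ?w (\<lambda>i. t * y i) j * (t * y i) = t ^ (e * d + 1) * (?w y i * y j - ?w y j * y i)"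
        if "y \<in> Rn (Suc m)" for t y unfolding sw[OF that] by (simp add: algebra_simps)
    qed
    have "?w y i * y j - ?w y j * y i = 0"
    proof (rule closure_test[OF hom _ _ y])
      show "h * q \<noteq> 0" using h q by simp
      fix t assume "poly (h * q) t \<noteq> 0"
      hence t: "poly h t \<noteq> 0" "poly q t \<noteq> 0" by auto
      let ?x = "hom_emb m (\<gamma> t)"
      have "emb2 (a ?x) (b ?x) = (\<lambda>i. (N (\<gamma> t) / poly q t) * zz t i)"
        using ab(3) NM(4)[of t] t(2) by (auto simp: emb2_def zz_def fun_eq_iff field_simps)
      hence "?w ?x = \<Phi> (\<lambda>i. (N (\<gamma> t) / poly q t) * zz t i)" by (simp only:)
      also have "\<dots> = (\<lambda>i. (N (\<gamma> t) / poly q t) ^ d * \<Phi> (zz t) i)" by (rule \<Phi>_scale) (simp add: zz_def emb2_Rn)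
      also have "\<dots> = (\<lambda>i. (N (\<gamma> t) / poly q t) ^ d * (\<phi> 0 (zz t) * ?x i))" by (simp only: \<Phi>_zz[OF t(1)])
      finally have "?w ?x = (\<lambda>i. (N (\<gamma> t) / poly q t) ^ d * (\<phi> 0 (zz t) * ?x i))" .
      thus "?w ?x i * ?x j - ?w ?x j * ?x i = 0" by simp
    qed
    thus ?thesis by simp
  qed
  have "\<Phi> (emb2 (a y) (b y)) \<noteq> (\<lambda>_. 0)" using nz by (intro \<Phi>_nz emb2_Rn) (simp add: emb2_eq_0_iff)
  then obtain i where i: "?w y i \<noteq> 0" by blast
  hence im: "i < Suc m" by (auto simp: \<Phi>_def split: if_splits)
  define c where "c = y i / ?w y i"
  have yc: "y j = c * ?w y j" for j
  proof (cases "j < Suc m")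
    case True
    show ?thesis using pair[OF im True] i by (simp add: c_def field_simps)
  next
    case False
    thus ?thesis using CD(1)[OF y] by (simp add: Rn_def \<Phi>_def)
  qed
  have "c \<noteq> 0"
  proof
    assume "c = 0"
    hence "y = (\<lambda>_. 0)" using yc by (auto simp: fun_eq_iff)
    thus False using CD(2)[OF y] by blast
  qed
  thus ?thesis using yc by blast
qed

text \<open>The forms \<open>a\<close>, \<open>y\<^sub>i\<^sup>e\<close>, \<open>y\<^sub>i\<^sup>e\<^sup>-\<^sup>1y\<^sub>j\<close> are algebraically dependent along the curve, since for large \<open>k\<close> there are more
  monomials of degree \<open>k\<close> than their degree in \<open>t\<close> allows. After cancelling powers of \<open>a\<close> the relation restricts
  \<open>y\<^sub>j / y\<^sub>i\<close> at the points with \<open>a y = 0\<close>.\<close>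
lemma ratio_relation:
  assumes ij: "i < Suc m" "j < Suc m"
  shows "\<exists>Q::real poly. Q \<noteq> 0 \<and> (\<forall>y\<in>C. a y = 0 \<longrightarrow> y i \<noteq> 0 \<longrightarrow> poly Q (y j / y i) = 0)"
proof -
  \<comment> \<open>Homogeneous coordinates of the curve multiplied by \<open>h\<close>, so that
    they are polynomials in t.\<close>
  define Pp where "Pp = (\<lambda>i. case i of 0 \<Rightarrow> h | Suc j \<Rightarrow> if j < m then r j else 0)"
  have Pp: "poly (Pp i) t = poly h t * hom_emb m (\<gamma> t) i" for i t
    using rel[of _ t] by (cases i) (auto simp: Pp_def hom_emb_def mult.commute)
  obtain A where A: "\<forall>t. a (\<lambda>i. poly (Pp i) t) = poly A t"
    using poly_fun_compose_poly[OF homog_polyD(1)[OF ab(1)]] by blast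
  have Ah: "poly A t = poly h t ^ e * N (\<gamma> t)" for t
    using A homog_polyD(2)[OF ab(1) hom_emb_Rn] ab(3) by (simp add: Pp)
  have A0: "A \<noteq> 0" using a_nz Ah by force
  define D where "D = Max {degree A, degree (Pp i), degree (Pp j)}"
  have D: "degree A \<le> D" "degree (Pp i) \<le> D" "degree (Pp j) \<le> D" by (simp_all add: D_def)
  \<comment> \<open>With this choice the degree bound \<open>D * ((e + 2) * k)\<close> is the square
    of \<open>k\<close>, while there are \<open>(k + 1)\<close> squared monomials.\<close>
  define k where "k = D * (e + 2)"
  define I where "I = {..k} \<times> {..k}"
  \<comment> \<open>The exponent of \<open>y i\<close> that fills every monomial up to the common
    degree \<open>(e + 1) * k\<close>; the relation is then homogeneous.\<close>
  define E where "E = (\<lambda>(u, v). (e + 1) * k - e * u - v)"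
  have Ele: "e * u + v \<le> (e + 1) * k" if "u \<le> k" "v \<le> k" for u v
    using mult_le_mono2[OF that(1), of e] that(2) unfolding distrib_right mult_1 by linarith
  define f where "f = (\<lambda>(u, v). A ^ u * Pp j ^ v * Pp i ^ E (u, v))"
  have degf: "degree (f uv) \<le> D * ((e + 2) * k)" if uvI: "uv \<in> I" for uv
  proof -
    obtain u v where uv: "uv = (u, v)" "u \<le> k" "v \<le> k" using uvI by (auto simp: I_def)
    have pw: "degree (P ^ n) \<le> D * n" if "degree P \<le> D" for P :: "real poly" and n
      using order_trans[OF degree_power_le mult_le_mono1[OF that]] .
    have "degree (f uv) \<le> D * u + D * v + D * E (u, v)"
      unfolding uv f_def prod.case
      using degree_mult_le[of "A ^ u * Pp j ^ v" "Pp i ^ E (u, v)"] degree_mult_le[of "A ^ u" "Pp j ^ v"]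
        pw[OF D(1), of u] pw[OF D(2), of "E (u, v)"] pw[OF D(3), of v] by linarith
    also have "\<dots> = D * (u + (v + E (u, v)))" by (simp add: algebra_simps)
    also have "\<dots> \<le> D * ((e + 2) * k)"
    proof (rule mult_le_mono2)
      have "v + E (u, v) \<le> (e + 1) * k" using Ele[OF uv(2,3)] by (simp add: E_def)
      thus "u + (v + E (u, v)) \<le> (e + 2) * k" using uv(2) by (simp add: algebra_simps)
    qed
    finally show ?thesis .
  qed
  have "card I = (k + 1) * (k + 1)" by (simp add: I_def card_cartesian_product)
  moreover have "D * ((e + 2) * k) = k * k" unfolding k_def by (simp only: mult_ac)
  ultimately have big: "D * ((e + 2) * k) + 1 < card I \<or> k = 0" by (cases "k = 0") auto
  show ?thesis
  proof (cases "k = 0")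
    \<comment> \<open>All three polynomials are constant in t, so a linear relation with constant
      coefficients holds between the two coordinates.\<close>
    case True
    hence "D = 0" by (simp add: k_def)
    hence "degree (Pp i) = 0" "degree (Pp j) = 0" "degree A = 0" using D by auto
    then obtain \<alpha> where \<alpha>: "A = [:\<alpha>:]" using degree_eq_zeroE by blast
    obtain \<beta> where \<beta>: "Pp i = [:\<beta>:]" using \<open>degree (Pp i) = 0\<close> degree_eq_zeroE by blast
    obtain \<delta> where \<delta>: "Pp j = [:\<delta>:]" using \<open>degree (Pp j) = 0\<close> degree_eq_zeroE by blast
    have lin: "\<beta> * y j - \<delta> * y i = 0" if "y \<in> C" for y
    proof (rule closure_test[OF _ h _ that])
      show "homog_poly (Suc m) 1 (\<lambda>y. \<beta> * y j - \<delta> * y i)"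
        unfolding homog_poly_def using ij by (auto simp: algebra_simps intro!: poly_fun_intros)
      fix t assume "poly h t \<noteq> 0"
      hence "hom_emb m (\<gamma> t) i = \<beta> / poly h t" "hom_emb m (\<gamma> t) j = \<delta> / poly h t"
        using Pp[of i t] Pp[of j t] \<beta> \<delta> by (simp_all add: field_simps)
      thus "\<beta> * hom_emb m (\<gamma> t) j - \<delta> * hom_emb m (\<gamma> t) i = 0" by simp
    qed
    have lin2: "y i = 0" if "y \<in> C" "\<beta> = 0" for y
    proof (rule closure_test[OF _ h _ that(1)])
      show "homog_poly (Suc m) 1 (\<lambda>y. y i)" unfolding homog_poly_def using ij by (auto intro!: poly_fun_intros)
      show "hom_emb m (\<gamma> t) i = 0" if "poly h t \<noteq> 0" for t using Pp[of i t] \<beta> \<open>\<beta> = 0\<close> that by simp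
    qed
    show ?thesis
    proof (cases "\<beta> = 0")
      case True
      thus ?thesis using lin2 by (intro exI[of _ 1]) auto
    next
      case False
      have "poly [:- \<delta>, \<beta>:] (y j / y i) = 0" if "y \<in> C" "y i \<noteq> 0" for y
        using lin[OF that(1)] that(2) by (simp add: field_simps)
      thus ?thesis using False by (intro exI[of _ "[:- \<delta>, \<beta>:]"]) auto
    qed
  next
    case False
    hence big: "D * ((e + 2) * k) + 1 < card I" using big by blast
    have fin: "finite I" by (simp add: I_def)
    have coeff0: "coeff (f x) l = 0" if "x \<in> I" "D * ((e + 2) * k) + 1 \<le> l" for x l
      using degf[OF that(1)] that(2) by (intro coeff_eq_0) simp
    have "\<exists>c. (\<exists>x\<in>I. c x \<noteq> 0) \<and> (\<Sum>x\<in>I. smult (c x) (f x)) = 0"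
      by (rule linear_dependence[OF fin big coeff0])
    then obtain c where c: "\<exists>x\<in>I. c x \<noteq> 0" "(\<Sum>x\<in>I. smult (c x) (f x)) = 0" by (elim exE conjE)
    define c1 where "c1 = (\<lambda>u v. c (u, v))"
    define ok where "ok = (\<lambda>u. u \<le> k \<and> (\<exists>v\<le>k. c1 u v \<noteq> 0))"
    have "\<exists>u. ok u" using c(1) by (auto simp: ok_def c1_def I_def)
    \<comment> \<open>The highest power of \<open>a\<close> common to all terms. After cancelling
      it, the terms with \<open>u = u0\<close> survive where \<open>a\<close> vanishes, and one of
      them has a nonzero coefficient.\<close>
    define u0 where "u0 = (LEAST u. ok u)"
    have u0: "ok u0" unfolding u0_def using \<open>\<exists>u. ok u\<close> by (rule LeastI_ex)
    have min: "c1 u v = 0" if "u < u0" "u \<le> k" "v \<le> k" for u v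
      using not_less_Least[of u ok] that unfolding u0_def ok_def by blast
    have u0k: "u0 \<le> k" using u0 by (simp add: ok_def)
    define G where "G = (\<lambda>y. \<Sum>u\<in>{u0..k}. \<Sum>v\<le>k. c1 u v * (a y ^ (u - u0) * y j ^ v * y i ^ E (u, v)))"
    have homG: "homog_poly (Suc m) ((e + 1) * k - e * u0) G"
      unfolding homog_poly_def
    proof (intro conjI allI ballI)
      show "poly_fun (Suc m) G" unfolding G_def using ij homog_polyD(1)[OF ab(1)] by (intro poly_fun_intros)
      fix t :: real and y assume y: "y \<in> Rn (Suc m)"
      have "(t ^ e * a y) ^ (u - u0) * (t * y j) ^ v * (t * y i) ^ E (u, v)
         = t ^ ((e + 1) * k - e * u0) * (a y ^ (u - u0) * y j ^ v * y i ^ E (u, v))" if "u0 \<le> u" "u \<le> k" "v \<le> k" for u v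
      proof -
        have "e * (u - u0) + v + E (u, v) = (e + 1) * k - e * u0"
        proof -
          have "e * u0 \<le> e * u" using that(1) by simp
          thus ?thesis using Ele[OF that(2,3)] unfolding E_def prod.case diff_mult_distrib2 by linarith
        qed
        hence "t ^ ((e + 1) * k - e * u0) = (t ^ e) ^ (u - u0) * t ^ v * t ^ E (u, v)"
          by (simp flip: power_mult power_add)
        thus ?thesis by (simp add: power_mult_distrib mult_ac)
      qed
      thus "G (\<lambda>i. t * y i) = t ^ ((e + 1) * k - e * u0) * G y"
        unfolding G_def homog_polyD(2)[OF ab(1) y] sum_distrib_left
        by (intro sum.cong refl) (simp add: mult.left_commute)
    qed
    have G0: "G y = 0" if "y \<in> C" for y
    proof (rule closure_test[OF homG _ _ that])
      show "h * A \<noteq> 0" using h A0 by simp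
      fix t assume "poly (h * A) t \<noteq> 0"
      hence t: "poly h t \<noteq> 0" "poly A t \<noteq> 0" by auto
      have "0 = poly (\<Sum>x\<in>I. smult (c x) (f x)) t" unfolding c(2) by simp
      also have "\<dots> = (\<Sum>u\<le>k. \<Sum>v\<le>k. c1 u v * (poly A t ^ u * poly (Pp j) t ^ v * poly (Pp i) t ^ E (u, v)))"
        by (simp add: poly_sum I_def f_def c1_def sum.cartesian_product case_prod_beta)
      also have "\<dots> = (\<Sum>u\<in>{u0..k}. \<Sum>v\<le>k. c1 u v * (poly A t ^ u * poly (Pp j) t ^ v * poly (Pp i) t ^ E (u, v)))"
        by (rule sum.mono_neutral_right) (auto simp: min)
      also have "\<dots> = poly A t ^ u0 * G (\<lambda>i. poly (Pp i) t)"
      proof -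
        have pow: "poly A t ^ u = poly A t ^ u0 * poly A t ^ (u - u0)" if "u0 \<le> u" for u
          using that by (simp flip: power_add)
        have tr: "c1 u v * (poly A t ^ u * X * Y) = poly A t ^ u0 * (c1 u v * (poly A t ^ (u - u0) * X * Y))" if "u0 \<le> u" for u v X Y
          by (subst pow[OF that]) (simp only: mult_ac)
        show ?thesis unfolding G_def sum_distrib_left A[rule_format] by (intro sum.cong refl tr) simp
      qed
      finally have "G (\<lambda>i. poly (Pp i) t) = 0" using t(2) by simp
      hence "G (\<lambda>i. poly h t * hom_emb m (\<gamma> t) i) = 0" unfolding Pp .
      thus "G (hom_emb m (\<gamma> t)) = 0" using homog_poly_nz_scale[OF homG hom_emb_Rn t(1)] by blast
    qed
    define Q where "Q = (\<Sum>v\<le>k. monom (c1 u0 v) v)"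
    obtain v0 where v0: "v0 \<le> k" "c1 u0 v0 \<noteq> 0" using u0 by (auto simp: ok_def)
    have "coeff Q v0 = c1 u0 v0" unfolding Q_def coeff_sum coeff_monom using v0(1) by simp
    hence "Q \<noteq> 0" using v0(2) by auto
    moreover have "poly Q (y j / y i) = 0" if y: "y \<in> C" "a y = 0" "y i \<noteq> 0" for y
    proof -
      let ?E = "(e + 1) * k - e * u0"
      have "0 = G y" using G0[OF y(1)] by simp
      also have "G y = (\<Sum>u\<in>{u0}. \<Sum>v\<le>k. c1 u v * (a y ^ (u - u0) * y j ^ v * y i ^ E (u, v)))"
        unfolding G_def
      proof (rule sum.mono_neutral_right)
        show "\<forall>u\<in>{u0..k} - {u0}. (\<Sum>v\<le>k. c1 u v * (a y ^ (u - u0) * y j ^ v * y i ^ E (u, v))) = 0"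
        proof
          fix u assume "u \<in> {u0..k} - {u0}"
          hence z: "a y ^ (u - u0) = 0" using y(2) by auto
          show "(\<Sum>v\<le>k. c1 u v * (a y ^ (u - u0) * y j ^ v * y i ^ E (u, v))) = 0" unfolding z by simp
        qed
      qed (use u0k in auto)
      also have "\<dots> = (\<Sum>v\<le>k. y i ^ ?E * (c1 u0 v * (y j / y i) ^ v))"
      proof -
        have "y j ^ v * y i ^ E (u0, v) = y i ^ ?E * (y j / y i) ^ v" if "v \<le> k" for v
        proof -
          have "?E = v + E (u0, v)" using Ele[OF u0k that] by (simp add: E_def)
          thus ?thesis using y(3) by (simp add: power_add power_divide)
        qed
        thus ?thesis by (simp add: mult_ac)
      qed
      also have "\<dots> = y i ^ ?E * poly Q (y j / y i)"
        unfolding Q_def poly_sum poly_monom sum_distrib_left ..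
      finally show ?thesis using y(3) by simp
    qed
    ultimately show ?thesis by blast
  qed
qed

text \<open>By \<open>ratio_relation\<close> each ratio of coordinates takes finitely many values at
  such points, and a unit vector is determined by its ratios to one nonzero coordinate and a
  sign.\<close>

lemma finite_base_points: "finite {y \<in> sph_sec (Suc m) C. a y = 0}"
proof -
  have "\<forall>ij\<in>{..m} \<times> {..m}. \<exists>Q::real poly. Q \<noteq> 0 \<and> (\<forall>y\<in>C. a y = 0 \<longrightarrow> y (fst ij) \<noteq> 0 \<longrightarrow> poly Q (y (snd ij) / y (fst ij)) = 0)"
  proof
    fix ij :: "nat \<times> nat" assume "ij \<in> {..m} \<times> {..m}"
    hence "fst ij < Suc m" "snd ij < Suc m" by auto
    from ratio_relation[OF this] show "\<exists>Q::real poly. Q \<noteq> 0 \<and> (\<forall>y\<in>C. a y = 0 \<longrightarrow> y (fst ij) \<noteq> 0 \<longrightarrow> poly Q (y (snd ij) / y (fst ij)) = 0)" .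
  qed
  hence "\<exists>Q::nat \<times> nat \<Rightarrow> real poly. \<forall>ij\<in>{..m} \<times> {..m}. Q ij \<noteq> 0 \<and> (\<forall>y\<in>C. a y = 0 \<longrightarrow> y (fst ij) \<noteq> 0 \<longrightarrow> poly (Q ij) (y (snd ij) / y (fst ij)) = 0)"
    by (rule bchoice)
  then obtain Q :: "nat \<times> nat \<Rightarrow> real poly" where
    Q: "\<forall>ij\<in>{..m} \<times> {..m}. Q ij \<noteq> 0 \<and> (\<forall>y\<in>C. a y = 0 \<longrightarrow> y (fst ij) \<noteq> 0 \<longrightarrow> poly (Q ij) (y (snd ij) / y (fst ij)) = 0)" by (elim exE)
  define g where "g = (\<lambda>\<sigma> v (j::nat). \<sigma> * normalize_pt (Suc m) (\<lambda>j. if j \<le> m then v j else 0) j :: real)"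
  define V where "V = (\<lambda>i. Pi\<^sub>E {..m} (\<lambda>j. {x. poly (Q (i, j)) x = 0}))"
  have "finite (V i)" if "i \<le> m" for i unfolding V_def
    using Q that by (intro finite_PiE poly_roots_finite) auto
  hence fin: "finite (\<Union>i\<in>{..m}. \<Union>\<sigma>\<in>{1, -1}. g \<sigma> ` V i)" by auto
  have "{y \<in> sph_sec (Suc m) C. a y = 0} \<subseteq> (\<Union>i\<in>{..m}. \<Union>\<sigma>\<in>{1, -1}. g \<sigma> ` V i)"
  proof
    fix y assume "y \<in> {y \<in> sph_sec (Suc m) C. a y = 0}"
    hence y: "y \<in> C" "sqnorm (Suc m) y = 1" "a y = 0" by (auto simp: sph_sec_def)
    have yR: "y j = 0" if "\<not> j \<le> m" for j using CD(1)[OF y(1)] that by (simp add: Rn_def)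
    obtain i where i: "y i \<noteq> 0" using CD(2)[OF y(1)] by blast
    hence im: "i \<le> m" using yR by blast
    define v where "v = (\<lambda>j\<in>{..m}. y j / y i)"
    have vV: "v \<in> V i" using Q im i y(1,3) by (auto simp: V_def v_def)
    have vy: "(\<lambda>j. if j \<le> m then v j else 0) = (\<lambda>j. (1 / y i) * y j)" using yR by (auto simp: v_def fun_eq_iff)
    have "g (sgn (y i)) v = y"
    proof
      fix j
      have "sqnorm (Suc m) (\<lambda>j. (1 / y i) * y j) = (1 / y i)\<^sup>2" unfolding sqnorm_scale y(2) by simp
      hence "sqrt (sqnorm (Suc m) (\<lambda>j. (1 / y i) * y j)) = \<bar>1 / y i\<bar>" by simp
      hence "normalize_pt (Suc m) (\<lambda>j. if j \<le> m then v j else 0) j = (1 / y i) * y j / \<bar>1 / y i\<bar>"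
        by (simp only: vy normalize_pt_def)
      thus "g (sgn (y i)) v j = y j" using i by (simp add: g_def sgn_if abs_if)
    qed
    moreover have "sgn (y i) \<in> {1, -1}" using i by (simp add: sgn_if)
    ultimately show "y \<in> (\<Union>i\<in>{..m}. \<Union>\<sigma>\<in>{1, -1}. g \<sigma> ` V i)" 
      using vV im by (intro UN_I[of i] UN_I[of "sgn (y i)"] image_eqI[of _ _ v]) auto
  qed
  thus ?thesis using fin finite_subset by blast
qed

end

context curve_closure
begin

text \<open>Off the finitely many points with \<open>a = 0\<close>, a point of \<open>C\<close> is
  determined up to scaling by the number \<open>b / a\<close>. On an embedded plane domain this
  would give an injective continuous map of an open set of the plane into the line.\<close>

lemma section_not_dim_ge_2: "\<not> dim_ge (sph_sec (Suc m) C) 2"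
proof
  assume "dim_ge (sph_sec (Suc m) C) 2"
  then obtain U V g g' where U: "openin (top_of_set (Rn 2)) U" "U \<noteq> {}" and V: "V \<subseteq> sph_sec (Suc m) C" "homeomorphism U V g g'"
    unfolding dim_ge_def by (elim exE conjE)
  define em :: "real \<times> real \<Rightarrow> pt" where "em = (\<lambda>x. emb2 (fst x) (snd x))"
  define O1 where "O1 = em -` U"
  obtain W where W: "open W" "U = Rn 2 \<inter> W" using U(1) by (auto simp: openin_open)
  have cem: "continuous_on A em" for A unfolding em_def by (intro continuous_emb2 continuous_intros)
  have "O1 = em -` W" unfolding O1_def W(2) em_def using emb2_Rn by auto
  hence oO: "open O1" using open_vimage[OF W(1) cem] by simp
  obtain x0 where x0: "x0 \<in> U" using U(2) by blast
  hence "x0 = em (x0 0, x0 1)" using W(2) Rn2_emb2 by (auto simp: em_def)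
  hence O1ne: "(x0 0, x0 1) \<in> O1" using x0 by (simp add: O1_def)
  define G where "G = (\<lambda>x. g (em x))"
  have cG: "continuous_on O1 G" unfolding G_def
    by (rule continuous_on_compose2[OF homeomorphism_cont1[OF V(2)] cem]) (auto simp: O1_def)
  have GV: "G x \<in> sph_sec (Suc m) C" if "x \<in> O1" for x
    using that V homeomorphism_image1[OF V(2)] by (auto simp: G_def O1_def)
  have injG: "inj_on G O1"
  proof (rule inj_onI)
    fix x y assume xy: "x \<in> O1" "y \<in> O1" "G x = G y"
    hence "em x = em y" using homeomorphism_apply1[OF V(2)] unfolding G_def O1_def by (metis vimageE)
    hence "em x 0 = em y 0" "em x 1 = em y 1" by simp_all
    thus "x = y" by (simp add: em_def prod_eq_iff)
  qed
  have "infinite O1"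
    using oO O1ne by (metis ex_in_conv finite_imp_not_open)
  moreover have "finite (O1 \<inter> G -` {y \<in> sph_sec (Suc m) C. a y = 0})"
    using finite_vimage_IntI[OF finite_base_points injG] by (simp add: Int_commute)
  ultimately have "\<not> O1 \<subseteq> O1 \<inter> G -` {y \<in> sph_sec (Suc m) C. a y = 0}" using finite_subset by blast
  then obtain x1 where x1: "x1 \<in> O1" "a (G x1) \<noteq> 0" using GV by blast
  have "G x1 \<noteq> (\<lambda>_. 0)" using CD(2) GV[OF x1(1)] by (auto simp: sph_sec_def)
  then obtain i where i: "G x1 i \<noteq> 0" by blast
  have ca: "continuous_on O1 (\<lambda>x. a (G x))" "continuous_on O1 (\<lambda>x. b (G x))"
    using continuous_on_compose2[OF poly_fun_continuous[OF homog_polyD(1)[OF ab(1)], of UNIV] cG]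
      continuous_on_compose2[OF poly_fun_continuous[OF homog_polyD(1)[OF ab(2)], of UNIV] cG] by auto
  \<comment> \<open>The sign of one coordinate is fixed so that the domain contains no pair of
    antipodal points, which have the same ratio.\<close>
  define O2 where "O2 = O1 \<inter> (\<lambda>x. a (G x)) -` (- {0}) \<inter> (O1 \<inter> (\<lambda>x. G x i * G x1 i) -` {0<..})"
  have "open O2" unfolding O2_def
    by (intro open_Int continuous_open_preimage oO ca continuous_on_mult continuous_coord cG continuous_on_const) auto
  have O2: "x \<in> O1" "a (G x) \<noteq> 0" "0 < G x i * G x1 i" if "x \<in> O2" for x using that by (auto simp: O2_def)
  have "x1 \<in> O2" using x1 i by (simp add: O2_def) (metis not_real_square_gt_zero)
  define f where "f = (\<lambda>x. b (G x) / a (G x))"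
  have cf: "continuous_on O2 f" unfolding f_def
    by (intro continuous_on_divide continuous_on_subset[OF ca(1)] continuous_on_subset[OF ca(2)]) (use O2 in auto)
  have par: "\<exists>c. c \<noteq> 0 \<and> G x = (\<lambda>i. c * \<Phi> (emb2 1 (f x)) i)" if x: "x \<in> O2" for x
  proof -
    have "G x \<in> C" using GV[OF O2(1)[OF x]] by (simp add: sph_sec_def)
    then obtain c where c: "c \<noteq> 0" "G x = (\<lambda>i. c * \<Phi> (emb2 (a (G x)) (b (G x))) i)" using in_cone O2(2)[OF x] by blast
    have "emb2 (a (G x)) (b (G x)) = (\<lambda>i. a (G x) * emb2 1 (f x) i)" using O2(2)[OF x] by (auto simp: f_def emb2_def fun_eq_iff)
    hence "\<Phi> (emb2 (a (G x)) (b (G x))) = (\<lambda>i. a (G x) ^ d * \<Phi> (emb2 1 (f x)) i)" by (simp only: \<Phi>_scale[OF emb2_Rn])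
    with c(2) have "G x = (\<lambda>i. (c * a (G x) ^ d) * \<Phi> (emb2 1 (f x)) i)" by (simp only: mult.assoc)
    moreover have "c * a (G x) ^ d \<noteq> 0" using c(1) O2(2)[OF x] by simp
    ultimately show ?thesis by blast
  qed
  have injf: "inj_on f O2"
  proof (rule inj_onI)
    fix x y assume x: "x \<in> O2" and y: "y \<in> O2" and fxy: "f x = f y"
    obtain c where c: "c \<noteq> 0" "G x = (\<lambda>i. c * \<Phi> (emb2 1 (f x)) i)" using par[OF x] by blast
    obtain c' where c': "c' \<noteq> 0" "G y = (\<lambda>i. c' * \<Phi> (emb2 1 (f x)) i)" using par[OF y] fxy by auto
    define l where "l = c / c'"
    have l: "G x = (\<lambda>i. l * G y i)" unfolding c(2) c'(2) using c'(1) by (simp add: l_def)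
    have "sqnorm (Suc m) (G x) = 1" "sqnorm (Suc m) (G y) = 1" using GV O2(1) x y by (auto simp: sph_sec_def)
    hence "l\<^sup>2 = 1" using sqnorm_scale[of "Suc m" l "G y"] unfolding l[symmetric] by simp
    hence "l = 1 \<or> l = -1" by (simp add: power2_eq_1_iff)
    moreover have "l \<noteq> -1"
    proof
      assume "l = -1"
      hence "G x i = - G y i" using fun_cong[OF l, of i] by simp
      thus False using O2(3)[OF x] O2(3)[OF y] by simp
    qed
    ultimately have "G x = G y" using l by simp
    thus "x = y" using injG O2(1) x y by (meson inj_onD)
  qed
  have "DIM(real \<times> real) \<le> DIM(real)"
    by (rule invariance_of_dimension[OF cf \<open>open O2\<close> injf]) (use \<open>x1 \<in> O2\<close> in blast)
  thus False by simp
qed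

text \<open>The parameter z is moved along \<open>z + s * (- z 1, z 0)\<close>. The form
  \<open>a\<close> pulled back to this line is a nonzero polynomial in s, so the inverse is defined
  for all small nonzero s, and there the curve is injective.\<close>

lemma cone_points_arc:
  assumes y: "y \<in> cone" and U: "open U" "normalize_pt (Suc m) y \<in> U"
  shows "dim_ge (sph_sec (Suc m) C \<inter> U) 1"
proof -
  obtain c z where z: "c \<noteq> 0" "z \<in> Rn 2" "z \<noteq> (\<lambda>_. 0)" "y = (\<lambda>i. c * \<Phi> z i)" using y unfolding cone_def by blast
  define qq pp where "qq = [:z 0, - z 1:]" and "pp = [:z 1, z 0:]"
  define Z where "Z = (\<lambda>s. emb2 (poly qq s) (poly pp s))"
  have ze: "z = emb2 (z 0) (z 1)" by (rule Rn2_emb2[OF z(2)])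
  have z01: "z 0 \<noteq> 0 \<or> z 1 \<noteq> 0" using z(3) ze emb2_eq_0_iff by metis
  hence sq: "0 < (z 0)\<^sup>2 + (z 1)\<^sup>2" by (simp add: sum_power2_gt_zero_iff)
  have qq: "qq \<noteq> 0" using z01 by (auto simp: qq_def)
  have pq: "pp \<noteq> smult T qq" for T
  proof
    assume eq: "pp = smult T qq"
    have "coeff pp 0 = z 1" "coeff pp 1 = z 0" "coeff (smult T qq) 0 = T * z 0" "coeff (smult T qq) 1 = - T * z 1"
      by (simp_all add: pp_def qq_def)
    hence A: "z 1 = T * z 0" and B: "z 0 = - T * z 1" unfolding eq by (simp_all only:)
    have "z 0 * z 0 + z 1 * z 1 = z 0 * (- T * z 1) + z 1 * (T * z 0)"
      by (rule arg_cong2[where f = "(+)", OF arg_cong[OF B] arg_cong[OF A]])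
    also have "\<dots> = 0" by (simp add: mult_ac)
    finally have "(z 0)\<^sup>2 + (z 1)\<^sup>2 = 0" unfolding power2_eq_square .
    thus False using sq by simp
  qed
  have Z0: "Z 0 = z" using ze by (simp add: Z_def qq_def pp_def)
  have cross: "Z s 0 * Z s' 1 - Z s 1 * Z s' 0 = (s' - s) * ((z 0)\<^sup>2 + (z 1)\<^sup>2)" for s s'
    by (simp add: Z_def qq_def pp_def power2_eq_square algebra_simps)
  have ZR: "Z s \<in> Rn 2" for s by (simp add: Z_def emb2_Rn)
  have Zn: "Z s \<noteq> (\<lambda>_. 0)" for s
  proof
    assume "Z s = (\<lambda>_. 0)"
    hence "1 * ((z 0)\<^sup>2 + (z 1)\<^sup>2) = 0" using cross[of s "s + 1"] by simp
    thus False using sq by simp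
  qed
  obtain X where X: "\<forall>s. a (\<Phi> (Z s)) = poly X s"
  proof -
    from poly_fun_compose_poly[OF homog_polyD(1)[OF homog_\<Phi>[OF ab(1)]], of "\<lambda>i. if i = 0 then qq else if i = 1 then pp else 0"]
    obtain X where X: "\<forall>t. a (\<Phi> (\<lambda>i. poly (if i = 0 then qq else if i = 1 then pp else 0) t)) = poly X t" by blast
    have e: "(\<lambda>i. poly (if i = 0 then qq else if i = 1 then pp else 0) t) = Z t" for t
      by (auto simp: Z_def emb2_def fun_eq_iff)
    show ?thesis by (rule that[OF X[unfolded e]])
  qed
  have "X \<noteq> 0"
  proof
    assume "X = 0"
    hence "a (\<Phi> w) = 0" if "w \<in> Rn 2" for w
      using form_vanishing[OF homog_\<Phi>[OF ab(1)] qq pq finite.emptyI _ that] X by (simp add: Z_def)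
    thus False using a_\<Phi>_nz by blast
  qed
  define cv where "cv = (\<lambda>s i. sgn c * normalize_pt (Suc m) (\<Phi> (Z s)) i)"
  have cZ: "continuous_on A Z" for A unfolding Z_def by (intro continuous_emb2 continuous_intros)
  have ccv: "continuous_on A cv" for A unfolding cv_def
    by (intro continuous_on_coordinatewise_then_product continuous_on_mult continuous_on_const
        continuous_on_product_then_coordinatewise[OF continuous_normalize[OF continuous_\<Phi>[OF cZ] \<Phi>_pos[OF ZR Zn]]])
  have cv0: "cv 0 = normalize_pt (Suc m) y"
  proof
    fix i
    have "sqrt (sqnorm (Suc m) y) = \<bar>c\<bar> * sqrt (sqnorm (Suc m) (\<Phi> z))"
      unfolding z(4) sqnorm_scale by (simp add: real_sqrt_mult)
    thus "cv 0 i = normalize_pt (Suc m) y i"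
      unfolding cv_def Z0 normalize_pt_def using z(1) by (simp add: z(4) sgn_if abs_if)
  qed
  have sc: "sgn c = 1 \<or> sgn c = -1" using z(1) by (simp add: sgn_if)
  have cvC: "cv s \<in> sph_sec (Suc m) C" for s
  proof -
    have pos: "0 < sqnorm (Suc m) (\<Phi> (Z s))" by (rule \<Phi>_pos[OF ZR Zn])
    have e: "cv s = (\<lambda>i. (sgn c * (1 / sqrt (sqnorm (Suc m) (\<Phi> (Z s))))) * \<Phi> (Z s) i)"
      unfolding cv_def normalize_pt_scale by (simp only: mult.assoc)
    have "sgn c * (1 / sqrt (sqnorm (Suc m) (\<Phi> (Z s)))) \<noteq> 0" using z(1) pos by (auto simp: sgn_eq_0_iff)
    hence "cv s \<in> cone" unfolding cone_def e using ZR Zn by blast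
    moreover have "sqnorm (Suc m) (cv s) = 1"
      unfolding cv_def sqnorm_scale sqnorm_normalize[OF pos] using sc by auto
    ultimately show ?thesis using cone_subset by (auto simp: sph_sec_def)
  qed
  have "open (cv -` U)" using open_vimage[OF U(1) ccv] .
  moreover have "0 \<in> cv -` U" using U(2) cv0 by simp
  ultimately obtain \<epsilon> where \<epsilon>: "0 < \<epsilon>" "ball 0 \<epsilon> \<subseteq> cv -` U" using open_contains_ball by blast
  have "finite {s. poly X s = 0}" by (rule poly_roots_finite[OF \<open>X \<noteq> 0\<close>])
  then obtain \<delta> where \<delta>: "0 < \<delta>" "\<forall>s\<in>{s. poly X s = 0}. s \<noteq> 0 \<longrightarrow> \<delta> \<le> dist 0 s"
    using finite_set_avoid by blast
  define \<eta> where "\<eta> = min \<epsilon> \<delta>"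
  have \<eta>: "0 < \<eta>" "\<eta> \<le> \<epsilon>" "\<eta> \<le> \<delta>" using \<epsilon>(1) \<delta>(1) by (auto simp: \<eta>_def)
  \<comment> \<open>The interval stays away from \<open>s = 0\<close>, where \<open>a\<close> may
    vanish, but is still close enough for the arc to lie in \<open>U\<close>.\<close>
  have Xnz: "poly X s \<noteq> 0" if "s \<in> {\<eta>/3..\<eta>/2}" for s
  proof
    assume "poly X s = 0"
    moreover have "s \<noteq> 0" using that \<eta>(1) by auto
    ultimately have "\<delta> \<le> \<bar>s\<bar>" using \<delta>(2) by (auto simp: dist_real_def)
    thus False using that \<eta> by auto
  qed
  have "inj_on cv {\<eta>/3..\<eta>/2}"
  proof (rule inj_onI)
    fix s s' assume s: "s \<in> {\<eta>/3..\<eta>/2}" "s' \<in> {\<eta>/3..\<eta>/2}" "cv s = cv s'"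
    define n where "n = (\<lambda>s. sqrt (sqnorm (Suc m) (\<Phi> (Z s))))"
    have np: "0 < n s" for s using \<Phi>_pos[OF ZR Zn] by (simp add: n_def)
    have "\<Phi> (Z s) i = n s / n s' * \<Phi> (Z s') i" for i
    proof -
      have "sgn c * (\<Phi> (Z s) i / n s) = sgn c * (\<Phi> (Z s') i / n s')"
        using fun_cong[OF s(3), of i] by (simp add: cv_def normalize_pt_def n_def)
      hence "\<Phi> (Z s) i / n s = \<Phi> (Z s') i / n s'" using sc by auto
      thus ?thesis using np[of s] np[of s'] by (simp add: field_simps)
    qed
    hence e1: "\<Phi> (Z s) = (\<lambda>i. n s / n s' * \<Phi> (Z s') i)" by (rule ext)
    define \<mu> where "\<mu> = (n s / n s') ^ e"
    have \<mu>: "\<mu> \<noteq> 0" using np[of s] np[of s'] by (simp add: \<mu>_def)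
    have A: "a (\<Phi> (Z s)) = \<mu> * a (\<Phi> (Z s'))" "b (\<Phi> (Z s)) = \<mu> * b (\<Phi> (Z s'))"
      unfolding e1 \<mu>_def by (rule homog_polyD(2)[OF ab(1) \<Phi>_Rn] homog_polyD(2)[OF ab(2) \<Phi>_Rn])+
    have 1: "a (\<Phi> (Z s')) * Z s 1 = b (\<Phi> (Z s')) * Z s 0" using ab_\<Phi>[OF ZR[of s]] \<mu> unfolding A by simp
    have 2: "a (\<Phi> (Z s')) * Z s' 1 = b (\<Phi> (Z s')) * Z s' 0" by (rule ab_\<Phi>[OF ZR])
    have "a (\<Phi> (Z s')) * (Z s 0 * Z s' 1 - Z s 1 * Z s' 0) = 0" using 1 2 by algebra
    moreover have "a (\<Phi> (Z s')) \<noteq> 0" using Xnz[OF s(2)] X by simp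
    ultimately have "(s' - s) * ((z 0)\<^sup>2 + (z 1)\<^sup>2) = 0" unfolding cross by simp
    thus "s = s'" using sq by auto
  qed
  moreover have "cv ` {\<eta>/3..\<eta>/2} \<subseteq> sph_sec (Suc m) C \<inter> U"
  proof (rule image_subsetI)
    fix s assume s: "s \<in> {\<eta>/3..\<eta>/2}"
    hence "s \<in> ball 0 \<epsilon>" using \<eta> by (auto simp: dist_real_def)
    thus "cv s \<in> sph_sec (Suc m) C \<inter> U" using \<epsilon>(2) cvC by blast
  qed
  moreover have "\<eta>/3 < \<eta>/2" using \<eta>(1) by simp
  ultimately have "contains_arc (sph_sec (Suc m) C \<inter> U)" unfolding contains_arc_def using ccv by blast
  thus ?thesis by (rule contains_arc_imp_dim_ge)
qed

text \<open>Points of the closure that the parametrization misses are among the finitely many zeros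
  of \<open>a\<close> in the section. The parametrized curve being closed, such points have a
  neighbourhood without arcs.\<close>

lemma local_dim_cone: "proj_local_dim_set (Suc m) C 1 = cone"
proof
  show "cone \<subseteq> proj_local_dim_set (Suc m) C 1"
  proof
    fix y assume y: "y \<in> cone"
    have yC: "y \<in> C" using y cone_subset by blast
    have "normalize_pt (Suc m) y \<in> sph_sec (Suc m) cone"
      using cone_iff_normalize[OF CD[OF yC]] y by blast
    hence 1: "normalize_pt (Suc m) y \<in> sph_sec (Suc m) C" using cone_subset by (auto simp: sph_sec_def)
    have 2: "\<not> dim_ge (sph_sec (Suc m) C \<inter> UNIV) (Suc 1)" using section_not_dim_ge_2 by (simp add: numeral_2_eq_2)
    have 3: "\<forall>U. open U \<and> normalize_pt (Suc m) y \<in> U \<longrightarrow> dim_ge (sph_sec (Suc m) C \<inter> U) 1"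
      using cone_points_arc[OF y] by blast
    show "y \<in> proj_local_dim_set (Suc m) C 1"
      unfolding proj_local_dim_set_def local_dim_set_def
      using yC 1 2 3 open_UNIV by blast
  qed
  show "proj_local_dim_set (Suc m) C 1 \<subseteq> cone"
  proof
    fix y assume "y \<in> proj_local_dim_set (Suc m) C 1"
    hence yC: "y \<in> C" and d: "\<forall>U. open U \<and> normalize_pt (Suc m) y \<in> U \<longrightarrow> dim_ge (sph_sec (Suc m) C \<inter> U) 1"
      by (auto simp: proj_local_dim_set_def local_dim_set_def)
    show "y \<in> cone"
    proof (rule ccontr)
      assume "y \<notin> cone"
      hence "normalize_pt (Suc m) y \<in> - sph_sec (Suc m) cone" using cone_iff_normalize[OF CD[OF yC]] by blast
      moreover have "open (- sph_sec (Suc m) cone)" using compact_imp_closed[OF compact_cone_section] by (rule open_Compl)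
      ultimately have "contains_arc (sph_sec (Suc m) C \<inter> - sph_sec (Suc m) cone)" using d dim_ge_imp_contains_arc by blast
      moreover have "sph_sec (Suc m) C \<inter> - sph_sec (Suc m) cone \<subseteq> {y \<in> sph_sec (Suc m) C. a y = 0}"
      proof
        fix w assume w: "w \<in> sph_sec (Suc m) C \<inter> - sph_sec (Suc m) cone"
        hence wC: "w \<in> C" "w \<notin> cone" by (auto simp: sph_sec_def)
        have "a w = 0"
        proof (rule ccontr)
          assume aw: "a w \<noteq> 0"
          then obtain c where "c \<noteq> 0" "w = (\<lambda>i. c * \<Phi> (emb2 (a w) (b w)) i)" using in_cone[OF wC(1)] by blast
          moreover have "emb2 (a w) (b w) \<noteq> (\<lambda>_. 0)" using aw by (simp add: emb2_eq_0_iff)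
          ultimately have "w \<in> cone" unfolding cone_def using emb2_Rn by blast
          thus False using wC(2) by blast
        qed
        thus "w \<in> {y \<in> sph_sec (Suc m) C. a y = 0}" using w by blast
      qed
      ultimately show False using contains_arc_infinite[OF _ finite_base_points] contains_arc_mono by blast
    qed
  qed
qed

text \<open>Irreducibility of the closure is inherited from \<open>S\<close>: polynomials are Nash
  functions, so homogeneous equations of two algebraic sets covering \<open>C\<close> would restrict
  to zero divisors on \<open>S\<close>.\<close>

lemma closure_rational_curve:
  assumes irr: "nash_irreducible m S"
  shows "real_rational_curve (Suc m) C"
proof -
  have C: "C = {y \<in> Rn (Suc m). y \<noteq> (\<lambda>_. 0) \<and> (\<forall>P\<in>{P. (\<exists>d. homog_poly (Suc m) d P) \<and> (\<forall>x\<in>S. P (hom_emb m x) = 0)}. P y = 0)}"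
    unfolding zar_closure_proj_def by blast
  have alg: "proj_alg (Suc m) C"
    unfolding proj_alg_def
    by (rule exI[of _ "{P. (\<exists>d. homog_poly (Suc m) d P) \<and> (\<forall>x\<in>S. P (hom_emb m x) = 0)}"], rule conjI[OF _ C]) blast
  have irrC: "proj_irreducible (Suc m) C"
    unfolding proj_irreducible_def
  proof (intro conjI allI impI)
    show "C \<noteq> {}" using zar_closure_contains[OF \<gamma>_S] by blast
    fix B1 B2 assume B: "proj_alg (Suc m) B1 \<and> proj_alg (Suc m) B2 \<and> C \<subseteq> B1 \<union> B2"
    obtain P1 where P1: "\<forall>p\<in>P1. \<exists>d. homog_poly (Suc m) d p" "B1 = {y \<in> Rn (Suc m). y \<noteq> (\<lambda>_. 0) \<and> (\<forall>p\<in>P1. p y = 0)}"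
      using B unfolding proj_alg_def by blast
    obtain P2 where P2: "\<forall>p\<in>P2. \<exists>d. homog_poly (Suc m) d p" "B2 = {y \<in> Rn (Suc m). y \<noteq> (\<lambda>_. 0) \<and> (\<forall>p\<in>P2. p y = 0)}"
      using B unfolding proj_alg_def by blast
    show "C \<subseteq> B1 \<or> C \<subseteq> B2"
    proof (rule ccontr)
      assume "\<not> ?thesis"
      then obtain y1 y2 where y: "y1 \<in> C" "y1 \<notin> B1" "y2 \<in> C" "y2 \<notin> B2" by blast
      obtain f1 where f1: "f1 \<in> P1" "f1 y1 \<noteq> 0" using y(1,2) CD[OF y(1)] unfolding P1(2) by blast
      obtain f2 where f2: "f2 \<in> P2" "f2 y2 \<noteq> 0" using y(3,4) CD[OF y(3)] unfolding P2(2) by blast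
      obtain d1 where d1: "homog_poly (Suc m) d1 f1" using P1(1) f1(1) by blast
      obtain d2 where d2: "homog_poly (Suc m) d2 f2" using P2(1) f2(1) by blast
      have n1: "\<not> (\<forall>x\<in>S. f1 (hom_emb m x) = 0)" using y(1) f1(2) d1 unfolding zar_closure_proj_def by blast
      have n2: "\<not> (\<forall>x\<in>S. f2 (hom_emb m x) = 0)" using y(3) f2(2) d2 unfolding zar_closure_proj_def by blast
      have nash: "nash_on m S f" if "poly_fun m f" for f
        using nash_on_quadratic[OF that pf_const[of m 0] pf_const[of m 1] S_Rn] by simp
      have "f1 (hom_emb m x) * f2 (hom_emb m x) = 0" if "x \<in> S" for x
      proof -
        have "hom_emb m x \<in> B1 \<union> B2" using B zar_closure_contains[OF that] by blast
        thus ?thesis using f1(1) f2(1) unfolding P1(2) P2(2) by auto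
      qed
      moreover have "nash_on m S (\<lambda>x. f1 (hom_emb m x))" "nash_on m S (\<lambda>x. f2 (hom_emb m x))"
        by (rule nash, rule poly_fun_hom_emb, rule homog_polyD(1), rule d1)
           (rule nash, rule poly_fun_hom_emb, rule homog_polyD(1), rule d2)
      ultimately show False using irr n1 n2 unfolding nash_irreducible_def by blast
    qed
  qed
  have dim: "proj_dim_eq (Suc m) C 1"
  proof -
    have "emb2 1 0 \<noteq> (\<lambda>_. 0)" by (simp add: emb2_eq_0_iff)
    hence "\<Phi> (emb2 1 0) \<in> cone" unfolding cone_def using emb2_Rn by (intro CollectI exI[of _ 1]) auto
    from cone_points_arc[OF this open_UNIV] have "dim_ge (sph_sec (Suc m) C) 1" by simp
    thus ?thesis using section_not_dim_ge_2 by (simp add: proj_dim_eq_def dim_eq_def numeral_2_eq_2)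
  qed
  have \<Phi>e: "(\<lambda>z. \<lambda>i. if i < Suc m then \<phi> i z else 0) = \<Phi>" by (simp add: \<Phi>_def fun_eq_iff)
  have inv: "\<exists>a b e. homog_poly (Suc m) e a \<and> homog_poly (Suc m) e b
                 \<and> (\<forall>z\<in>Rn 2. a (\<Phi> z) * z 1 = b (\<Phi> z) * z 0)
                 \<and> (\<exists>z\<in>Rn 2. a (\<Phi> z) \<noteq> 0 \<or> b (\<Phi> z) \<noteq> 0)"
    using ab(1,2) ab_\<Phi> a_\<Phi>_nz by blast
  show ?thesis
    unfolding real_rational_curve_def
  proof (intro conjI alg irrC dim exI[of _ \<phi>] exI[of _ d])
    show "\<forall>i<Suc m. homog_poly 2 d (\<phi> i)" by (rule hom)
    show "\<forall>z\<in>Rn 2. z \<noteq> (\<lambda>_. 0) \<longrightarrow> (\<exists>i<Suc m. \<phi> i z \<noteq> 0)" by (rule nz)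
    show "let \<Phi> = (\<lambda>z. \<lambda>i. if i < Suc m then \<phi> i z else 0) in
              (\<exists>a b e. homog_poly (Suc m) e a \<and> homog_poly (Suc m) e b
                 \<and> (\<forall>z\<in>Rn 2. a (\<Phi> z) * z 1 = b (\<Phi> z) * z 0)
                 \<and> (\<exists>z\<in>Rn 2. a (\<Phi> z) \<noteq> 0 \<or> b (\<Phi> z) \<noteq> 0))
            \<and> proj_local_dim_set (Suc m) C 1
                = {y. \<exists>c z. c \<noteq> 0 \<and> z \<in> Rn 2 \<and> z \<noteq> (\<lambda>_. 0) \<and> y = (\<lambda>i. c * \<Phi> z i)}"
      unfolding Let_def \<Phi>e using inv local_dim_cone unfolding cone_def by blast
  qed
qed

end

section \<open>Assembling the equivalences\<close>

lemma (in rat_param) rational_curve: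
  assumes dim: "dim_eq S 1"
  shows "real_rational_curve (Suc m) (zar_closure_proj m S)"
proof -
  have nd: "\<not> dim_ge S 2" using dim by (simp add: dim_eq_def numeral_2_eq_2)
  have "infinite S" using dim dim_ge_imp_contains_arc contains_arc_infinite by (auto simp: dim_eq_def)
  then obtain p0 p1 t1 where p: "p0 \<in> Rn n" "p1 \<in> Rn n" "D p0 \<noteq> 0" "\<Gamma> (line p0 p1 t1) \<noteq> \<Gamma> p0"
    using nonconstant_line by blast
  obtain h r where rc: "rat_curve m (\<lambda>t. \<Gamma> (line p0 p1 t)) h r" using rat_curve_on_line[OF p(1,2)] p(3) by blast
  interpret rc: rat_curve m "\<lambda>t. \<Gamma> (line p0 p1 t)" h r by (rule rc)
  have "\<Gamma> (line p0 p1 t1) \<noteq> \<Gamma> (line p0 p1 0)" using p(4) by simp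
  from rc.curve_param_exists[OF this] obtain d \<phi> pp q N M where
    cp: "curve_param m d \<phi> (\<lambda>t. \<Gamma> (line p0 p1 t)) h r pp q N M" by (elim exE)
  interpret cp: curve_param m d \<phi> "\<lambda>t. \<Gamma> (line p0 p1 t)" h r pp q N M by (rule cp)
  obtain e a b where ab: "homog_poly (Suc m) e a" "homog_poly (Suc m) e b" "\<forall>x. a (hom_emb m x) = N x \<and> b (hom_emb m x) = M x"
    using homogenize_pair[OF cp.NM(1,2)] by blast
  interpret cc: curve_closure m d \<phi> "\<lambda>t. \<Gamma> (line p0 p1 t)" h r pp q N M S a b e
  proof unfold_locales
    show "\<Gamma> (line p0 p1 t) \<in> S" for t using S line_Rn[OF p(1,2)] by blast
    show "S \<subseteq> Rn m" using S \<Gamma>_Rn by blast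
    show "f y = 0" if "poly_fun m f" "\<And>t. f (\<Gamma> (line p0 p1 t)) = 0" "y \<in> S" for f y
      by (rule vanish_from_line[OF nd p(1,2,3,4) that])
  qed (use ab in auto)
  show ?thesis by (rule cc.closure_rational_curve[OF irreducible])
qed

text \<open>Any admissible dimension yields the property, which in turn makes dimension 1
  admissible; so the infimum is either 1 or infinite.\<close>

lemma index_eq_1_iff:
  assumes "\<And>n. 1 \<le> n \<Longrightarrow> A n \<Longrightarrow> P" "P \<Longrightarrow> A 1"
  shows "((INF n\<in>{n. n \<ge> 1 \<and> A n}. enat n) = 1 \<longleftrightarrow> P) \<and> ((INF n\<in>{n. n \<ge> 1 \<and> A n}. enat n) < \<infinity> \<longleftrightarrow> P)"
proof -
  let ?I = "INF n\<in>{n. n \<ge> 1 \<and> A n}. enat n"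
  have 1: "?I = 1" if P
  proof (rule antisym)
    have "?I \<le> enat 1" using assms(2)[OF \<open>P\<close>] by (intro INF_lower) simp
    thus "?I \<le> 1" by (simp add: one_enat_def)
    show "1 \<le> ?I" by (rule INF_greatest) (simp add: one_enat_def)
  qed
  have 2: P if "?I < \<infinity>" using that assms(1) unfolding INF_less_iff by blast
  show ?thesis using 1 2 by (metis one_enat_def enat_ord_simps(4) infinity_ne_i1 less_le)
qed

theorem theorem1p6:
  fixes m :: nat and S :: "(nat \<Rightarrow> real) set"
  assumes "semialg m S" and "dim_eq S 1"
  defines "P9 \<equiv> nash_irreducible m S \<and> compact S
                 \<and> real_rational_curve (Suc m) (zar_closure_proj m S)"
  shows "(rB m S = 1 \<longleftrightarrow> P9) \<and> (rB m S < \<infinity> \<longleftrightarrow> P9)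
       \<and> (rsB m S = 1 \<longleftrightarrow> P9) \<and> (rsB m S < \<infinity> \<longleftrightarrow> P9)
       \<and> (rS m S = 1 \<longleftrightarrow> P9) \<and> (rS m S < \<infinity> \<longleftrightarrow> P9)
       \<and> (rsS m S = 1 \<longleftrightarrow> P9) \<and> (rsS m S < \<infinity> \<longleftrightarrow> P9)"
proof -
  have ball: "closed_ball_n n \<subseteq> Rn n" and sphere: "sphere_n n \<subseteq> Rn (Suc n)" for n
    by (auto simp: closed_ball_n_def sphere_n_def)
  have param: P9 if cp: "compact S" and ex: "\<exists>n \<Gamma> D R. rat_param n m \<Gamma> D R S"
  proof -
    obtain n \<Gamma> D R where "rat_param n m \<Gamma> D R S" using ex by (elim exE)
    then interpret rat_param n m \<Gamma> D R S .
    show P9 unfolding P9_def using irreducible rational_curve[OF assms(2)] cp by blast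
  qed
  have rsB: P9 if "regulous_image n m (closed_ball_n n) S" for n
    using param[OF compact_regulous_image[OF compact_closed_ball_n that]] regulous_image_ball[OF that] by blast
  have rsS: P9 if "1 \<le> n" "regulous_image (Suc n) m (sphere_n n) S" for n
    using param[OF compact_regulous_image[OF compact_sphere_n that(2)]] regulous_image_sphere[OF that(2,1)] by blast
  have rB: "regular_image 1 m (closed_ball_n 1) S" if P9
    using that regular_image_of_rational_curve[OF assms(1,2)] unfolding P9_def by blast
  then have rS: "regular_image (Suc 1) m (sphere_n 1) S" if P9
    using regular_image_circle that by (simp add: numeral_2_eq_2)
  have "(rB m S = 1 \<longleftrightarrow> P9) \<and> (rB m S < \<infinity> \<longleftrightarrow> P9)" unfolding rB_def
    by (rule index_eq_1_iff) (use rsB regular_imp_regulous[OF ball] rB in blast)+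
  moreover have "(rsB m S = 1 \<longleftrightarrow> P9) \<and> (rsB m S < \<infinity> \<longleftrightarrow> P9)" unfolding rsB_def
    by (rule index_eq_1_iff) (use rsB regular_imp_regulous[OF ball] rB in blast)+
  moreover have "(rS m S = 1 \<longleftrightarrow> P9) \<and> (rS m S < \<infinity> \<longleftrightarrow> P9)" unfolding rS_def
    by (rule index_eq_1_iff) (use rsS regular_imp_regulous[OF sphere] rS in blast)+
  moreover have "(rsS m S = 1 \<longleftrightarrow> P9) \<and> (rsS m S < \<infinity> \<longleftrightarrow> P9)" unfolding rsS_def
    by (rule index_eq_1_iff) (use rsS regular_imp_regulous[OF sphere] rS in blast)+
  ultimately show ?thesis by blast
qed

end
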